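(* Let $L\colon TM\times I\to\mathbb R$ be a $C^2$ function whose second-order derivatives are locally Lipschitz, and let $\mu$ be a compactly-supported, positive Radon measure on $TM\times I$. Assume that the support of $\mu$ is contained in an open set $V\subset TM\times I$ in which the second fiberwise derivative $L_{vv}=\partial^2L/\partial v^2$ is invertible. Then the following are equivalent: (1) The measure $\mu$ is invariant under the Euler-Lagrange flow of $L$. (2) The measure $\mu$ is a closed measure with closed velocities (i.e. $\mu\in\mathscr H_\Delta$) and $\mu$ is horizontally critical, i.e., for all exact horizontal variations $(\mu_s)_{s}$ of $\mu=\mu_0$ we have $$\left.\frac{d}{ds}\int L\,d\mu_s\right|_{s=0}=0.$$
   Context: $M$ is a $C^\infty$ manifold, $I=[0,t_0]$ with $t_0>0$; points of $TM\times I$ are $(x,v,t)$, $x\in M$, $v\in T_xM$, $t\in I$; $\mathbf 1=\partial/\partial t$. Formulas below are written in local coordinates $x$ on $M$ and the induced coordinates $v$ on the fibers. $\mathscr E'$ is the space of compactly-supported distributions on $TM\times I$ (dual of $C^\infty(TM\times I)$). Euler-Lagrange flow and invariance. On the open set $V$ where $L_{vv}$ is invertible, the Euler-Lagrange vector field is $$\mathcal X(x,v,t)=\frac{\partial}{\partial t}+\sum_i v_i\frac{\partial}{\partial x_i}+\sum_{i,k}\Big(L_{x_i}-L_{v_it}-\sum_j v_jL_{x_jv_i}\Big)(L_{vv}^{-1})_{ik}\frac{\partial}{\partial v_k},$$ and the Euler-Lagrange flow is its (local) flow. The measure $\mu$ (with support in $V$) is invariant under the Euler-Lagrange flow if $\int\mathcal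 X\varphi\,d\mu=0$ for all compactly-supported $\varphi\in C^\infty_c(TM\times I)$ vanishing on $t=0$ and $t=t_0$. Closed measures. $\mathscr H\subset\mathscr E'$ is the set of positive, compactly-supported Radon measures $\mu$ on $TM\times I$ such that $\int d\phi_{(x,t)}(v,\mathbf 1)\,d\mu(x,v,t)=\int(\phi_x\cdot v+\phi_t)\,d\mu=0$ for all $\phi\in C^\infty(M\times I)$ vanishing on $M\times\{0,t_0\}$. Closed velocities. A measure $\mu\in\mathscr H$ is a closed measure with closed velocities, $\mu\in\mathscr H_\Delta$, if there is a Borel measurable function $C$, bounded on $\operatorname{supp}\mu$, giving a vector field $v\frac{\partial}{\partial x}+C(x,v,t)\frac{\partial}{\partial v}+\frac{\partial}{\partial t}$ on $TM\times I$ such that $$\int df_{(x,v,t)}\Big(v\frac{\partial}{\partial x}+C(x,v,t)\frac{\partial}{\partial v}+\frac{\partial}{\partial t}\Big)d\mu=0$$ for all $f\in C^\infty(TM\times I)$ vanishing on $t=0$ and $t=t_0$. Any such $C$ is called a second derivative of $\mu$. Exact horizontal variations. Let $\mu\in\mathscr H_\Delta$, let $C$ be a second derivative of $\mu$, and let $F\colon TM\times I\to TM$ be a $C^1$ map with $F(x,v,t)\in T_xM$ that vanishes on $TM\times\{0,t_0\}$. Define $\eta_{F,\mu,C}\in\mathscr E'$ by $$\langle\eta_{F,\mu,C},f\rangle=\int_{TM\times I}\Big[F\cdot\frac{\partial f}{\partial x}+(F_xv+F_vC+F_t)\cdot\frac{\partial f}{\partial v}\Big]d\mu .$$ $\Theta_\Delta(L)$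 is the set of all distributions $\eta_{F,\mu,C}$ of this form for which, in addition, the restriction of the 1-form $L_{vv}F$ to each fiber $T_xM\times\{t\}$ is closed, i.e. $d_v(L_{vv}F)=0$. An exact horizontal variation of $\mu$ is a family $(\mu_s)_{s\in\mathbb R}\subset\mathscr H$ with $\mu_0=\mu$ that is weakly differentiable at $s=0$ (i.e. there is $\eta\in\mathscr E'$ with $\frac{d}{ds}|_{s=0}\int g\,d\mu_s=\langle\eta,g\rangle$ for all $g\in C^\infty(TM\times I)$) and whose derivative $\eta$ is an element $\eta_{F,\mu,C}$ of $\Theta_\Delta(L)$ for this $\mu$. The derivative $\frac{d}{ds}|_{s=0}\int L\,d\mu_s$ is understood as $\langle\eta,L\rangle$ (the formula for $\eta_{F,\mu,C}$ makes sense on $C^1$ functions). *)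

theory Defs
  imports "HOL-Analysis.Analysis"
begin

text \<open>
  Everything is differentiated inside sets of the form
  (open) \<open>\<times> UNIV \<times> {0..t0}\<close> or (open) \<open>\<times> {0..t0}\<close> with \<open>t0 > 0\<close>, or inside open sets.  There the derivative
  within the set is unique; at \<open>t = 0\<close> and \<open>t = t0\<close> it is one-sided in \<open>t\<close>.
\<close>

abbreviation dir_deriv ::
  "'a::real_normed_vector set \<Rightarrow> ('a \<Rightarrow> 'b::real_normed_vector) \<Rightarrow> 'a \<Rightarrow> 'a \<Rightarrow> 'b" where
  "dir_deriv S f h p \<equiv> frechet_derivative f (at p within S) h"

primrec Ck_on ::
  "nat \<Rightarrow> ('a::euclidean_space \<Rightarrow> 'b::real_normed_vector) \<Rightarrow> 'a set \<Rightarrow> bool" where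
  "Ck_on 0 f S \<longleftrightarrow> continuous_on S f"
| "Ck_on (Suc k) f S \<longleftrightarrow>
     (\<exists>D. (\<forall>p\<in>S. (f has_derivative D p) (at p within S)) \<and> (\<forall>h. Ck_on k (\<lambda>p. D p h) S))"

definition smooth_on ::
  "('a::euclidean_space \<Rightarrow> 'b::real_normed_vector) \<Rightarrow> 'a set \<Rightarrow> bool" where
  "smooth_on f S \<longleftrightarrow> (\<forall>k. Ck_on k f S)"

definition locally_lipschitz_on ::
  "('a::metric_space \<Rightarrow> 'b::metric_space) \<Rightarrow> 'a set \<Rightarrow> bool" where
  "locally_lipschitz_on f S \<longleftrightarrow>
     (\<forall>p\<in>S. \<exists>e>0. \<exists>K. K-lipschitz_on (S \<inter> ball p e) f)"

text \<open>
  A chart is a pair of its domain and the coordinate map (whose values off the domain are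
  irrelevant).  The manifold \<open>M\<close> is the whole type \<open>'m\<close>; Hausdorffness and second countability are
  imposed by the type class in the theorem.
\<close>

type_synonym ('m, 'n) chart = "'m set \<times> ('m \<Rightarrow> (real, 'n) vec)"

definition chart_change ::
  "('m, 'n::finite) chart \<Rightarrow> ('m, 'n) chart \<Rightarrow> real^'n \<Rightarrow> real^'n" where
  "chart_change c d y = snd d (inv_into (fst c) (snd c) y)"

definition smooth_atlas :: "('m::topological_space, 'n::finite) chart set \<Rightarrow> bool" where
  "smooth_atlas A \<longleftrightarrow>
     \<Union> (fst ` A) = UNIV \<and>
     (\<forall>c\<in>A. open (fst c) \<and> open (snd c ` fst c) \<and>
        (\<exists>\<psi>. homeomorphism (fst c) (snd c ` fst c) (snd c) \<psi>)) \<and>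
     (\<forall>c\<in>A. \<forall>d\<in>A. smooth_on (chart_change c d) (snd c ` (fst c \<inter> fst d)))"

text \<open>
  A tangent vector at \<open>x\<close> is the family of its coordinate vectors in all the charts around \<open>x\<close>,
  related by the Jacobians of the changes of charts; it is normalised to \<open>0\<close> at the other charts
  so that it is determined by any one of its coordinate vectors.
\<close>

type_synonym ('m, 'n) tangent = "('m, 'n) chart \<Rightarrow> (real, 'n) vec"

definition tangent_space :: "('m, 'n::finite) chart set \<Rightarrow> 'm \<Rightarrow> ('m, 'n) tangent set" where
  "tangent_space A x =
     {v. (\<forall>c\<in>A. \<forall>d\<in>A. x \<in> fst c \<longrightarrow> x \<in> fst d \<longrightarrow>
            v d = frechet_derivative (chart_change c d) (at (snd c x)) (v c)) \<and>
         (\<forall>c. \<not> (c \<in> A \<and> x \<in> fst c) \<longrightarrow> v c = 0)}"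

type_synonym ('m, 'n) point = "'m \<times> ('m, 'n) tangent \<times> real"
type_synonym 'n coords = "(real, 'n) vec \<times> (real, 'n) vec \<times> real"

definition TMI :: "('m, 'n::finite) chart set \<Rightarrow> real \<Rightarrow> ('m, 'n) point set" where
  "TMI A t0 = {(x, v, t). v \<in> tangent_space A x \<and> t \<in> {0..t0}}"

definition chart_dom ::
  "('m, 'n::finite) chart set \<Rightarrow> real \<Rightarrow> ('m, 'n) chart \<Rightarrow> ('m, 'n) point set" where
  "chart_dom A t0 c = {p \<in> TMI A t0. fst p \<in> fst c}"

definition chart_img :: "real \<Rightarrow> ('m, 'n::finite) chart \<Rightarrow> 'n coords set" where
  "chart_img t0 c = (snd c ` fst c) \<times> UNIV \<times> {0..t0}"

definition coord :: "('m, 'n::finite) chart \<Rightarrow> ('m, 'n) point \<Rightarrow> 'n coords" where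
  "coord c p = (snd c (fst p), fst (snd p) c, snd (snd p))"

definition uncoord ::
  "('m, 'n::finite) chart set \<Rightarrow> real \<Rightarrow> ('m, 'n) chart \<Rightarrow> 'n coords \<Rightarrow> ('m, 'n) point" where
  "uncoord A t0 c = inv_into (chart_dom A t0 c) (coord c)"

definition loc ::
  "('m, 'n::finite) chart set \<Rightarrow> real \<Rightarrow> ('m, 'n) chart \<Rightarrow> (('m, 'n) point \<Rightarrow> 'b) \<Rightarrow> 'n coords \<Rightarrow> 'b" where
  "loc A t0 c f = (\<lambda>q. f (uncoord A t0 c q))"

definition TMI_top :: "('m, 'n::finite) chart set \<Rightarrow> real \<Rightarrow> ('m, 'n) point topology" where
  "TMI_top A t0 = topology (\<lambda>U. U \<subseteq> TMI A t0 \<and>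
     (\<forall>c\<in>A. openin (top_of_set (chart_img t0 c)) {q \<in> chart_img t0 c. uncoord A t0 c q \<in> U}))"

lemma openin_TMI_top:
  "openin (TMI_top A t0) U \<longleftrightarrow> U \<subseteq> TMI A t0 \<and>
     (\<forall>c\<in>A. openin (top_of_set (chart_img t0 c)) {q \<in> chart_img t0 c. uncoord A t0 c q \<in> U})"
proof -
  let ?P = "\<lambda>c U. {q \<in> chart_img t0 c. uncoord A t0 c q \<in> U}"
  have i: "?P c (S \<inter> T) = ?P c S \<inter> ?P c T" for c S T
    by auto
  have u: "?P c (\<Union>K) = \<Union> (?P c ` K)" for c K
    by auto
  have "istopology (\<lambda>U. U \<subseteq> TMI A t0 \<and>
      (\<forall>c\<in>A. openin (top_of_set (chart_img t0 c)) (?P c U)))"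
    unfolding istopology_def i u by (auto intro!: openin_Union)
  then show ?thesis
    by (simp add: TMI_top_def topology_inverse')
qed

text \<open>
  Formulas in local coordinates are evaluated in an arbitrary chart around the base point; the
  quantities in question do not depend on it.
\<close>

definition chart_at :: "('m, 'n::finite) chart set \<Rightarrow> ('m, 'n) point \<Rightarrow> ('m, 'n) chart" where
  "chart_at A p = (SOME c. c \<in> A \<and> fst p \<in> fst c)"

definition Ck_TMI ::
  "('m, 'n::finite) chart set \<Rightarrow> real \<Rightarrow> nat \<Rightarrow> (('m, 'n) point \<Rightarrow> real) \<Rightarrow> bool" where
  "Ck_TMI A t0 k f \<longleftrightarrow> (\<forall>c\<in>A. Ck_on k (loc A t0 c f) (chart_img t0 c))"

definition smooth_TMI ::
  "('m, 'n::finite) chart set \<Rightarrow> real \<Rightarrow> (('m, 'n) point \<Rightarrow> real) \<Rightarrow> bool" where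
  "smooth_TMI A t0 f \<longleftrightarrow> (\<forall>k. Ck_TMI A t0 k f)"

definition vanishes_at_ends ::
  "('m, 'n::finite) chart set \<Rightarrow> real \<Rightarrow> (('m, 'n) point \<Rightarrow> 'b::zero) \<Rightarrow> bool" where
  "vanishes_at_ends A t0 f \<longleftrightarrow>
     (\<forall>(x, v, t)\<in>TMI A t0. t = 0 \<or> t = t0 \<longrightarrow> f (x, v, t) = 0)"

definition compactly_supported ::
  "('m, 'n::finite) chart set \<Rightarrow> real \<Rightarrow> (('m, 'n) point \<Rightarrow> real) \<Rightarrow> bool" where
  "compactly_supported A t0 f \<longleftrightarrow>
     compactin (TMI_top A t0) (TMI_top A t0 closure_of {p \<in> TMI A t0. f p \<noteq> 0})"

definition C2_lipschitz ::
  "('m, 'n::finite) chart set \<Rightarrow> real \<Rightarrow> (('m, 'n) point \<Rightarrow> real) \<Rightarrow> bool" where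
  "C2_lipschitz A t0 L \<longleftrightarrow> Ck_TMI A t0 2 L \<and>
     (\<forall>c\<in>A. \<forall>h k. locally_lipschitz_on
        (dir_deriv (chart_img t0 c) (dir_deriv (chart_img t0 c) (loc A t0 c L) h) k)
        (chart_img t0 c))"

definition TMI_borel :: "('m, 'n::finite) chart set \<Rightarrow> real \<Rightarrow> ('m, 'n) point measure" where
  "TMI_borel A t0 = sigma (TMI A t0) {U. openin (TMI_top A t0) U}"

definition msupport ::
  "('m, 'n::finite) chart set \<Rightarrow> real \<Rightarrow> ('m, 'n) point measure \<Rightarrow> ('m, 'n) point set" where
  "msupport A t0 \<mu> =
     {p \<in> TMI A t0. \<forall>U. openin (TMI_top A t0) U \<and> p \<in> U \<longrightarrow> emeasure \<mu> U \<noteq> 0}"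

text \<open>
  Since \<open>TM \<times> I\<close> is locally compact, Hausdorff and second countable, a positive Radon measure is a
  Borel measure that is finite on compact sets; regularity is automatic.
\<close>

definition compact_radon_measure ::
  "('m, 'n::finite) chart set \<Rightarrow> real \<Rightarrow> ('m, 'n) point measure \<Rightarrow> bool" where
  "compact_radon_measure A t0 \<mu> \<longleftrightarrow>
     sets \<mu> = sets (TMI_borel A t0) \<and>
     (\<forall>K. compactin (TMI_top A t0) K \<longrightarrow> emeasure \<mu> K < \<infinity>) \<and>
     compactin (TMI_top A t0) (msupport A t0 \<mu>)"

text \<open>
  A vector field on \<open>TM \<times> I\<close> is given by its coordinate expressions in all the induced charts.
\<close>

type_synonym ('m, 'n) vfield = "('m, 'n) chart \<Rightarrow> ('m, 'n) point \<Rightarrow> 'n coords"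

definition vector_field ::
  "('m, 'n::finite) chart set \<Rightarrow> real \<Rightarrow> ('m, 'n) vfield \<Rightarrow> bool" where
  "vector_field A t0 X \<longleftrightarrow>
     (\<forall>c\<in>A. \<forall>d\<in>A. \<forall>p \<in> chart_dom A t0 c \<inter> chart_dom A t0 d.
        X d p = dir_deriv (chart_img t0 c) (\<lambda>q. coord d (uncoord A t0 c q)) (X c p) (coord c p))"

definition deriv_along ::
  "('m, 'n::finite) chart set \<Rightarrow> real \<Rightarrow> ('m, 'n) vfield \<Rightarrow> (('m, 'n) point \<Rightarrow> real)
     \<Rightarrow> ('m, 'n) point \<Rightarrow> real" where
  "deriv_along A t0 X f p =
     (let c = chart_at A p in dir_deriv (chart_img t0 c) (loc A t0 c f) (X c p) (coord c p))"

text \<open>The field \<open>v \<partial>/\<partial>x + C \<partial>/\<partial>v + \<partial>/\<partial>t\<close>.\<close>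

definition second_order_field ::
  "(('m, 'n::finite) chart \<Rightarrow> ('m, 'n) point \<Rightarrow> real^'n) \<Rightarrow> ('m, 'n) vfield" where
  "second_order_field C c p = (fst (snd p) c, C c p, 1)"

abbreviation dir_x :: "'n::finite \<Rightarrow> 'n coords" where "dir_x i \<equiv> (axis i 1, 0, 0)"
abbreviation dir_v :: "'n::finite \<Rightarrow> 'n coords" where "dir_v i \<equiv> (0, axis i 1, 0)"
abbreviation dir_t :: "'n::finite coords" where "dir_t \<equiv> (0, 0, 1)"

definition Lvv ::
  "('m, 'n::finite) chart set \<Rightarrow> real \<Rightarrow> (('m, 'n) point \<Rightarrow> real) \<Rightarrow> ('m, 'n) chart
     \<Rightarrow> 'n coords \<Rightarrow> real^'n^'n" where
  "Lvv A t0 L c q = (let S = chart_img t0 c in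
     \<chi> i j. dir_deriv S (dir_deriv S (loc A t0 c L) (dir_v i)) (dir_v j) q)"

definition EL_accel ::
  "('m, 'n::finite) chart set \<Rightarrow> real \<Rightarrow> (('m, 'n) point \<Rightarrow> real) \<Rightarrow> ('m, 'n) chart
     \<Rightarrow> ('m, 'n) point \<Rightarrow> real^'n" where
  "EL_accel A t0 L c p =
     (let S = chart_img t0 c; l = loc A t0 c L; q = coord c p; v = fst (snd p) c in
      \<chi> k. \<Sum>i\<in>UNIV.
        (dir_deriv S l (dir_x i) q
         - dir_deriv S (dir_deriv S l (dir_v i)) dir_t q
         - (\<Sum>j\<in>UNIV. v $ j * dir_deriv S (dir_deriv S l (dir_x j)) (dir_v i) q))
        * matrix_inv (Lvv A t0 L c q) $ i $ k)"

definition EL_field ::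
  "('m, 'n::finite) chart set \<Rightarrow> real \<Rightarrow> (('m, 'n) point \<Rightarrow> real) \<Rightarrow> ('m, 'n) vfield" where
  "EL_field A t0 L = second_order_field (EL_accel A t0 L)"

definition Lvv_invertible_on ::
  "('m, 'n::finite) chart set \<Rightarrow> real \<Rightarrow> (('m, 'n) point \<Rightarrow> real) \<Rightarrow> ('m, 'n) point set \<Rightarrow> bool" where
  "Lvv_invertible_on A t0 L V \<longleftrightarrow>
     (\<forall>c\<in>A. \<forall>p \<in> V \<inter> chart_dom A t0 c. invertible (Lvv A t0 L c (coord c p)))"

text \<open>
  The field is meaningful only on \<open>V\<close>, which carries \<open>\<mu>\<close>; hence the integral is taken over \<open>V\<close>.
\<close>

definition EL_invariant ::
  "('m, 'n::finite) chart set \<Rightarrow> real \<Rightarrow> (('m, 'n) point \<Rightarrow> real) \<Rightarrow> ('m, 'n) point set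
     \<Rightarrow> ('m, 'n) point measure \<Rightarrow> bool" where
  "EL_invariant A t0 L V \<mu> \<longleftrightarrow>
     (\<forall>\<phi>. smooth_TMI A t0 \<phi> \<and> compactly_supported A t0 \<phi> \<and> vanishes_at_ends A t0 \<phi> \<longrightarrow>
        (LINT p:V|\<mu>. deriv_along A t0 (EL_field A t0 L) \<phi> p) = 0)"

definition base_loc :: "('m, 'n::finite) chart \<Rightarrow> ('m \<times> real \<Rightarrow> real) \<Rightarrow> (real^'n) \<times> real \<Rightarrow> real" where
  "base_loc c \<phi> = (\<lambda>(y, t). \<phi> (inv_into (fst c) (snd c) y, t))"

definition smooth_MI ::
  "('m, 'n::finite) chart set \<Rightarrow> real \<Rightarrow> ('m \<times> real \<Rightarrow> real) \<Rightarrow> bool" where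
  "smooth_MI A t0 \<phi> \<longleftrightarrow> (\<forall>c\<in>A. smooth_on (base_loc c \<phi>) ((snd c ` fst c) \<times> {0..t0}))"

definition closed_measures ::
  "('m, 'n::finite) chart set \<Rightarrow> real \<Rightarrow> ('m, 'n) point measure set" where
  "closed_measures A t0 =
     {\<mu>. compact_radon_measure A t0 \<mu> \<and>
        (\<forall>\<phi>. smooth_MI A t0 \<phi> \<and> (\<forall>x. \<phi> (x, 0) = 0 \<and> \<phi> (x, t0) = 0) \<longrightarrow>
          (LINT p|\<mu>. (let c = chart_at A p; (x, v, t) = p in
             dir_deriv ((snd c ` fst c) \<times> {0..t0}) (base_loc c \<phi>) (v c, 1) (snd c x, t))) = 0)}"

definition second_derivative ::
  "('m, 'n::finite) chart set \<Rightarrow> real \<Rightarrow> ('m, 'n) point measure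
     \<Rightarrow> (('m, 'n) chart \<Rightarrow> ('m, 'n) point \<Rightarrow> real^'n) \<Rightarrow> bool" where
  "second_derivative A t0 \<mu> C \<longleftrightarrow>
     vector_field A t0 (second_order_field C) \<and>
     (\<forall>c\<in>A. C c \<in> borel_measurable (restrict_space (TMI_borel A t0) (chart_dom A t0 c))) \<and>
     (\<forall>c\<in>A. \<forall>K. compactin (TMI_top A t0) K \<and> K \<subseteq> chart_dom A t0 c \<longrightarrow>
        bounded (C c ` (K \<inter> msupport A t0 \<mu>))) \<and>
     (\<forall>f. smooth_TMI A t0 f \<and> vanishes_at_ends A t0 f \<longrightarrow>
        (LINT p|\<mu>. deriv_along A t0 (second_order_field C) f p) = 0)"

definition closed_velocity_measures ::
  "('m, 'n::finite) chart set \<Rightarrow> real \<Rightarrow> ('m, 'n) point measure set" where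
  "closed_velocity_measures A t0 =
     {\<mu> \<in> closed_measures A t0. \<exists>C. second_derivative A t0 \<mu> C}"

definition horizontal_map ::
  "('m, 'n::finite) chart set \<Rightarrow> real \<Rightarrow> (('m, 'n) point \<Rightarrow> ('m, 'n) tangent) \<Rightarrow> bool" where
  "horizontal_map A t0 F \<longleftrightarrow>
     (\<forall>p \<in> TMI A t0. F p \<in> tangent_space A (fst p)) \<and>
     (\<forall>c\<in>A. Ck_on 1 (loc A t0 c (\<lambda>p. F p c)) (chart_img t0 c)) \<and>
     (\<forall>(x, v, t)\<in>TMI A t0. t = 0 \<or> t = t0 \<longrightarrow> (\<forall>c. F (x, v, t) c = 0))"

text \<open>
  The integrand of \<open>hor_variation\<close> is \<open>df (F \<partial>/\<partial>x + (F\<^sub>x v + F\<^sub>v C + F\<^sub>t) \<partial>/\<partial>v)\<close>, in a chart.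
\<close>

definition hor_variation ::
  "('m, 'n::finite) chart set \<Rightarrow> real \<Rightarrow> (('m, 'n) point \<Rightarrow> ('m, 'n) tangent)
     \<Rightarrow> ('m, 'n) point measure \<Rightarrow> (('m, 'n) chart \<Rightarrow> ('m, 'n) point \<Rightarrow> real^'n)
     \<Rightarrow> (('m, 'n) point \<Rightarrow> real) \<Rightarrow> real" where
  "hor_variation A t0 F \<mu> C f =
     (LINT p|\<mu>. deriv_along A t0
        (\<lambda>c p. (F p c,
                dir_deriv (chart_img t0 c) (loc A t0 c (\<lambda>p. F p c))
                  (second_order_field C c p) (coord c p),
                0)) f p)"

text \<open>
  \<open>L\<^sub>v\<^sub>v F\<close> is in general only a locally Lipschitz 1-form on the fibers, since \<open>L\<close> has no third
  derivatives.  Its exterior derivative is therefore taken in the sense of distributions.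
\<close>

definition closed_1form :: "(real^'n \<Rightarrow> real^'n::finite) \<Rightarrow> bool" where
  "closed_1form \<omega> \<longleftrightarrow>
     (\<forall>f. smooth_on (f :: real^'n \<Rightarrow> real) UNIV \<and> compact (closure {w. f w \<noteq> 0}) \<longrightarrow>
        (\<forall>i j. (LINT w|lborel. \<omega> w $ i * dir_deriv UNIV f (axis j 1) w
                             - \<omega> w $ j * dir_deriv UNIV f (axis i 1) w) = 0))"

definition fiber_closed ::
  "('m, 'n::finite) chart set \<Rightarrow> real \<Rightarrow> (('m, 'n) point \<Rightarrow> real)
     \<Rightarrow> (('m, 'n) point \<Rightarrow> ('m, 'n) tangent) \<Rightarrow> bool" where
  "fiber_closed A t0 L F \<longleftrightarrow>
     (\<forall>c\<in>A. \<forall>y \<in> snd c ` fst c. \<forall>t\<in>{0..t0}.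
        closed_1form (\<lambda>w. Lvv A t0 L c (y, w, t) *v loc A t0 c (\<lambda>p. F p c) (y, w, t)))"

definition Theta ::
  "('m, 'n::finite) chart set \<Rightarrow> real \<Rightarrow> (('m, 'n) point \<Rightarrow> real) \<Rightarrow> ('m, 'n) point measure
     \<Rightarrow> ((('m, 'n) point \<Rightarrow> real) \<Rightarrow> real) set" where
  "Theta A t0 L \<mu> = {hor_variation A t0 F \<mu> C | F C.
     \<mu> \<in> closed_velocity_measures A t0 \<and> second_derivative A t0 \<mu> C \<and>
     horizontal_map A t0 F \<and> fiber_closed A t0 L F}"

text \<open>
  An element of \<open>Theta\<close> is a distribution on smooth functions; the same formula extends it to
  \<open>C\<^sup>1\<close> functions such as \<open>L\<close>.
\<close>

definition exact_horizontal_variation ::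
  "('m, 'n::finite) chart set \<Rightarrow> real \<Rightarrow> (('m, 'n) point \<Rightarrow> real) \<Rightarrow> ('m, 'n) point measure
     \<Rightarrow> (real \<Rightarrow> ('m, 'n) point measure) \<Rightarrow> ((('m, 'n) point \<Rightarrow> real) \<Rightarrow> real) \<Rightarrow> bool" where
  "exact_horizontal_variation A t0 L \<mu> \<mu>s \<eta> \<longleftrightarrow>
     range \<mu>s \<subseteq> closed_measures A t0 \<and> \<mu>s 0 = \<mu> \<and> \<eta> \<in> Theta A t0 L \<mu> \<and>
     (\<forall>g. smooth_TMI A t0 g \<longrightarrow>
        ((\<lambda>s. LINT p|\<mu>s s. g p) has_real_derivative \<eta> g) (at 0))"

definition horizontally_critical ::
  "('m, 'n::finite) chart set \<Rightarrow> real \<Rightarrow> (('m, 'n) point \<Rightarrow> real) \<Rightarrow> ('m, 'n) point measure \<Rightarrow> bool" where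
  "horizontally_critical A t0 L \<mu> \<longleftrightarrow>
     (\<forall>\<mu>s \<eta>. exact_horizontal_variation A t0 L \<mu> \<mu>s \<eta> \<longrightarrow> \<eta> L = 0)"

end

(* Choose any second derivative C of \<mu> and let W be the difference of the Euler-Lagrange acceleration
   and C, a vertical field.  Then \<mu> is invariant iff \<integral> f\<^sub>v W d\<mu> = 0 for all admissible f.  Testing C
   against F L\<^sub>v gives <\<eta>, L> = \<integral> (L\<^sub>v\<^sub>v F) W d\<mu> for \<eta> the horizontal variation defined by F and C.  A
   fiberwise closed L\<^sub>v\<^sub>v F has a fiberwise primitive, so invariance implies criticality.  Conversely,
   take f locally supported, mollify f composed with the inverse of the local Legendre transform
   (x, v, t) -> (x, L\<^sub>v, t), and let F be the fiber gradient of the result, evaluated at (x, L\<^sub>v, t):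
   then L\<^sub>v\<^sub>v F is a fiberwise gradient close to f\<^sub>v.  The corresponding variation of \<mu> is its image under
   (x, v, t) -> (x + s F, v + s (F\<^sub>x v + F\<^sub>v C + F\<^sub>t), t). *)

theory Submission
  imports Defs
begin

section \<open>Functions of class \<open>C\<^sup>k\<close>\<close>

text \<open>The obstacle is regularity. Since L is only C^2, the natural candidate F = L_vv^-1 f_v
  need not be C^1, hence need not be admissible. In the coordinates (x, p, t) with p = L_v things
  improve: the p-gradient of a smooth u, evaluated at (x, L_v, t), is C^1 because L_v is, and by the
  chain rule L_vv maps it to the fiber gradient of u(x, L_v, t). Mollifying after the transform
  therefore gives regularity and closedness at once. The functions to be tested are not smooth
  either: L_v F is C^1, and the fiber primitive of L_vv F is known to be differentiable along the
  fibers only. So the test classes are enlarged twice, for second derivatives to C^1 functions and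
  for vertical fields to functions with a continuous fiber derivative. Mollification mixes times and
  works only away from t = 0 and t = t0. The ends are reached by time cutoffs, whose derivatives
  stay bounded against a C^1 function vanishing at the ends and are not seen by vertical fields. For
  second derivatives the limit also needs that \<mu> has no mass at the ends.\<close>

definition thick :: "'a::euclidean_space set \<Rightarrow> bool" where
  "thick S \<longleftrightarrow> (\<forall>p\<in>S. \<forall>i\<in>Basis. \<forall>e>0. \<exists>d. 0 < \<bar>d\<bar> \<and> \<bar>d\<bar> < e \<and> p + d *\<^sub>R i \<in> S)"

text \<open>\<open>frechet_derivative\<close> is a choice among derivatives. It is forced if the set
  can be re-entered from the point at arbitrarily small nonzero distance along every basis
  direction, which is what \<open>thick\<close> says. Open sets and closed time intervals have this
  property, hence also \<open>chart_img\<close>, where the time derivative at an end is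
  one-sided.\<close>

lemma thick_frechet_derivative:
  assumes "thick S" "p \<in> S" "(f has_derivative D) (at p within S)"
  shows "frechet_derivative f (at p within S) = D"
proof -
  have "(f has_derivative frechet_derivative f (at p within S)) (at p within S)"
    using assms(3) differentiableI frechet_derivative_works by blast
  then show ?thesis
    using frechet_derivative_unique_within[OF _ assms(3)] assms(1,2) unfolding thick_def by blast
qed

lemma thick_openin:
  assumes "thick S" "openin (top_of_set S) U"
  shows "thick U"
  unfolding thick_def
proof (intro ballI allI impI)
  fix p i :: 'a and e :: real assume p: "p \<in> U" and i: "i \<in> Basis" and e: "e > 0"
  from assms(2) obtain T where T: "open T" "U = S \<inter> T" by (auto simp: openin_open)
  then obtain r where r: "r > 0" "ball p r \<subseteq> T" using p by (meson IntE openE)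
  from assms(1) p T i have "\<exists>d. 0 < \<bar>d\<bar> \<and> \<bar>d\<bar> < min e r \<and> p + d *\<^sub>R i \<in> S"
    unfolding thick_def using e r by (metis IntE min_less_iff_conj)
  then obtain d where d: "0 < \<bar>d\<bar>" "\<bar>d\<bar> < min e r" "p + d *\<^sub>R i \<in> S" by blast
  have "p + d *\<^sub>R i \<in> ball p r" using d i by (simp add: dist_norm)
  then show "\<exists>d. 0 < \<bar>d\<bar> \<and> \<bar>d\<bar> < e \<and> p + d *\<^sub>R i \<in> U" using d r T by auto
qed

lemma thick_UNIV [simp]: "thick UNIV"
  unfolding thick_def
proof (intro ballI allI impI)
  fix p i :: 'a and e :: real assume "e > 0"
  then show "\<exists>d. 0 < \<bar>d\<bar> \<and> \<bar>d\<bar> < e \<and> p + d *\<^sub>R i \<in> UNIV"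
    by (intro exI[of _ "e/2"]) auto
qed

lemma thick_open: "open S \<Longrightarrow> thick S"
  using thick_openin[of UNIV S] by simp

lemma thick_interval: "t0 > 0 \<Longrightarrow> thick {0..t0::real}"
  unfolding thick_def
proof (intro ballI allI impI)
  fix p i e :: real assume a: "t0 > 0" "p \<in> {0..t0}" "i \<in> Basis" "e > 0"
  have i: "i = 1" using a by simp
  show "\<exists>d. 0 < \<bar>d\<bar> \<and> \<bar>d\<bar> < e \<and> p + d *\<^sub>R i \<in> {0..t0}"
  proof (cases "p < t0")
    case True
    then show ?thesis using a i by (intro exI[of _ "min (e/2) (t0 - p)"]) auto
  next
    case False
    then show ?thesis using a i by (intro exI[of _ "- min (e/2) t0"]) auto
  qed
qed

lemma thick_Times: "thick S \<Longrightarrow> thick T \<Longrightarrow> thick (S \<times> T)"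
  unfolding thick_def Basis_prod_def by (fastforce simp: zero_prod_def)

lemma Ck_on_cong:
  assumes "Ck_on k f S" "\<And>p. p \<in> S \<Longrightarrow> f p = g p"
  shows "Ck_on k g S"
proof (cases k)
  case 0
  then show ?thesis using assms by (simp cong: continuous_on_cong)
next
  case (Suc n)
  with assms obtain D where D: "\<forall>p\<in>S. (f has_derivative D p) (at p within S)"
    "\<forall>h. Ck_on n (\<lambda>p. D p h) S" by auto
  have "\<forall>p\<in>S. (g has_derivative D p) (at p within S)"
    using D assms(2) by (metis has_derivative_transform)
  with D Suc show ?thesis by auto
qed

lemma Ck_on_subset: "Ck_on k f S \<Longrightarrow> T \<subseteq> S \<Longrightarrow> Ck_on k f T"
proof (induction k arbitrary: f)
  case 0 then show ?case using continuous_on_subset by auto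
next
  case (Suc k)
  then obtain D where D: "\<forall>p\<in>S. (f has_derivative D p) (at p within S)"
    "\<forall>h. Ck_on k (\<lambda>p. D p h) S" by auto
  with Suc show ?case by (auto intro!: exI[of _ D] intro: has_derivative_subset)
qed

lemma Ck_on_imp_continuous: "Ck_on k f S \<Longrightarrow> continuous_on S f"
proof (cases k)
  case (Suc n)
  assume "Ck_on k f S"
  with Suc obtain D where "\<forall>p\<in>S. (f has_derivative D p) (at p within S)" by auto
  then show ?thesis by (meson continuous_on_eq_continuous_within has_derivative_continuous)
qed simp

lemma Ck_on_Suc_D: "Ck_on (Suc k) f S \<Longrightarrow> Ck_on k f S"
proof (induction k arbitrary: f)
  case 0 then show ?case using Ck_on_imp_continuous[of "Suc 0"] by simp
next
  case (Suc k)
  then obtain D where D: "\<forall>p\<in>S. (f has_derivative D p) (at p within S)"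
    "\<forall>h. Ck_on (Suc k) (\<lambda>p. D p h) S" by (subst (asm) Ck_on.simps(2)) blast
  have "\<forall>h. Ck_on k (\<lambda>p. D p h) S" using D(2) Suc.IH by blast
  with D(1) show ?case unfolding Ck_on.simps(2) by blast
qed

lemma Ck_on_SucI:
  assumes "\<And>p. p \<in> S \<Longrightarrow> (f has_derivative D p) (at p within S)" "\<And>h. Ck_on k (\<lambda>p. D p h) S"
  shows "Ck_on (Suc k) f S"
  using assms by auto

lemma Ck_on_SucE:
  assumes "Ck_on (Suc k) f S"
  obtains D where "\<And>p. p \<in> S \<Longrightarrow> (f has_derivative D p) (at p within S)" "\<And>h. Ck_on k (\<lambda>p. D p h) S"
  using assms by auto

text \<open>On a thick set the existential witness in \<open>Ck_on\<close> is the Frechet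
  derivative, so regularity passes to the \<open>dir_deriv\<close> in which all the notions are
  written.\<close>

lemma Ck_on_frechet:
  assumes "Ck_on (Suc k) f S" "thick S"
  shows "p \<in> S \<Longrightarrow> (f has_derivative frechet_derivative f (at p within S)) (at p within S)"
    and "Ck_on k (dir_deriv S f h) S"
proof -
  obtain D where D: "\<And>p. p \<in> S \<Longrightarrow> (f has_derivative D p) (at p within S)" "\<And>h. Ck_on k (\<lambda>p. D p h) S"
    using assms(1) Ck_on_SucE by blast
  have *: "frechet_derivative f (at p within S) = D p" if "p \<in> S" for p
    using thick_frechet_derivative[OF assms(2) that D(1)[OF that]] .
  show "p \<in> S \<Longrightarrow> (f has_derivative frechet_derivative f (at p within S)) (at p within S)"
    using * D(1) by simp
  show "Ck_on k (dir_deriv S f h) S"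
    using Ck_on_cong[OF D(2)[of h]] * by simp
qed

lemma Ck_on_const: "Ck_on k (\<lambda>p. c) S"
proof (induction k arbitrary: c)
  case (Suc k) then show ?case by (intro Ck_on_SucI[where D="\<lambda>p h. 0"]) auto
qed simp

lemma Ck_on_bounded_linear:
  assumes "bounded_linear l" shows "Ck_on k l S"
proof (cases k)
  case 0 then show ?thesis using assms by (simp add: linear_continuous_on)
next
  case (Suc n)
  show ?thesis unfolding Suc
    by (intro Ck_on_SucI[where D="\<lambda>p. l"]) (auto intro: bounded_linear.has_derivative[OF assms] simp: Ck_on_const bounded_linear_imp_has_derivative assms)
qed

lemma Ck_on_id: "Ck_on k (\<lambda>p. p) S"
  by (rule Ck_on_bounded_linear) (rule bounded_linear_ident)

lemma Ck_on_linear_compose: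
  assumes "bounded_linear l" "Ck_on k f S"
  shows "Ck_on k (\<lambda>p. l (f p)) S"
  using assms(2)
proof (induction k arbitrary: f)
  case 0 then show ?case using assms(1) by (simp add: bounded_linear.continuous_on)
next
  case (Suc k)
  then obtain D where D: "\<And>p. p \<in> S \<Longrightarrow> (f has_derivative D p) (at p within S)" "\<And>h. Ck_on k (\<lambda>p. D p h) S"
    using Ck_on_SucE by blast
  show ?case
    by (rule Ck_on_SucI[where D="\<lambda>p h. l (D p h)"])
      (auto intro: bounded_linear.has_derivative[OF assms(1)] D Suc.IH)
qed

lemma Ck_on_add:
  assumes "Ck_on k f S" "Ck_on k g S"
  shows "Ck_on k (\<lambda>p. f p + g p) S"
  using assms
proof (induction k arbitrary: f g)
  case 0 then show ?case by (simp add: continuous_on_add)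
next
  case (Suc k)
  obtain D where D: "\<And>p. p \<in> S \<Longrightarrow> (f has_derivative D p) (at p within S)" "\<And>h. Ck_on k (\<lambda>p. D p h) S"
    using Suc Ck_on_SucE by blast
  obtain E where E: "\<And>p. p \<in> S \<Longrightarrow> (g has_derivative E p) (at p within S)" "\<And>h. Ck_on k (\<lambda>p. E p h) S"
    using Suc Ck_on_SucE by blast
  show ?case
    by (rule Ck_on_SucI[where D="\<lambda>p h. D p h + E p h"])
      (auto intro: has_derivative_add D E Suc.IH)
qed

lemma Ck_on_minus: "Ck_on k f S \<Longrightarrow> Ck_on k (\<lambda>p. - f p) S"
  using Ck_on_linear_compose[OF bounded_linear_minus[OF bounded_linear_ident]] .

lemma Ck_on_diff: "Ck_on k f S \<Longrightarrow> Ck_on k g S \<Longrightarrow> Ck_on k (\<lambda>p. f p - g p) S"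
  using Ck_on_add[OF _ Ck_on_minus, of k f S g] by simp

lemma Ck_on_sum: "(\<And>i. i \<in> I \<Longrightarrow> Ck_on k (f i) S) \<Longrightarrow> Ck_on k (\<lambda>p. \<Sum>i\<in>I. f i p) S"
  by (induction I rule: infinite_finite_induct) (auto simp: Ck_on_const Ck_on_add)

lemma Ck_on_bilinear:
  assumes bl: "bounded_bilinear b" and "Ck_on k f S" "Ck_on k g S"
  shows "Ck_on k (\<lambda>p. b (f p) (g p)) S"
  using assms(2,3)
proof (induction k arbitrary: f g)
  case 0 then show ?case using bl by (simp add: bounded_bilinear.continuous_on)
next
  case (Suc k)
  obtain D where D: "\<And>p. p \<in> S \<Longrightarrow> (f has_derivative D p) (at p within S)" "\<And>h. Ck_on k (\<lambda>p. D p h) S"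
    using Suc.prems Ck_on_SucE by blast
  obtain E where E: "\<And>p. p \<in> S \<Longrightarrow> (g has_derivative E p) (at p within S)" "\<And>h. Ck_on k (\<lambda>p. E p h) S"
    using Suc.prems Ck_on_SucE by blast
  note f = Ck_on_Suc_D[OF Suc.prems(1)] and g = Ck_on_Suc_D[OF Suc.prems(2)]
  show ?case
    by (rule Ck_on_SucI[where D="\<lambda>p h. b (f p) (E p h) + b (D p h) (g p)"])
      (intro bounded_bilinear.FDERIV[OF bl] D E Ck_on_add Suc.IH f g
       | assumption)+
qed

lemmas Ck_on_mult = Ck_on_bilinear[OF bounded_bilinear_mult]
lemmas Ck_on_scaleR = Ck_on_bilinear[OF bounded_bilinear_scaleR]
lemmas Ck_on_inner = Ck_on_bilinear[OF bounded_bilinear_inner]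

text \<open>\<open>Ck_on\<close> controls derivatives in a fixed direction, while the chain rule
  produces \<open>D (g p)\<close> in the moving direction \<open>E p h\<close>. Expanding that
  direction in the basis separates the two dependences on \<open>p\<close>, and the induction
  hypothesis applies to each fixed basis direction.\<close>

lemma Ck_on_compose:
  fixes f :: "'b::euclidean_space \<Rightarrow> 'c::real_normed_vector" and g :: "'a::euclidean_space \<Rightarrow> 'b"
  assumes "Ck_on k f T" "Ck_on k g S" "g ` S \<subseteq> T"
  shows "Ck_on k (\<lambda>p. f (g p)) S"
  using assms
proof (induction k arbitrary: f)
  case 0 then show ?case by (auto intro: continuous_on_compose2)
next
  case (Suc k)
  obtain D where D: "\<And>p. p \<in> T \<Longrightarrow> (f has_derivative D p) (at p within T)" "\<And>h. Ck_on k (\<lambda>p. D p h) T"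
    using Suc.prems Ck_on_SucE by blast
  obtain E where E: "\<And>p. p \<in> S \<Longrightarrow> (g has_derivative E p) (at p within S)" "\<And>h. Ck_on k (\<lambda>p. E p h) S"
    using Suc.prems Ck_on_SucE by blast
  have g: "Ck_on k g S" using Suc.prems Ck_on_Suc_D by blast
  have 1: "((\<lambda>p. f (g p)) has_derivative (\<lambda>h. \<Sum>b\<in>Basis. (E p h \<bullet> b) *\<^sub>R D (g p) b)) (at p within S)"
    if p: "p \<in> S" for p
  proof -
    have gp: "g p \<in> T" using p Suc.prems by auto
    have "(f has_derivative D (g p)) (at (g p) within g ` S)"
      using D(1)[OF gp] Suc.prems(3) has_derivative_subset by blast
    then have "((\<lambda>p. f (g p)) has_derivative (\<lambda>h. D (g p) (E p h))) (at p within S)"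
      using diff_chain_within[OF E(1)[OF p]] by (simp add: o_def)
    moreover have l: "linear (D (g p))" using D(1)[OF gp] has_derivative_linear by blast
    have "D (g p) (\<Sum>b\<in>Basis. (E p h \<bullet> b) *\<^sub>R b) = (\<Sum>b\<in>Basis. (E p h \<bullet> b) *\<^sub>R D (g p) b)" for h
      by (simp only: linear_sum[OF l] linear_scale[OF l])
    then have "D (g p) (E p h) = (\<Sum>b\<in>Basis. (E p h \<bullet> b) *\<^sub>R D (g p) b)" for h
      by (simp only: euclidean_representation)
    ultimately show ?thesis by simp
  qed
  have 2: "Ck_on k (\<lambda>p. \<Sum>b\<in>Basis. (E p h \<bullet> b) *\<^sub>R D (g p) b) S" for h
    by (intro Ck_on_sum Ck_on_scaleR Ck_on_inner E Ck_on_const Suc.IH[OF D(2) g Suc.prems(3)])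
  show ?case
    using Ck_on_SucI[where D="\<lambda>p h. \<Sum>b\<in>Basis. (E p h \<bullet> b) *\<^sub>R D (g p) b", OF 1 2] .
qed

lemma Ck_on_Pair:
  assumes "Ck_on k f S" "Ck_on k g S"
  shows "Ck_on k (\<lambda>p. (f p, g p)) S"
proof -
  have "Ck_on k (\<lambda>p. (f p, 0) + (0, g p)) S"
    by (intro Ck_on_add Ck_on_linear_compose[OF _ assms(1), of "\<lambda>x. (x, 0)"]
        Ck_on_linear_compose[OF _ assms(2), of "\<lambda>x. (0, x)"] bounded_linear_intros)
  then show ?thesis by simp
qed

lemma Ck_on_vec:
  fixes f :: "'a::euclidean_space \<Rightarrow> real^'n"
  assumes "\<And>i. Ck_on k (\<lambda>p. f p $ i) S"
  shows "Ck_on k f S"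
proof -
  have "Ck_on k (\<lambda>p. \<Sum>i\<in>UNIV. f p $ i *\<^sub>R axis i (1::real)) S"
    by (intro Ck_on_sum Ck_on_scaleR assms Ck_on_const)
  moreover have "(\<Sum>i\<in>UNIV. f p $ i *\<^sub>R axis i (1::real)) = f p" for p
    by (simp add: vec_eq_iff axis_def if_distrib sum.delta cong: if_cong)
  ultimately show ?thesis by simp
qed

lemma Ck_on_nth: "Ck_on k f S \<Longrightarrow> Ck_on k (\<lambda>p. f p $ i) S"
  using Ck_on_linear_compose[OF bounded_linear_vec_nth] .

lemma Ck_on_fst: "Ck_on k f S \<Longrightarrow> Ck_on k (\<lambda>p. fst (f p)) S"
  using Ck_on_linear_compose[OF bounded_linear_fst] .

lemma Ck_on_snd: "Ck_on k f S \<Longrightarrow> Ck_on k (\<lambda>p. snd (f p)) S"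
  using Ck_on_linear_compose[OF bounded_linear_snd] .

lemma Ck_on_power: "Ck_on k f S \<Longrightarrow> Ck_on k (\<lambda>p. (f p :: real) ^ n) S"
  by (induction n) (auto simp: Ck_on_const Ck_on_mult)

lemma Ck_on_inverse:
  fixes f :: "'a::euclidean_space \<Rightarrow> real"
  assumes "Ck_on k f S" "\<And>p. p \<in> S \<Longrightarrow> f p \<noteq> 0"
  shows "Ck_on k (\<lambda>p. inverse (f p)) S"
  using assms(1)
proof (induction k)
  case 0 then show ?case using assms(2) by (auto intro: continuous_on_inverse)
next
  case (Suc k)
  obtain D where D: "\<And>p. p \<in> S \<Longrightarrow> (f has_derivative D p) (at p within S)" "\<And>h. Ck_on k (\<lambda>p. D p h) S"
    using Suc.prems Ck_on_SucE by blast
  show ?case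
  proof (rule Ck_on_SucI[where D="\<lambda>p h. - (inverse (f p) * D p h * inverse (f p))"])
    show "((\<lambda>p. inverse (f p)) has_derivative (\<lambda>h. - (inverse (f p) * D p h * inverse (f p)))) (at p within S)"
      if "p \<in> S" for p
      using Deriv.has_derivative_inverse[OF assms(2)[OF that] D(1)[OF that]] .
    show "Ck_on k (\<lambda>p. - (inverse (f p) * D p h * inverse (f p))) S" for h
      by (intro Ck_on_minus Ck_on_mult D(2) Suc.IH Ck_on_Suc_D[OF Suc.prems])
  qed
qed

lemma at_within_openin:
  assumes "openin (top_of_set S) U" "p \<in> U"
  shows "at p within U = at p within S"
proof -
  obtain T where "open T" "U = S \<inter> T" using assms(1) by (auto simp: openin_open)
  then show ?thesis using assms(2) by (intro at_within_nhd[of _ T]) auto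
qed

text \<open>Passing to a relatively open subset does not change the filter
  \<open>at p within S\<close>, so the local derivatives are restrictions of one derivative on
  \<open>S\<close>.\<close>

lemma Ck_on_local:
  assumes "thick S" "\<And>p. p \<in> S \<Longrightarrow> \<exists>U. openin (top_of_set S) U \<and> p \<in> U \<and> Ck_on k f U"
  shows "Ck_on k f S"
  using assms(2)
proof (induction k arbitrary: f)
  case 0
  have "continuous (at p within S) f" if p: "p \<in> S" for p
  proof -
    obtain U where U: "openin (top_of_set S) U" "p \<in> U" "continuous_on U f" using 0[OF p] by auto
    then show ?thesis using at_within_openin[OF U(1,2)] by (metis continuous_on_eq_continuous_within)
  qed
  then show ?case by (simp add: continuous_on_eq_continuous_within)
next
  case (Suc k)
  have *: "(f has_derivative frechet_derivative f (at p within S)) (at p within S) \<and>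
     (\<exists>U. openin (top_of_set S) U \<and> p \<in> U \<and> Ck_on k (dir_deriv S f h) U)" if p: "p \<in> S" for p h
  proof -
    obtain U where U: "openin (top_of_set S) U" "p \<in> U" "Ck_on (Suc k) f U" using Suc.prems[OF p] by blast
    note tU = thick_openin[OF assms(1) U(1)]
    have eq: "at q within U = at q within S" if "q \<in> U" for q
      using at_within_openin[OF U(1) that] .
    have "(f has_derivative frechet_derivative f (at p within U)) (at p within U)"
      using Ck_on_frechet(1)[OF U(3) tU U(2)] .
    moreover have "Ck_on k (dir_deriv U f h) U" using Ck_on_frechet(2)[OF U(3) tU] .
    then have "Ck_on k (dir_deriv S f h) U" by (rule Ck_on_cong) (simp add: eq)
    ultimately show ?thesis using eq[OF U(2)] U by auto
  qed
  show ?case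
  proof (rule Ck_on_SucI)
    show "(f has_derivative frechet_derivative f (at p within S)) (at p within S)" if "p \<in> S" for p
      using *[OF that] by blast
    show "Ck_on k (dir_deriv S f h) S" for h
      by (rule Suc.IH) (use * in blast)
  qed
qed

lemma smooth_onD: "smooth_on f S \<Longrightarrow> Ck_on k f S"
  by (simp add: smooth_on_def)

section \<open>Symmetry of second derivatives\<close>

lemma dir_deriv_2_mean_value:
  fixes f :: "'a::euclidean_space \<Rightarrow> real"
  assumes D: "\<And>q. q \<in> ball p r \<Longrightarrow> (f has_derivative D q) (at q)"
    and E: "\<And>q. q \<in> ball p r \<Longrightarrow> ((\<lambda>q. D q h) has_derivative E q) (at q)"
    and s: "0 < s" "s * (norm h + norm k) < r"
  shows "\<exists>q. dist q p \<le> s * (norm h + norm k) \<and>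
     f (p + s *\<^sub>R h + s *\<^sub>R k) - f (p + s *\<^sub>R h) - f (p + s *\<^sub>R k) + f p = s * s * E q k"
proof -
  have n: "norm (a *\<^sub>R h + b *\<^sub>R k) \<le> s * (norm h + norm k)" if "0 \<le> a" "a \<le> s" "0 \<le> b" "b \<le> s" for a b
  proof -
    have "norm (a *\<^sub>R h + b *\<^sub>R k) \<le> a * norm h + b * norm k"
      using norm_triangle_ineq[of "a *\<^sub>R h" "b *\<^sub>R k"] that by simp
    also have "\<dots> \<le> s * norm h + s * norm k" using that by (intro add_mono mult_right_mono) auto
    finally show ?thesis by (simp add: algebra_simps)
  qed
  have d: "dist (p + a *\<^sub>R h + b *\<^sub>R k) p \<le> s * (norm h + norm k)"
    if "0 \<le> a" "a \<le> s" "0 \<le> b" "b \<le> s" for a b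
    using n[OF that] by (simp add: dist_norm add.assoc)
  have B: "p + a *\<^sub>R h + b *\<^sub>R k \<in> ball p r" if "0 \<le> a" "a \<le> s" "0 \<le> b" "b \<le> s" for a b
    using d[OF that] s by (simp add: dist_commute)
  have der: "((\<lambda>x. F (c + x *\<^sub>R w)) has_real_derivative G w) (at a)"
    if "(F has_derivative G) (at (c + a *\<^sub>R w))" for F :: "'a \<Rightarrow> real" and G c w a
  proof -
    have l: "linear G" using that has_derivative_linear by blast
    have "((\<lambda>x. F (c + x *\<^sub>R w)) has_derivative (\<lambda>x. G (x *\<^sub>R w))) (at a)"
      by (rule has_derivative_compose[where g=F and g'=G and f="\<lambda>x. c + x *\<^sub>R w", OF _ that]) (auto intro!: derivative_eq_intros)
    moreover have "(\<lambda>x. G (x *\<^sub>R w)) = (*) (G w)" using linear_scale[OF l] by (auto simp: fun_eq_iff)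
    ultimately show ?thesis by (simp add: has_field_derivative_def)
  qed
  \<comment> \<open>The second difference is the increment over the \<open>h\<close>-segment of the
    first difference in direction \<open>k\<close>. The mean value theorem is applied to it in the
    variable along \<open>h\<close>, and then once more along \<open>k\<close>.\<close>
  have "\<exists>z. 0 < z \<and> z < s \<and> (f (p + s *\<^sub>R k + s *\<^sub>R h) - f (p + s *\<^sub>R h)) - (f (p + s *\<^sub>R k + 0 *\<^sub>R h) - f (p + 0 *\<^sub>R h))
      = (s - 0) * (D (p + s *\<^sub>R k + z *\<^sub>R h) h - D (p + z *\<^sub>R h) h)"
  proof (rule MVT2[OF s(1)])
    fix x assume x: "0 \<le> x" "x \<le> s"
    show "((\<lambda>x. f (p + s *\<^sub>R k + x *\<^sub>R h) - f (p + x *\<^sub>R h)) has_real_derivative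
            D (p + s *\<^sub>R k + x *\<^sub>R h) h - D (p + x *\<^sub>R h) h) (at x)"
      using B[of x s] B[of x 0] x s
      by (intro DERIV_diff der D) (auto simp: algebra_simps)
  qed
  then obtain z where z: "0 < z" "z < s"
    "f (p + s *\<^sub>R h + s *\<^sub>R k) - f (p + s *\<^sub>R h) - f (p + s *\<^sub>R k) + f p
       = s * (D (p + z *\<^sub>R h + s *\<^sub>R k) h - D (p + z *\<^sub>R h + 0 *\<^sub>R k) h)"
    by (auto simp: algebra_simps)
  have "\<exists>y. 0 < y \<and> y < s \<and> D (p + z *\<^sub>R h + s *\<^sub>R k) h - D (p + z *\<^sub>R h + 0 *\<^sub>R k) h
      = (s - 0) * E (p + z *\<^sub>R h + y *\<^sub>R k) k"
  proof (rule MVT2[OF s(1)])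
    fix x assume x: "0 \<le> x" "x \<le> s"
    have "p + z *\<^sub>R h + x *\<^sub>R k \<in> ball p r" using B[of z x] x z by simp
    from der[OF E[OF this]]
    show "((\<lambda>x. D (p + z *\<^sub>R h + x *\<^sub>R k) h) has_real_derivative E (p + z *\<^sub>R h + x *\<^sub>R k) k) (at x)" .
  qed
  then show ?thesis using z d[of z] by (metis (no_types, lifting) diff_zero less_imp_le mult.assoc)
qed

text \<open>The second difference over a small parallelogram does not distinguish \<open>h\<close>
  from \<open>k\<close>, and equals s^2 times either mixed derivative at some nearby point.
  Continuity of both mixed derivatives forces their values at \<open>p\<close> to agree.\<close>

lemma second_derivative_symmetric:
  fixes f :: "'a::euclidean_space \<Rightarrow> real"
  assumes O: "open S" "p \<in> S"
    and D: "\<And>q. q \<in> S \<Longrightarrow> (f has_derivative D q) (at q)"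
    and E: "\<And>q. q \<in> S \<Longrightarrow> ((\<lambda>q. D q h) has_derivative E q) (at q)"
    and F: "\<And>q. q \<in> S \<Longrightarrow> ((\<lambda>q. D q k) has_derivative F q) (at q)"
    and cE: "continuous_on S (\<lambda>q. E q k)" and cF: "continuous_on S (\<lambda>q. F q h)"
  shows "E p k = F p h"
proof (rule ccontr)
  assume ne: "E p k \<noteq> F p h"
  define e where "e = \<bar>E p k - F p h\<bar> / 3"
  have e: "e > 0" using ne by (simp add: e_def)
  obtain r0 where r0: "r0 > 0" "ball p r0 \<subseteq> S" using O openE by blast
  have "continuous (at p) (\<lambda>q. E q k)" "continuous (at p) (\<lambda>q. F q h)"
    using cE cF O continuous_on_eq_continuous_at by blast+
  then obtain d1 d2 where d: "d1 > 0" "\<And>q. dist q p < d1 \<Longrightarrow> dist (E q k) (E p k) < e"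
     "d2 > 0" "\<And>q. dist q p < d2 \<Longrightarrow> dist (F q h) (F p h) < e"
    unfolding continuous_at_eps_delta using e by metis
  define r where "r = min r0 (min d1 d2)"
  have r: "r > 0" using r0 d by (simp add: r_def)
  \<comment> \<open>The parallelogram must stay in the ball where both mixed derivatives are within
    a third of the supposed gap from their values at \<open>p\<close>. The summand 1 covers the case
    that \<open>h\<close> and \<open>k\<close> are both 0.\<close>
  define s where "s = r / (2 * (norm h + norm k + 1))"
  have nn: "norm h + norm k + 1 > 0" by (simp add: add_nonneg_pos)
  then have s: "s > 0" using r by (simp add: s_def)
  have "s * (norm h + norm k) < s * (2 * (norm h + norm k + 1))"
    using s nn norm_ge_zero[of h] norm_ge_zero[of k] by (intro mult_strict_left_mono) (auto simp del: norm_ge_zero)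
  also have "\<dots> = r" using nn by (simp add: s_def)
  finally have sr: "s * (norm h + norm k) < r" .
  have br: "ball p r \<subseteq> S" using r0 by (auto simp: r_def)
  have "\<exists>q. dist q p \<le> s * (norm h + norm k) \<and>
     f (p + s *\<^sub>R h + s *\<^sub>R k) - f (p + s *\<^sub>R h) - f (p + s *\<^sub>R k) + f p = s * s * E q k"
    by (rule dir_deriv_2_mean_value[of p r _ D]) (use D E s sr br in auto)
  then obtain q1 where q1: "dist q1 p \<le> s * (norm h + norm k)"
    "f (p + s *\<^sub>R h + s *\<^sub>R k) - f (p + s *\<^sub>R h) - f (p + s *\<^sub>R k) + f p = s * s * E q1 k"
    by blast
  have "\<exists>q. dist q p \<le> s * (norm k + norm h) \<and>
     f (p + s *\<^sub>R k + s *\<^sub>R h) - f (p + s *\<^sub>R k) - f (p + s *\<^sub>R h) + f p = s * s * F q h"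
    by (rule dir_deriv_2_mean_value[of p r _ D]) (use D F s sr br in \<open>auto simp: add.commute\<close>)
  then obtain q2 where q2: "dist q2 p \<le> s * (norm k + norm h)"
    "f (p + s *\<^sub>R k + s *\<^sub>R h) - f (p + s *\<^sub>R k) - f (p + s *\<^sub>R h) + f p = s * s * F q2 h"
    by blast
  have "s * s * E q1 k = s * s * F q2 h"
    unfolding q1(2)[symmetric] q2(2)[symmetric] by (simp add: algebra_simps)
  then have "E q1 k = F q2 h" using s by simp
  moreover have "dist (E q1 k) (E p k) < e" "dist (F q2 h) (F p h) < e"
    using d q1 q2 sr by (auto simp: r_def add.commute)
  moreover have "3 * e = \<bar>E p k - F p h\<bar>" by (simp add: e_def)
  ultimately show False using e unfolding dist_real_def by linarith
qed

lemma dir_deriv_commute: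
  fixes f :: "'a::euclidean_space \<Rightarrow> real"
  assumes "Ck_on 2 f S" "open S" "p \<in> S"
  shows "dir_deriv S (dir_deriv S f h) k p = dir_deriv S (dir_deriv S f k) h p"
proof -
  have w: "at q within S = at q" if "q \<in> S" for q using at_within_open[OF that assms(2)] .
  have C: "Ck_on (Suc (Suc 0)) f S" using assms(1) by (simp only: numeral_2_eq_2)
  note t = thick_open[OF assms(2)]
  have C1: "Ck_on (Suc 0) (dir_deriv S f h) S" for h using Ck_on_frechet(2)[OF C t] .
  show ?thesis
  proof (rule second_derivative_symmetric[OF assms(2,3), where f=f and D="\<lambda>q. frechet_derivative f (at q within S)"
      and E="\<lambda>q. frechet_derivative (dir_deriv S f h) (at q within S)" and h=h and k=k
      and F="\<lambda>q. frechet_derivative (dir_deriv S f k) (at q within S)"])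
    show "(f has_derivative frechet_derivative f (at q within S)) (at q)" if "q \<in> S" for q
      using Ck_on_frechet(1)[OF C t that] w[OF that] by simp
    show "(dir_deriv S f h has_derivative frechet_derivative (dir_deriv S f h) (at q within S)) (at q)"
      if "q \<in> S" for q
      using Ck_on_frechet(1)[OF C1 t that] w[OF that] by simp
    show "(dir_deriv S f k has_derivative frechet_derivative (dir_deriv S f k) (at q within S)) (at q)"
      if "q \<in> S" for q
      using Ck_on_frechet(1)[OF C1 t that] w[OF that] by simp
    show "continuous_on S (dir_deriv S (dir_deriv S f h) k)"
      using Ck_on_frechet(2)[OF C1 t] by simp
    show "continuous_on S (dir_deriv S (dir_deriv S f k) h)"
      using Ck_on_frechet(2)[OF C1 t] by simp
  qed
qed

section \<open>Cutoff functions and mollification\<close>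

text \<open>The factor (1/x)^k makes the family stable under differentiation, so the smoothness of
  exp(-1/x) extended by 0 becomes an induction over all members simultaneously.\<close>

definition flat :: "nat \<Rightarrow> real \<Rightarrow> real" where
  "flat k x = (if x > 0 then (1/x)^k * exp (-1/x) else 0)"

lemma power_le_fact_exp:
  assumes "0 \<le> (y::real)" shows "y ^ n \<le> fact n * exp y"
proof -
  have s: "(\<lambda>n. y^n /\<^sub>R fact n) sums exp y" by (rule exp_converges)
  have "(\<Sum>i\<in>{n}. y^i /\<^sub>R fact i) \<le> (\<Sum>i. y^i /\<^sub>R fact i)"
    by (rule sum_le_suminf) (use s assms in \<open>auto simp: sums_iff\<close>)
  then show ?thesis using s by (simp add: sums_iff field_simps)
qed

text \<open>Comes from y^(k+1) <= (k+1)! exp y at y = 1/x. The difference quotient of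
  \<open>flat k\<close> at 0 is \<open>flat (k+1)\<close>, so this bound is what makes the
  derivative at 0 exist and vanish.\<close>

lemma flat_bound: "\<bar>flat k x\<bar> \<le> fact (k+1) * \<bar>x\<bar>"
proof (cases "x > 0")
  case True
  have "(1/x)^(k+1) \<le> fact (k+1) * exp (1/x)" using True by (intro power_le_fact_exp) simp
  then have "(1/x)^(k+1) * exp (-1/x) * x \<le> fact (k+1) * exp (1/x) * exp (-1/x) * x"
    using True by (intro mult_right_mono) auto
  also have "\<dots> = fact (k+1) * x" by (simp add: mult.assoc flip: exp_add)
  also have "(1/x)^(k+1) * exp (-1/x) * x = (1/x)^k * exp (-1/x)" using True by simp
  finally show ?thesis using True by (simp add: flat_def abs_mult)
next
  case False
  have "0 \<le> fact (k+1) * \<bar>x\<bar>" by (intro mult_nonneg_nonneg) auto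
  with False show ?thesis by (simp add: flat_def)
qed

lemma flat_deriv: "(flat k has_real_derivative flat (k+2) x - k * flat (k+1) x) (at x)"
proof -
  consider "x > 0" | "x < 0" | "x = 0" by linarith
  then show ?thesis
  proof cases
    case 1
    have "((\<lambda>x. 1/x) has_real_derivative - ((1/x)\<^sup>2)) (at x)"
      using 1 by (auto intro!: derivative_eq_intros simp: power2_eq_square)
    then have "((\<lambda>x. (1/x)^k) has_real_derivative of_nat k * (- ((1/x)\<^sup>2) * (1/x)^(k - Suc 0))) (at x)"
      by (rule DERIV_power)
    moreover have "of_nat k * (- ((1/x)\<^sup>2) * (1/x)^(k - Suc 0)) = - (k * (1/x)^(k+1))"
      using 1 by (cases k) (simp_all add: power2_eq_square)
    ultimately have P: "((\<lambda>x. (1/x)^k) has_real_derivative - (k * (1/x)^(k+1))) (at x)" by simp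
    have "((\<lambda>x. exp (-1/x)) has_real_derivative exp (-1/x) * (1/x)\<^sup>2) (at x)"
      using 1 by (auto intro!: derivative_eq_intros simp: power2_eq_square)
    from DERIV_mult[OF P this]
    have "((\<lambda>x. (1/x)^k * exp (-1/x)) has_real_derivative flat (k+2) x - k * flat (k+1) x) (at x)"
      using 1 by (simp add: flat_def algebra_simps power2_eq_square)
    moreover have ev: "\<forall>\<^sub>F y in nhds x. (1/y)^k * exp (-1/y) = flat k y"
      using eventually_nhds_in_open[of "{0<..}" x] 1 by (auto simp: flat_def elim!: eventually_mono)
    ultimately show ?thesis using DERIV_cong_ev[OF refl ev refl] by simp
  next
    case 2
    have "((\<lambda>x. 0) has_real_derivative flat (k+2) x - k * flat (k+1) x) (at x)"
      using 2 by (simp add: flat_def)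
    moreover have ev: "\<forall>\<^sub>F y in nhds x. 0 = flat k y"
      using eventually_nhds_in_open[of "{..<0}" x] 2 by (auto simp: flat_def elim!: eventually_mono)
    ultimately show ?thesis using DERIV_cong_ev[OF refl ev refl] by simp
  next
    case 3
    have "((\<lambda>h. (flat k (0 + h) - flat k 0) / h) \<longlongrightarrow> 0) (at 0)"
    proof (rule Lim_null_comparison)
      show "\<forall>\<^sub>F h in at 0. norm ((flat k (0 + h) - flat k 0) / h) \<le> fact (k+2) * \<bar>h\<bar>"
      proof (rule eventuallyI)
        fix h :: real
        have "norm ((flat k (0 + h) - flat k 0) / h) = \<bar>flat (k+1) h\<bar>"
          by (auto simp: flat_def field_simps)
        then show "norm ((flat k (0 + h) - flat k 0) / h) \<le> fact (k+2) * \<bar>h\<bar>"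
          using flat_bound[of "k+1" h] by simp
      qed
      show "((\<lambda>h::real. fact (k+2) * \<bar>h\<bar>) \<longlongrightarrow> 0) (at 0)"
        by (auto intro!: tendsto_eq_intros)
    qed
    then show ?thesis using 3 by (simp add: DERIV_def flat_def)
  qed
qed

lemma Ck_on_flat: "Ck_on n (flat k) UNIV"
proof (induction n arbitrary: k)
  case 0
  show ?case using flat_deriv by (auto intro!: continuous_at_imp_continuous_on DERIV_isCont)
next
  case (Suc n)
  show ?case
  proof (rule Ck_on_SucI[where D="\<lambda>x h. (flat (k+2) x - k * flat (k+1) x) * h"])
    show "(flat k has_derivative (*) (flat (k+2) x - k * flat (k+1) x)) (at x within UNIV)" for x
      using flat_deriv[of k x] by (simp add: has_field_derivative_def)
    show "Ck_on n (\<lambda>x. (flat (k+2) x - k * flat (k+1) x) * h) UNIV" for h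
      by (intro Ck_on_mult Ck_on_diff Ck_on_const Suc.IH)
  qed
qed

definition smooth_step :: "real \<Rightarrow> real" where
  "smooth_step x = flat 0 x / (flat 0 x + flat 0 (1 - x))"

lemma smooth_step_denominator: "flat 0 x + flat 0 (1 - x) > 0"
  by (auto simp: flat_def add_pos_pos)

lemma Ck_on_smooth_step: "Ck_on k smooth_step UNIV"
proof -
  have "Ck_on k (\<lambda>x. flat 0 (1 - x)) UNIV"
    by (rule Ck_on_compose[OF Ck_on_flat]) (intro Ck_on_diff Ck_on_const Ck_on_id, simp)
  then have "Ck_on k (\<lambda>x. flat 0 x * inverse (flat 0 x + flat 0 (1 - x))) UNIV"
    by (intro Ck_on_mult Ck_on_flat Ck_on_inverse Ck_on_add) (use smooth_step_denominator in \<open>auto simp: less_le\<close>)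
  then show ?thesis by (rule Ck_on_cong) (simp add: smooth_step_def divide_inverse)
qed

lemma smooth_step_simps:
  "x \<le> 0 \<Longrightarrow> smooth_step x = 0" "x \<ge> 1 \<Longrightarrow> smooth_step x = 1" "0 \<le> smooth_step x" "smooth_step x \<le> 1"
  "x > 0 \<Longrightarrow> smooth_step x > 0"
  using smooth_step_denominator[of x]
  by (auto simp: smooth_step_def flat_def field_simps add_pos_pos)

text \<open>The squared distance keeps the function smooth at the center. The argument of
  \<open>smooth_step\<close> is at least 1 up to distance r / sqrt 2, in particular up to r / 2, and
  is nonpositive from distance r on.\<close>

definition cutoff :: "'a::euclidean_space \<Rightarrow> real \<Rightarrow> 'a \<Rightarrow> real" where
  "cutoff q r p = smooth_step (2 - 2 * ((p - q) \<bullet> (p - q)) / r\<^sup>2)"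

lemma Ck_on_cutoff: "Ck_on k (cutoff q r) S"
proof -
  have "Ck_on k (\<lambda>p. 2 - (2 / r\<^sup>2) * ((p - q) \<bullet> (p - q))) UNIV"
    by (intro Ck_on_diff Ck_on_mult Ck_on_inner Ck_on_const Ck_on_id)
  then have "Ck_on k (\<lambda>p. smooth_step (2 - (2 / r\<^sup>2) * ((p - q) \<bullet> (p - q)))) UNIV"
    by (rule Ck_on_compose[OF Ck_on_smooth_step]) simp
  then have "Ck_on k (cutoff q r) UNIV" by (rule Ck_on_cong) (simp add: cutoff_def)
  then show ?thesis using Ck_on_subset by blast
qed

lemma cutoff_range: "0 \<le> cutoff q r p" "cutoff q r p \<le> 1"
  by (simp_all add: cutoff_def smooth_step_simps)

lemma cutoff_eq_1: "r > 0 \<Longrightarrow> dist p q \<le> r / 2 \<Longrightarrow> cutoff q r p = 1"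
proof -
  assume r: "r > 0" "dist p q \<le> r / 2"
  then have "(norm (p - q))\<^sup>2 \<le> (r/2)\<^sup>2" by (intro power_mono) (auto simp: dist_norm)
  then have "2 * ((p - q) \<bullet> (p - q)) / r\<^sup>2 \<le> 1" 
    using r by (simp add: field_simps power2_norm_eq_inner power_divide) (smt (verit) zero_le_power2)
  then show ?thesis by (simp add: cutoff_def smooth_step_simps)
qed

lemma cutoff_eq_0: "r > 0 \<Longrightarrow> dist p q \<ge> r \<Longrightarrow> cutoff q r p = 0"
proof -
  assume r: "r > 0" "dist p q \<ge> r"
  then have "(norm (p - q))\<^sup>2 \<ge> r\<^sup>2" by (intro power_mono) (auto simp: dist_norm)
  then have "2 * ((p - q) \<bullet> (p - q)) / r\<^sup>2 \<ge> 2" 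
    using r by (simp add: field_simps power2_norm_eq_inner)
  then show ?thesis by (simp add: cutoff_def smooth_step_simps)
qed

lemma dir_deriv_UNIV_linear:
  fixes f :: "'a::euclidean_space \<Rightarrow> 'b::real_normed_vector"
  assumes "Ck_on (Suc 0) f UNIV"
  shows "(f has_derivative frechet_derivative f (at p)) (at p)" 
    "continuous_on UNIV (dir_deriv UNIV f h)" "bounded_linear (frechet_derivative f (at p))"
proof -
  show 1: "(f has_derivative frechet_derivative f (at p)) (at p)"
    using Ck_on_frechet(1)[OF assms thick_UNIV, of p] by simp
  show "continuous_on UNIV (dir_deriv UNIV f h)"
    using Ck_on_frechet(2)[OF assms thick_UNIV, of h] by simp
  show "bounded_linear (frechet_derivative f (at p))" using 1 has_derivative_bounded_linear by blast
qed

section \<open>Convolution and approximation by smooth functions\<close>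

lemma integrable_compact_support:
  fixes f :: "'a::euclidean_space \<Rightarrow> real"
  assumes "continuous_on UNIV f" "\<And>x. x \<notin> cbox a b \<Longrightarrow> f x = 0"
  shows "integrable lborel f" "(LINT x|lborel. f x) = integral (cbox a b) f"
proof -
  have eq: "indicator (cbox a b) x *\<^sub>R f x = f x" for x using assms(2)[of x] by (auto simp: indicator_def)
  have i: "integrable lborel (\<lambda>x. indicator (cbox a b) x *\<^sub>R f x)"
    by (rule borel_integrable_compact) (use assms(1) continuous_on_subset in auto)
  then show "integrable lborel f" by (simp only: eq)
  have "(LINT x:cbox a b|lborel. f x) = integral (cbox a b) f"
    using set_borel_integral_eq_integral(2)[of "cbox a b" f] i unfolding set_integrable_def by blast
  then show "(LINT x|lborel. f x) = integral (cbox a b) f"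
    unfolding set_lebesgue_integral_def by (simp only: eq)
qed

lemma lborel_integral_reflect:
  fixes g :: "'a::euclidean_space \<Rightarrow> real"
  assumes "continuous_on UNIV g"
  shows "(LINT y|lborel. g (x - y)) = (LINT y|lborel. g y)"
proof -
  have [measurable]: "g \<in> borel_measurable borel" using assms by (rule borel_measurable_continuous_onI)
  have "lborel = distr lborel borel (\<lambda>y. x - y)"
    using lborel_affine[of "-1" x] by (simp add: density_1)
  then have "(LINT y|lborel. g y) = (LINT y|distr lborel borel (\<lambda>y. x - y). g y)" by simp
  also have "\<dots> = (LINT y|lborel. g (x - y))" by (subst integral_distr) auto
  finally show ?thesis by simp
qed

lemma compact_support_cbox:
  fixes f :: "'a::euclidean_space \<Rightarrow> 'b::zero"
  assumes "compact K" "\<And>x. x \<notin> K \<Longrightarrow> f x = 0"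
  shows "\<exists>a b. \<forall>x. x \<notin> cbox a b \<longrightarrow> f x = 0"
proof -
  obtain a where "K \<subseteq> cbox (-a) a"
    using bounded_subset_cbox_symmetric[OF compact_imp_bounded[OF assms(1)]] by blast
  then show ?thesis using assms(2) by blast
qed

definition conv :: "('a::euclidean_space \<Rightarrow> real) \<Rightarrow> ('a \<Rightarrow> real) \<Rightarrow> 'a \<Rightarrow> real" where
  "conv f k x = (LINT y|lborel. f y * k (x - y))"

lemma conv_eq_integral:
  assumes "continuous_on UNIV f" "continuous_on UNIV k" "\<And>x. x \<notin> cbox a b \<Longrightarrow> f x = 0"
  shows "conv f k x = integral (cbox a b) (\<lambda>y. f y * k (x - y))"
  unfolding conv_def
  by (rule integrable_compact_support)
    (use assms in \<open>auto intro!: continuous_intros continuous_on_compose2[OF assms(2)]\<close>)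

lemma conv_commute:
  assumes "continuous_on UNIV f" "continuous_on UNIV k"
  shows "conv f k x = conv k f x"
proof -
  have "conv k f x = (LINT y|lborel. (\<lambda>z. k (x - z) * f z) (x - y))"
    by (simp add: conv_def)
  also have "\<dots> = (LINT y|lborel. k (x - y) * f y)"
    by (rule lborel_integral_reflect)
      (intro continuous_intros continuous_on_compose2[OF assms(2)] assms, auto)
  finally show ?thesis by (simp add: conv_def mult.commute)
qed

text \<open>The derivative falls on the kernel. Compact support of \<open>f\<close> restricts the
  integral to a fixed box, where differentiation under the integral is available.\<close>

lemma conv_has_derivative:
  fixes f k :: "'a::euclidean_space \<Rightarrow> real"
  assumes f: "continuous_on UNIV f" "compact K" "\<And>x. x \<notin> K \<Longrightarrow> f x = 0"
    and k: "Ck_on (Suc 0) k UNIV"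
  shows "(conv f k has_derivative (\<lambda>h. conv f (dir_deriv UNIV k h) x)) (at x)"
proof -
  obtain a b where ab: "\<And>x. x \<notin> cbox a b \<Longrightarrow> f x = 0" using compact_support_cbox[of K f] f(2,3) by auto
  note k' = dir_deriv_UNIV_linear[OF k]
  define D where "D x y = f y *\<^sub>R Blinfun (frechet_derivative k (at (x - y)))" for x y
  have D: "blinfun_apply (D x y) h = f y * frechet_derivative k (at (x - y)) h" for x y h
    by (simp add: D_def bounded_linear_Blinfun_apply k' blinfun.scaleR_left)
  have ck: "continuous_on UNIV k" using k Ck_on_imp_continuous by blast
  have cD: "continuous_on (UNIV \<times> cbox a b) (\<lambda>(x, y). D x y)"
  proof (rule continuous_on_blinfun_componentwise)
    fix i :: 'a
    have "continuous_on (UNIV \<times> cbox a b) (\<lambda>p. f (snd p) * frechet_derivative k (at (fst p - snd p)) i)"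
      by (intro continuous_intros continuous_on_compose2[OF f(1)] continuous_on_compose2[OF k'(2)[of i], simplified]) auto
    then show "continuous_on (UNIV \<times> cbox a b) (\<lambda>p. blinfun_apply (case p of (x, y) \<Rightarrow> D x y) i)"
      by (rule continuous_on_eq) (auto simp: D)
  qed
  have "((\<lambda>x. integral (cbox a b) (\<lambda>y. f y * k (x - y))) has_derivative integral (cbox a b) (D x)) (at x within UNIV)"
  proof (rule leibniz_rule[OF _ _ cD])
    fix x y
    have "((\<lambda>x. k (x - y)) has_derivative frechet_derivative k (at (x - y))) (at x)"
      by (rule has_derivative_compose[where f="\<lambda>x. x - y" and g=k and f'="\<lambda>h. h", OF _ k'(1)])
        (auto intro!: derivative_eq_intros)
    then have "((\<lambda>x. f y * k (x - y)) has_derivative (\<lambda>h. f y * frechet_derivative k (at (x - y)) h)) (at x)"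
      by (rule has_derivative_mult_right)
    then show "((\<lambda>x. f y * k (x - y)) has_derivative blinfun_apply (D x y)) (at x within UNIV)"
      by (simp add: D[abs_def])
    show "(\<lambda>y. f y * k (x - y)) integrable_on cbox a b"
      by (intro integrable_continuous continuous_intros continuous_on_compose2[OF f(1)] continuous_on_compose2[OF ck]) auto
  qed auto
  moreover have "blinfun_apply (integral (cbox a b) (D x)) = (\<lambda>h. conv f (dir_deriv UNIV k h) x)"
  proof (rule ext)
    fix h
    have "continuous_on (cbox a b) (D x)"
      using continuous_on_compose2[OF cD, of "cbox a b" "\<lambda>y. (x, y)"]
        continuous_on_Pair[OF continuous_on_const continuous_on_id, of "cbox a b" x]
      by auto
    then have "integral (cbox a b) ((\<lambda>L. blinfun_apply L h) \<circ> D x) = integral (cbox a b) (D x) h"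
      by (intro integral_linear integrable_continuous bounded_linear_intros)
    then show "integral (cbox a b) (D x) h = conv f (dir_deriv UNIV k h) x"
      by (subst conv_eq_integral[where a=a and b=b, OF f(1) k'(2) ab]) (auto simp: o_def D)
  qed
  moreover have "conv f k = (\<lambda>x. integral (cbox a b) (\<lambda>y. f y * k (x - y)))"
    using conv_eq_integral[OF f(1) ck ab] by blast
  ultimately show ?thesis by simp
qed

lemma smooth_dir_deriv_UNIV:
  assumes "\<And>j. Ck_on j k UNIV" shows "Ck_on j (dir_deriv UNIV k h) UNIV"
  using Ck_on_frechet(2)[OF assms thick_UNIV] .

lemma conv_smooth:
  fixes f k :: "'a::euclidean_space \<Rightarrow> real"
  assumes f: "continuous_on UNIV f" "compact K" "\<And>x. x \<notin> K \<Longrightarrow> f x = 0"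
    and k: "\<And>j. Ck_on j k UNIV"
  shows "Ck_on n (conv f k) UNIV"
  using k
proof (induction n arbitrary: k)
  case 0
  show ?case
    using conv_has_derivative[OF f, of k] 0 
    by (auto intro!: continuous_at_imp_continuous_on intro: has_derivative_continuous)
next
  case (Suc n)
  show ?case
  proof (rule Ck_on_SucI[where D="\<lambda>x h. conv f (dir_deriv UNIV k h) x"])
    show "(conv f k has_derivative (\<lambda>h. conv f (dir_deriv UNIV k h) x)) (at x within UNIV)" for x
      using conv_has_derivative[OF f, of k] Suc.prems by simp
    show "Ck_on n (\<lambda>x. conv f (dir_deriv UNIV k h) x) UNIV" for h
      using Suc.IH[OF smooth_dir_deriv_UNIV[OF Suc.prems]] by simp
  qed
qed

lemma dir_deriv_along_line:
  fixes f :: "'a::real_vector \<Rightarrow> real"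
  assumes "\<And>y. ((\<lambda>s. f (y + s *\<^sub>R b)) has_real_derivative f' y) (at 0)"
  shows "((\<lambda>s. f (y + s *\<^sub>R b)) has_real_derivative f' (y + s *\<^sub>R b)) (at s)"
  using assms[of "y + s *\<^sub>R b"] DERIV_shift[of "\<lambda>s. f (y + s *\<^sub>R b)" _ 0 s]
  by (simp add: algebra_simps)

text \<open>Here the derivative falls on \<open>f\<close>, in a single direction \<open>b\<close>.
  After commuting the convolution the box is given by the support of \<open>k\<close>, and only the
  real variable \<open>s\<close> along \<open>b\<close> is differentiated under the integral. Since
  the total derivative exists by \<open>conv_has_derivative\<close>, both computations give the same
  directional derivative.\<close>

lemma conv_dir_deriv:
  fixes f k :: "'a::euclidean_space \<Rightarrow> real"
  assumes f: "continuous_on UNIV f" "compact K" "\<And>x. x \<notin> K \<Longrightarrow> f x = 0"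
    and f': "\<And>y. ((\<lambda>s. f (y + s *\<^sub>R b)) has_real_derivative f' y) (at 0)" "continuous_on UNIV f'"
    and k: "Ck_on (Suc 0) k UNIV" "compact K'" "\<And>x. x \<notin> K' \<Longrightarrow> k x = 0"
  shows "dir_deriv UNIV (conv f k) b x = conv f' k x"
proof -
  obtain c d where cd: "\<And>x. x \<notin> cbox c d \<Longrightarrow> k x = 0" using compact_support_cbox[of K' k] k(2,3) by auto
  have ck: "continuous_on UNIV k" using k Ck_on_imp_continuous by blast
  define F where "F s = conv f k (x + s *\<^sub>R b)" for s
  have F: "F s = integral (cbox c d) (\<lambda>y. k y * f (x + s *\<^sub>R b - y))" for s
    unfolding F_def by (subst conv_commute[OF f(1) ck]) (rule conv_eq_integral[OF ck f(1) cd])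
  have "(F has_vector_derivative integral (cbox c d) (\<lambda>y. k y * f' (x + 0 *\<^sub>R b - y))) (at 0 within UNIV)"
    unfolding F[abs_def]
  proof (rule leibniz_rule_vector_derivative)
    show "((\<lambda>s. k y * f (x + s *\<^sub>R b - y)) has_vector_derivative k y * f' (x + s *\<^sub>R b - y)) (at s within UNIV)" for s y
      using dir_deriv_along_line[OF f'(1), of "x - y" s]
      by (auto intro!: DERIV_cmult simp: algebra_simps simp flip: has_real_derivative_iff_has_vector_derivative)
    show "(\<lambda>y. k y * f (x + s *\<^sub>R b - y)) integrable_on cbox c d" for s
      by (intro integrable_continuous continuous_intros continuous_on_compose2[OF f(1)] continuous_on_compose2[OF ck]) auto
    show "continuous_on (UNIV \<times> cbox c d) (\<lambda>(s, y). k y * f' (x + s *\<^sub>R b - y))"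
      unfolding case_prod_beta
      by (intro continuous_intros continuous_on_compose2[OF f'(2)] continuous_on_compose2[OF ck]) auto
  qed auto
  moreover have "integral (cbox c d) (\<lambda>y. k y * f' (x + 0 *\<^sub>R b - y)) = conv f' k x"
    using conv_eq_integral[where a=c and b=d, OF ck f'(2) cd, of x] conv_commute[OF f'(2) ck] by simp
  ultimately have 1: "(F has_real_derivative conv f' k x) (at 0)"
    by (simp add: has_real_derivative_iff_has_vector_derivative)
  let ?D = "\<lambda>h. conv f (dir_deriv UNIV k h) x"
  have D: "(conv f k has_derivative ?D) (at x)" using conv_has_derivative[OF f k(1)] .
  have "(F has_derivative (\<lambda>s. ?D (s *\<^sub>R b))) (at 0)"
    unfolding F_def
    by (rule has_derivative_compose[where g="conv f k" and f="\<lambda>s. x + s *\<^sub>R b" and g'="?D"])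
      (use D in \<open>auto intro!: derivative_eq_intros\<close>)
  moreover have "(\<lambda>s. ?D (s *\<^sub>R b)) = (*) (?D b)"
    using linear_scale[OF has_derivative_linear[OF D]] by (auto simp: fun_eq_iff)
  ultimately have "(F has_real_derivative ?D b) (at 0)" by (simp add: has_field_derivative_def)
  then have "?D b = conv f' k x" using 1 DERIV_unique by blast
  moreover have "frechet_derivative (conv f k) (at x) = ?D"
    using frechet_derivative_at[OF D] by simp
  ultimately show ?thesis by simp
qed

definition mollifier :: "real \<Rightarrow> 'a::euclidean_space \<Rightarrow> real" where
  "mollifier d x = cutoff 0 d x / (LINT y|lborel. cutoff 0 d (y::'a))"

lemma mollifier:
  fixes S :: "'a::euclidean_space set"
  assumes "d > 0"
  shows "Ck_on j (mollifier d) S" "\<And>x::'a. 0 \<le> mollifier d x" "(LINT y|lborel. mollifier d (y::'a)) = 1"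
    "\<And>x::'a. x \<notin> cball 0 d \<Longrightarrow> mollifier d x = 0"
proof -
  have z: "\<And>x::'a. x \<notin> cball 0 d \<Longrightarrow> cutoff 0 d x = 0" using assms by (intro cutoff_eq_0) auto
  then obtain a b where ab: "\<And>x. x \<notin> cbox a b \<Longrightarrow> cutoff (0::'a) d x = 0" 
    using compact_support_cbox[of "cball (0::'a) d" "cutoff 0 d"] by auto
  have c: "continuous_on UNIV (cutoff (0::'a) d)" using Ck_on_imp_continuous[OF Ck_on_cutoff] by blast
  note i = integrable_compact_support[where a=a and b=b, OF c ab]
  have "(LINT y|lborel. cutoff 0 d (y::'a)) \<noteq> 0"
  proof
    assume "(LINT y|lborel. cutoff 0 d (y::'a)) = 0"
    then have "AE x in lborel. cutoff (0::'a) d x = 0"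
      using integral_nonneg_eq_0_iff_AE[OF i(1)] cutoff_range(1) by auto
    then have "AE x in lborel. x \<notin> ball (0::'a) (d/2)"
    proof (rule AE_mp, intro AE_I2 impI notI)
      fix x :: 'a assume "cutoff 0 d x = 0" "x \<in> ball 0 (d/2)"
      then show False using cutoff_eq_1[OF assms, of x 0] by (simp add: dist_commute)
    qed
    then have "emeasure lborel (ball (0::'a) (d/2)) = 0"
      using AE_iff_measurable[of "ball (0::'a) (d/2)" lborel "\<lambda>x. x \<notin> ball 0 (d/2)"] by (simp del: mem_ball mem_ball_0)
    then show False using emeasure_lborel_ball_finite content_ball_pos[of "d/2" "0::'a"] assms
      by (simp add: measure_def)
  qed
  then have pos: "(LINT y|lborel. cutoff 0 d (y::'a)) > 0"
    using integral_nonneg_AE[of "cutoff (0::'a) d" lborel] cutoff_range(1)[of "0::'a" d] by (simp add: less_le)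
  show "Ck_on j (mollifier d) S"
    unfolding mollifier_def[abs_def] divide_inverse by (intro Ck_on_mult Ck_on_cutoff Ck_on_const)
  show "\<And>x::'a. 0 \<le> mollifier d x" using pos by (simp add: mollifier_def cutoff_range)
  show "(LINT y|lborel. mollifier d (y::'a)) = 1" using pos by (simp add: mollifier_def[abs_def])
  show "\<And>x::'a. x \<notin> cball 0 d \<Longrightarrow> mollifier d x = 0" using z by (simp add: mollifier_def)
qed

text \<open>\<open>mollifier d\<close> is a probability density on the ball of radius
  \<open>d\<close>, so the convolution is an average of values of \<open>f\<close> at distance at
  most \<open>d\<close>.\<close>

lemma conv_mollifier_approx:
  fixes f :: "'a::euclidean_space \<Rightarrow> real"
  assumes d: "d > 0" and f: "continuous_on UNIV f" and e: "\<And>y. dist x y \<le> d \<Longrightarrow> \<bar>f y - f x\<bar> \<le> e"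
  shows "\<bar>conv f (mollifier d) x - f x\<bar> \<le> e"
proof -
  note m = mollifier[OF d, where ?'a='a]
  have cm: "continuous_on UNIV (mollifier d :: 'a \<Rightarrow> real)" using Ck_on_imp_continuous[OF m(1)] .
  have cm': "continuous_on UNIV (\<lambda>y::'a. mollifier d (x - y) :: real)"
    by (intro continuous_on_compose2[OF cm] continuous_intros) auto
  have z: "y \<notin> cball x d \<Longrightarrow> mollifier d (x - y) = 0" for y using m(4)[of "x - y"] by (simp add: dist_norm norm_minus_commute)
  have int1: "integrable lborel (\<lambda>y. g y * mollifier d (x - y))" if g: "continuous_on UNIV g" for g :: "'a \<Rightarrow> real"
  proof -
    obtain a b where "\<And>y. y \<notin> cbox a b \<Longrightarrow> g y * mollifier d (x - y) = 0"
      using compact_support_cbox[of "cball x d" "\<lambda>y. g y * mollifier d (x - y)"] z by auto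
    then show ?thesis by (intro integrable_compact_support(1) continuous_intros g cm')
  qed
  have one: "(LINT y|lborel. mollifier d (x - y)) = 1" using lborel_integral_reflect[OF cm] m(3) by simp
  have "integrable lborel (\<lambda>y. 1 * mollifier d (x - y))" by (rule int1) simp
  then have i1: "integrable lborel (\<lambda>y. mollifier d (x - y))" by simp
  have "conv f (mollifier d) x - f x = (LINT y|lborel. f y * mollifier d (x - y)) - (LINT y|lborel. f x * mollifier d (x - y))"
    by (simp only: conv_def Bochner_Integration.integral_mult_right[OF i1] one mult_1_right)
  also have "\<dots> = (LINT y|lborel. (f y - f x) * mollifier d (x - y))"
    by (subst Bochner_Integration.integral_diff[symmetric]) (auto intro!: int1 f simp: algebra_simps i1)
  finally have "\<bar>conv f (mollifier d) x - f x\<bar> = norm (LINT y|lborel. (f y - f x) * mollifier d (x - y))" by simp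
  also have "\<dots> \<le> (LINT y|lborel. e * mollifier d (x - y))"
  proof (rule Bochner_Integration.integral_norm_bound_integral)
    show "norm ((f y - f x) * mollifier d (x - y)) \<le> e * mollifier d (x - y)" for y
    proof (cases "y \<in> cball x d")
      case True
      then have "\<bar>f y - f x\<bar> \<le> e" using e by simp
      then show ?thesis using m(2)[of "x - y"] by (simp add: abs_mult mult_right_mono)
    qed (simp add: z)
  qed (auto intro!: int1 continuous_intros f simp: i1)
  also have "\<dots> = e" by (simp only: Bochner_Integration.integral_mult_right[OF i1] one mult_1_right)
  finally show ?thesis .
qed

lemma dir_deriv_outside_support:
  fixes f :: "'a::euclidean_space \<Rightarrow> real"
  assumes "compact K" "\<And>x. x \<notin> K \<Longrightarrow> f x = 0" "((\<lambda>s. f (y + s *\<^sub>R b)) has_real_derivative f') (at 0)" "y \<notin> K"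
  shows "f' = 0"
proof -
  have "open ((\<lambda>s. y + s *\<^sub>R b) -` (- K))"
    using assms(1) by (intro open_vimage open_Compl compact_imp_closed continuous_intros)
  then have "\<forall>\<^sub>F s in nhds 0. s \<in> (\<lambda>s. y + s *\<^sub>R b) -` (- K)"
    using assms(4) by (intro eventually_nhds_in_open) auto
  then have ev: "\<forall>\<^sub>F s in nhds 0. f (y + s *\<^sub>R b) = 0"
    by (rule eventually_mono) (use assms(2) in auto)
  have "((\<lambda>s. 0) has_real_derivative f') (at 0)"
    using DERIV_cong_ev[OF refl ev refl] assms(3) by blast
  then show ?thesis using DERIV_unique DERIV_const by blast
qed

lemma uniformly_continuous_compact_support:
  fixes f :: "'a::euclidean_space \<Rightarrow> real"
  assumes "continuous_on UNIV f" "compact K" "\<And>x. x \<notin> K \<Longrightarrow> f x = 0" "e > 0"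
  shows "\<exists>d>0. \<forall>x y. dist x y \<le> d \<longrightarrow> \<bar>f y - f x\<bar> \<le> e"
proof -
  obtain c where c: "\<And>x. x \<in> K \<Longrightarrow> norm x \<le> c" using compact_imp_bounded[OF assms(2)] bounded_iff by blast
  define B where "B = cball (0::'a) (c + 1)"
  have "uniformly_continuous_on B f"
    unfolding B_def by (rule compact_uniformly_continuous) (use assms(1) continuous_on_subset in auto)
  then obtain d where d: "d > 0" "\<And>x y. x \<in> B \<Longrightarrow> y \<in> B \<Longrightarrow> dist y x < d \<Longrightarrow> dist (f y) (f x) < e"
    using assms(4) unfolding uniformly_continuous_on_def by metis
  show ?thesis
  proof (intro exI[of _ "min (d/2) 1"] conjI allI impI)
    fix x y :: 'a assume xy: "dist x y \<le> min (d/2) 1"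
    show "\<bar>f y - f x\<bar> \<le> e"
    proof (cases "x \<in> K \<or> y \<in> K")
      case True
      then have "x \<in> B \<and> y \<in> B"
        using xy c[of x] c[of y] norm_triangle_sub[of x y] norm_triangle_sub[of y x]
        by (auto simp: B_def dist_norm norm_minus_commute)
      then show ?thesis using d(2)[of x y] xy d(1) by (auto simp: dist_commute dist_real_def)
    qed (use assms(3,4) in simp)
  qed (use d in auto)
qed

text \<open>Derivatives are approximated only along a finite set \<open>B\<close> of directions,
  because some of the functions treated later are differentiable along the fibers only. Each of the
  finitely many functions involved is uniformly continuous, being continuous with compact support,
  so one radius of mollification serves all of them.\<close>

lemma smooth_approximation:
  fixes f :: "'a::euclidean_space \<Rightarrow> real" and f' :: "'a \<Rightarrow> 'a \<Rightarrow> real"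
  assumes f: "continuous_on UNIV f" "compact K" "\<And>x. x \<notin> K \<Longrightarrow> f x = 0"
    and f': "\<And>b y. b \<in> B \<Longrightarrow> ((\<lambda>s. f (y + s *\<^sub>R b)) has_real_derivative f' b y) (at 0)"
      "\<And>b. b \<in> B \<Longrightarrow> continuous_on UNIV (f' b)"
    and "finite B" "e > 0" "d > 0"
  obtains g where "smooth_on g UNIV" "\<And>x. g x \<noteq> 0 \<Longrightarrow> \<exists>y\<in>K. dist x y \<le> d" "\<And>x. \<bar>g x - f x\<bar> \<le> e"
    "\<And>b x. b \<in> B \<Longrightarrow> \<bar>dir_deriv UNIV g b x - f' b x\<bar> \<le> e"
proof -
  obtain d0 where d0: "d0 > 0" "\<And>x y. dist x y \<le> d0 \<Longrightarrow> \<bar>f y - f x\<bar> \<le> e"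
    using uniformly_continuous_compact_support[OF f \<open>e > 0\<close>] by metis
  have z: "f' b x = 0" if "b \<in> B" "x \<notin> K" for b x
    using dir_deriv_outside_support[OF f(2,3) f'(1)[OF that(1)] that(2)] .
  have "\<forall>b\<in>B. \<exists>d>0. \<forall>x y. dist x y \<le> d \<longrightarrow> \<bar>f' b y - f' b x\<bar> \<le> e"
    using uniformly_continuous_compact_support[OF f'(2) f(2) z \<open>e > 0\<close>] by blast
  then obtain d1 where d1: "\<And>b. b \<in> B \<Longrightarrow> d1 b > 0" "\<And>b x y. b \<in> B \<Longrightarrow> dist x y \<le> d1 b \<Longrightarrow> \<bar>f' b y - f' b x\<bar> \<le> e"
    by metis
  define r where "r = Min (insert d (insert d0 (d1 ` B)))"
  have "r > 0"
    unfolding r_def using d0 d1 \<open>finite B\<close> \<open>d > 0\<close> by (subst Min_gr_iff) auto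
  moreover have "r \<le> c" if "c \<in> insert d (insert d0 (d1 ` B))" for c
    unfolding r_def by (rule Min_le) (use that \<open>finite B\<close> in auto)
  ultimately have r: "r > 0" "r \<le> d" "r \<le> d0" "\<And>b. b \<in> B \<Longrightarrow> r \<le> d1 b" by auto
  note m = mollifier[OF r(1), where ?'a='a]
  show ?thesis
  proof (rule that[of "conv f (mollifier r)"])
    show "smooth_on (conv f (mollifier r)) UNIV"
      unfolding smooth_on_def using conv_smooth[OF f m(1)] by blast
    show "\<bar>conv f (mollifier r) x - f x\<bar> \<le> e" for x
      by (rule conv_mollifier_approx[OF r(1) f(1)]) (use d0 r in force)
    show "\<bar>dir_deriv UNIV (conv f (mollifier r)) b x - f' b x\<bar> \<le> e" if b: "b \<in> B" for b x
    proof -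
      have "dir_deriv UNIV (conv f (mollifier r)) b x = conv (f' b) (mollifier r) x"
        by (rule conv_dir_deriv[where K=K and K'="cball 0 r"]) (use f f'[OF b] m in auto)
      moreover have "\<bar>conv (f' b) (mollifier r) x - f' b x\<bar> \<le> e"
        by (rule conv_mollifier_approx[OF r(1) f'(2)[OF b]]) (use d1 r b in force)
      ultimately show ?thesis by simp
    qed
    show "\<exists>y\<in>K. dist x y \<le> d" if x: "conv f (mollifier r) x \<noteq> 0" for x
    proof (rule ccontr)
      assume "\<not> ?thesis"
      then have *: "dist x y > r" if "y \<in> K" for y using that r(2) by force
      have "f y * mollifier r (x - y) = 0" for y
        using f(3)[of y] *[of y] m(4)[of "x - y"] by (cases "y \<in> K") (auto simp: dist_norm norm_minus_commute)
      then have "(\<lambda>y. f y * mollifier r (x - y)) = (\<lambda>y. 0)" by blast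
      then show False using x by (simp add: conv_def)
    qed
  qed
qed

text \<open>Take a kernel \<open>k\<close> that is 1 near the reflection of \<open>K\<close>. The
  integral is then the convolution of \<open>f'\<close> with \<open>k\<close> at 0, that is, the
  \<open>b\<close>-derivative of \<open>conv f k\<close> there. Moving this derivative to the kernel
  gives 0, since \<open>k\<close> is locally constant wherever \<open>f\<close> contributes.\<close>

lemma integral_dir_deriv_0:
  fixes f :: "'a::euclidean_space \<Rightarrow> real"
  assumes f: "continuous_on UNIV f" "compact K" "\<And>x. x \<notin> K \<Longrightarrow> f x = 0"
    and f': "\<And>y. ((\<lambda>s. f (y + s *\<^sub>R b)) has_real_derivative f' y) (at 0)" "continuous_on UNIV f'"
  shows "(LINT y|lborel. f' y) = 0"
proof -
  obtain r where r: "r > 0" "\<And>x. x \<in> K \<Longrightarrow> norm x \<le> r"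
    using compact_imp_bounded[OF f(2)] bounded_pos by blast
  \<comment> \<open>Half of this radius is 2 (r + 1), so \<open>k\<close> is 1 on an open set
    containing -y for all y in \<open>K\<close>, and its derivative vanishes there as well.\<close>
  define k :: "'a \<Rightarrow> real" where "k = cutoff 0 (4 * (r + 1))"
  have k: "Ck_on j k S" "k x = 0" if "x \<notin> cball 0 (4 * (r + 1))" for x j S
    unfolding k_def using Ck_on_cutoff that cutoff_eq_0[of "4 * (r+1)" x 0] r by (auto simp: dist_norm)
  have kk: "Ck_on j k S" for j S unfolding k_def using Ck_on_cutoff .
  have one: "k x = 1" if "norm x \<le> r + 1" for x
    unfolding k_def using that r by (intro cutoff_eq_1) (auto simp: dist_norm)
  have ck: "continuous_on UNIV k" using Ck_on_imp_continuous[OF kk] .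
  have z: "f' x = 0" if "x \<notin> K" for x
    using dir_deriv_outside_support[OF f(2,3) f'(1) that] .
  have eq: "f' y * k (0 - y) = f' y" for y
    using z[of y] r(2)[of y] one[of "- y"] by (cases "y \<in> K") auto
  have d: "dir_deriv UNIV k b (0 - y) = 0" if "y \<in> K" for y
  proof -
    have "(k has_derivative (\<lambda>h. 0)) (at (- y))"
    proof (rule has_derivative_transform_within_open[of "\<lambda>_. 1" _ _ _ "ball 0 (r + 1)"])
      show "- y \<in> ball 0 (r + 1)" using r(2)[OF that] by simp
    qed (auto simp: one)
    then show ?thesis using frechet_derivative_at[of k "\<lambda>h. 0" "- y"] by (simp add: fun_eq_iff)
  qed
  have "(LINT y|lborel. f' y) = conv f' k 0" unfolding conv_def by (simp only: eq)
  also have "\<dots> = dir_deriv UNIV (conv f k) b 0"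
    using conv_dir_deriv[where K'="cball 0 (4 * (r + 1))", OF f f' kk compact_cball k(2)] by simp
  also have "\<dots> = conv f (dir_deriv UNIV k b) 0"
    using frechet_derivative_at[OF conv_has_derivative[OF f kk]] by (simp add: fun_eq_iff)
  also have "\<dots> = 0"
  proof -
    have "(\<lambda>y. f y * dir_deriv UNIV k b (0 - y)) = (\<lambda>y. 0)" using d f(3) by (auto simp: fun_eq_iff)
    then show ?thesis by (simp add: conv_def)
  qed
  finally show ?thesis .
qed

section \<open>Closed 1-forms on a vector space\<close>

lemma has_derivative_along_line:
  fixes f :: "'a::real_normed_vector \<Rightarrow> real"
  assumes "(f has_derivative D) (at y)"
  shows "((\<lambda>s. f (y + s *\<^sub>R b)) has_real_derivative D b) (at 0)"
proof -
  have "((\<lambda>s. f (y + s *\<^sub>R b)) has_derivative (\<lambda>s. D (s *\<^sub>R b))) (at 0)"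
    by (rule has_derivative_compose[where g=f and f="\<lambda>s. y + s *\<^sub>R b" and g'=D])
      (use assms in \<open>auto intro!: derivative_eq_intros\<close>)
  moreover have "(\<lambda>s. D (s *\<^sub>R b)) = (*) (D b)"
    using linear_scale[OF has_derivative_linear[OF assms]] by (auto simp: fun_eq_iff)
  ultimately show ?thesis by (simp add: has_field_derivative_def)
qed

lemma dir_deriv_zero_outside:
  fixes f :: "'a::euclidean_space \<Rightarrow> real"
  assumes "Ck_on (Suc 0) f UNIV" "compact K" "\<And>x. x \<notin> K \<Longrightarrow> f x = 0" "y \<notin> K"
  shows "dir_deriv UNIV f b y = 0"
  using dir_deriv_outside_support[of K f, OF assms(2,3) has_derivative_along_line[OF dir_deriv_UNIV_linear(1)[OF assms(1)]] assms(4)]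
  by simp

text \<open>The integral of d_i (g d_j f) = \<omega>_i d_j f + g d_i d_j f is 0 for each pair of
  indices. Antisymmetrizing in i and j cancels the terms with second derivatives, which fall on the
  smooth test function; \<open>g\<close> itself is differentiated only once.\<close>

lemma gradient_closed_1form:
  fixes g :: "real^'n \<Rightarrow> real"
  assumes g: "\<And>x. (g has_derivative (\<lambda>h. \<omega> x \<bullet> h)) (at x)" and c: "continuous_on UNIV \<omega>"
  shows "closed_1form \<omega>"
  unfolding closed_1form_def
proof (intro allI impI)
  fix f :: "real^'n \<Rightarrow> real" and i j
  assume f: "smooth_on f UNIV \<and> compact (closure {w. f w \<noteq> 0})"
  define K where "K = closure {w. f w \<noteq> 0}"
  have K: "compact K" "\<And>x. x \<notin> K \<Longrightarrow> f x = 0" using f closure_subset[of "{w. f w \<noteq> 0}"] by (auto simp: K_def)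
  have fs: "Ck_on k f UNIV" for k using f by (simp add: smooth_onD)
  define fi where "fi i = dir_deriv UNIV f (axis i 1)" for i
  define fij where "fij i j = dir_deriv UNIV (fi i) (axis j 1)" for i j
  have fis: "Ck_on k (fi i) UNIV" for k i unfolding fi_def using smooth_dir_deriv_UNIV[OF fs] .
  have fijs: "Ck_on k (fij i j) UNIV" for k i j unfolding fij_def using smooth_dir_deriv_UNIV[OF fis] .
  have comm: "fij i j x = fij j i x" for i j x
    unfolding fij_def fi_def by (rule dir_deriv_commute[OF fs]) auto
  have zi: "fi i x = 0" if "x \<notin> K" for i x
    unfolding fi_def using dir_deriv_zero_outside[OF fs K that] .
  have zij: "fij i j x = 0" if "x \<notin> K" for i j x
    unfolding fij_def using dir_deriv_zero_outside[OF fis K(1) zi that] .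
  have cg: "continuous_on UNIV g"
    using g by (auto intro!: continuous_at_imp_continuous_on intro: has_derivative_continuous)
  have ci: "continuous_on UNIV (fi i)" "continuous_on UNIV (fij i j)" for i j
    using fis fijs Ck_on_imp_continuous by blast+
  define A where "A i j x = \<omega> x $ i * fi j x + g x * fij j i x" for i j x
  have cA: "continuous_on UNIV (A i j)" for i j
    unfolding A_def by (intro continuous_intros c cg ci)
  have A0: "(LINT x|lborel. A i j x) = 0" for i j
  proof (rule integral_dir_deriv_0[where f="\<lambda>x. g x * fi j x" and K=K and b="axis i 1"])
    show "((\<lambda>s. g (y + s *\<^sub>R axis i 1) * fi j (y + s *\<^sub>R axis i 1)) has_real_derivative A i j y) (at 0)" for y
      using DERIV_mult[OF has_derivative_along_line[OF g, of y "axis i 1"] has_derivative_along_line[OF dir_deriv_UNIV_linear(1)[OF fis], of j y "axis i 1"]]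
      by (simp add: A_def fij_def inner_axis algebra_simps)
  qed (auto intro!: continuous_intros cg ci cA K(1) simp: zi)
  obtain a b where ab: "K \<subseteq> cbox a b"
    using bounded_subset_cbox_symmetric[OF compact_imp_bounded[OF K(1)]] by blast
  have iA: "integrable lborel (A i j)" for i j
  proof (rule integrable_compact_support(1)[OF cA])
    show "A i j x = 0" if "x \<notin> cbox a b" for x
    proof -
      have "x \<notin> K" using that ab by blast
      then show ?thesis using zi zij by (simp add: A_def)
    qed
  qed
  have "(LINT w|lborel. \<omega> w $ i * dir_deriv UNIV f (axis j 1) w - \<omega> w $ j * dir_deriv UNIV f (axis i 1) w)
      = (LINT w|lborel. A i j w - A j i w)"
    by (rule Bochner_Integration.integral_cong) (simp_all add: A_def fi_def comm[of i j])
  also have "\<dots> = 0"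
    by (subst Bochner_Integration.integral_diff[OF iA iA]) (simp only: A0)
  finally show "(LINT w|lborel. \<omega> w $ i * dir_deriv UNIV f (axis j 1) w - \<omega> w $ j * dir_deriv UNIV f (axis i 1) w) = 0" .
qed

text \<open>The classical homotopy formula on a ball, for a \<open>C\<^sup>1\<close> form with symmetric derivative \<open>J\<close>.\<close>

lemma radial_integral_has_derivative:
  fixes w :: "real^'n \<Rightarrow> real^'n"
  assumes w: "\<And>y. (w has_derivative J y) (at y)" "\<And>h. continuous_on UNIV (\<lambda>y. J y h)"
    and sym: "\<And>y h k. y \<in> ball 0 R \<Longrightarrow> J y h \<bullet> k = J y k \<bullet> h" and x: "x \<in> ball 0 R"
  shows "((\<lambda>x. integral (cbox 0 1) (\<lambda>s::real. w (s *\<^sub>R x) \<bullet> x)) has_derivative (\<lambda>h. w x \<bullet> h)) (at x within ball 0 R)"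
proof -
  have cw: "continuous_on UNIV w"
    using w(1) by (auto intro!: continuous_at_imp_continuous_on intro: has_derivative_continuous)
  have lJ: "linear (J y)" for y using w(1) has_derivative_linear by blast
  have cJ: "continuous_on UNIV (\<lambda>p. J (fst p) (snd p))"
  proof -
    have J: "J y h = (\<Sum>b\<in>Basis. (h \<bullet> b) *\<^sub>R J y b)" for y h
    proof -
      have "J y (\<Sum>b\<in>Basis. (h \<bullet> b) *\<^sub>R b) = (\<Sum>b\<in>Basis. (h \<bullet> b) *\<^sub>R J y b)"
        by (simp only: linear_sum[OF lJ] linear_scale[OF lJ])
      then show ?thesis by (simp only: euclidean_representation)
    qed
    have C: "continuous_on UNIV (\<lambda>p. \<Sum>b\<in>Basis. (snd p \<bullet> b) *\<^sub>R J (fst p) b)"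
      by (intro continuous_intros continuous_on_compose2[OF w(2)]) auto
    show ?thesis by (rule continuous_on_eq[OF C]) (rule J[symmetric])
  qed
  define V where "V x s = s *\<^sub>R J (s *\<^sub>R x) x + w (s *\<^sub>R x)" for x and s :: real
  have cV: "continuous_on S (\<lambda>(x, s). V x s)" for S
    unfolding V_def case_prod_beta
    by (intro continuous_intros continuous_on_compose2[OF cw] continuous_on_compose2[OF cJ, of _ "\<lambda>p. (snd p *\<^sub>R fst p, fst p)", simplified])
      auto
  have ball: "s *\<^sub>R x \<in> ball 0 R" if "x \<in> ball 0 R" "s \<in> cbox 0 1" for x :: "real^'n" and s :: real
    using that mult_left_le_one_le[of "norm x" "\<bar>s\<bar>"] by (auto intro: le_less_trans)
  have "((\<lambda>x. integral (cbox 0 1) (\<lambda>s. w (s *\<^sub>R x) \<bullet> x)) has_derivative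
      integral (cbox 0 1) (\<lambda>s. blinfun_inner_right (V x s))) (at x within ball 0 R)"
  proof (rule leibniz_rule)
    show "((\<lambda>x. w (s *\<^sub>R x) \<bullet> x) has_derivative blinfun_apply (blinfun_inner_right (V x s))) (at x within ball 0 R)"
      if "x \<in> ball 0 R" "s \<in> cbox 0 1" for x and s :: real
    proof -
      have "((\<lambda>x. w (s *\<^sub>R x)) has_derivative (\<lambda>h. J (s *\<^sub>R x) (s *\<^sub>R h))) (at x within ball 0 R)"
        by (rule has_derivative_compose[where g=w and f="\<lambda>x. s *\<^sub>R x" and g'="J (s *\<^sub>R x)", OF _ w(1)])
          (auto intro!: derivative_eq_intros)
      from has_derivative_inner[OF this has_derivative_ident]
      have "((\<lambda>x. w (s *\<^sub>R x) \<bullet> x) has_derivative (\<lambda>h. w (s *\<^sub>R x) \<bullet> h + J (s *\<^sub>R x) (s *\<^sub>R h) \<bullet> x)) (at x within ball 0 R)" .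
      moreover have "w (s *\<^sub>R x) \<bullet> h + J (s *\<^sub>R x) (s *\<^sub>R h) \<bullet> x = blinfun_apply (blinfun_inner_right (V x s)) h" for h
        using sym[OF ball[OF that], of h x] linear_scale[OF lJ]
        by (simp add: V_def algebra_simps inner_commute)
      ultimately show ?thesis by simp
    qed
    show "(\<lambda>s. w (s *\<^sub>R x) \<bullet> x) integrable_on cbox 0 1" for x
      by (intro integrable_continuous continuous_intros continuous_on_compose2[OF cw]) auto
    show "continuous_on (ball 0 R \<times> cbox 0 1) (\<lambda>(x, s). blinfun_inner_right (V x s))"
      using bounded_linear.continuous_on[OF bounded_linear_blinfun_inner_right cV, of "ball 0 R \<times> cbox 0 1"]
      by (simp add: case_prod_beta)
  qed (use x in auto)
  moreover have "integral (cbox 0 1) (\<lambda>s. blinfun_inner_right (V x s)) = blinfun_inner_right (w x)"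
  proof -
    have cVx: "continuous_on (cbox 0 1) (V x)"
      using continuous_on_compose2[OF cV[of UNIV] continuous_on_Pair[OF continuous_on_const continuous_on_id, of "cbox 0 1" x]]
      by simp
    have "(V x has_integral (1 *\<^sub>R w (1 *\<^sub>R x) - 0 *\<^sub>R w (0 *\<^sub>R x))) {0..1}"
    proof (rule fundamental_theorem_of_calculus)
      show "((\<lambda>s. s *\<^sub>R w (s *\<^sub>R x)) has_vector_derivative V x s) (at s within {0..1})" for s
      proof -
        have 1: "((\<lambda>s. w (s *\<^sub>R x)) has_derivative (\<lambda>h. J (s *\<^sub>R x) (h *\<^sub>R x))) (at s within {0..1})"
          by (rule has_derivative_compose[where g=w and f="\<lambda>s. s *\<^sub>R x" and g'="J (s *\<^sub>R x)", OF _ w(1)])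
            (auto intro!: derivative_eq_intros)
        have "((\<lambda>s. s *\<^sub>R w (s *\<^sub>R x)) has_derivative (\<lambda>h. s *\<^sub>R J (s *\<^sub>R x) (h *\<^sub>R x) + h *\<^sub>R w (s *\<^sub>R x))) (at s within {0..1})"
          by (rule has_derivative_scaleR[OF has_derivative_ident 1])
        then show ?thesis
          by (simp add: has_vector_derivative_def V_def linear_scale[OF lJ] scaleR_right_distrib mult.commute[of s])
      qed
    qed simp
    then have "integral (cbox 0 1) (V x) = w x" by (simp add: integral_unique)
    moreover have "integral (cbox 0 1) (blinfun_inner_right \<circ> V x) = blinfun_inner_right (integral (cbox 0 1) (V x))"
      by (rule integral_linear[OF integrable_continuous[OF cVx] bounded_linear_blinfun_inner_right])
    ultimately show ?thesis by (simp add: o_def)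
  qed
  moreover have "blinfun_apply (blinfun_inner_right (w x)) = (\<lambda>h. w x \<bullet> h)" by (simp add: fun_eq_iff)
  ultimately show ?thesis by simp
qed

text \<open>Tested against the translated and reflected kernel, closedness in the sense of
  distributions is exactly the symmetry of the derivative of the mollified form at \<open>y\<close>.
  The form is first cut off to have compact support, which confines the symmetry to a ball.\<close>

lemma mollified_closed_1form:
  fixes \<omega> :: "real^'n \<Rightarrow> real^'n"
  assumes c: "continuous_on UNIV \<omega>" and cl: "closed_1form \<omega>" and "R > 0" and "e > 0"
  obtains w J where "\<And>y. (w has_derivative J y) (at y)" "\<And>h. continuous_on UNIV (\<lambda>y. J y h)"
    "\<And>y h k. y \<in> ball 0 R \<Longrightarrow> J y h \<bullet> k = J y k \<bullet> h"
    "\<And>y. y \<in> ball 0 R \<Longrightarrow> norm (w y - \<omega> y) \<le> e"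
proof -
  \<comment> \<open>Equal to 1 up to radius R + 1, so that averaging at distance at most 1 around a
    point of \<open>ball 0 R\<close> does not meet the cutoff.\<close>
  define cu :: "real^'n \<Rightarrow> real" where "cu = cutoff 0 (2 * (R + 1))"
  have cu1: "cu y = 1" if "norm y \<le> R + 1" for y
    unfolding cu_def using that \<open>R > 0\<close> by (intro cutoff_eq_1) auto
  define K where "K = cball (0::real^'n) (2 * (R + 1))"
  have K: "compact K" by (simp add: K_def)
  define oc where "oc i y = cu y * \<omega> y $ i" for i y
  have co: "continuous_on UNIV (oc i)" for i
    unfolding oc_def cu_def by (intro continuous_intros c Ck_on_imp_continuous[OF Ck_on_cutoff])
  have zo: "oc i y = 0" if "y \<notin> K" for i y
    using that cutoff_eq_0[of "2 * (R + 1)" y 0] \<open>R > 0\<close> by (simp add: oc_def cu_def K_def)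
  \<comment> \<open>An error of this size in each component adds up to at most \<open>e\<close> in
    the sum norm, which dominates the Euclidean norm.\<close>
  define e' where "e' = e / CARD('n)"
  have e': "e' > 0" using \<open>e > 0\<close> by (simp add: e'_def)
  have "\<forall>i. \<exists>d>0. \<forall>x y. dist x y \<le> d \<longrightarrow> \<bar>oc i y - oc i x\<bar> \<le> e'"
    using uniformly_continuous_compact_support[OF co K zo e'] by blast
  then obtain d0 where d0: "\<And>i. d0 i > 0" "\<And>i x y. dist x y \<le> d0 i \<Longrightarrow> \<bar>oc i y - oc i x\<bar> \<le> e'" by metis
  define d where "d = Min (insert 1 (range d0))"
  have "d > 0" unfolding d_def using d0 by (subst Min_gr_iff) auto
  moreover have "d \<le> c" if "c \<in> insert 1 (range d0)" for c unfolding d_def by (rule Min_le) (use that in auto)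
  ultimately have d: "d > 0" "d \<le> 1" "\<And>i. d \<le> d0 i" by auto
  define m where "m = (mollifier d :: real^'n \<Rightarrow> real)"
  note m = mollifier[OF d(1), where ?'a="real^'n", folded m_def]
  have mz: "m x = 0" if "x \<notin> cball 0 d" for x using m(4) that .
  define mj where "mj j = dir_deriv UNIV m (axis j 1)" for j
  have mjs: "Ck_on k (mj j) UNIV" for j k unfolding mj_def using smooth_dir_deriv_UNIV[OF m(1)] .
  have mjz: "mj j x = 0" if "x \<notin> cball 0 d" for j x
    unfolding mj_def using dir_deriv_zero_outside[OF m(1) compact_cball mz that] by blast
  define w where "w y = (\<chi> i. conv (oc i) m y)" for y
  define J where "J y h = (\<chi> i. conv (oc i) (dir_deriv UNIV m h) y)" for y h
  have ci: "(conv (oc i) m has_derivative (\<lambda>h. conv (oc i) (dir_deriv UNIV m h) y)) (at y)" for i y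
    by (rule conv_has_derivative[OF co K zo m(1)])
  have w: "(w has_derivative J y) (at y)" for y
    unfolding has_derivative_componentwise_within[of w] 
  proof
    fix b :: "real^'n" assume "b \<in> Basis"
    then obtain i where "b = axis i 1" by (auto simp: Basis_vec_def)
    then show "((\<lambda>x. w x \<bullet> b) has_derivative (\<lambda>x. J y x \<bullet> b)) (at y)"
      using ci[of i y] by (simp add: w_def J_def inner_axis)
  qed
  have cJ: "continuous_on UNIV (\<lambda>y. J y h)" for h
  proof -
    have "continuous_on UNIV (conv (oc i) (dir_deriv UNIV m h))" for i
      using Ck_on_imp_continuous[OF conv_smooth[OF co K zo smooth_dir_deriv_UNIV[OF m(1)]]] .
    then show ?thesis unfolding J_def by (intro continuous_on_vec_lambda)
  qed
  have Jsym: "J y (axis j 1) $ i = J y (axis i 1) $ j" if y: "y \<in> ball 0 R" for y i j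
  proof -
    have cuy: "cu z = 1" if "y - z \<in> cball 0 d" for z
      using y that d(2) norm_triangle_ineq4[of y "y - z"] by (intro cu1) auto
    have o1: "oc i z * mj j (y - z) = \<omega> z $ i * mj j (y - z)" for i j z
      using mjz[of "y - z" j] cuy[of z] by (cases "y - z \<in> cball 0 d") (auto simp: oc_def)
    have int: "integrable lborel (\<lambda>z. oc i z * mj j (y - z))" for i j
    proof -
      have "\<exists>a b. \<forall>x. x \<notin> cbox a b \<longrightarrow> oc i x = 0" by (rule compact_support_cbox[OF K zo])
      then obtain a b where ab: "\<And>x. x \<notin> cbox a b \<Longrightarrow> oc i x = 0" by blast
      show ?thesis
        by (rule integrable_compact_support(1)[where a=a and b=b])
          (auto intro!: continuous_intros co continuous_on_compose2[OF Ck_on_imp_continuous[OF mjs]] simp: ab)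
    qed
    define f where "f z = m (y - z)" for z
    have "smooth_on f UNIV"
      unfolding smooth_on_def f_def
      by (intro allI Ck_on_compose[OF m(1)] Ck_on_diff Ck_on_const Ck_on_id) auto
    moreover have "compact (closure {z. f z \<noteq> 0})"
    proof -
      have "{z. f z \<noteq> 0} \<subseteq> cball y d" using mz by (force simp: f_def dist_norm)
      then have "closure {z. f z \<noteq> 0} \<subseteq> cball y d" by (simp add: closure_minimal)
      then show ?thesis by (meson bounded_cball bounded_subset closed_closure compact_eq_bounded_closed)
    qed
    ultimately have "(LINT z|lborel. \<omega> z $ i * dir_deriv UNIV f (axis j 1) z - \<omega> z $ j * dir_deriv UNIV f (axis i 1) z) = 0"
      using cl unfolding closed_1form_def by blast
    moreover have df: "dir_deriv UNIV f (axis j 1) z = - mj j (y - z)" for j z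
    proof -
      have "(f has_derivative (\<lambda>h. frechet_derivative m (at (y - z)) (- h))) (at z)"
        unfolding f_def
        by (rule has_derivative_compose[where g=m and f="\<lambda>z. y - z" and g'="frechet_derivative m (at (y - z))", OF _ dir_deriv_UNIV_linear(1)[OF m(1)]])
          (auto intro!: derivative_eq_intros)
      from frechet_derivative_at[OF this, symmetric] show ?thesis
        using linear_neg[OF bounded_linear.linear[OF dir_deriv_UNIV_linear(3)[OF m(1)]]]
        by (simp add: mj_def)
    qed
    ultimately have "(LINT z|lborel. oc j z * mj i (y - z) - oc i z * mj j (y - z)) = 0"
      by (simp add: df o1)
    then have "(LINT z|lborel. oc j z * mj i (y - z)) = (LINT z|lborel. oc i z * mj j (y - z))"
      by (simp add: Bochner_Integration.integral_diff[OF int int])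
    then show ?thesis by (simp add: J_def conv_def mj_def)
  qed
  have sym: "J y h \<bullet> k = J y k \<bullet> h" if "y \<in> ball 0 R" for y h k
  proof -
    have l: "linear (J y)" using w has_derivative_linear by blast
    have J: "J y h $ i = (\<Sum>j\<in>UNIV. h $ j * J y (axis j 1) $ i)" for h i
    proof -
      have "J y (\<Sum>j\<in>UNIV. h $ j *\<^sub>R axis j 1) = (\<Sum>j\<in>UNIV. h $ j *\<^sub>R J y (axis j 1))"
        by (simp only: linear_sum[OF l] linear_scale[OF l])
      moreover have "(\<Sum>j\<in>UNIV. h $ j *\<^sub>R axis j (1::real)) = h"
        using basis_expansion[of h] by (simp add: scalar_mult_eq_scaleR)
      ultimately show ?thesis by simp
    qed
    have "J y h \<bullet> k = (\<Sum>i\<in>UNIV. \<Sum>j\<in>UNIV. h $ j * J y (axis j 1) $ i * k $ i)"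
      by (simp add: inner_vec_def J[of h] sum_distrib_right)
    also have "\<dots> = (\<Sum>i\<in>UNIV. \<Sum>j\<in>UNIV. h $ j * J y (axis i 1) $ j * k $ i)"
      using Jsym[OF that] by simp
    also have "\<dots> = (\<Sum>j\<in>UNIV. \<Sum>i\<in>UNIV. h $ j * J y (axis i 1) $ j * k $ i)"
      by (rule sum.swap)
    also have "\<dots> = J y k \<bullet> h"
      by (simp add: inner_vec_def J[of k] sum_distrib_left sum_distrib_right mult_ac)
    finally show ?thesis .
  qed
  have "norm (w y - \<omega> y) \<le> e" if y: "y \<in> ball 0 R" for y
  proof -
    have "\<bar>(w y - \<omega> y) $ i\<bar> \<le> e'" for i
    proof -
      have "\<bar>conv (oc i) m y - oc i y\<bar> \<le> e'"
        unfolding m_def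
      proof (rule conv_mollifier_approx[OF d(1) co])
        fix z assume "dist y z \<le> d"
        then show "\<bar>oc i z - oc i y\<bar> \<le> e'" using d0(2)[of y z i] d(3)[of i] by simp
      qed
      then show ?thesis using y cu1[of y] by (simp add: w_def oc_def)
    qed
    then have "(\<Sum>i\<in>UNIV. \<bar>(w y - \<omega> y) $ i\<bar>) \<le> of_nat (CARD('n)) * e'"
      by (intro sum_bounded_above) simp
    then show ?thesis using norm_le_l1_cart[of "w y - \<omega> y"] by (simp add: e'_def)
  qed
  from that[OF w cJ sym this] show ?thesis .
qed

text \<open>On a ball the form is a uniform limit of C^1 forms with symmetric derivative. Their
  radial integrals vanish at 0 and have uniformly converging gradients, so the limit has gradient
  \<omega>; the limit is then identified with the radial integral of \<omega> itself. Having the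
  explicit formula, rather than mere existence, allows the primitives on all fibers to be chosen
  continuously.\<close>

lemma closed_1form_primitive:
  fixes \<omega> :: "real^'n \<Rightarrow> real^'n"
  assumes c: "continuous_on UNIV \<omega>" and cl: "closed_1form \<omega>"
  shows "((\<lambda>x. integral (cbox 0 1) (\<lambda>s::real. \<omega> (s *\<^sub>R x) \<bullet> x)) has_derivative (\<lambda>h. \<omega> x \<bullet> h)) (at x)"
proof -
  define R where "R = norm x + 1"
  have R: "R > 0" "x \<in> ball 0 R" by (auto simp: R_def add_nonneg_pos)
  have "\<forall>n. \<exists>w J. (\<forall>y. (w has_derivative J y) (at y)) \<and> (\<forall>h. continuous_on UNIV (\<lambda>y. J y h)) \<and>
    (\<forall>y h k. y \<in> ball 0 R \<longrightarrow> J y h \<bullet> k = J y k \<bullet> h) \<and> (\<forall>y. y \<in> ball 0 R \<longrightarrow> norm (w y - \<omega> y) \<le> inverse (real (Suc n)))"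
  proof
    fix n
    show "\<exists>w J. (\<forall>y. (w has_derivative J y) (at y)) \<and> (\<forall>h. continuous_on UNIV (\<lambda>y. J y h)) \<and>
    (\<forall>y h k. y \<in> ball 0 R \<longrightarrow> J y h \<bullet> k = J y k \<bullet> h) \<and> (\<forall>y. y \<in> ball 0 R \<longrightarrow> norm (w y - \<omega> y) \<le> inverse (real (Suc n)))"
      by (rule mollified_closed_1form[OF c cl R(1), of "inverse (real (Suc n))"]) (simp, blast)
  qed
  then obtain w J where w: "\<And>n y. (w n has_derivative J n y) (at y)" "\<And>n h. continuous_on UNIV (\<lambda>y. J n y h)"
    "\<And>n y h k. y \<in> ball 0 R \<Longrightarrow> J n y h \<bullet> k = J n y k \<bullet> h"
    "\<And>n y. y \<in> ball 0 R \<Longrightarrow> norm (w n y - \<omega> y) \<le> inverse (real (Suc n))"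
    by metis
  define u where "u v x = integral (cbox 0 1) (\<lambda>s::real. v (s *\<^sub>R x) \<bullet> x)" for v :: "real^'n \<Rightarrow> real^'n" and x
  have lim: "(\<lambda>n. inverse (real (Suc n)) * C) \<longlonglongrightarrow> 0" for C
    using tendsto_mult_left_zero[OF LIMSEQ_inverse_real_of_nat] by simp
  have "\<exists>g. \<forall>x\<in>ball 0 R. (\<lambda>n. u (w n) x) \<longlonglongrightarrow> g x \<and> (g has_derivative (\<lambda>h. \<omega> x \<bullet> h)) (at x within ball 0 R)"
  proof (rule has_derivative_sequence[where f'="\<lambda>n x h. w n x \<bullet> h"])
    show "(u (w n) has_derivative (\<bullet>) (w n x)) (at x within ball 0 R)" if "x \<in> ball 0 R" for n and x :: "real^'n"
      using radial_integral_has_derivative[OF w(1,2,3) that] by (simp add: u_def[abs_def])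
    show "\<forall>\<^sub>F n in sequentially. \<forall>x\<in>ball 0 R. \<forall>h. norm (w n x \<bullet> h - \<omega> x \<bullet> h) \<le> e * norm h" if "e > 0" for e
    proof -
      have "\<forall>\<^sub>F n in sequentially. inverse (real (Suc n)) < e"
        using LIMSEQ_inverse_real_of_nat that by (rule order_tendstoD)
      then show ?thesis
      proof (rule eventually_mono, intro ballI allI)
        fix n and x h :: "real^'n" assume n: "inverse (real (Suc n)) < e" "x \<in> ball 0 R"
        have "norm (w n x \<bullet> h - \<omega> x \<bullet> h) \<le> norm (w n x - \<omega> x) * norm h"
          using Cauchy_Schwarz_ineq2[of "w n x - \<omega> x" h] by (simp add: inner_diff_left)
        also have "\<dots> \<le> e * norm h" using w(4)[OF n(2), of n] n(1) by (intro mult_right_mono) auto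
        finally show "norm (w n x \<bullet> h - \<omega> x \<bullet> h) \<le> e * norm h" .
      qed
    qed
    show "0 \<in> ball 0 R" using R by simp
    show "(\<lambda>n. u (w n) 0) \<longlonglongrightarrow> 0" by (simp add: u_def)
  qed auto
  then obtain g where g: "\<And>x. x \<in> ball 0 R \<Longrightarrow> (\<lambda>n. u (w n) x) \<longlonglongrightarrow> g x"
    "\<And>x. x \<in> ball 0 R \<Longrightarrow> (g has_derivative (\<lambda>h. \<omega> x \<bullet> h)) (at x within ball 0 R)" by blast
  have cw: "continuous_on UNIV (w n)" for n
    using w(1) by (auto intro!: continuous_at_imp_continuous_on intro: has_derivative_continuous)
  have "g y = u \<omega> y" if y: "y \<in> ball 0 R" for y
  proof -
    have "\<bar>u (w n) y - u \<omega> y\<bar> \<le> inverse (real (Suc n)) * norm y" for n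
    proof -
      have i: "(\<lambda>s::real. v (s *\<^sub>R y) \<bullet> y) integrable_on cbox 0 1" if "continuous_on UNIV v" for v :: "real^'n \<Rightarrow> real^'n"
        by (intro integrable_continuous continuous_intros continuous_on_compose2[OF that]) auto
      have "u (w n) y - u \<omega> y = integral (cbox 0 1) (\<lambda>s. w n (s *\<^sub>R y) \<bullet> y - \<omega> (s *\<^sub>R y) \<bullet> y)"
        unfolding u_def by (rule Henstock_Kurzweil_Integration.integral_diff[symmetric]) (intro i cw c)+
      also have "norm \<dots> \<le> inverse (real (Suc n)) * norm y * Henstock_Kurzweil_Integration.content (cbox 0 (1::real))"
      proof (rule integrable_bound)
        show "norm (w n (s *\<^sub>R y) \<bullet> y - \<omega> (s *\<^sub>R y) \<bullet> y) \<le> inverse (real (Suc n)) * norm y" if s: "s \<in> cbox 0 1" for s :: real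
        proof -
          have "s *\<^sub>R y \<in> ball 0 R"
            using s y mult_left_le_one_le[of "norm y" "\<bar>s\<bar>"] by (auto intro: le_less_trans)
          have "norm (w n (s *\<^sub>R y) \<bullet> y - \<omega> (s *\<^sub>R y) \<bullet> y) \<le> norm (w n (s *\<^sub>R y) - \<omega> (s *\<^sub>R y)) * norm y"
            using Cauchy_Schwarz_ineq2[of "w n (s *\<^sub>R y) - \<omega> (s *\<^sub>R y)" y] by (simp add: inner_diff_left)
          also have "\<dots> \<le> inverse (real (Suc n)) * norm y"
            using w(4)[OF \<open>s *\<^sub>R y \<in> ball 0 R\<close>, of n] by (intro mult_right_mono) auto
          finally show ?thesis .
        qed
      qed (use integrable_diff[OF i[OF cw[of n]] i[OF c]] in auto)
      finally show ?thesis by simp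
    qed
    then have "(\<lambda>n. u (w n) y - u \<omega> y) \<longlonglongrightarrow> 0"
      by (intro Lim_null_comparison[OF _ lim[of "norm y"]] always_eventually) auto
    then have "(\<lambda>n. u (w n) y) \<longlonglongrightarrow> u \<omega> y" by (rule LIM_zero_cancel)
    then show ?thesis using g(1)[OF y] LIMSEQ_unique by blast
  qed
  then have "(u \<omega> has_derivative (\<lambda>h. \<omega> x \<bullet> h)) (at x within ball 0 R)"
    using g(2)[OF R(2)] R(2) by (metis (mono_tags, lifting) has_derivative_transform)
  then show ?thesis using R(2) by (simp add: at_within_open[of _ "ball 0 R"] u_def[abs_def])
qed

section \<open>Charts of the tangent bundle\<close>

lemma second_derivative_symmetric_vec:
  fixes f :: "'a::euclidean_space \<Rightarrow> real^'n"
  assumes O: "open S" "p \<in> S"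
    and D: "\<And>q. q \<in> S \<Longrightarrow> (f has_derivative D q) (at q)"
    and E: "\<And>h q. q \<in> S \<Longrightarrow> ((\<lambda>q. D q h) has_derivative E h q) (at q)"
    and c: "\<And>h k. continuous_on S (\<lambda>q. E h q k)"
  shows "E h p k = E k p h"
proof -
  note nth = bounded_linear.has_derivative[OF bounded_linear_vec_nth]
  have "E h p k $ i = E k p h $ i" for i
    by (rule second_derivative_symmetric[where f="\<lambda>q. f q $ i" and D="\<lambda>q h. D q h $ i"
        and E="\<lambda>q k. E h q k $ i" and F="\<lambda>q h. E k q h $ i", OF O])
      (auto intro!: nth D E continuous_intros c)
  then show ?thesis by (simp add: vec_eq_iff)
qed

locale mfd =
  fixes A :: "('m::{second_countable_topology, t2_space}, 'n::finite) chart set" and t0 :: real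
  assumes atlas: "smooth_atlas A" and t0: "t0 > 0"
begin

abbreviation im :: "('m, 'n) chart \<Rightarrow> (real^'n) set" where "im c \<equiv> snd c ` fst c"
abbreviation iv :: "('m, 'n) chart \<Rightarrow> real^'n \<Rightarrow> 'm" where "iv c \<equiv> inv_into (fst c) (snd c)"

definition ov :: "('m, 'n) chart \<Rightarrow> ('m, 'n) chart \<Rightarrow> (real^'n) set" where
  "ov c d = snd c ` (fst c \<inter> fst d)"

definition J :: "('m, 'n) chart \<Rightarrow> ('m, 'n) chart \<Rightarrow> real^'n \<Rightarrow> real^'n \<Rightarrow> real^'n" where
  "J c d y = frechet_derivative (chart_change c d) (at y)"

text \<open>The second derivative of the change of charts, with \<open>w\<close> the direction of
  the first differentiation. It is the inhomogeneous term in the transformation law of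
  accelerations.\<close>

definition J2 :: "('m, 'n) chart \<Rightarrow> ('m, 'n) chart \<Rightarrow> real^'n \<Rightarrow> real^'n \<Rightarrow> real^'n \<Rightarrow> real^'n" where
  "J2 c d y w = frechet_derivative (\<lambda>y. J c d y w) (at y)"

lemma chart:
  assumes "c \<in> A"
  shows open_dom: "open (fst c)" and open_im: "open (im c)" and inj_chart: "inj_on (snd c) (fst c)"
    and cont_chart: "continuous_on (fst c) (snd c)" and cont_iv: "continuous_on (im c) (iv c)"
proof -
  obtain \<psi> where h: "open (fst c)" "open (im c)" "homeomorphism (fst c) (im c) (snd c) \<psi>"
    using atlas assms unfolding smooth_atlas_def by blast
  show "open (fst c)" "open (im c)" using h by auto
  show i: "inj_on (snd c) (fst c)" using h(3) by (intro inj_on_inverseI[where g=\<psi>]) (auto simp: homeomorphism_def)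
  show "continuous_on (fst c) (snd c)" using h(3) by (simp add: homeomorphism_def)
  have "continuous_on (im c) \<psi>" using h(3) by (simp add: homeomorphism_def)
  then show "continuous_on (im c) (iv c)"
    by (rule continuous_on_eq) (use h(3) i in \<open>auto simp: homeomorphism_def\<close>)
qed

lemma iv_simps [simp]:
  assumes "c \<in> A"
  shows "x \<in> fst c \<Longrightarrow> iv c (snd c x) = x" "y \<in> im c \<Longrightarrow> snd c (iv c y) = y" "y \<in> im c \<Longrightarrow> iv c y \<in> fst c"
  using inj_chart[OF assms] by (auto simp: inv_into_into f_inv_into_f)

lemma ov_iff: "c \<in> A \<Longrightarrow> y \<in> ov c d \<longleftrightarrow> y \<in> im c \<and> iv c y \<in> fst d"
  by (auto simp: ov_def)

lemma ov_subset: "ov c d \<subseteq> im c" by (auto simp: ov_def)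

lemma open_ov: assumes "c \<in> A" "d \<in> A" shows "open (ov c d)"
proof -
  have "openin (top_of_set (im c)) (im c \<inter> iv c -` fst d)"
    by (rule continuous_openin_preimage_gen[OF cont_iv[OF assms(1)] open_dom[OF assms(2)]])
  moreover have "im c \<inter> iv c -` fst d = ov c d" by (auto simp: ov_iff[OF assms(1)])
  ultimately show ?thesis using open_im[OF assms(1)] openin_open_eq by metis
qed

lemma chart_change_simp: "c \<in> A \<Longrightarrow> x \<in> fst c \<Longrightarrow> chart_change c d (snd c x) = snd d x"
  by (simp add: chart_change_def)

lemma Ck_chart_change: "c \<in> A \<Longrightarrow> d \<in> A \<Longrightarrow> Ck_on k (chart_change c d) (ov c d)"
  using atlas unfolding smooth_atlas_def smooth_on_def ov_def by blast

lemma J_deriv: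
  assumes "c \<in> A" "d \<in> A" "y \<in> ov c d"
  shows "(chart_change c d has_derivative J c d y) (at y)"
  using Ck_on_frechet(1)[OF Ck_chart_change[OF assms(1,2), of "Suc 0"] thick_open[OF open_ov[OF assms(1,2)]] assms(3)]
  by (simp add: J_def at_within_open[OF assms(3) open_ov[OF assms(1,2)]])

lemma linear_J: "c \<in> A \<Longrightarrow> d \<in> A \<Longrightarrow> y \<in> ov c d \<Longrightarrow> linear (J c d y)"
  using J_deriv has_derivative_linear by blast

lemma Ck_J: assumes "c \<in> A" "d \<in> A" shows "Ck_on k (\<lambda>y. J c d y h) (ov c d)"
proof (rule Ck_on_cong[OF Ck_on_frechet(2)[OF Ck_chart_change[OF assms, of "Suc k"] thick_open[OF open_ov[OF assms]], of h]])
  show "dir_deriv (ov c d) (chart_change c d) h y = J c d y h" if "y \<in> ov c d" for y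
    by (simp add: J_def at_within_open[OF that open_ov[OF assms]])
qed

lemma J2_deriv:
  assumes "c \<in> A" "d \<in> A" "y \<in> ov c d"
  shows "((\<lambda>y. J c d y w) has_derivative J2 c d y w) (at y)"
  using Ck_on_frechet(1)[OF Ck_J[OF assms(1,2), of "Suc 0"] thick_open[OF open_ov[OF assms(1,2)]] assms(3)]
  by (simp add: J2_def at_within_open[OF assms(3) open_ov[OF assms(1,2)]])

lemma Ck_J2: assumes "c \<in> A" "d \<in> A" shows "Ck_on k (\<lambda>y. J2 c d y w h) (ov c d)"
proof (rule Ck_on_cong[OF Ck_on_frechet(2)[OF Ck_J[OF assms, of "Suc k" w] thick_open[OF open_ov[OF assms]], of h]])
  show "dir_deriv (ov c d) (\<lambda>y. J c d y w) h y = J2 c d y w h" if "y \<in> ov c d" for y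
    by (simp add: J2_def at_within_open[OF that open_ov[OF assms]])
qed

lemma J2_sym:
  assumes "c \<in> A" "d \<in> A" "y \<in> ov c d" shows "J2 c d y h k = J2 c d y k h"
  using second_derivative_symmetric_vec[where f="chart_change c d" and D="J c d" and E="\<lambda>h y. J2 c d y h",
      OF open_ov[OF assms(1,2)] assms(3) J_deriv[OF assms(1,2)] J2_deriv[OF assms(1,2)]
        Ck_on_imp_continuous[OF Ck_J2[OF assms(1,2)]]] .

lemma linear_expand:
  fixes l :: "real^'n \<Rightarrow> 'b::real_vector"
  assumes "linear l" shows "l w = (\<Sum>i\<in>UNIV. w $ i *\<^sub>R l (axis i 1))"
proof -
  have "l (\<Sum>i\<in>UNIV. w $ i *\<^sub>R axis i 1) = (\<Sum>i\<in>UNIV. w $ i *\<^sub>R l (axis i 1))"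
    by (simp only: linear_sum[OF assms] linear_scale[OF assms])
  moreover have "(\<Sum>i\<in>UNIV. w $ i *\<^sub>R axis i (1::real)) = w"
    using basis_expansion[of w] by (simp add: scalar_mult_eq_scaleR)
  ultimately show ?thesis by simp
qed

lemma J_comp:
  assumes "c \<in> A" "d \<in> A" "e \<in> A" "x \<in> fst c" "x \<in> fst d" "x \<in> fst e"
  shows "J d e (snd d x) (J c d (snd c x) w) = J c e (snd c x) w"
proof -
  let ?y = "snd c x"
  have y: "?y \<in> ov c d" "?y \<in> ov c e" "snd d x \<in> ov d e" using assms by (auto simp: ov_def)
  have "(chart_change d e has_derivative J d e (snd d x)) (at (chart_change c d ?y))"
    using J_deriv[OF assms(2,3) y(3)] assms by (simp add: chart_change_simp)
  from has_derivative_compose[OF J_deriv[OF assms(1,2) y(1)] this]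
  have "((\<lambda>y. chart_change d e (chart_change c d y)) has_derivative (\<lambda>w. J d e (snd d x) (J c d ?y w))) (at ?y)" .
  then have "(chart_change c e has_derivative (\<lambda>w. J d e (snd d x) (J c d ?y w))) (at ?y)"
  proof (rule has_derivative_transform_within_open)
    show "open (ov c d \<inter> ov c e)" using open_ov[OF assms(1,2)] open_ov[OF assms(1,3)] by (rule open_Int)
    show "?y \<in> ov c d \<inter> ov c e" using y by auto
    show "chart_change d e (chart_change c d z) = chart_change c e z" if "z \<in> ov c d \<inter> ov c e" for z
      using that assms by (auto simp: ov_iff chart_change_def)
  qed
  then have "(\<lambda>w. J d e (snd d x) (J c d ?y w)) = J c e ?y"
    using J_deriv[OF assms(1,3) y(2)] has_derivative_unique by blast
  then show ?thesis by (rule fun_cong)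
qed

lemma J_self:
  assumes "c \<in> A" "x \<in> fst c" shows "J c c (snd c x) w = w"
proof -
  have y: "snd c x \<in> ov c c" using assms by (auto simp: ov_def)
  have "(chart_change c c has_derivative (\<lambda>w. w)) (at (snd c x))"
  proof (rule has_derivative_transform_within_open[where f="\<lambda>y. y"])
    show "z = chart_change c c z" if "z \<in> ov c c" for z using that assms by (auto simp: ov_iff chart_change_def)
  qed (use open_ov assms y in auto)
  then have "(\<lambda>w. w) = J c c (snd c x)"
    using J_deriv[OF assms(1,1) y] has_derivative_unique by blast
  then show ?thesis by metis
qed

text \<open>One coordinate vector determines the others through the Jacobians, and the value 0 at
  the remaining charts is the normalization of \<open>tangent_space\<close>; so this is the only
  tangent vector at \<open>x\<close> with \<open>c\<close>-coordinates \<open>w\<close>.\<close>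

definition lift :: "('m, 'n) chart \<Rightarrow> 'm \<Rightarrow> real^'n \<Rightarrow> ('m, 'n) tangent" where
  "lift c x w = (\<lambda>d. if d \<in> A \<and> x \<in> fst d then J c d (snd c x) w else 0)"

lemma lift_tangent: "c \<in> A \<Longrightarrow> x \<in> fst c \<Longrightarrow> lift c x w \<in> tangent_space A x"
  unfolding tangent_space_def lift_def using J_comp[of c _ _ x w] by (auto simp flip: J_def)

lemma lift_same: "c \<in> A \<Longrightarrow> x \<in> fst c \<Longrightarrow> lift c x w c = w"
  by (simp add: lift_def J_self)

lemma tangent_J: "v \<in> tangent_space A x \<Longrightarrow> c \<in> A \<Longrightarrow> d \<in> A \<Longrightarrow> x \<in> fst c \<Longrightarrow> x \<in> fst d \<Longrightarrow> v d = J c d (snd c x) (v c)"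
  unfolding tangent_space_def J_def by blast

lemma tangent_0: "v \<in> tangent_space A x \<Longrightarrow> \<not> (c \<in> A \<and> x \<in> fst c) \<Longrightarrow> v c = 0"
  unfolding tangent_space_def by blast

lemma lift_unique:
  assumes "v \<in> tangent_space A x" "c \<in> A" "x \<in> fst c"
  shows "lift c x (v c) = v"
proof
  fix d show "lift c x (v c) d = v d"
  proof (cases "d \<in> A \<and> x \<in> fst d")
    case True
    then have "v d = J c d (snd c x) (v c)" using tangent_J[OF assms(1,2) _ assms(3)] by blast
    with True show ?thesis by (simp add: lift_def)
  next
    case False
    then show ?thesis using tangent_0[OF assms(1) False] by (simp only: lift_def if_False)
  qed
qed

abbreviation TM where "TM \<equiv> TMI A t0"
abbreviation cd where "cd \<equiv> chart_dom A t0"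
abbreviation ci where "ci \<equiv> chart_img t0"
abbreviation unc where "unc \<equiv> uncoord A t0"
abbreviation lc where "lc \<equiv> loc A t0"
abbreviation top where "top \<equiv> TMI_top A t0"

lemma cd_iff: "p \<in> cd c \<longleftrightarrow> p \<in> TM \<and> fst p \<in> fst c" by (simp add: chart_dom_def)
lemma cd_TM: "p \<in> cd c \<Longrightarrow> p \<in> TM" by (simp add: cd_iff)
lemma ci_iff: "q \<in> ci c \<longleftrightarrow> fst q \<in> im c \<and> 0 \<le> snd (snd q) \<and> snd (snd q) \<le> t0"
  by (cases q) (auto simp: chart_img_def)
lemma TM_iff: "p \<in> TM \<longleftrightarrow> fst (snd p) \<in> tangent_space A (fst p) \<and> 0 \<le> snd (snd p) \<and> snd (snd p) \<le> t0"
  by (auto simp: TMI_def)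

lemma coord_in: "p \<in> cd c \<Longrightarrow> coord c p \<in> ci c"
  by (auto simp: cd_iff ci_iff TM_iff coord_def)

lemma inj_coord: assumes "c \<in> A" shows "inj_on (coord c) (cd c)"
proof (rule inj_onI)
  fix p q assume p: "p \<in> cd c" and q: "q \<in> cd c" and e: "coord c p = coord c q"
  have x: "fst p = fst q" using e p q inj_chart[OF assms] by (auto simp: coord_def cd_iff inj_on_def)
  have "fst (snd p) = lift c (fst p) (fst (snd p) c)" using lift_unique p assms by (auto simp: cd_iff TM_iff)
  also have "\<dots> = fst (snd q)" using lift_unique q assms e x by (auto simp: cd_iff TM_iff coord_def)
  finally show "p = q" using x e by (auto simp: coord_def prod_eq_iff)
qed

lemma pt_coord: 
  assumes "c \<in> A" "q \<in> ci c"
  defines "p \<equiv> (iv c (fst q), lift c (iv c (fst q)) (fst (snd q)), snd (snd q))"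
  shows "p \<in> cd c" "coord c p = q"
proof -
  have "fst q \<in> im c" using assms(2) by (simp add: ci_iff)
  note s = iv_simps(2,3)[OF assms(1) this]
  show "p \<in> cd c" unfolding p_def cd_iff TM_iff using assms(2) lift_tangent[OF assms(1)] s(2) by (simp add: ci_iff)
  show "coord c p = q" unfolding p_def coord_def using lift_same[OF assms(1) s(2)] s by simp
qed

lemma unc_coord [simp]: "c \<in> A \<Longrightarrow> p \<in> cd c \<Longrightarrow> unc c (coord c p) = p"
  unfolding uncoord_def by (rule inv_into_f_f[OF inj_coord])

lemma unc_in: "c \<in> A \<Longrightarrow> q \<in> ci c \<Longrightarrow> unc c q \<in> cd c"
  using pt_coord[of c q] unc_coord[of c] by metis

lemma coord_unc [simp]: "c \<in> A \<Longrightarrow> q \<in> ci c \<Longrightarrow> coord c (unc c q) = q"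
  using pt_coord[of c q] unc_coord[of c] by metis

lemma unc_eq: "c \<in> A \<Longrightarrow> q \<in> ci c \<Longrightarrow> unc c q = (iv c (fst q), lift c (iv c (fst q)) (fst (snd q)), snd (snd q))"
  using pt_coord[of c q] unc_coord[of c] by metis

lemma lc_coord [simp]: "c \<in> A \<Longrightarrow> p \<in> cd c \<Longrightarrow> lc c f (coord c p) = f p"
  by (simp add: loc_def)

lemma exists_chart: "\<exists>c\<in>A. x \<in> fst c"
proof -
  have "x \<in> \<Union> (fst ` A)" using atlas unfolding smooth_atlas_def by simp
  then show ?thesis by blast
qed

lemma exists_cd: "p \<in> TM \<Longrightarrow> \<exists>c\<in>A. p \<in> cd c"
  using exists_chart[of "fst p"] by (auto simp: cd_iff)

lemma chart_at: "chart_at A p \<in> A" "fst p \<in> fst (chart_at A p)"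
  using someI_ex[of "\<lambda>c. c \<in> A \<and> fst p \<in> fst c"] exists_chart[of "fst p"] unfolding chart_at_def by blast+

lemma chart_at_cd: "p \<in> TM \<Longrightarrow> p \<in> cd (chart_at A p)"
  using chart_at(2) by (auto simp: cd_iff)

lemma thick_ci: "c \<in> A \<Longrightarrow> thick (ci c)"
  unfolding chart_img_def by (intro thick_Times thick_open open_im thick_UNIV thick_interval t0)

definition OV :: "('m, 'n) chart \<Rightarrow> ('m, 'n) chart \<Rightarrow> 'n coords set" where
  "OV c d = ov c d \<times> UNIV \<times> {0..t0}"

text \<open>The transition map between the induced charts of the tangent bundle times the interval;
  \<open>OV c d\<close> is its domain.\<close>

definition T :: "('m, 'n) chart \<Rightarrow> ('m, 'n) chart \<Rightarrow> 'n coords \<Rightarrow> 'n coords" where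
  "T c d q = (chart_change c d (fst q), J c d (fst q) (fst (snd q)), snd (snd q))"

lemma OV_iff:
  assumes "c \<in> A" shows "q \<in> OV c d \<longleftrightarrow> q \<in> ci c \<and> unc c q \<in> cd d"
proof -
  have 1: "q \<in> OV c d \<longleftrightarrow> fst q \<in> ov c d \<and> 0 \<le> snd (snd q) \<and> snd (snd q) \<le> t0"
    by (cases q) (auto simp: OV_def)
  show ?thesis
  proof (cases "q \<in> ci c")
    case True
    have "unc c q \<in> TM" using unc_in[OF assms True] by (simp add: cd_iff)
    then have "unc c q \<in> cd d \<longleftrightarrow> iv c (fst q) \<in> fst d"
      using unc_eq[OF assms True] by (simp add: cd_iff)
    then show ?thesis using True 1 by (simp add: ov_iff[OF assms] ci_iff)
  next
    case False
    then show ?thesis using 1 by (simp add: ov_iff[OF assms] ci_iff) blast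
  qed
qed

lemma OV_subset: "c \<in> A \<Longrightarrow> OV c d \<subseteq> ci c" using OV_iff by blast

lemma coord_OV: "c \<in> A \<Longrightarrow> p \<in> cd c \<Longrightarrow> p \<in> cd d \<Longrightarrow> coord c p \<in> OV c d"
  by (simp add: OV_iff coord_in)

lemma openin_OV: assumes "c \<in> A" "d \<in> A" shows "openin (top_of_set (ci c)) (OV c d)"
proof -
  have "OV c d = ci c \<inter> (ov c d \<times> UNIV \<times> UNIV)" using ov_subset[of c d] by (auto simp: OV_def chart_img_def)
  then show ?thesis using open_ov[OF assms] by (simp add: openin_open_Int open_Times)
qed

lemma T_coord: "c \<in> A \<Longrightarrow> d \<in> A \<Longrightarrow> p \<in> cd c \<Longrightarrow> p \<in> cd d \<Longrightarrow> T c d (coord c p) = coord d p"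
  using tangent_J[of "fst (snd p)" "fst p" c d] by (simp add: T_def coord_def cd_iff TM_iff chart_change_simp)

lemma T_unc: "c \<in> A \<Longrightarrow> d \<in> A \<Longrightarrow> q \<in> OV c d \<Longrightarrow> coord d (unc c q) = T c d q"
  using T_coord[of c d "unc c q"] OV_iff[of c q d] unc_in[of c q] by simp

lemma T_in: "c \<in> A \<Longrightarrow> d \<in> A \<Longrightarrow> q \<in> OV c d \<Longrightarrow> T c d q \<in> OV d c"
  using T_unc[of c d q] OV_iff[of c q d] unc_in[of c q] coord_OV[of d "unc c q" c] by simp

lemma unc_T: "c \<in> A \<Longrightarrow> d \<in> A \<Longrightarrow> q \<in> OV c d \<Longrightarrow> unc d (T c d q) = unc c q"
  using T_unc[of c d q] OV_iff[of c q d] by (metis unc_coord)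

lemma lc_T: "c \<in> A \<Longrightarrow> d \<in> A \<Longrightarrow> q \<in> OV c d \<Longrightarrow> lc c f q = lc d f (T c d q)"
  by (simp add: loc_def unc_T)

lemma J_sum: assumes "c \<in> A" "d \<in> A" "y \<in> ov c d" shows "J c d y w = (\<Sum>i\<in>UNIV. w $ i *\<^sub>R J c d y (axis i 1))"
  using linear_expand[OF linear_J[OF assms]] .

lemma Ck_T: assumes "c \<in> A" "d \<in> A" shows "Ck_on k (T c d) (OV c d)"
proof -
  have f: "Ck_on k (\<lambda>q. fst q) (OV c d)" and w: "Ck_on k (\<lambda>q. fst (snd q)) (OV c d)" and t: "Ck_on k (\<lambda>q. snd (snd q)) (OV c d)"
    by (intro Ck_on_fst Ck_on_snd Ck_on_id)+
  have fi: "fst ` OV c d \<subseteq> ov c d" by (auto simp: OV_def)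
  have "Ck_on k (\<lambda>q. \<Sum>i\<in>UNIV. (fst (snd q)) $ i *\<^sub>R J c d (fst q) (axis i 1)) (OV c d)"
    by (intro Ck_on_sum Ck_on_scaleR Ck_on_nth w Ck_on_compose[OF Ck_J[OF assms] f fi])
  then have "Ck_on k (\<lambda>q. J c d (fst q) (fst (snd q))) (OV c d)"
  proof (rule Ck_on_cong)
    fix q assume "q \<in> OV c d"
    then have "fst q \<in> ov c d" by (auto simp: OV_def)
    from J_sum[OF assms this, of "fst (snd q)"]
    show "(\<Sum>i\<in>UNIV. (fst (snd q)) $ i *\<^sub>R J c d (fst q) (axis i 1)) = J c d (fst q) (fst (snd q))" by (rule sym)
  qed
  then show ?thesis unfolding T_def[abs_def]
    by (intro Ck_on_Pair Ck_on_compose[OF Ck_chart_change[OF assms] f fi] t)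
qed

text \<open>The derivative of \<open>T c d\<close> at \<open>q\<close>. The \<open>J2\<close> term
  arises because the Jacobian that acts on the velocity varies with the base point.\<close>

definition DT :: "('m, 'n) chart \<Rightarrow> ('m, 'n) chart \<Rightarrow> 'n coords \<Rightarrow> 'n coords \<Rightarrow> 'n coords" where
  "DT c d q h = (J c d (fst q) (fst h), J2 c d (fst q) (fst (snd q)) (fst h) + J c d (fst q) (fst (snd h)), snd (snd h))"

lemma J2_sum:
  assumes "c \<in> A" "d \<in> A" "y \<in> ov c d" shows "J2 c d y w a = (\<Sum>i\<in>UNIV. w $ i *\<^sub>R J2 c d y (axis i 1) a)"
proof -
  have "((\<lambda>y. \<Sum>i\<in>UNIV. w $ i *\<^sub>R J c d y (axis i 1)) has_derivative (\<lambda>a. \<Sum>i\<in>UNIV. w $ i *\<^sub>R J2 c d y (axis i 1) a)) (at y)"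
    by (intro has_derivative_sum has_derivative_scaleR_right J2_deriv assms)
  then have "((\<lambda>y. J c d y w) has_derivative (\<lambda>a. \<Sum>i\<in>UNIV. w $ i *\<^sub>R J2 c d y (axis i 1) a)) (at y)"
  proof (rule has_derivative_transform_within_open[OF _ open_ov[OF assms(1,2)] assms(3)])
    fix z assume "z \<in> ov c d"
    from J_sum[OF assms(1,2) this, of w]
    show "(\<Sum>i\<in>UNIV. w $ i *\<^sub>R J c d z (axis i 1)) = J c d z w" by (rule sym)
  qed
  from has_derivative_unique[OF this J2_deriv[OF assms]]
  show ?thesis by (rule fun_cong[symmetric])
qed

lemma T_deriv:
  assumes "c \<in> A" "d \<in> A" "q \<in> OV c d"
  shows "(T c d has_derivative DT c d q) (at q within S)"
proof -
  let ?y = "fst q" let ?w = "fst (snd q)"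
  have y: "?y \<in> ov c d" using assms(3) by (auto simp: OV_def)
  have J1: "((\<lambda>q. J c d (fst q) (axis i 1)) has_derivative (\<lambda>h. J2 c d ?y (axis i 1) (fst h))) (at q)" for i
    by (rule has_derivative_compose[where f=fst and g="\<lambda>y. J c d y (axis i 1)", OF _ J2_deriv[OF assms(1,2) y]])
      (auto intro!: derivative_eq_intros)
  have W: "((\<lambda>q. fst (snd q) $ i) has_derivative (\<lambda>h. fst (snd h) $ i)) (at q)" for i
    by (intro bounded_linear.has_derivative[OF bounded_linear_vec_nth] derivative_intros)
  have "((\<lambda>q. \<Sum>i\<in>UNIV. (fst (snd q) $ i) *\<^sub>R J c d (fst q) (axis i 1)) has_derivative
     (\<lambda>h. \<Sum>i\<in>UNIV. (?w $ i *\<^sub>R J2 c d ?y (axis i 1) (fst h) + (fst (snd h) $ i) *\<^sub>R J c d ?y (axis i 1)))) (at q)"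
    by (intro has_derivative_sum has_derivative_scaleR W J1)
  moreover have "(\<Sum>i\<in>UNIV. (?w $ i *\<^sub>R J2 c d ?y (axis i 1) (fst h) + (fst (snd h) $ i) *\<^sub>R J c d ?y (axis i 1)))
      = J2 c d ?y ?w (fst h) + J c d ?y (fst (snd h))" for h :: "'n coords"
    unfolding sum.distrib J2_sum[OF assms(1,2) y, symmetric] J_sum[OF assms(1,2) y, symmetric] ..
  ultimately have "((\<lambda>q. \<Sum>i\<in>UNIV. (fst (snd q) $ i) *\<^sub>R J c d (fst q) (axis i 1)) has_derivative
     (\<lambda>h. J2 c d ?y ?w (fst h) + J c d ?y (fst (snd h)))) (at q)" by (simp only:)
  then have 2: "((\<lambda>q. J c d (fst q) (fst (snd q))) has_derivative (\<lambda>h. J2 c d ?y ?w (fst h) + J c d ?y (fst (snd h)))) (at q)"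
  proof (rule has_derivative_transform_within_open)
    show "open (ov c d \<times> (UNIV :: ((real^'n) \<times> real) set))" using open_ov assms by (intro open_Times) auto
    show "q \<in> ov c d \<times> UNIV" using y by (auto simp: mem_Times_iff)
    show "(\<Sum>i\<in>UNIV. (fst (snd x) $ i) *\<^sub>R J c d (fst x) (axis i 1)) = J c d (fst x) (fst (snd x))" if "x \<in> ov c d \<times> UNIV" for x
    proof -
      have "fst x \<in> ov c d" using that by (auto simp: mem_Times_iff)
      from J_sum[OF assms(1,2) this, of "fst (snd x)"] show ?thesis by (rule sym)
    qed
  qed
  have 1: "((\<lambda>q. chart_change c d (fst q)) has_derivative (\<lambda>h. J c d ?y (fst h))) (at q)"
    by (rule has_derivative_compose[where f=fst and g="chart_change c d", OF _ J_deriv[OF assms(1,2) y]])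
      (auto intro!: derivative_eq_intros)
  have 3: "((\<lambda>q. snd (snd q)) has_derivative (\<lambda>h. snd (snd h))) (at q)" by (intro derivative_intros)
  have "(T c d has_derivative DT c d q) (at q)"
    unfolding T_def[abs_def] DT_def[abs_def] by (intro has_derivative_Pair 1 2 3)
  then show ?thesis by (rule has_derivative_at_withinI)
qed

text \<open>The transformation law of \<open>vector_field\<close>, at a single point and with an explicit Jacobian.\<close>

definition cov :: "('m, 'n) vfield \<Rightarrow> ('m, 'n) point \<Rightarrow> bool" where
  "cov X p \<longleftrightarrow> (\<forall>c\<in>A. \<forall>d\<in>A. p \<in> cd c \<longrightarrow> p \<in> cd d \<longrightarrow> X d p = DT c d (coord c p) (X c p))"

lemma coord_unc_derivative:
  assumes "c \<in> A" "d \<in> A" "p \<in> cd c" "p \<in> cd d"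
  shows "frechet_derivative (\<lambda>q. coord d (unc c q)) (at (coord c p) within ci c) = DT c d (coord c p)"
proof -
  let ?q = "coord c p"
  have q: "?q \<in> OV c d" using coord_OV assms by blast
  have "(T c d has_derivative DT c d ?q) (at ?q within OV c d)" using T_deriv[OF assms(1,2) q] .
  then have "((\<lambda>q. coord d (unc c q)) has_derivative DT c d ?q) (at ?q within OV c d)"
    by (rule has_derivative_transform[OF q, rotated]) (simp add: T_unc assms)
  then have "((\<lambda>q. coord d (unc c q)) has_derivative DT c d ?q) (at ?q within ci c)"
    using at_within_openin[OF openin_OV[OF assms(1,2)] q] by simp
  then show ?thesis by (rule thick_frechet_derivative[OF thick_ci[OF assms(1)] coord_in[OF assms(3)]])
qed

text \<open>The pointwise form of the law is what can be used for the Euler-Lagrange field, which is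
  known to transform correctly only at points of \<open>V\<close>.\<close>

lemma vector_field_cov: "vector_field A t0 X \<longleftrightarrow> (\<forall>p\<in>TM. cov X p)"
proof -
  have "vector_field A t0 X \<longleftrightarrow> (\<forall>c\<in>A. \<forall>d\<in>A. \<forall>p \<in> cd c \<inter> cd d. X d p = DT c d (coord c p) (X c p))"
    unfolding vector_field_def by (intro ball_cong refl) (simp add: coord_unc_derivative)
  also have "\<dots> \<longleftrightarrow> (\<forall>p\<in>TM. cov X p)" unfolding cov_def using cd_TM by blast
  finally show ?thesis .
qed

lemma lc_deriv:
  assumes "Ck_TMI A t0 (Suc k) f" "c \<in> A" "q \<in> ci c"
  shows "(lc c f has_derivative frechet_derivative (lc c f) (at q within ci c)) (at q within ci c)"
  using assms Ck_on_frechet(1)[OF _ thick_ci[OF assms(2)]] unfolding Ck_TMI_def by blast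

text \<open>Meant for \<open>f\<close> and \<open>g\<close> expressing one object in two charts. As
  \<open>OV c d\<close> is relatively open in the chart image, differentiating within either set is
  the same.\<close>

lemma deriv_T:
  fixes g :: "'n coords \<Rightarrow> 'b::real_normed_vector"
  assumes "c \<in> A" "d \<in> A" "q \<in> OV c d"
    and g: "(g has_derivative D) (at (T c d q) within ci d)"
    and f: "\<And>q. q \<in> OV c d \<Longrightarrow> f q = g (T c d q)"
  shows "(f has_derivative (\<lambda>h. D (DT c d q h))) (at q within ci c)"
proof -
  have "T c d ` OV c d \<subseteq> ci d" using T_in[OF assms(1,2)] OV_subset[OF assms(2)] by blast
  then have g': "(g has_derivative D) (at (T c d q) within T c d ` OV c d)" using g has_derivative_subset by blast
  have "((\<lambda>q. g (T c d q)) has_derivative (\<lambda>h. D (DT c d q h))) (at q within OV c d)"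
    using diff_chain_within[OF T_deriv[OF assms(1-3)] g'] by (simp add: o_def)
  then have "(f has_derivative (\<lambda>h. D (DT c d q h))) (at q within OV c d)"
    by (rule has_derivative_transform[OF assms(3), rotated]) (simp add: f)
  then show ?thesis using at_within_openin[OF openin_OV[OF assms(1,2)] assms(3)] by simp
qed

text \<open>The definition evaluates in the chart picked by \<open>chart_at\<close>. The chain rule
  through the transition map and the covariance of the field at \<open>p\<close> carry the value to
  any other chart.\<close>

lemma deriv_along_eq:
  assumes f: "Ck_TMI A t0 (Suc k) f" and X: "cov X p" and c: "c \<in> A" "p \<in> cd c"
  shows "deriv_along A t0 X f p = dir_deriv (ci c) (lc c f) (X c p) (coord c p)"
proof -
  let ?d = "chart_at A p" let ?q = "coord c p"
  have d: "?d \<in> A" "p \<in> cd ?d" using chart_at(1) chart_at_cd c by (auto simp: cd_iff)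
  have q: "?q \<in> OV c ?d" using coord_OV c d by blast
  have "(lc ?d f has_derivative frechet_derivative (lc ?d f) (at (coord ?d p) within ci ?d)) (at (T c ?d ?q) within ci ?d)"
    using lc_deriv[OF f d(1) coord_in[OF d(2)]] T_coord[OF c(1) d(1) c(2) d(2)] by simp
  from deriv_T[OF c(1) d(1) q this lc_T[OF c(1) d(1)]]
  have "frechet_derivative (lc c f) (at ?q within ci c) = (\<lambda>h. frechet_derivative (lc ?d f) (at (coord ?d p) within ci ?d) (DT c ?d ?q h))"
    by (rule thick_frechet_derivative[OF thick_ci[OF c(1)] coord_in[OF c(2)]])
  moreover have "X ?d p = DT c ?d ?q (X c p)" using X c d unfolding cov_def by blast
  ultimately show ?thesis by (simp add: deriv_along_def Let_def)
qed

end

section \<open>Topology of the tangent bundle times the interval, extension by zero,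
  localization\<close>

context mfd
begin

lemma topspace_top: "topspace top = TM"
proof -
  have "openin top TM"
    unfolding openin_TMI_top
  proof (intro conjI ballI)
    fix c assume c: "c \<in> A"
    have "{q \<in> ci c. unc c q \<in> TM} = ci c" using unc_in[OF c] cd_TM by blast
    then show "openin (top_of_set (ci c)) {q \<in> ci c. unc c q \<in> TM}" by simp
  qed simp
  moreover have "U \<subseteq> TM" if "openin top U" for U using that by (simp add: openin_TMI_top)
  ultimately show ?thesis unfolding topspace_def by blast
qed

lemma openin_chart: "openin top U \<Longrightarrow> c \<in> A \<Longrightarrow> openin (top_of_set (ci c)) {q \<in> ci c. unc c q \<in> U}"
  by (simp add: openin_TMI_top)

text \<open>Read in another chart, the image is the preimage of \<open>W\<close> under the
  transition map, which is continuous on a relatively open set.\<close>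

lemma openin_image:
  assumes c: "c \<in> A" and W: "openin (top_of_set (ci c)) W"
  shows "openin top (unc c ` W)"
  unfolding openin_TMI_top
proof (intro conjI ballI)
  have Wc: "W \<subseteq> ci c" using W openin_imp_subset by blast
  show "unc c ` W \<subseteq> TM" using Wc unc_in[OF c] cd_TM by blast
  fix d assume d: "d \<in> A"
  have "{q \<in> ci d. unc d q \<in> unc c ` W} = OV d c \<inter> T d c -` W"
  proof (intro set_eqI iffI)
    fix q assume "q \<in> {q \<in> ci d. unc d q \<in> unc c ` W}"
    then obtain w where w: "q \<in> ci d" "w \<in> W" "unc d q = unc c w" by blast
    have "unc c w \<in> cd c" using unc_in[OF c] Wc w(2) by blast
    then have q: "q \<in> OV d c" using w OV_iff[OF d, of q c] by simp
    have "w \<in> ci c" using Wc w(2) by blast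
    then have "T d c q = w" using T_unc[OF d c q] w coord_unc[OF c] by simp
    then show "q \<in> OV d c \<inter> T d c -` W" using q w by simp
  next
    fix q assume q: "q \<in> OV d c \<inter> T d c -` W"
    then have "unc d q = unc c (T d c q)" using unc_T[OF d c] by simp
    then show "q \<in> {q \<in> ci d. unc d q \<in> unc c ` W}" using q OV_iff[OF d] by blast
  qed
  moreover have "openin (top_of_set (OV d c)) (OV d c \<inter> T d c -` W)"
    by (rule continuous_openin_preimage[OF Ck_on_imp_continuous[OF Ck_T[OF d c]] _ W])
      (use T_in[OF d c] OV_subset[OF c] in blast)
  ultimately show "openin (top_of_set (ci d)) {q \<in> ci d. unc d q \<in> unc c ` W}"
    using openin_trans[OF _ openin_OV[OF d c]] by simp
qed

lemma unc_image_ci: "c \<in> A \<Longrightarrow> unc c ` ci c = cd c"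
  using unc_in coord_in unc_coord by (metis (no_types, lifting) image_eqI image_subsetI subsetI subset_antisym)

lemma openin_cd: "c \<in> A \<Longrightarrow> openin top (cd c)"
  using openin_image[of c "ci c"] unc_image_ci by simp

lemma continuous_unc: "c \<in> A \<Longrightarrow> continuous_map (top_of_set (ci c)) top (unc c)"
  unfolding continuous_map_def topspace_top topspace_euclidean_subtopology Pi_iff
  using cd_TM[OF unc_in] openin_chart by blast

lemma continuous_coord: 
  assumes c: "c \<in> A" shows "continuous_map (subtopology top (cd c)) (top_of_set (ci c)) (coord c)"
  unfolding continuous_map_def
proof (intro conjI allI impI)
  have ts: "topspace (subtopology top (cd c)) = cd c" using cd_TM[of _ c] by (simp add: topspace_top) blast
  show "coord c \<in> topspace (subtopology top (cd c)) \<rightarrow> topspace (top_of_set (ci c))"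
    unfolding ts topspace_euclidean_subtopology Pi_iff using coord_in by blast
  fix W assume W: "openin (top_of_set (ci c)) W"
  then have Wc: "W \<subseteq> ci c" using openin_imp_subset by blast
  have "{p \<in> cd c. coord c p \<in> W} = cd c \<inter> unc c ` W"
  proof (intro set_eqI iffI)
    fix p assume "p \<in> {p \<in> cd c. coord c p \<in> W}"
    then show "p \<in> cd c \<inter> unc c ` W" using unc_coord[OF c, of p] by (metis (no_types, lifting) Int_iff image_eqI mem_Collect_eq)
  next
    fix p assume "p \<in> cd c \<inter> unc c ` W"
    then obtain w where "p \<in> cd c" "p = unc c w" "w \<in> W" by blast
    moreover from this have "coord c p = w" using coord_unc[OF c] Wc by blast
    ultimately show "p \<in> {p \<in> cd c. coord c p \<in> W}" by simp
  qed
  then show "openin (subtopology top (cd c)) {p \<in> topspace (subtopology top (cd c)). coord c p \<in> W}"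
    unfolding ts using openin_image[OF c W] by (simp add: openin_subtopology_Int2)
qed

lemma compactin_unc: "c \<in> A \<Longrightarrow> compact K \<Longrightarrow> K \<subseteq> ci c \<Longrightarrow> compactin top (unc c ` K)"
  using image_compactin[OF _ continuous_unc] by (simp add: compactin_subtopology)

lemma compact_coord: "c \<in> A \<Longrightarrow> compactin top K \<Longrightarrow> K \<subseteq> cd c \<Longrightarrow> compact (coord c ` K)"
  using image_compactin[OF _ continuous_coord, of c K] by (simp add: compactin_subtopology)

lemma continuous_fst: "continuous_map top euclidean fst"
  unfolding continuous_map_def
proof (intro conjI allI impI)
  fix U :: "'m set" assume "openin euclidean U"
  then have U: "open U" by simp
  show "openin top {p \<in> topspace top. fst p \<in> U}"
    unfolding topspace_top openin_TMI_top
  proof (intro conjI ballI)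
    fix c assume c: "c \<in> A"
    have eq: "{q \<in> ci c. unc c q \<in> {p \<in> TM. fst p \<in> U}} = ci c \<inter> (\<lambda>q. iv c (fst q)) -` U"
      using cd_TM[OF unc_in[OF c]] by (simp add: set_eq_iff unc_eq[OF c] cong: conj_cong)
    have cont: "continuous_on (ci c) (\<lambda>q. iv c (fst q))"
      by (intro continuous_on_compose2[OF cont_iv[OF c]] continuous_intros) (auto simp: chart_img_def)
    show "openin (top_of_set (ci c)) {q \<in> ci c. unc c q \<in> {p \<in> TM. fst p \<in> U}}"
      unfolding eq by (rule continuous_openin_preimage_gen[OF cont U])
  qed auto
qed auto

text \<open>Different base points are separated in the manifold; two points of one fiber lie in a
  common chart and are separated in its coordinates. The result makes compact sets closed, on which
  extension by zero depends.\<close>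

lemma Hausdorff_top: "Hausdorff_space top"
  unfolding Hausdorff_space_def topspace_top
proof (intro allI impI)
  fix p q assume pq: "p \<in> TM \<and> q \<in> TM \<and> p \<noteq> q"
  show "\<exists>U V. openin top U \<and> openin top V \<and> p \<in> U \<and> q \<in> V \<and> disjnt U V"
  proof (cases "fst p = fst q")
    case False
    then obtain U V where UV: "open U" "open V" "fst p \<in> U" "fst q \<in> V" "U \<inter> V = {}" using hausdorff[OF False] by blast
    have "openin top {p \<in> TM. fst p \<in> S}" if "open S" for S
      using openin_continuous_map_preimage[OF continuous_fst, of S] that by (simp add: topspace_top)
    then show ?thesis using UV pq
      by (intro exI[of _ "{p \<in> TM. fst p \<in> U}"] exI[of _ "{p \<in> TM. fst p \<in> V}"]) (auto simp: disjnt_def)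
  next
    case True
    obtain c where c: "c \<in> A" "p \<in> cd c" using exists_cd pq by blast
    have q: "q \<in> cd c" using c True pq by (simp add: cd_iff)
    have ne: "coord c p \<noteq> coord c q" using inj_onD[OF inj_coord[OF c(1)] _ c(2) q] pq by blast
    obtain U V where UV: "open U" "open V" "coord c p \<in> U" "coord c q \<in> V" "U \<inter> V = {}" using hausdorff[OF ne] by blast
    have o: "openin top (unc c ` (ci c \<inter> S))" if "open S" for S
      by (rule openin_image[OF c(1)]) (use that in auto)
    have d: "unc c ` (ci c \<inter> U) \<inter> unc c ` (ci c \<inter> V) = {}"
    proof -
      have "w = z" if "w \<in> ci c" "z \<in> ci c" "unc c w = unc c z" for w z
        using arg_cong[OF that(3), of "coord c"] coord_unc[OF c(1)] that(1,2) by simp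
      then show ?thesis using UV(5) by blast
    qed
    have m: "r \<in> unc c ` (ci c \<inter> S)" if "coord c r \<in> S" "r \<in> cd c" for r S
      by (rule image_eqI[where f="unc c" and x="coord c r", OF unc_coord[OF c(1) that(2), symmetric]]) (use that coord_in in blast)
    show ?thesis using o[OF UV(1)] o[OF UV(2)] m[OF UV(3) c(2)] m[OF UV(4) q] d unfolding disjnt_def by blast
  qed
qed

lemma closedin_unc: "c \<in> A \<Longrightarrow> compact K \<Longrightarrow> K \<subseteq> ci c \<Longrightarrow> closedin top (unc c ` K)"
  using compactin_imp_closedin[OF Hausdorff_top compactin_unc] .

text \<open>The chart in which regularity is known may change from point to point; the transition
  maps are smooth and carry it to \<open>d\<close>.\<close>

lemma Ck_chart_local:
  fixes f :: "('m, 'n) point \<Rightarrow> 'b::real_normed_vector"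
  assumes d: "d \<in> A"
    and loc: "\<And>p. p \<in> cd d \<Longrightarrow> \<exists>c\<in>A. \<exists>W. p \<in> cd c \<and> openin (top_of_set (ci c)) W \<and> coord c p \<in> W \<and> Ck_on k (lc c f) W"
  shows "Ck_on k (lc d f) (ci d)"
proof (rule Ck_on_local[OF thick_ci[OF d]])
  fix q assume q: "q \<in> ci d"
  from loc[OF unc_in[OF d q]] obtain c W where c: "c \<in> A" "unc d q \<in> cd c" and
    W: "openin (top_of_set (ci c)) W" "coord c (unc d q) \<in> W" "Ck_on k (lc c f) W" by blast
  have q': "q \<in> OV d c" using OV_iff[OF d] q c by blast
  define U where "U = OV d c \<inter> T d c -` W"
  have "openin (top_of_set (OV d c)) U"
    unfolding U_def
    by (rule continuous_openin_preimage[OF Ck_on_imp_continuous[OF Ck_T[OF d c(1)]] _ W(1)])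
      (use T_in[OF d c(1)] OV_subset[OF c(1)] in blast)
  then have "openin (top_of_set (ci d)) U" using openin_trans[OF _ openin_OV[OF d c(1)]] by blast
  moreover have "q \<in> U" using q' W(2) T_unc[OF d c(1) q'] by (simp add: U_def)
  moreover have "Ck_on k (\<lambda>q. lc c f (T d c q)) U"
    by (rule Ck_on_compose[OF W(3) Ck_on_subset[OF Ck_T[OF d c(1)]]]) (auto simp: U_def)
  then have "Ck_on k (lc d f) U"
    by (rule Ck_on_cong) (simp add: lc_T[OF d c(1), of _ f] U_def)
  ultimately show "\<exists>U. openin (top_of_set (ci d)) U \<and> q \<in> U \<and> Ck_on k (lc d f) U" by blast
qed

definition ext :: "('m, 'n) chart \<Rightarrow> ('n coords \<Rightarrow> 'b::zero) \<Rightarrow> ('m, 'n) point \<Rightarrow> 'b" where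
  "ext c g p = (if p \<in> cd c then g (coord c p) else 0)"

lemma ext_outside:
  assumes "c \<in> A" "\<And>q. q \<in> ci c - K \<Longrightarrow> g q = 0" "p \<notin> unc c ` K"
  shows "ext c g p = 0"
proof (cases "p \<in> cd c")
  case True
  then have "coord c p \<notin> K" using assms(3) unc_coord[OF assms(1) True] by (metis image_eqI)
  then show ?thesis using assms(2) coord_in[OF True] by (simp add: ext_def)
qed (simp add: ext_def)

text \<open>Regularity is checked on two open pieces: the chart domain, and the complement of the
  compact set outside of which the function is 0.\<close>

lemma Ck_ext:
  fixes g :: "'n coords \<Rightarrow> 'b::real_normed_vector"
  assumes c: "c \<in> A" and K: "compact K" "K \<subseteq> ci c" "\<And>q. q \<in> ci c - K \<Longrightarrow> g q = 0"
    and g: "Ck_on k g (ci c)" and d: "d \<in> A"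
  shows "Ck_on k (lc d (ext c g)) (ci d)"
proof (rule Ck_chart_local[OF d])
  fix p assume p: "p \<in> cd d"
  show "\<exists>e\<in>A. \<exists>W. p \<in> cd e \<and> openin (top_of_set (ci e)) W \<and> coord e p \<in> W \<and> Ck_on k (lc e (ext c g)) W"
  proof (cases "p \<in> cd c")
    case True
    have "Ck_on k (lc c (ext c g)) (ci c)"
      by (rule Ck_on_cong[OF g]) (simp add: loc_def ext_def unc_in[OF c] coord_unc[OF c])
    then show ?thesis using c True coord_in[OF True] by (intro bexI[of _ c] exI[of _ "ci c"]) simp_all
  next
    case False
    define W where "W = {q \<in> ci d. unc d q \<in> TM - unc c ` K}"
    have "unc c ` K \<subseteq> cd c" using K unc_in[OF c] by blast
    then have "coord d p \<in> W" using False coord_in[OF p] unc_coord[OF d p] cd_TM[OF p] by (simp add: W_def) blast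
    moreover have "openin top (TM - unc c ` K)"
      using closedin_unc[OF c K(1,2)] by (simp add: closedin_def topspace_top)
    then have "openin (top_of_set (ci d)) W" unfolding W_def by (rule openin_chart[OF _ d])
    moreover have "Ck_on k (lc d (ext c g)) W"
    proof (rule Ck_on_cong[OF Ck_on_const[where c=0]])
      fix q assume "q \<in> W"
      then have "unc d q \<notin> unc c ` K" by (simp add: W_def)
      then show "0 = lc d (ext c g) q" using ext_outside[where K=K and g=g, OF c K(3)] by (simp add: loc_def)
    qed
    ultimately show ?thesis using d p by (intro bexI[of _ d] exI[of _ W]) simp_all
  qed
qed

lemma Ck_TMI_ext:
  assumes "c \<in> A" "compact K" "K \<subseteq> ci c" "\<And>q. q \<in> ci c - K \<Longrightarrow> g q = 0" "Ck_on k g (ci c)"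
  shows "Ck_TMI A t0 k (ext c g)"
  unfolding Ck_TMI_def using Ck_ext[OF assms] by blast

lemma Ck_TMI_mult: "Ck_TMI A t0 k f \<Longrightarrow> Ck_TMI A t0 k g \<Longrightarrow> Ck_TMI A t0 k (\<lambda>p. f p * g p)"
  unfolding Ck_TMI_def loc_def by (simp add: Ck_on_mult)

lemma Ck_TMI_add: "Ck_TMI A t0 k f \<Longrightarrow> Ck_TMI A t0 k g \<Longrightarrow> Ck_TMI A t0 k (\<lambda>p. f p + g p)"
  unfolding Ck_TMI_def loc_def by (simp add: Ck_on_add)

lemma Ck_TMI_diff: "Ck_TMI A t0 k f \<Longrightarrow> Ck_TMI A t0 k g \<Longrightarrow> Ck_TMI A t0 k (\<lambda>p. f p - g p)"
  unfolding Ck_TMI_def loc_def by (simp add: Ck_on_diff)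

lemma Ck_TMI_const: "Ck_TMI A t0 k (\<lambda>p. a)"
  unfolding Ck_TMI_def loc_def by (simp add: Ck_on_const)

lemma smooth_TMI_mult: "smooth_TMI A t0 f \<Longrightarrow> smooth_TMI A t0 g \<Longrightarrow> smooth_TMI A t0 (\<lambda>p. f p * g p)"
  unfolding smooth_TMI_def by (blast intro: Ck_TMI_mult)

lemma smooth_TMI_diff: "smooth_TMI A t0 f \<Longrightarrow> smooth_TMI A t0 g \<Longrightarrow> smooth_TMI A t0 (\<lambda>p. f p - g p)"
  unfolding smooth_TMI_def by (blast intro: Ck_TMI_diff)

lemma smooth_TMI_const: "smooth_TMI A t0 (\<lambda>p. a)"
  unfolding smooth_TMI_def by (blast intro: Ck_TMI_const)

lemma Ck_TMI_time:
  assumes "Ck_on k h UNIV" shows "Ck_TMI A t0 k (\<lambda>p. h (snd (snd p)))"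
  unfolding Ck_TMI_def
proof
  fix c assume c: "c \<in> A"
  have "Ck_on k (\<lambda>q. h (snd (snd q))) (ci c)"
    by (intro Ck_on_compose[OF assms] Ck_on_snd Ck_on_id) auto
  then show "Ck_on k (lc c (\<lambda>p. h (snd (snd p)))) (ci c)"
    by (rule Ck_on_cong) (simp add: loc_def unc_eq[OF c])
qed

text \<open>The chart image is not closed, because its base is only an open set. If the base
  projection of a closed ball stays in that open set, though, the chart image cuts out of the ball
  the same set as the closed condition on time does.\<close>

lemma compact_box:
  assumes c: "c \<in> A" "p \<in> cd c" and U: "openin top U" "p \<in> U"
  obtains r where "r > 0" "compact (ci c \<inter> cball (coord c p) r)" "unc c ` (ci c \<inter> cball (coord c p) r) \<subseteq> U"
    "cball (fst (coord c p)) r \<subseteq> im c"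
proof -
  let ?q = "coord c p"
  have q: "?q \<in> ci c" using coord_in c by blast
  have "fst ?q \<in> im c" using q by (simp add: ci_iff)
  then obtain r1 where r1: "r1 > 0" "cball (fst ?q) r1 \<subseteq> im c"
    using open_im[OF c(1)] open_contains_cball by blast
  have "openin (top_of_set (ci c)) {q \<in> ci c. unc c q \<in> U}" using openin_chart[OF U(1) c(1)] .
  then obtain r2 where r2: "r2 > 0" "ball ?q r2 \<inter> ci c \<subseteq> {q \<in> ci c. unc c q \<in> U}"
    using bspec[OF conjunct2[OF openin_contains_ball[THEN iffD1]], of _ "{q \<in> ci c. unc c q \<in> U}" ?q] q U(2) unc_coord[OF c]
    by (metis (no_types, lifting) mem_Collect_eq)
  \<comment> \<open>Half of \<open>r2\<close>, so that the closed ball fits into the open one of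
    radius \<open>r2\<close>.\<close>
  define r where "r = min r1 (r2 / 2)"
  have r: "r > 0" "r \<le> r1" "r < r2" using r1 r2 by (auto simp: r_def)
  have "ci c \<inter> cball ?q r = cball ?q r \<inter> (UNIV \<times> UNIV \<times> {0..t0})"
  proof (intro set_eqI iffI)
    fix z assume z: "z \<in> cball ?q r \<inter> (UNIV \<times> UNIV \<times> {0..t0})"
    have "dist (fst ?q) (fst z) \<le> r1" using z r(2) dist_fst_le[of ?q z] by auto
    then have "fst z \<in> im c" using r1 by auto
    then show "z \<in> ci c \<inter> cball ?q r" using z by (auto simp: ci_iff)
  qed (auto simp: chart_img_def)
  then have "compact (ci c \<inter> cball ?q r)"
    by (simp add: compact_Int_closed closed_Times)
  moreover have "unc c ` (ci c \<inter> cball ?q r) \<subseteq> U" using r2(2) r(3) by force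
  moreover have "cball (fst ?q) r \<subseteq> im c" using r1(2) r(2) by auto
  ultimately show ?thesis using that r(1) by blast
qed

lemma bump_function:
  assumes U: "openin top U" "p \<in> U"
  obtains \<chi>' N where "smooth_TMI A t0 \<chi>'" "openin top N" "p \<in> N" "\<And>q. q \<in> N \<Longrightarrow> \<chi>' q = 1"
    "\<And>q. q \<notin> U \<Longrightarrow> \<chi>' q = 0" "\<exists>K. compactin top K \<and> (\<forall>q. q \<notin> K \<longrightarrow> \<chi>' q = 0)"
proof -
  have p: "p \<in> TM" using U openin_subset topspace_top by blast
  then obtain c where c: "c \<in> A" "p \<in> cd c" using exists_cd by blast
  let ?q = "coord c p"
  obtain r where r: "r > 0" "compact (ci c \<inter> cball ?q r)" "unc c ` (ci c \<inter> cball ?q r) \<subseteq> U"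
    "cball (fst ?q) r \<subseteq> im c"
    by (rule compact_box[OF c U])
  define g where "g = ext c (cutoff ?q r)"
  have z: "cutoff ?q r q = 0" if "q \<in> ci c - ci c \<inter> cball ?q r" for q
    using that r(1) by (intro cutoff_eq_0) (auto simp: dist_commute)
  have g0: "g q = 0" if "q \<notin> unc c ` (ci c \<inter> cball ?q r)" for q
    unfolding g_def by (rule ext_outside[OF c(1) z that])
  show ?thesis
  proof (rule that[of g "unc c ` (ci c \<inter> ball ?q (r/2))"])
    show "smooth_TMI A t0 g"
      unfolding smooth_TMI_def g_def using Ck_TMI_ext[OF c(1) r(2) _ z Ck_on_cutoff] by blast
    show "openin top (unc c ` (ci c \<inter> ball ?q (r/2)))" by (rule openin_image[OF c(1)]) auto
    show "p \<in> unc c ` (ci c \<inter> ball ?q (r/2))"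
      using unc_coord[OF c] coord_in[OF c(2)] r(1) by (intro image_eqI[of _ _ ?q]) auto
    show "g q = 1" if q: "q \<in> unc c ` (ci c \<inter> ball ?q (r/2))" for q
    proof -
      obtain z where "z \<in> ci c \<inter> ball ?q (r/2)" "q = unc c z" using q by blast
      then have z: "q = unc c z" "z \<in> ci c" "dist ?q z < r/2" by simp_all
      then have "q \<in> cd c" "coord c q = z" using unc_in[OF c(1)] coord_unc[OF c(1)] by simp_all
      then show ?thesis using cutoff_eq_1[OF r(1), of z ?q] z(3) by (simp add: g_def ext_def dist_commute)
    qed
    show "g q = 0" if "q \<notin> U" for q using g0 that r(3) by blast
    show "\<exists>K. compactin top K \<and> (\<forall>q. q \<notin> K \<longrightarrow> g q = 0)"
      using g0 compactin_unc[OF c(1) r(2)] by blast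
  qed
qed

text \<open>Localization by cutting off successively, which avoids dividing by a sum of cutoff functions.\<close>

lemma localize:
  fixes G :: "(('m, 'n) point \<Rightarrow> real) \<Rightarrow> bool" and \<Lambda> :: "(('m, 'n) point \<Rightarrow> real) \<Rightarrow> real"
  assumes S: "compactin top S"
    and mult: "\<And>f u. G f \<Longrightarrow> smooth_TMI A t0 u \<Longrightarrow> G (\<lambda>p. u p * f p)"
    and add: "\<And>f g. G f \<Longrightarrow> G g \<Longrightarrow> \<Lambda> (\<lambda>p. f p + g p) = \<Lambda> f + \<Lambda> g"
    and zero: "\<And>f U. G f \<Longrightarrow> openin top U \<Longrightarrow> S \<subseteq> U \<Longrightarrow> (\<And>p. p \<in> U \<Longrightarrow> f p = 0) \<Longrightarrow> \<Lambda> f = 0"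
    and loc: "\<And>p. p \<in> S \<Longrightarrow> \<exists>U. openin top U \<and> p \<in> U \<and> (\<forall>f. G f \<longrightarrow> (\<forall>q. q \<notin> U \<longrightarrow> f q = 0) \<longrightarrow> \<Lambda> f = 0)"
    and f: "G f"
  shows "\<Lambda> f = 0"
proof -
  have "\<forall>p\<in>S. \<exists>u N. smooth_TMI A t0 u \<and> openin top N \<and> p \<in> N \<and> (\<forall>q\<in>N. u q = 1) \<and>
    (\<forall>f. G f \<longrightarrow> \<Lambda> (\<lambda>q. u q * f q) = 0)"
  proof
    fix p assume "p \<in> S"
    then obtain U where U: "openin top U" "p \<in> U" "\<And>f. G f \<Longrightarrow> (\<And>q. q \<notin> U \<Longrightarrow> f q = 0) \<Longrightarrow> \<Lambda> f = 0"
      using loc by meson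
    obtain u N where "smooth_TMI A t0 u" "openin top N" "p \<in> N" "\<And>q. q \<in> N \<Longrightarrow> u q = 1"
      "\<And>q. q \<notin> U \<Longrightarrow> u q = 0" "\<exists>K. compactin top K \<and> (\<forall>q. q \<notin> K \<longrightarrow> u q = 0)"
      by (rule bump_function[OF U(1,2)]) blast
    then show "\<exists>u N. smooth_TMI A t0 u \<and> openin top N \<and> p \<in> N \<and> (\<forall>q\<in>N. u q = 1) \<and>
      (\<forall>f. G f \<longrightarrow> \<Lambda> (\<lambda>q. u q * f q) = 0)"
      using U(3)[OF mult] by (intro exI[of _ u] exI[of _ N]) auto
  qed
  from bchoice[OF this] obtain u where "\<forall>p\<in>S. \<exists>N. smooth_TMI A t0 (u p) \<and> openin top N \<and> p \<in> N \<and> (\<forall>q\<in>N. u p q = 1) \<and>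
    (\<forall>f. G f \<longrightarrow> \<Lambda> (\<lambda>q. u p q * f q) = 0)" ..
  from bchoice[OF this] obtain N where N: "\<forall>p\<in>S. smooth_TMI A t0 (u p) \<and> openin top (N p) \<and> p \<in> N p \<and> (\<forall>q\<in>N p. u p q = 1) \<and>
    (\<forall>f. G f \<longrightarrow> \<Lambda> (\<lambda>q. u p q * f q) = 0)" ..
  have u: "smooth_TMI A t0 (u p)" "openin top (N p)" "p \<in> N p" "q \<in> N p \<Longrightarrow> u p q = 1"
    "G f \<Longrightarrow> \<Lambda> (\<lambda>q. u p q * f q) = 0" if "p \<in> S" for p q f
    using bspec[OF N that] by simp_all
  have "S \<subseteq> \<Union> (N ` S)" using u(3) by blast
  then obtain F where F: "finite F" "F \<subseteq> N ` S" "S \<subseteq> \<Union> F"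
    using compactinD[OF S, of "N ` S"] u(2) by blast
  then obtain P where P: "finite P" "P \<subseteq> S" "F = N ` P" using finite_subset_image[OF F(1,2)] by blast
  \<comment> \<open>The claim is generalized to functions vanishing on an open set \<open>V\<close>
    that, together with the neighbourhoods still to be treated, covers \<open>S\<close>. Writing f
    as u_p f + (1 - u_p) f removes one neighbourhood: the first term is handled locally, the second
    vanishes on \<open>N p\<close> too.\<close>
  have "\<Lambda> f = 0" if "finite P" "P \<subseteq> S" "G f" "openin top V" "S \<subseteq> V \<union> \<Union> (N ` P)" "\<And>p. p \<in> V \<Longrightarrow> f p = 0" for P f V
    using that
  proof (induction P arbitrary: f V rule: finite_induct)
    case empty
    then show ?case using zero[of f V] by simp
  next
    case (insert p P)
    have p: "p \<in> S" using insert by simp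
    define g where "g q = (1 - u p q) * f q" for q
    have g: "G g" unfolding g_def
      using mult[OF insert.prems(2) smooth_TMI_diff[OF smooth_TMI_const u(1)[OF p], of 1]] .
    have "\<Lambda> g = 0"
    proof (rule insert.IH)
      show "P \<subseteq> S" "G g" using insert.prems g by auto
      show "openin top (V \<union> N p)" using insert.prems u(2)[OF p] by blast
      show "S \<subseteq> V \<union> N p \<union> \<Union> (N ` P)" using insert.prems by auto
      show "g q = 0" if "q \<in> V \<union> N p" for q
        using that u(4)[OF p, of q] insert.prems(5)[of q] by (auto simp: g_def)
    qed
    moreover have "(\<lambda>q. u p q * f q + g q) = f" by (auto simp: g_def algebra_simps)
    ultimately show ?case
      using add[OF mult[OF insert.prems(2) u(1)[OF p]] g] u(5)[OF p insert.prems(2)] by simp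
  qed
  from this[OF P(1,2) f, of "{}"] show ?thesis using F P by simp
qed

end

section \<open>Integration of derivatives along vector fields\<close>

context mfd
begin

lemma lc_has_derivative_cong:
  assumes "c \<in> A" "p \<in> cd c" "openin top U" "p \<in> U" "\<And>q. q \<in> U \<Longrightarrow> f q = g q"
    and "(lc c f has_derivative D) (at (coord c p) within ci c)"
  shows "(lc c g has_derivative D) (at (coord c p) within ci c)"
proof -
  let ?W = "{q \<in> ci c. unc c q \<in> U}"
  have W: "openin (top_of_set (ci c)) ?W" using openin_chart[OF assms(3,1)] .
  have m: "coord c p \<in> ?W" using assms(1,2,4) coord_in[of p c] unc_coord[of c p] by simp
  have "(lc c f has_derivative D) (at (coord c p) within ?W)"
    using assms(6) at_within_openin[OF W m] by simp
  then have "(lc c g has_derivative D) (at (coord c p) within ?W)"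
    by (rule has_derivative_transform[OF m, rotated]) (simp add: loc_def assms(5))
  then show ?thesis using at_within_openin[OF W m] by simp
qed

lemma deriv_along_D:
  assumes "p \<in> TM" "(lc (chart_at A p) f has_derivative D) (at (coord (chart_at A p) p) within ci (chart_at A p))"
  shows "deriv_along A t0 X f p = D (X (chart_at A p) p)"
  using thick_frechet_derivative[OF thick_ci[OF chart_at(1)] coord_in[OF chart_at_cd[OF assms(1)]] assms(2)]
  by (simp add: deriv_along_def Let_def)

lemma lc_deriv_at:
  assumes "Ck_TMI A t0 (Suc k) f" "p \<in> TM"
  shows "(lc (chart_at A p) f has_derivative frechet_derivative (lc (chart_at A p) f) (at (coord (chart_at A p) p) within ci (chart_at A p)))
     (at (coord (chart_at A p) p) within ci (chart_at A p))"
  using lc_deriv[OF assms(1) chart_at(1) coord_in[OF chart_at_cd[OF assms(2)]]] .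

lemma deriv_along_frechet: 
  "deriv_along A t0 X f p = frechet_derivative (lc (chart_at A p) f) (at (coord (chart_at A p) p) within ci (chart_at A p)) (X (chart_at A p) p)"
  by (simp add: deriv_along_def Let_def)

lemma deriv_along_add:
  assumes "Ck_TMI A t0 (Suc k) f" "Ck_TMI A t0 (Suc k) g" "p \<in> TM"
  shows "deriv_along A t0 X (\<lambda>p. f p + g p) p = deriv_along A t0 X f p + deriv_along A t0 X g p"
  using deriv_along_D[OF assms(3), of "\<lambda>p. f p + g p"] has_derivative_add[OF lc_deriv_at[OF assms(1,3)] lc_deriv_at[OF assms(2,3)]]
  unfolding deriv_along_frechet by (simp add: loc_def[abs_def])

lemma deriv_along_mult:
  assumes "Ck_TMI A t0 (Suc k) f" "Ck_TMI A t0 (Suc k) g" "p \<in> TM"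
  shows "deriv_along A t0 X (\<lambda>p. f p * g p) p = f p * deriv_along A t0 X g p + deriv_along A t0 X f p * g p"
  using deriv_along_D[OF assms(3), of "\<lambda>p. f p * g p"] has_derivative_mult[OF lc_deriv_at[OF assms(1,3)] lc_deriv_at[OF assms(2,3)]]
    unc_coord[OF chart_at(1) chart_at_cd[OF assms(3)]]
  unfolding deriv_along_frechet by (simp add: loc_def[abs_def])

lemma deriv_along_cong:
  assumes "Ck_TMI A t0 (Suc k) f" "openin top U" "p \<in> U" "\<And>q. q \<in> U \<Longrightarrow> f q = g q"
  shows "deriv_along A t0 X f p = deriv_along A t0 X g p"
proof -
  have p: "p \<in> TM" using assms(2,3) openin_subset topspace_top by blast
  show ?thesis
    using deriv_along_D[OF p lc_has_derivative_cong[OF chart_at(1) chart_at_cd[OF p] assms(2-4) lc_deriv_at[OF assms(1) p]], of X]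
    unfolding deriv_along_frechet by simp
qed

lemma deriv_along_0: "p \<in> TM \<Longrightarrow> deriv_along A t0 X (\<lambda>p. 0) p = 0"
  using deriv_along_D[of p "\<lambda>p. 0" "\<lambda>h. 0" X] by (simp add: loc_def[abs_def])

lemma deriv_along_time:
  assumes "p \<in> TM" "(h has_real_derivative h') (at (snd (snd p)))"
  shows "deriv_along A t0 X (\<lambda>p. h (snd (snd p))) p = h' * snd (snd (X (chart_at A p) p))"
proof (rule deriv_along_D[OF assms(1)])
  let ?c = "chart_at A p"
  note c = chart_at(1)[of p] chart_at_cd[OF assms(1)]
  have "((\<lambda>q. h (snd (snd q))) has_derivative (\<lambda>k. h' * snd (snd k))) (at (coord ?c p) within ci ?c)"
  proof (rule has_derivative_compose[where g=h and f="\<lambda>q. snd (snd q)" and g'="\<lambda>k. h' * k"])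
    show "((\<lambda>q. snd (snd q)) has_derivative (\<lambda>k. snd (snd k))) (at (coord ?c p) within ci ?c)"
      by (intro derivative_intros)
    show "(h has_derivative (*) h') (at (snd (snd (coord ?c p))))"
      using assms(2) by (simp add: has_field_derivative_def coord_def)
  qed
  then show "(lc ?c (\<lambda>p. h (snd (snd p))) has_derivative (\<lambda>k. h' * snd (snd k))) (at (coord ?c p) within ci ?c)"
    by (rule has_derivative_transform[OF coord_in[OF c(2)], rotated]) (simp add: loc_def unc_eq[OF c(1)])
qed

end

section \<open>The measure: support, null sets and integrable fields\<close>

locale mfdm = mfd A t0 for A :: "('m::{second_countable_topology, t2_space}, 'n::finite) chart set" and t0 +
  fixes \<mu> :: "('m, 'n) point measure"
  assumes radon: "compact_radon_measure A t0 \<mu>"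
begin

abbreviation supp where "supp \<equiv> msupport A t0 \<mu>"

lemma TMI_borel: "space (TMI_borel A t0) = TM" "sets (TMI_borel A t0) = sigma_sets TM {U. openin top U}"
proof -
  have "{U. openin top U} \<subseteq> Pow TM" using openin_subset[of top] by (auto simp: topspace_top)
  then show "space (TMI_borel A t0) = TM" "sets (TMI_borel A t0) = sigma_sets TM {U. openin top U}"
    unfolding TMI_borel_def by (simp_all add: space_measure_of_conv)
qed

lemma sets_mu: "sets \<mu> = sets (TMI_borel A t0)" using radon by (simp add: compact_radon_measure_def)

lemma space_mu: "space \<mu> = TM" using sets_eq_imp_space_eq[OF sets_mu] TMI_borel by simp

lemma open_sets: "openin top U \<Longrightarrow> U \<in> sets \<mu>"
  unfolding sets_mu TMI_borel by (rule sigma_sets.Basic) simp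

lemma closed_sets: "closedin top S \<Longrightarrow> S \<in> sets \<mu>"
proof -
  assume S: "closedin top S"
  then have "TM - S \<in> sets \<mu>" "S \<subseteq> TM" using open_sets unfolding closedin_def topspace_top by blast+
  moreover have "TM - (TM - S) = S" using calculation(2) by blast
  ultimately show ?thesis using sets.compl_sets[of "TM - S" \<mu>] space_mu by simp
qed

lemma cd_sets: "c \<in> A \<Longrightarrow> cd c \<in> sets \<mu>" using open_sets openin_cd by blast

lemma cd_Int_space: "c \<in> A \<Longrightarrow> cd c \<inter> space \<mu> \<in> sets \<mu>"
  using sets.Int_space_eq2[OF cd_sets] cd_sets by simp

text \<open>The Lindelof property of the second countable manifold. It turns chartwise measurability
  and chartwise null sets into global statements, whatever the cardinality of the atlas.\<close>

lemma countable_charts: "\<exists>B. countable B \<and> B \<subseteq> A \<and> TM \<subseteq> \<Union> (cd ` B)"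
proof -
  obtain F where F: "F \<subseteq> fst ` A" "countable F" "\<Union> F = \<Union> (fst ` A)"
    using Lindelof[of "fst ` A"] open_dom by blast
  then obtain B where B: "countable B" "B \<subseteq> A" "F = fst ` B" using countable_subset_image[of F fst A] by blast
  have U: "\<Union> (fst ` A) = UNIV" using atlas by (simp add: smooth_atlas_def)
  have "p \<in> \<Union> (cd ` B)" if "p \<in> TM" for p
  proof -
    have "fst p \<in> \<Union> (fst ` B)" using F B U by simp
    then obtain c where "c \<in> B" "fst p \<in> fst c" by blast
    then show ?thesis using that by (intro UN_I[of c]) (simp_all add: cd_iff)
  qed
  then show ?thesis using B by blast
qed

lemma supp_compact: "compactin top supp" using radon by (simp add: compact_radon_measure_def)

lemma supp_TM: "supp \<subseteq> TM" by (simp add: msupport_def)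

lemma supp_closed: "closedin top supp" using compactin_imp_closedin[OF Hausdorff_top supp_compact] .

text \<open>Within one chart, the open null sets correspond to open sets of a Euclidean subspace, so
  countably many of them have the same union. Countably many charts then suffice.\<close>

lemma null_outside_supp: "TM - supp \<in> null_sets \<mu>"
proof -
  obtain B where B: "countable B" "B \<subseteq> A" "TM \<subseteq> \<Union> (cd ` B)" using countable_charts by blast
  have "\<exists>N. N \<in> null_sets \<mu> \<and> cd c - supp \<subseteq> N" if c: "c \<in> A" for c
  proof -
    define F where "F = {W. openin (top_of_set (ci c)) W \<and> emeasure \<mu> (unc c ` W) = 0}"
    obtain F' where F': "F' \<subseteq> F" "countable F'" "\<Union> F' = \<Union> F"
      using Lindelof_openin[of F "ci c"] by (auto simp: F_def)
    have "(\<Union>W\<in>F'. unc c ` W) \<in> null_sets \<mu>"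
      using F' openin_image[OF c] open_sets by (intro null_sets_UN') (auto simp: F_def null_sets_def)
    moreover have "p \<in> (\<Union>W\<in>F'. unc c ` W)" if p: "p \<in> cd c" "p \<notin> supp" for p
    proof -
      obtain U where U: "openin top U" "p \<in> U" "emeasure \<mu> U = 0"
        using p cd_TM[OF p(1)] by (auto simp: msupport_def)
      let ?W = "{q \<in> ci c. unc c q \<in> U}"
      have W: "openin (top_of_set (ci c)) ?W" using openin_chart[OF U(1) c] .
      have "emeasure \<mu> (unc c ` ?W) \<le> emeasure \<mu> U"
        by (rule emeasure_mono[OF _ open_sets[OF U(1)]]) blast
      then have "?W \<in> F" using W U(3) by (simp add: F_def)
      moreover have "coord c p \<in> ?W" using coord_in[OF p(1)] unc_coord[OF c p(1)] U(2) by simp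
      ultimately have "coord c p \<in> \<Union> F'" using F'(3) by blast
      then obtain W' where "W' \<in> F'" "coord c p \<in> W'" by blast
      then show ?thesis using unc_coord[OF c p(1)] by (intro UN_I[of W'] image_eqI[of p "unc c" "coord c p"]) simp_all
    qed
    ultimately show ?thesis by blast
  qed
  then obtain N where N: "\<And>c. c \<in> A \<Longrightarrow> N c \<in> null_sets \<mu>" "\<And>c. c \<in> A \<Longrightarrow> cd c - supp \<subseteq> N c" by metis
  have "(\<Union>c\<in>B. N c) \<in> null_sets \<mu>" using B N(1) by (intro null_sets_UN') auto
  moreover have "TM - supp \<subseteq> (\<Union>c\<in>B. N c)" using B(2,3) N(2) by blast
  moreover have "TM - supp \<in> sets \<mu>" using supp_closed by (intro open_sets) (simp add: closedin_def topspace_top)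
  ultimately show ?thesis by (meson null_sets_subset)
qed

lemma AE_supp: "AE p in \<mu>. p \<in> supp"
  by (rule AE_I'[OF null_outside_supp]) (auto simp: space_mu)

lemma finite_mu: "finite_measure \<mu>"
proof
  have "emeasure \<mu> (supp \<union> (TM - supp)) \<le> emeasure \<mu> supp + emeasure \<mu> (TM - supp)"
    by (rule emeasure_subadditive) (use closed_sets[OF supp_closed] null_outside_supp in auto)
  moreover have "emeasure \<mu> supp < \<infinity>" using radon supp_compact by (simp add: compact_radon_measure_def)
  moreover have "supp \<union> (TM - supp) = TM" using supp_TM by blast
  ultimately show "emeasure \<mu> (space \<mu>) \<noteq> \<infinity>" using null_outside_supp by (auto simp: space_mu null_sets_def)
qed

lemma measurable_chartI:
  assumes "\<And>c. c \<in> A \<Longrightarrow> f \<in> measurable (restrict_space \<mu> (cd c)) N"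
  shows "f \<in> measurable \<mu> N"
proof -
  obtain B where B: "countable B" "B \<subseteq> A" "TM \<subseteq> \<Union> (cd ` B)" using countable_charts by blast
  show ?thesis
  proof (rule measurable_piecewise_restrict[of "cd ` B"])
    show "countable (cd ` B)" "space \<mu> \<subseteq> \<Union> (cd ` B)" using B by (simp_all add: space_mu)
    fix W assume "W \<in> cd ` B"
    then obtain c where "c \<in> A" "W = cd c" using B(2) by blast
    then show "W \<inter> space \<mu> \<in> sets \<mu>" "f \<in> measurable (restrict_space \<mu> W) N"
      using cd_Int_space assms by simp_all
  qed
qed

lemma space_restrict_cd: "c \<in> A \<Longrightarrow> space (restrict_space \<mu> (cd c)) = cd c"
  using cd_TM[of _ c] by (simp add: space_restrict_space space_mu) blast

lemma measurable_coord:
  assumes c: "c \<in> A"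
  shows "coord c \<in> measurable (restrict_space \<mu> (cd c)) (restrict_space borel (ci c))"
proof (rule measurable_restrict_space2)
  show "coord c \<in> space (restrict_space \<mu> (cd c)) \<rightarrow> ci c"
    unfolding space_restrict_cd[OF c] Pi_iff using coord_in by blast
  show "coord c \<in> borel_measurable (restrict_space \<mu> (cd c))"
  proof (rule borel_measurableI)
    fix S :: "'n coords set" assume S: "open S"
    have "coord c -` S \<inter> cd c = unc c ` (ci c \<inter> S)"
    proof (intro set_eqI iffI)
      fix p assume "p \<in> coord c -` S \<inter> cd c"
      then have p: "coord c p \<in> S" "p \<in> cd c" by simp_all
      show "p \<in> unc c ` (ci c \<inter> S)"
        by (rule image_eqI[of p "unc c" "coord c p"]) (use p coord_in unc_coord[OF c p(2)] in simp_all)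
    next
      fix p assume "p \<in> unc c ` (ci c \<inter> S)"
      then obtain q where "q \<in> ci c" "q \<in> S" "p = unc c q" by blast
      then show "p \<in> coord c -` S \<inter> cd c" using unc_in[OF c] coord_unc[OF c] by simp
    qed
    moreover have "unc c ` (ci c \<inter> S) \<in> sets \<mu>"
      by (intro open_sets openin_image[OF c]) (use S in auto)
    moreover have "unc c ` (ci c \<inter> S) \<subseteq> cd c" using unc_in[OF c] by blast
    ultimately show "coord c -` S \<inter> space (restrict_space \<mu> (cd c)) \<in> sets (restrict_space \<mu> (cd c))"
      unfolding space_restrict_cd[OF c] sets_restrict_space_iff[OF cd_Int_space[OF c]] by simp
  qed
qed

lemma measurable_continuous_coord:
  assumes "c \<in> A" "continuous_on (ci c) g"
  shows "(\<lambda>p. g (coord c p)) \<in> borel_measurable (restrict_space \<mu> (cd c))"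
  using measurable_compose[OF measurable_coord[OF assms(1)] borel_measurable_continuous_on_restrict[OF assms(2)]] .

lemma borel_measurable_TMI_borel:
  "borel_measurable (restrict_space (TMI_borel A t0) S) = borel_measurable (restrict_space \<mu> S)"
  by (rule measurable_cong_sets[OF sets_restrict_space_cong[OF sets_mu[symmetric]] refl])

lemma integrable_bounded:
  fixes h :: "('m, 'n) point \<Rightarrow> real"
  assumes "h \<in> borel_measurable \<mu>" "bounded (h ` supp)"
  shows "integrable \<mu> h"
proof -
  obtain B where "\<And>p. p \<in> supp \<Longrightarrow> norm (h p) \<le> B" using assms(2) by (auto simp: bounded_iff)
  then have "AE p in \<mu>. norm (h p) \<le> B" using AE_supp by (auto elim: AE_mp)
  then show ?thesis using finite_measure.integrable_const_bound[OF finite_mu _ assms(1)] by blast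
qed

lemma bounded_suppI:
  fixes h :: "('m, 'n) point \<Rightarrow> 'b::real_normed_vector"
  assumes "\<And>c K. c \<in> A \<Longrightarrow> compact K \<Longrightarrow> K \<subseteq> ci c \<Longrightarrow> bounded (h ` (unc c ` K \<inter> supp))"
  shows "bounded (h ` supp)"
proof -
  define \<U> where "\<U> = {N. openin top N \<and> bounded (h ` (N \<inter> supp))}"
  have "supp \<subseteq> \<Union> \<U>"
  proof
    fix p assume p: "p \<in> supp"
    then obtain c where c: "c \<in> A" "p \<in> cd c" using exists_cd supp_TM by blast
    obtain r where r: "r > 0" "compact (ci c \<inter> cball (coord c p) r)" "unc c ` (ci c \<inter> cball (coord c p) r) \<subseteq> cd c"
      "cball (fst (coord c p)) r \<subseteq> im c"
      by (rule compact_box[OF c openin_cd[OF c(1)] c(2)])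
    let ?N = "unc c ` (ci c \<inter> ball (coord c p) r)"
    have "bounded (h ` (unc c ` (ci c \<inter> cball (coord c p) r) \<inter> supp))"
      using assms[OF c(1) r(2)] by blast
    then have "bounded (h ` (?N \<inter> supp))"
      by (rule bounded_subset) (use ball_subset_cball[of "coord c p" r] in blast)
    moreover have "openin top ?N" by (rule openin_image[OF c(1)]) auto
    moreover have "p \<in> ?N"
      by (rule image_eqI[of p "unc c" "coord c p"]) (use c coord_in unc_coord r(1) in simp_all)
    ultimately show "p \<in> \<Union> \<U>" by (auto simp: \<U>_def)
  qed
  then obtain F where F: "finite F" "F \<subseteq> \<U>" "supp \<subseteq> \<Union> F"
    using compactinD[OF supp_compact, of \<U>] by (auto simp: \<U>_def)
  have "bounded (\<Union>N\<in>F. h ` (N \<inter> supp))" using F by (intro bounded_UN) (auto simp: \<U>_def)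
  then show ?thesis by (rule bounded_subset) (use F(3) in blast)
qed

text \<open>What is needed to integrate along a field: accelerations are only measurable, and their
  coordinates are bounded only over compact parts of a chart and on the support.\<close>

definition nice :: "('m, 'n) vfield \<Rightarrow> bool" where
  "nice X \<longleftrightarrow> (\<forall>p\<in>TM. cov X p) \<and> (\<forall>c\<in>A. X c \<in> borel_measurable (restrict_space \<mu> (cd c))) \<and>
     (\<forall>c\<in>A. \<forall>K. compact K \<and> K \<subseteq> ci c \<longrightarrow> bounded (X c ` (unc c ` K \<inter> supp)))"

lemma frechet_expand:
  fixes D :: "'n coords \<Rightarrow> real"
  assumes "(f has_derivative D) F"
  shows "D h = (\<Sum>b\<in>Basis. (h \<bullet> b) * D b)"
proof -
  have l: "linear D" using assms has_derivative_linear by blast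
  have "D (\<Sum>b\<in>Basis. (h \<bullet> b) *\<^sub>R b) = (\<Sum>b\<in>Basis. (h \<bullet> b) * D b)"
    by (simp only: linear_sum[OF l] linear_scale[OF l] real_scaleR_def)
  then show ?thesis by (simp only: euclidean_representation)
qed

lemma bounded_mult_image:
  fixes f g :: "'a \<Rightarrow> real"
  assumes "bounded (f ` S)" "bounded (g ` S)" shows "bounded ((\<lambda>x. f x * g x) ` S)"
proof -
  obtain B C where "\<And>x. x \<in> S \<Longrightarrow> \<bar>f x\<bar> \<le> B" "\<And>x. x \<in> S \<Longrightarrow> \<bar>g x\<bar> \<le> C"
    using assms by (auto simp: bounded_iff)
  then have "\<And>x. x \<in> S \<Longrightarrow> \<bar>f x * g x\<bar> \<le> B * C"
    unfolding abs_mult by (intro mult_mono) (auto intro: order_trans[OF abs_ge_zero])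
  then show ?thesis by (auto simp: bounded_iff)
qed

lemma bounded_sum_image:
  fixes f :: "'i \<Rightarrow> 'a \<Rightarrow> real"
  assumes "finite I" "\<And>i. i \<in> I \<Longrightarrow> bounded (f i ` S)"
  shows "bounded ((\<lambda>x. \<Sum>i\<in>I. f i x) ` S)"
  using assms
proof (induction I rule: finite_induct)
  case (insert i I)
  then show ?case using bounded_plus_comp[of "f i" S "\<lambda>x. \<Sum>i\<in>I. f i x"] by simp
qed (auto simp: image_constant_conv)

lemma bounded_continuous_coord:
  fixes g :: "'n coords \<Rightarrow> 'b::real_normed_vector"
  assumes "c \<in> A" "continuous_on (ci c) g" "compact K" "K \<subseteq> ci c"
  shows "bounded ((\<lambda>p. g (coord c p)) ` (unc c ` K \<inter> S))"
proof -
  have "bounded (g ` K)"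
    using compact_imp_bounded[OF compact_continuous_image[OF continuous_on_subset[OF assms(2,4)] assms(3)]] .
  moreover have "(\<lambda>p. g (coord c p)) ` (unc c ` K \<inter> S) \<subseteq> g ` K"
  proof
    fix y assume "y \<in> (\<lambda>p. g (coord c p)) ` (unc c ` K \<inter> S)"
    then obtain q where "q \<in> K" "y = g (coord c (unc c q))" by blast
    moreover have "coord c (unc c q) = q" using coord_unc[OF assms(1)] assms(4) \<open>q \<in> K\<close> by blast
    ultimately show "y \<in> g ` K" by simp
  qed
  ultimately show ?thesis using bounded_subset by blast
qed

text \<open>In every chart the integrand is linear in the field with continuous coefficients, hence
  bounded on the compact support; the measure is finite.\<close>

lemma nice_integrable:
  fixes h :: "('m, 'n) point \<Rightarrow> real" and g :: "('m, 'n) chart \<Rightarrow> 'n coords \<Rightarrow> 'n coords \<Rightarrow> real"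
  assumes X: "nice X" and g: "\<And>c b. c \<in> A \<Longrightarrow> b \<in> Basis \<Longrightarrow> continuous_on (ci c) (g c b)"
    and h: "\<And>c p. c \<in> A \<Longrightarrow> p \<in> cd c \<Longrightarrow> h p = (\<Sum>b\<in>Basis. (X c p \<bullet> b) * g c b (coord c p))"
  shows "integrable \<mu> h" "bounded (h ` supp)"
proof -
  show b: "bounded (h ` supp)"
  proof (rule bounded_suppI)
    fix c and K :: "'n coords set" assume c: "c \<in> A" and K: "compact K" "K \<subseteq> ci c"
    let ?S = "unc c ` K \<inter> supp"
    have S: "?S \<subseteq> cd c" using K(2) unc_in[OF c] by blast
    have "bounded (X c ` ?S)" using X c K unfolding nice_def by blast
    then have "bounded ((\<lambda>p. X c p \<bullet> b) ` ?S)" for b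
      using bounded_linear_image[OF _ bounded_linear_inner_left, of "X c ` ?S" b] by (simp add: image_image)
    then have "bounded ((\<lambda>p. \<Sum>b\<in>Basis. (X c p \<bullet> b) * g c b (coord c p)) ` ?S)"
      by (intro bounded_sum_image bounded_mult_image bounded_continuous_coord[OF c g[OF c] K]) auto
    moreover have "(\<lambda>p. \<Sum>b\<in>Basis. (X c p \<bullet> b) * g c b (coord c p)) ` ?S = h ` ?S"
    proof (rule image_cong[OF refl])
      fix p assume "p \<in> ?S"
      then have "p \<in> cd c" using S by blast
      from h[OF c this] show "(\<Sum>b\<in>Basis. (X c p \<bullet> b) * g c b (coord c p)) = h p" by (rule sym)
    qed
    ultimately show "bounded (h ` ?S)" by simp
  qed
  have "h \<in> borel_measurable \<mu>"
  proof (rule measurable_chartI)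
    fix c assume c: "c \<in> A"
    have [measurable]: "X c \<in> borel_measurable (restrict_space \<mu> (cd c))" using X c unfolding nice_def by blast
    have "(\<lambda>p. X c p \<bullet> b) \<in> borel_measurable (restrict_space \<mu> (cd c))" for b by measurable
    then have "(\<lambda>p. \<Sum>b\<in>Basis. (X c p \<bullet> b) * g c b (coord c p)) \<in> borel_measurable (restrict_space \<mu> (cd c))"
      by (intro borel_measurable_sum borel_measurable_times measurable_continuous_coord[OF c g[OF c]])
    then show "h \<in> borel_measurable (restrict_space \<mu> (cd c))"
      by (subst measurable_cong[OF h[OF c]]) (simp_all add: space_restrict_cd[OF c])
  qed
  then show "integrable \<mu> h" using integrable_bounded b by blast
qed

lemma integrable_deriv_along:
  assumes X: "nice X" and f: "Ck_TMI A t0 (Suc k) f"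
  shows "integrable \<mu> (deriv_along A t0 X f)" "bounded (deriv_along A t0 X f ` supp)"
proof -
  have g: "continuous_on (ci c) (dir_deriv (ci c) (lc c f) b)" if "c \<in> A" for c b
    using f that Ck_on_frechet(2)[OF _ thick_ci[OF that]] Ck_on_imp_continuous unfolding Ck_TMI_def by blast
  have h: "deriv_along A t0 X f p = (\<Sum>b\<in>Basis. (X c p \<bullet> b) * dir_deriv (ci c) (lc c f) b (coord c p))"
    if "c \<in> A" "p \<in> cd c" for c p
    using deriv_along_eq[OF f _ that] X cd_TM[OF that(2)] frechet_expand[OF lc_deriv[OF f that(1) coord_in[OF that(2)]], of "X c p"]
    unfolding nice_def by simp
  show "integrable \<mu> (deriv_along A t0 X f)" "bounded (deriv_along A t0 X f ` supp)"
    by (rule nice_integrable[where g="\<lambda>c b. dir_deriv (ci c) (lc c f) b", OF X g h]; assumption)+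
qed

lemma bounded_Pair_image:
  assumes "bounded (f ` S)" "bounded (g ` S)" shows "bounded ((\<lambda>x. (f x, g x)) ` S)"
  by (rule bounded_subset[OF bounded_Times[OF assms]]) auto

lemma coord_continuous: "continuous_on S (\<lambda>q :: 'n coords. fst (snd q))" by (intro continuous_intros)

lemma sof_nice:
  assumes cov: "\<And>p. p \<in> TM \<Longrightarrow> cov (second_order_field C) p"
    and meas: "\<And>c. c \<in> A \<Longrightarrow> C c \<in> borel_measurable (restrict_space \<mu> (cd c))"
    and bdd: "\<And>c K. c \<in> A \<Longrightarrow> compact K \<Longrightarrow> K \<subseteq> ci c \<Longrightarrow> bounded (C c ` (unc c ` K \<inter> supp))"
  shows "nice (second_order_field C)"
  unfolding nice_def
proof (intro conjI ballI allI impI)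
  show "cov (second_order_field C) p" if "p \<in> TM" for p using cov that .
  fix c assume c: "c \<in> A"
  have e: "second_order_field C c = (\<lambda>p. (fst (snd (coord c p)), C c p, 1))"
    by (simp add: fun_eq_iff second_order_field_def coord_def)
  show "second_order_field C c \<in> borel_measurable (restrict_space \<mu> (cd c))"
    unfolding e by (intro borel_measurable_Pair measurable_continuous_coord[OF c coord_continuous] measurable_const meas c) auto
  fix K :: "'n coords set" assume K: "compact K \<and> K \<subseteq> ci c"
  show "bounded (second_order_field C c ` (unc c ` K \<inter> supp))"
    unfolding e using K bdd[OF c, of K]
    by (intro bounded_Pair_image bounded_continuous_coord[OF c coord_continuous]) (auto simp: image_constant_conv)
qed

lemma second_derivative_nice:
  assumes C: "second_derivative A t0 \<mu> C"
  shows "nice (second_order_field C)"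
proof (rule sof_nice)
  show "cov (second_order_field C) p" if "p \<in> TM" for p
    using C that unfolding second_derivative_def vector_field_cov by blast
  fix c assume c: "c \<in> A"
  show "C c \<in> borel_measurable (restrict_space \<mu> (cd c))"
    using C c borel_measurable_TMI_borel unfolding second_derivative_def by blast
  fix K :: "'n coords set" assume K: "compact K" "K \<subseteq> ci c"
  have "compactin top (unc c ` K)" "unc c ` K \<subseteq> cd c"
    using compactin_unc[OF c] unc_in[OF c] K by blast+
  then show "bounded (C c ` (unc c ` K \<inter> supp))" using C c unfolding second_derivative_def by blast
qed

section \<open>Absence of mass at the ends of the time interval\<close>

lemma time_integral:
  assumes C: "second_derivative A t0 \<mu> C" and h: "\<And>k. Ck_on k h UNIV" "h 0 = 0" "h t0 = 0"
    and h': "\<And>t. (h has_real_derivative h' t) (at t)"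
  shows "(LINT p|\<mu>. h' (snd (snd p))) = 0"
proof -
  let ?f = "\<lambda>p :: ('m, 'n) point. h (snd (snd p))"
  have "smooth_TMI A t0 ?f" unfolding smooth_TMI_def using Ck_TMI_time[OF h(1)] by blast
  moreover have "vanishes_at_ends A t0 ?f" using h by (auto simp: vanishes_at_ends_def)
  ultimately have "(LINT p|\<mu>. deriv_along A t0 (second_order_field C) ?f p) = 0"
    using C unfolding second_derivative_def by blast
  moreover have "deriv_along A t0 (second_order_field C) ?f p = h' (snd (snd p))" if "p \<in> space \<mu>" for p
    using deriv_along_time[OF _ h', of p] that by (simp add: space_mu second_order_field_def)
  ultimately show ?thesis by (simp cong: Bochner_Integration.integral_cong)
qed

text \<open>The functions with derivative \<open>(1 - t/t0)\<^sup>n - 1/(n+1)\<close> that vanish at both ends show that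
  no mass sits at an end.\<close>

lemma AE_not_end:
  assumes C: "second_derivative A t0 \<mu> C" and "a = 1 \<or> a = (-1::real)"
  defines "s \<equiv> (\<lambda>t. if a = 1 then t / t0 else 1 - t / t0)"
  shows "AE p in \<mu>. s (snd (snd p)) \<noteq> 0"
proof -
  define h where "h n t = t0 / (n + 1) * (1 - (1 - s t) ^ (n + 1)) - t0 * s t / (n + 1)" for n :: nat and t
  have Cs: "Ck_on k s UNIV" for k
    unfolding s_def divide_inverse
    by (cases "a = 1") (auto intro!: Ck_on_mult Ck_on_id Ck_on_const Ck_on_diff)
  have Ch: "Ck_on k (h n) UNIV" for k n
    unfolding h_def[abs_def] divide_inverse
    by (intro Ck_on_diff Ck_on_mult Ck_on_const Cs Ck_on_power)
  have s0: "s 0 = 0 \<and> s t0 = 1 \<or> s 0 = 1 \<and> s t0 = 0" using t0 by (auto simp: s_def)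
  then have h0: "h n 0 = 0" "h n t0 = 0" for n by (auto simp: h_def)
  have ds: "(s has_real_derivative a / t0) (at t)" for t
    using assms(2) t0 by (auto simp: s_def[abs_def] intro!: derivative_eq_intros)
  have dh: "(h n has_real_derivative a * ((1 - s t) ^ n - 1 / (real n + 1))) (at t)" for n t
  proof -
    have "((\<lambda>t. (1 - s t) ^ (n + 1)) has_real_derivative of_nat (n + 1) * ((0 - a / t0) * (1 - s t) ^ (n + 1 - Suc 0))) (at t)"
      by (intro DERIV_power DERIV_diff DERIV_const ds)
    then have "(h n has_real_derivative t0 / (n + 1) * (0 - of_nat (n + 1) * ((0 - a / t0) * (1 - s t) ^ (n + 1 - Suc 0)))
       - t0 * (a / t0) / (n + 1)) (at t)"
      unfolding h_def[abs_def] by (intro DERIV_diff DERIV_cmult DERIV_cdivide DERIV_const ds)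
    moreover have "t0 / N * (0 - N * ((0 - a / t0) * X)) - t0 * (a / t0) / N = a * (X - 1 / N)" if "N > 0" for N X :: real
      using t0 that by (simp add: field_simps)
    from this[of "real (n + 1)" "(1 - s t) ^ n"]
    have "t0 / (n + 1) * (0 - of_nat (n + 1) * ((0 - a / t0) * (1 - s t) ^ (n + 1 - Suc 0)))
       - t0 * (a / t0) / (n + 1) = a * ((1 - s t) ^ n - 1 / (real n + 1))" by simp
    ultimately show ?thesis by (simp only: of_nat_add of_nat_1)
  qed
  have i0: "(LINT p|\<mu>. (1 - s (snd (snd p))) ^ n - 1 / (real n + 1)) = 0" for n
    using time_integral[OF C Ch h0 dh, of n] assms(2) by (auto simp: add.commute)
  have sr: "0 \<le> s (snd (snd p))" "s (snd (snd p)) \<le> 1" if "p \<in> TM" for p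
    using that t0 by (auto simp: s_def TM_iff)
  have ms: "(\<lambda>p. s (snd (snd p))) \<in> borel_measurable \<mu>"
  proof (rule measurable_chartI)
    fix c assume c: "c \<in> A"
    have "continuous_on (ci c) (\<lambda>q. s (snd (snd q)))"
      by (intro continuous_on_compose2[OF Ck_on_imp_continuous[OF Cs]] continuous_intros) auto
    from measurable_continuous_coord[OF c this]
    show "(\<lambda>p. s (snd (snd p))) \<in> borel_measurable (restrict_space \<mu> (cd c))" by (simp add: coord_def)
  qed
  \<comment> \<open>The powers decrease to the indicator of the end where s = 0, and the subtracted
    constants tend to 0. The mass of that end is thus a limit of integrals that all vanish.\<close>
  have "(\<lambda>n. LINT p|\<mu>. ((1 - s (snd (snd p))) ^ n - 1 / (real n + 1))) \<longlonglongrightarrow> (LINT p|\<mu>. (if s (snd (snd p)) = 0 then 1 else 0))"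
  proof (rule integral_dominated_convergence[where w="\<lambda>_. 1"])
    show "(\<lambda>p. (1 - s (snd (snd p))) ^ n - 1 / (real n + 1)) \<in> borel_measurable \<mu>" for n
      using ms by measurable
    show "(\<lambda>p. if s (snd (snd p)) = 0 then 1 else (0::real)) \<in> borel_measurable \<mu>"
      using ms by measurable
    show "integrable \<mu> (\<lambda>_. 1::real)" using finite_measure.integrable_const[OF finite_mu] .
    show "AE p in \<mu>. norm ((1 - s (snd (snd p))) ^ n - 1 / (real n + 1)) \<le> 1" for n
    proof (rule AE_I2)
      fix p assume "p \<in> space \<mu>"
      then have "0 \<le> (1 - s (snd (snd p))) ^ n" "(1 - s (snd (snd p))) ^ n \<le> 1" 
        using sr[of p] by (auto simp: space_mu intro: power_le_one)
      moreover have "0 \<le> 1 / (real n + 1)" "1 / (real n + 1) \<le> 1" by auto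
      ultimately show "norm ((1 - s (snd (snd p))) ^ n - 1 / (real n + 1)) \<le> 1"
        unfolding real_norm_def abs_le_iff by linarith
    qed
    show "AE p in \<mu>. (\<lambda>n. (1 - s (snd (snd p))) ^ n - 1 / (real n + 1)) \<longlonglongrightarrow> (if s (snd (snd p)) = 0 then 1 else 0)"
    proof (rule AE_I2)
      fix p assume p: "p \<in> space \<mu>"
      have z: "(\<lambda>n. 1 / (real n + 1)) \<longlonglongrightarrow> 0"
        using LIMSEQ_inverse_real_of_nat by (simp add: inverse_eq_divide add.commute)
      show "(\<lambda>n. (1 - s (snd (snd p))) ^ n - 1 / (real n + 1)) \<longlonglongrightarrow> (if s (snd (snd p)) = 0 then 1 else 0)"
      proof (cases "s (snd (snd p)) = 0")
        case True
        then show ?thesis using tendsto_diff[OF tendsto_const z, of 1] by simp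
      next
        case False
        then have "(\<lambda>n. (1 - s (snd (snd p))) ^ n) \<longlonglongrightarrow> 0"
          using sr[of p] p by (intro LIMSEQ_realpow_zero) (auto simp: space_mu)
        then show ?thesis using tendsto_diff[OF _ z] False by force
      qed
    qed
  qed
  then have "(LINT p|\<mu>. (if s (snd (snd p)) = 0 then 1 else (0::real))) = 0"
    unfolding i0 by (simp add: LIMSEQ_const_iff)
  moreover have "integrable \<mu> (\<lambda>p. if s (snd (snd p)) = 0 then 1 else (0::real))"
    using ms by (intro finite_measure.integrable_const_bound[OF finite_mu, where B=1]) auto
  ultimately have "AE p in \<mu>. (if s (snd (snd p)) = 0 then 1 else (0::real)) = 0"
    by (subst (asm) integral_nonneg_eq_0_iff_AE) auto
  then show ?thesis by (rule AE_mp) (auto intro!: AE_I2)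
qed

lemma AE_interior:
  assumes C: "second_derivative A t0 \<mu> C"
  shows "AE p in \<mu>. 0 < snd (snd p) \<and> snd (snd p) < t0"
proof -
  have 1: "AE p in \<mu>. snd (snd p) / t0 \<noteq> 0" using AE_not_end[OF C, of 1] by simp
  have 2: "AE p in \<mu>. 1 - snd (snd p) / t0 \<noteq> 0" using AE_not_end[OF C, of "-1"] by simp
  have "AE p in \<mu>. p \<in> space \<mu>" by (rule AE_space)
  then show ?thesis
    using 1 2
  proof eventually_elim
    case (elim p)
    then have "0 \<le> snd (snd p)" "snd (snd p) \<le> t0" "snd (snd p) \<noteq> 0" "snd (snd p) \<noteq> t0"
      using t0 by (auto simp: space_mu TM_iff)
    then show ?case by simp
  qed
qed

end

section \<open>Test functions of class C^1\<close>

context mfdm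
begin

abbreviation interior_img :: "('m, 'n) chart \<Rightarrow> 'n coords set" where
  "interior_img c \<equiv> im c \<times> UNIV \<times> {0<..<t0}"

lemma open_interior_img: "c \<in> A \<Longrightarrow> open (interior_img c)"
  by (intro open_Times open_im) auto

lemma interior_img_subset: "interior_img c \<subseteq> ci c" by (auto simp: chart_img_def)

lemma coord_interior: "p \<in> cd c \<Longrightarrow> 0 < snd (snd p) \<Longrightarrow> snd (snd p) < t0 \<Longrightarrow> coord c p \<in> interior_img c"
  using coord_in[of p c] by (simp add: ci_iff coord_def)

lemma compact_neighbourhood:
  fixes K O' :: "'a::euclidean_space set"
  assumes "compact K" "open O'" "K \<subseteq> O'"
  obtains d where "d > 0" "compact {x. \<exists>y\<in>K. dist x y \<le> d}" "{x. \<exists>y\<in>K. dist x y \<le> d} \<subseteq> O'"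
proof -
  obtain d where d: "d > 0" "(\<Union>x\<in>K. cball x d) \<subseteq> O'"
    using compact_subset_open_imp_cball_epsilon_subset[OF assms] by blast
  have "{x. \<exists>y\<in>K. dist x y \<le> d} = {y + z | y z. y \<in> K \<and> z \<in> cball 0 d}"
  proof (intro set_eqI iffI)
    fix x assume "x \<in> {x. \<exists>y\<in>K. dist x y \<le> d}"
    then obtain y where y: "y \<in> K" "dist x y \<le> d" by blast
    then have "x - y \<in> cball 0 d" "x = y + (x - y)" by (simp_all add: dist_norm norm_minus_commute)
    then show "x \<in> {y + z | y z. y \<in> K \<and> z \<in> cball 0 d}" using y(1) by blast
  next
    fix x assume "x \<in> {y + z | y z. y \<in> K \<and> z \<in> cball 0 d}"
    then obtain y z where "y \<in> K" "norm z \<le> d" "x = y + z" by auto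
    then show "x \<in> {x. \<exists>y\<in>K. dist x y \<le> d}" by (intro CollectI bexI[of _ y]) (simp_all add: dist_norm)
  qed
  then have "compact {x. \<exists>y\<in>K. dist x y \<le> d}" using compact_sums[OF assms(1) compact_cball[of 0 d]] by (simp only:)
  moreover have "{x. \<exists>y\<in>K. dist x y \<le> d} \<subseteq> O'" using d(2) by (force simp: dist_commute)
  ultimately show ?thesis using that d(1) by blast
qed

lemma vanishes_ext:
  assumes "\<And>q. q \<notin> interior_img c \<Longrightarrow> g q = 0"
  shows "vanishes_at_ends A t0 (ext c g)"
  unfolding vanishes_at_ends_def
proof (clarify)
  fix x v t assume "(x, v, t) \<in> TM" "t = 0 \<or> t = t0"
  then have "coord c (x, v, t) \<notin> interior_img c" by (auto simp: coord_def)
  then show "ext c g (x, v, t) = 0" using assms by (simp add: ext_def)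
qed

text \<open>If the field has components only in the directions \<open>Bs\<close>, a test function
  enters only through its \<open>Bs\<close>-derivatives, and mollification approximates these
  uniformly. Compact support in the open interior of the chart image keeps the mollified function in
  the chart and zero at the ends, so it is an admissible smooth function.\<close>

lemma integral_interior:
  fixes g :: "'n coords \<Rightarrow> real" and g' :: "'n coords \<Rightarrow> 'n coords \<Rightarrow> real"
  assumes X: "nice X" and Bs: "Bs \<subseteq> Basis" "\<And>p b. p \<in> cd c \<Longrightarrow> b \<in> Basis - Bs \<Longrightarrow> X c p \<bullet> b = 0"
    and \<Lambda>: "\<And>f. smooth_TMI A t0 f \<Longrightarrow> vanishes_at_ends A t0 f \<Longrightarrow> (LINT p|\<mu>. deriv_along A t0 X f p) = 0"
    and c: "c \<in> A" and K: "compact K" "K \<subseteq> interior_img c"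
    and g: "continuous_on UNIV g" "\<And>q. q \<notin> K \<Longrightarrow> g q = 0"
    and g': "\<And>b q. b \<in> Bs \<Longrightarrow> ((\<lambda>s. g (q + s *\<^sub>R b)) has_real_derivative g' b q) (at 0)"
      "\<And>b. b \<in> Bs \<Longrightarrow> continuous_on UNIV (g' b)"
  shows "(LINT p|\<mu>. (if p \<in> cd c then \<Sum>b\<in>Bs. (X c p \<bullet> b) * g' b (coord c p) else 0)) = 0"
proof -
  define h where "h p = (if p \<in> cd c then \<Sum>b\<in>Bs. (X c p \<bullet> b) * g' b (coord c p) else 0)" for p
  have finB: "finite Bs" using finite_subset[OF Bs(1) finite_Basis] .
  have g'0: "g' b q = 0" if "b \<in> Bs" "q \<notin> K" for b q
    by (rule dir_deriv_outside_support[where f=g and y=q and b=b, OF K(1) _ g'(1)[OF that(1)] that(2)]) (rule g(2))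
  obtain d where d: "d > 0" "compact {x. \<exists>y\<in>K. dist x y \<le> d}" "{x. \<exists>y\<in>K. dist x y \<le> d} \<subseteq> interior_img c"
    by (rule compact_neighbourhood[OF K(1) open_interior_img[OF c] K(2)])
  define K' where "K' = {x. \<exists>y\<in>K. dist x y \<le> d}"
  have K': "compact K'" "K' \<subseteq> interior_img c" "K' \<subseteq> ci c" "K \<subseteq> K'"
  proof -
    show "compact K'" "K' \<subseteq> interior_img c" using d(2,3) by (simp_all add: K'_def)
    then show "K' \<subseteq> ci c" using interior_img_subset by blast
    show "K \<subseteq> K'"
    proof
      fix x assume "x \<in> K"
      then show "x \<in> K'" unfolding K'_def using d(1) by (intro CollectI bexI[of _ x]) auto
    qed
  qed
  have "bounded (X c ` (unc c ` K' \<inter> supp))" using X c K' unfolding nice_def by blast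
  then obtain M where M: "M > 0" "\<And>p. p \<in> unc c ` K' \<inter> supp \<Longrightarrow> norm (X c p) \<le> M"
    unfolding bounded_pos by blast
  \<comment> \<open>The error in the integrand is a sum over \<open>Bs\<close> of a component of the
    field, at most \<open>M\<close>, times an error of at most \<open>e\<close> in a directional
    derivative.\<close>
  define M' where "M' = M * real (card Bs)"
  have M': "M' \<ge> 0" using M(1) by (simp add: M'_def)
  have approx: "\<exists>f. smooth_TMI A t0 f \<and> vanishes_at_ends A t0 f \<and> (\<forall>p\<in>supp. \<bar>deriv_along A t0 X f p - h p\<bar> \<le> e * M')"
    if e: "e > 0" for e
  proof -
    obtain k where k: "smooth_on k UNIV" "\<And>x. k x \<noteq> 0 \<Longrightarrow> \<exists>y\<in>K. dist x y \<le> d" "\<And>x. \<bar>k x - g x\<bar> \<le> e"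
      "\<And>b x. b \<in> Bs \<Longrightarrow> \<bar>dir_deriv UNIV k b x - g' b x\<bar> \<le> e"
      by (rule smooth_approximation[where f'=g', OF g(1) K(1) g(2) g' finB e d(1)]) blast+
    have k0: "k q = 0" if "q \<notin> K'" for q using that k(2)[of q] by (auto simp: K'_def)
    have kC: "Ck_on j k UNIV" for j using smooth_onD[OF k(1)] .
    define f where "f = ext c k"
    have fC: "Ck_TMI A t0 j f" for j
      unfolding f_def using Ck_TMI_ext[OF c K'(1,3) _ Ck_on_subset[OF kC subset_UNIV]] k0 by blast
    have "smooth_TMI A t0 f" unfolding smooth_TMI_def using fC by blast
    moreover have "vanishes_at_ends A t0 f"
      unfolding f_def by (rule vanishes_ext) (use k0 K'(2) in blast)
    moreover have "\<bar>deriv_along A t0 X f p - h p\<bar> \<le> e * M'" if p: "p \<in> supp" for p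
    proof (cases "p \<in> unc c ` K'")
      case True
      then obtain q where q: "q \<in> K'" "p = unc c q" by blast
      have pc: "p \<in> cd c" using q K'(3) unc_in[OF c] by blast
      have D: "(lc c f has_derivative frechet_derivative k (at (coord c p))) (at (coord c p) within ci c)"
      proof (rule has_derivative_transform[OF coord_in[OF pc]])
        show "lc c f q = k q" if "q \<in> ci c" for q
          using unc_in[OF c that] coord_unc[OF c that] by (simp add: f_def ext_def loc_def)
        show "(k has_derivative frechet_derivative k (at (coord c p))) (at (coord c p) within ci c)"
          using dir_deriv_UNIV_linear(1)[OF kC] has_derivative_at_withinI by blast
      qed
      have "deriv_along A t0 X f p = frechet_derivative k (at (coord c p)) (X c p)"
        using deriv_along_eq[OF fC _ c pc] X cd_TM[OF pc] thick_frechet_derivative[OF thick_ci[OF c] coord_in[OF pc] D]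
        unfolding nice_def by simp
      also have "\<dots> = (\<Sum>b\<in>Basis. (X c p \<bullet> b) * dir_deriv UNIV k b (coord c p))"
        by (rule frechet_expand[OF D])
      also have "\<dots> = (\<Sum>b\<in>Bs. (X c p \<bullet> b) * dir_deriv UNIV k b (coord c p))"
        by (rule sum.mono_neutral_right) (use Bs pc in auto)
      finally have "deriv_along A t0 X f p - h p = (\<Sum>b\<in>Bs. (X c p \<bullet> b) * (dir_deriv UNIV k b (coord c p) - g' b (coord c p)))"
        using pc by (simp add: h_def sum_subtractf right_diff_distrib)
      also have "\<bar>\<dots>\<bar> \<le> (\<Sum>b\<in>Bs. M * e)"
      proof (rule order_trans[OF sum_abs sum_mono])
        fix b assume b: "b \<in> Bs"
        have "norm b = 1" using b Bs(1) by auto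
        then have "\<bar>X c p \<bullet> b\<bar> \<le> M"
          using Cauchy_Schwarz_ineq2[of "X c p" b] M(2)[of p] True p by simp
        then show "\<bar>(X c p \<bullet> b) * (dir_deriv UNIV k b (coord c p) - g' b (coord c p))\<bar> \<le> M * e"
          unfolding abs_mult using k(4)[OF b] by (intro mult_mono) auto
      qed
      finally show ?thesis by (simp add: M'_def mult_ac)
    next
      case False
      have oT: "openin top (TM - unc c ` K')"
        using closedin_unc[OF c K'(1,3)] by (simp add: closedin_def topspace_top)
      have pT: "p \<in> TM - unc c ` K'" using False p supp_TM by blast
      have "f q = 0" if "q \<in> TM - unc c ` K'" for q
        unfolding f_def using that k0 by (intro ext_outside[OF c, of K']) auto
      then have "deriv_along A t0 X f p = deriv_along A t0 X (\<lambda>p. 0) p"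
        by (rule deriv_along_cong[OF fC[of "Suc 0"] oT pT])
      then have "deriv_along A t0 X f p = 0" using deriv_along_0[of p X] pT by simp
      moreover have "h p = 0"
      proof (cases "p \<in> cd c")
        case True
        then have "coord c p \<notin> K'" using False unc_coord[OF c True] by (metis image_eqI)
        then have "coord c p \<notin> K" using K'(4) by blast
        then show ?thesis using g'0 by (simp add: h_def)
      qed (simp add: h_def)
      ultimately show ?thesis using e M' by simp
    qed
    ultimately show ?thesis by blast
  qed
  have "(\<lambda>p. \<Sum>b\<in>Bs. (X c p \<bullet> b) * g' b (coord c p)) \<in> borel_measurable (restrict_space \<mu> (cd c))"
  proof -
    have [measurable]: "X c \<in> borel_measurable (restrict_space \<mu> (cd c))" using X c unfolding nice_def by blast
    have "(\<lambda>p. X c p \<bullet> b) \<in> borel_measurable (restrict_space \<mu> (cd c))" for b by measurable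
    then show ?thesis
      by (intro borel_measurable_sum borel_measurable_times measurable_continuous_coord[OF c] continuous_on_subset[OF g'(2)]) auto
  qed
  then have "(\<lambda>p. indicator (cd c) p *\<^sub>R (\<Sum>b\<in>Bs. (X c p \<bullet> b) * g' b (coord c p))) \<in> borel_measurable \<mu>"
    by (rule borel_measurable_restrict_space_iff[OF cd_Int_space[OF c], THEN iffD1])
  moreover have "(\<lambda>p. indicator (cd c) p *\<^sub>R (\<Sum>b\<in>Bs. (X c p \<bullet> b) * g' b (coord c p))) = h"
    by (auto simp: fun_eq_iff h_def)
  ultimately have hm: "h \<in> borel_measurable \<mu>" by simp
  have hb: "bounded (h ` supp)"
  proof -
    obtain f where f: "smooth_TMI A t0 f" "\<forall>p\<in>supp. \<bar>deriv_along A t0 X f p - h p\<bar> \<le> 1 * M'" using approx[of 1] by auto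
    have "Ck_TMI A t0 (Suc 0) f" using f(1) unfolding smooth_TMI_def by blast
    then obtain C where C: "\<And>p. p \<in> supp \<Longrightarrow> \<bar>deriv_along A t0 X f p\<bar> \<le> C"
      using integrable_deriv_along(2)[OF X] unfolding bounded_iff by fastforce
    have "\<bar>h p\<bar> \<le> C + M'" if "p \<in> supp" for p
      using C[OF that] f(2) that by force
    then have "\<forall>p\<in>supp. \<bar>h p\<bar> \<le> C + M'" by blast
    then show ?thesis unfolding bounded_iff by auto
  qed
  have hi: "integrable \<mu> h" using integrable_bounded[OF hm hb] .
  have small: "\<bar>LINT p|\<mu>. h p\<bar> \<le> e * M' * measure \<mu> TM" if e: "e > 0" for e
  proof -
    obtain f where f: "smooth_TMI A t0 f" "vanishes_at_ends A t0 f" "\<forall>p\<in>supp. \<bar>deriv_along A t0 X f p - h p\<bar> \<le> e * M'"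
      using approx[OF e] by blast
    have "Ck_TMI A t0 (Suc 0) f" using f(1) unfolding smooth_TMI_def by blast
    then have fi: "integrable \<mu> (deriv_along A t0 X f)" using integrable_deriv_along(1)[OF X] by blast
    have "(LINT p|\<mu>. h p) = - (LINT p|\<mu>. deriv_along A t0 X f p - h p)"
      using \<Lambda>[OF f(1,2)] by (simp add: Bochner_Integration.integral_diff[OF fi hi])
    also have "\<bar>\<dots>\<bar> \<le> (LINT p|\<mu>. \<bar>deriv_along A t0 X f p - h p\<bar>)"
      using integral_norm_bound[of \<mu> "\<lambda>p. deriv_along A t0 X f p - h p"] by simp
    also have "\<dots> \<le> (LINT p|\<mu>. e * M')"
    proof (rule integral_mono_AE)
      show "integrable \<mu> (\<lambda>_. e * M')" using finite_measure.integrable_const[OF finite_mu] .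
      show "AE p in \<mu>. \<bar>deriv_along A t0 X f p - h p\<bar> \<le> e * M'"
        using AE_supp f(3) by (auto elim: AE_mp)
    qed (use fi hi in auto)
    also have "\<dots> = e * M' * measure \<mu> TM" by (simp add: space_mu)
    finally show ?thesis .
  qed
  have "\<bar>LINT p|\<mu>. h p\<bar> \<le> 0 + e" if "e > 0" for e
  proof -
    define B where "B = M' * measure \<mu> TM"
    have B: "B \<ge> 0" using M' by (simp add: B_def)
    have "\<bar>LINT p|\<mu>. h p\<bar> \<le> e / (B + 1) * M' * measure \<mu> TM"
      using small[of "e / (B + 1)"] that B by simp
    also have "\<dots> = e * (B / (B + 1))" by (simp add: B_def)
    also have "\<dots> \<le> e * 1" using B that by (intro mult_left_mono) auto
    finally show ?thesis by simp
  qed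
  then have "\<bar>LINT p|\<mu>. h p\<bar> \<le> 0" by (rule field_le_epsilon)
  then show ?thesis by (simp add: h_def[abs_def])
qed

text \<open>A time cutoff: for positive \<open>n\<close> it is 0 within distance 1/n of either end,
  and 1 where the distance to both ends is at least 2/n.\<close>

definition theta :: "nat \<Rightarrow> real \<Rightarrow> real" where
  "theta n t = smooth_step (n * t - 1) * smooth_step (n * (t0 - t) - 1)"

definition step' :: "real \<Rightarrow> real" where "step' = dir_deriv UNIV smooth_step 1"

lemma step': "(smooth_step has_real_derivative step' x) (at x)" "continuous_on UNIV step'"
  "x < 0 \<or> x > 1 \<Longrightarrow> step' x = 0"
proof -
  note d = dir_deriv_UNIV_linear[OF Ck_on_smooth_step]
  show 1: "(smooth_step has_real_derivative step' x) (at x)" for x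
    using has_derivative_along_line[OF d(1)[of x], of 1] DERIV_shift[of smooth_step "step' x" 0 x]
    by (simp add: step'_def add.commute)
  show "continuous_on UNIV step'" using d(2) by (simp add: step'_def)
  show "step' x = 0" if "x < 0 \<or> x > 1"
  proof -
    have "\<forall>\<^sub>F y in nhds x. smooth_step y = (if x < 0 then 0 else 1)"
      using that eventually_nhds_in_open[of "{..<0::real}" x] eventually_nhds_in_open[of "{1<..}" x]
      by (auto simp: smooth_step_simps elim!: eventually_mono)
    from DERIV_cong_ev[OF refl this refl] have "((\<lambda>y. if x < 0 then 0 else 1) has_real_derivative step' x) (at x)"
      using 1 by blast
    then show ?thesis using DERIV_unique DERIV_const by blast
  qed
qed

definition theta' :: "nat \<Rightarrow> real \<Rightarrow> real" where
  "theta' n t = real n * step' (n * t - 1) * smooth_step (n * (t0 - t) - 1)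
     - real n * smooth_step (n * t - 1) * step' (n * (t0 - t) - 1)"

lemma theta_deriv: "(theta n has_real_derivative theta' n t) (at t)"
proof -
  have 1: "((\<lambda>t. smooth_step (n * t - 1)) has_real_derivative step' (n * t - 1) * n) (at t)"
    by (rule DERIV_chain2[OF step'(1)]) (auto intro!: derivative_eq_intros)
  have 2: "((\<lambda>t. smooth_step (n * (t0 - t) - 1)) has_real_derivative step' (n * (t0 - t) - 1) * - n) (at t)"
    by (rule DERIV_chain2[OF step'(1)]) (auto intro!: derivative_eq_intros)
  from DERIV_mult[OF 1 2] show ?thesis
    unfolding theta_def[abs_def] theta'_def by (simp add: algebra_simps)
qed

lemma Ck_theta: "Ck_on k (theta n) UNIV"
proof -
  have 1: "Ck_on k (\<lambda>t. n * t - 1) UNIV" "Ck_on k (\<lambda>t. n * (t0 - t) - 1) UNIV"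
    by (intro Ck_on_diff Ck_on_mult Ck_on_const Ck_on_id)+
  show ?thesis unfolding theta_def[abs_def]
    by (rule Ck_on_mult[OF Ck_on_compose[OF Ck_on_smooth_step 1(1)] Ck_on_compose[OF Ck_on_smooth_step 1(2)]]) auto
qed

lemma theta_range: "0 \<le> theta n t" "theta n t \<le> 1"
  unfolding theta_def using smooth_step_simps(3,4) by (auto intro: mult_le_one)

lemma theta_support: "n > 0 \<Longrightarrow> theta n t \<noteq> 0 \<Longrightarrow> 1 / n \<le> t \<and> t \<le> t0 - 1 / n"
proof -
  assume n: "n > 0" and "theta n t \<noteq> 0"
  then have "\<not> n * t - 1 \<le> 0" "\<not> n * (t0 - t) - 1 \<le> 0"
    using smooth_step_simps(1) unfolding theta_def by fastforce+
  then show ?thesis using n by (simp add: field_simps)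
qed

lemma theta_eventually:
  assumes "0 < t" "t < t0" shows "\<forall>\<^sub>F n in sequentially. theta n t = 1 \<and> theta' n t = 0"
proof -
  have "\<forall>\<^sub>F n in sequentially. 3 / t < real n" "\<forall>\<^sub>F n in sequentially. 3 / (t0 - t) < real n"
    using filterlim_real_sequentially filterlim_at_top_dense by blast+
  then show ?thesis
  proof eventually_elim
    case (elim n)
    then have "n * t - 1 > 1" "n * (t0 - t) - 1 > 1"
      using assms by (simp_all add: divide_less_eq)
    then show ?case by (simp add: theta_def theta'_def smooth_step_simps step'(3))
  qed
qed

text \<open>The derivative of the cutoff is of order n, but it can be nonzero only at distance
  between 1/n and 2/n from an end. There a function that vanishes linearly at both ends is of order
  1/n, and the product is bounded uniformly in n.\<close>

lemma theta'_bound: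
  "\<exists>S. \<forall>n t y M. 0 \<le> M \<longrightarrow> 0 \<le> t \<longrightarrow> t \<le> t0 \<longrightarrow> \<bar>y\<bar> \<le> M * t \<longrightarrow> \<bar>y\<bar> \<le> M * (t0 - t) \<longrightarrow> \<bar>theta' n t * y\<bar> \<le> S * M"
proof -
  have "bounded (step' ` {0..1})"
    using compact_imp_bounded[OF compact_continuous_image[OF continuous_on_subset[OF step'(2)]]] by auto
  then have "\<exists>S. \<forall>x\<in>{0..1}. \<bar>step' x\<bar> \<le> S" by (simp add: bounded_iff)
  then obtain S where S: "\<And>x. x \<in> {0..1} \<Longrightarrow> \<bar>step' x\<bar> \<le> S" by blast
  have S0: "S \<ge> 0" using S[of 0] by auto
  have b: "\<bar>real n * step' (n * t - 1) * y\<bar> \<le> 2 * S * M" if t: "0 \<le> t" "\<bar>y\<bar> \<le> M * t" "0 \<le> M" for n :: nat and t y M :: real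
  proof (cases "n * t - 1 \<in> {0..1}")
    case True
    have "\<bar>real n * step' (n * t - 1) * y\<bar> = \<bar>step' (n * t - 1)\<bar> * (n * \<bar>y\<bar>)" by (simp add: abs_mult)
    also have "\<dots> \<le> S * (n * (M * t))" using S[OF True] t S0 by (intro mult_mono mult_left_mono) auto
    also have "\<dots> = S * M * (n * t)" by simp
    also have "\<dots> \<le> S * M * 2" using True S0 t(3) by (intro mult_left_mono) auto
    finally show ?thesis by simp
  next
    case False
    then have "step' (n * t - 1) = 0" by (intro step'(3)) auto
    then show ?thesis using S0 t(3) by simp
  qed
  show ?thesis
  \<comment> \<open>One term for each end, each bounded by 2 S M: the factor 2 is the largest value
    of n times the distance to the end on the transition zone.\<close>
  proof (intro exI[of _ "4 * S"] allI impI)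
    fix n :: nat and t y M :: real
    assume t: "0 \<le> M" "0 \<le> t" "t \<le> t0" "\<bar>y\<bar> \<le> M * t" "\<bar>y\<bar> \<le> M * (t0 - t)"
    let ?a = "real n * step' (n * t - 1) * y" and ?b = "real n * step' (n * (t0 - t) - 1) * y"
    let ?u = "smooth_step (n * (t0 - t) - 1)" and ?v = "smooth_step (n * t - 1)"
    have "theta' n t * y = ?a * ?u - ?b * ?v" by (simp add: theta'_def algebra_simps)
    also have "\<bar>\<dots>\<bar> \<le> \<bar>?a\<bar> * \<bar>?u\<bar> + \<bar>?b\<bar> * \<bar>?v\<bar>"
      unfolding abs_mult[symmetric] by (rule abs_triangle_ineq4)
    also have "\<dots> \<le> 2 * S * M * 1 + 2 * S * M * 1"
      using b[OF t(2,4,1)] b[OF _ t(5,1)] t S0 smooth_step_simps(3,4)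
      by (intro add_mono mult_mono) (auto intro: order_trans[OF abs_ge_zero])
    finally show "\<bar>theta' n t * y\<bar> \<le> 4 * S * M" by (simp add: mult_ac)
  qed
qed

text \<open>The mean value inequality in time, started from either end, with the time derivative
  bounded over a compact set of positions and velocities.\<close>

lemma vanishes_bound:
  assumes f: "Ck_TMI A t0 (Suc 0) f" "vanishes_at_ends A t0 f" and c: "c \<in> A"
    and K: "compact K" "K \<subseteq> im c \<times> UNIV"
  shows "\<exists>M\<ge>0. \<forall>y w t. (y, w) \<in> K \<longrightarrow> 0 \<le> t \<longrightarrow> t \<le> t0 \<longrightarrow> \<bar>lc c f (y, w, t)\<bar> \<le> M * t \<and> \<bar>lc c f (y, w, t)\<bar> \<le> M * (t0 - t)"
proof -
  define d where "d = dir_deriv (ci c) (lc c f) (0, 0, 1)"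
  have cl: "Ck_on (Suc 0) (lc c f) (ci c)" using f c by (simp add: Ck_TMI_def)
  have dc: "continuous_on (ci c) d" using Ck_on_frechet(2)[OF cl thick_ci[OF c]] by (simp add: d_def)
  define m where "m = (\<lambda>p :: ((real^'n) \<times> (real^'n)) \<times> real. (fst (fst p), snd (fst p), snd p))"
  have mK: "m ` (K \<times> {0..t0}) \<subseteq> ci c" using K(2) by (auto simp: m_def chart_img_def)
  have "compact (m ` (K \<times> {0..t0}))"
    unfolding m_def by (intro compact_continuous_image continuous_intros compact_Times K(1) compact_Icc)
  then have "bounded (d ` m ` (K \<times> {0..t0}))"
    using compact_imp_bounded compact_continuous_image continuous_on_subset[OF dc mK] by blast
  then obtain M where M: "M > 0" "\<And>p. p \<in> K \<times> {0..t0} \<Longrightarrow> norm (d (m p)) \<le> M"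
    unfolding bounded_pos by blast
  have diff: "\<bar>lc c f (y, w, s) - lc c f (y, w, t)\<bar> \<le> M * \<bar>s - t\<bar>"
    if yw: "(y, w) \<in> K" and s: "s \<in> {0..t0}" and t: "t \<in> {0..t0}" for y w s t
  proof -
    have "norm (lc c f (y, w, s) - lc c f (y, w, t)) \<le> M * norm (s - t)"
    proof (rule field_differentiable_bound[of "{0..t0}" "\<lambda>s. lc c f (y, w, s)" "\<lambda>s. d (y, w, s)"])
      fix z assume z: "z \<in> {0..t0}"
      have q: "(y, w, z) \<in> ci c" using yw z K(2) by (auto simp: chart_img_def)
      let ?D = "frechet_derivative (lc c f) (at (y, w, z) within ci c)"
      have D: "(lc c f has_derivative ?D) (at (y, w, z) within ci c)" using lc_deriv[OF f(1) c q] .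
      have "(lc c f has_derivative ?D) (at (y, w, z) within (\<lambda>s. (y, w, s)) ` {0..t0})"
        by (rule has_derivative_subset[OF D]) (use yw K(2) in \<open>auto simp: chart_img_def\<close>)
      moreover have "((\<lambda>s. (y, w, s)) has_derivative (\<lambda>h. (0, 0, h))) (at z within {0..t0})"
        by (intro has_derivative_Pair has_derivative_const has_derivative_ident)
      ultimately have "((\<lambda>s. lc c f (y, w, s)) has_derivative (\<lambda>h. ?D (0, 0, h))) (at z within {0..t0})"
        using diff_chain_within[of "\<lambda>s. (y, w, s)" "\<lambda>h. (0, 0, h)" z "{0..t0}" "lc c f" ?D]
        by (simp add: o_def)
      moreover have "(\<lambda>h. ?D (0, 0, h)) = (*) (d (y, w, z))"
      proof
        fix h
        have "?D (h *\<^sub>R (0, 0, 1)) = h *\<^sub>R ?D (0, 0, 1)" using linear_scale[OF has_derivative_linear[OF D]] .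
        then show "?D (0, 0, h) = d (y, w, z) * h" by (simp add: d_def)
      qed
      ultimately show "((\<lambda>s. lc c f (y, w, s)) has_field_derivative d (y, w, z)) (at z within {0..t0})"
        by (simp add: has_field_derivative_def)
      show "norm (d (y, w, z)) \<le> M" using M(2)[of "((y, w), z)"] yw z by (simp add: m_def)
    qed (use s t in auto)
    then show ?thesis by simp
  qed
  have zero: "lc c f (y, w, 0) = 0" "lc c f (y, w, t0) = 0" if "(y, w) \<in> K" for y w
  proof -
    have q: "(y, w, 0) \<in> ci c" "(y, w, t0) \<in> ci c" using that K(2) t0 by (auto simp: chart_img_def)
    have "f (unc c (y, w, s)) = 0" if "(y, w, s) \<in> ci c" "s = 0 \<or> s = t0" for s
      using f(2) cd_TM[OF unc_in[OF c that(1)]] that(2) unfolding vanishes_at_ends_def unc_eq[OF c that(1)] by fastforce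
    then show "lc c f (y, w, 0) = 0" "lc c f (y, w, t0) = 0" using q by (simp_all add: loc_def)
  qed
  have "\<bar>lc c f (y, w, t)\<bar> \<le> M * t \<and> \<bar>lc c f (y, w, t)\<bar> \<le> M * (t0 - t)"
    if t: "(y, w) \<in> K" "0 \<le> t" "t \<le> t0" for y w t
    using diff[OF t(1), of t 0] diff[OF t(1), of t t0] zero[OF t(1)] t t0 by simp
  then show ?thesis using M(1) by (intro exI[of _ M]) auto
qed

text \<open>Multiplied by \<open>theta n\<close>, the function is supported in the interior, where
  it can be mollified. The additional term with \<open>theta'\<close> is bounded by
  \<open>theta'_bound\<close> and tends to 0 at interior times, which carry all the mass, so
  dominated convergence applies.\<close>

lemma second_derivative_C1_local:
  assumes C: "second_derivative A t0 \<mu> C" and f: "Ck_TMI A t0 (Suc 0) f" "vanishes_at_ends A t0 f"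
    and c: "c \<in> A" "q0 \<in> ci c" and r: "r > 0" "compact (ci c \<inter> cball q0 r)" "cball (fst q0) r \<subseteq> im c"
    and f0: "\<And>p. p \<notin> unc c ` (ci c \<inter> cball q0 r) \<Longrightarrow> f p = 0"
  shows "(LINT p|\<mu>. deriv_along A t0 (second_order_field C) f p) = 0"
proof -
  let ?X = "second_order_field C"
  define K where "K = ci c \<inter> cball q0 r"
  have K: "compact K" "K \<subseteq> ci c" using r by (auto simp: K_def)
  have f0: "f p = 0" if "p \<notin> unc c ` K" for p using f0 that by (simp add: K_def)
  note nX = second_derivative_nice[OF C]
  define g where "g q = (if q \<in> ci c then lc c f q else 0)" for q
  have g0: "g q = 0" if q: "q \<notin> K" for q
  proof (cases "q \<in> ci c")
    case True
    have "unc c q \<notin> unc c ` K"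
    proof
      assume "unc c q \<in> unc c ` K"
      then obtain z where "z \<in> K" "unc c q = unc c z" by blast
      then have "q = z" using coord_unc[OF c(1) True] coord_unc[OF c(1), of z] K(2) by auto
      then show False using q \<open>z \<in> K\<close> by simp
    qed
    then show ?thesis using f0 True by (simp add: g_def loc_def)
  qed (simp add: g_def)
  have TK: "openin top (TM - unc c ` K)"
    using closedin_unc[OF c(1) K] by (simp add: closedin_def topspace_top)
  define F where "F n p = theta n (snd (snd p)) * f p" for n and p :: "('m, 'n) point"
  have FC: "Ck_TMI A t0 (Suc 0) (F n)" for n
    unfolding F_def by (intro Ck_TMI_mult Ck_TMI_time Ck_theta f)
  have int_F: "(LINT p|\<mu>. deriv_along A t0 ?X (F n) p) = 0" if n: "n > 0" for n
  proof -
    define gn where "gn q = theta n (snd (snd q)) * g q" for q :: "'n coords"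
    define Kn where "Kn = K \<inter> {q. 1 / n \<le> snd (snd q) \<and> snd (snd q) \<le> t0 - 1 / n}"
    have "closed {q :: 'n coords. 1 / n \<le> snd (snd q) \<and> snd (snd q) \<le> t0 - 1 / n}"
      by (intro closed_Collect_conj closed_Collect_le continuous_intros)
    then have Kn: "compact Kn" using K(1) unfolding Kn_def by (rule compact_Int_closed[rotated])
    have KnO: "Kn \<subseteq> interior_img c"
    proof
      fix q assume q: "q \<in> Kn"
      have "1 / real n > 0" "1 / real n \<le> snd (snd q)" "snd (snd q) \<le> t0 - 1 / real n"
        using n q by (simp_all add: Kn_def)
      then have "0 < snd (snd q)" "snd (snd q) < t0" by linarith+
      moreover have "fst q \<in> im c" using q K(2) ci_iff[of q c] by (auto simp: Kn_def)
      ultimately show "q \<in> interior_img c" by (cases q) auto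
    qed
    have gn0: "gn q = 0" if "q \<notin> Kn" for q
      using that g0[of q] theta_support[OF n, of "snd (snd q)"] by (auto simp: gn_def Kn_def)
    have gnC: "Ck_on (Suc 0) gn UNIV"
    proof (rule Ck_on_local[OF thick_UNIV])
      fix q :: "'n coords"
      show "\<exists>U. openin (top_of_set UNIV) U \<and> q \<in> U \<and> Ck_on (Suc 0) gn U"
      proof (cases "q \<in> interior_img c")
        case True
        have "Ck_on (Suc 0) (\<lambda>q. theta n (snd (snd q)) * lc c f q) (interior_img c)"
          by (intro Ck_on_mult Ck_on_compose[OF Ck_theta] Ck_on_snd Ck_on_id Ck_on_subset[OF _ interior_img_subset])
            (use f c in \<open>auto simp: Ck_TMI_def\<close>)
        then have "Ck_on (Suc 0) gn (interior_img c)"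
        proof (rule Ck_on_cong)
          fix q assume "q \<in> interior_img c"
          then have "q \<in> ci c" using interior_img_subset by blast
          then show "theta n (snd (snd q)) * lc c f q = gn q" by (simp add: gn_def g_def)
        qed
        then show ?thesis using True open_interior_img[OF c(1)] by (intro exI[of _ "interior_img c"]) simp
      next
        case False
        then have "q \<in> - Kn" using KnO by blast
        moreover have "Ck_on (Suc 0) gn (- Kn)"
          by (rule Ck_on_cong[OF Ck_on_const[where c=0]]) (simp add: gn0)
        ultimately show ?thesis using compact_imp_closed[OF Kn] by (intro exI[of _ "- Kn"]) (simp add: open_Compl)
      qed
    qed
    note dg = dir_deriv_UNIV_linear[OF gnC]
    have "(LINT p|\<mu>. (if p \<in> cd c then \<Sum>b\<in>Basis. (?X c p \<bullet> b) * dir_deriv UNIV gn b (coord c p) else 0)) = 0"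
    proof (rule integral_interior[where g=gn and K=Kn, OF nX _ _ _ c(1) Kn KnO])
      show "(LINT p|\<mu>. deriv_along A t0 ?X f p) = 0" if "smooth_TMI A t0 f" "vanishes_at_ends A t0 f" for f
        using C that unfolding second_derivative_def by blast
      show "((\<lambda>s. gn (q + s *\<^sub>R b)) has_real_derivative dir_deriv UNIV gn b q) (at 0)" for b q
        using has_derivative_along_line[OF dg(1)[of q], of b] by simp
    qed (use gn0 dg(2) Ck_on_imp_continuous[OF gnC] in auto)
    moreover have "(if p \<in> cd c then \<Sum>b\<in>Basis. (?X c p \<bullet> b) * dir_deriv UNIV gn b (coord c p) else 0) = deriv_along A t0 ?X (F n) p"
      if p: "p \<in> space \<mu>" for p
    proof (cases "p \<in> cd c")
      case True
      have D: "(lc c (F n) has_derivative frechet_derivative gn (at (coord c p))) (at (coord c p) within ci c)"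
      proof (rule has_derivative_transform[OF coord_in[OF True]])
        show "lc c (F n) q = gn q" if "q \<in> ci c" for q
          using that by (simp add: F_def gn_def g_def loc_def unc_eq[OF c(1)])
        show "(gn has_derivative frechet_derivative gn (at (coord c p))) (at (coord c p) within ci c)"
          using dg(1) has_derivative_at_withinI by blast
      qed
      have "deriv_along A t0 ?X (F n) p = frechet_derivative gn (at (coord c p)) (?X c p)"
        using deriv_along_eq[OF FC _ c(1) True] nX cd_TM[OF True] thick_frechet_derivative[OF thick_ci[OF c(1)] coord_in[OF True] D]
        unfolding nice_def by simp
      then show ?thesis using True frechet_expand[OF D, of "?X c p"] by simp
    next
      case False
      have "unc c ` K \<subseteq> cd c" using K(2) unc_in[OF c(1)] by blast
      then have pT: "p \<in> TM - unc c ` K" using False p by (simp add: space_mu) blast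
      have "F n q = 0" if "q \<in> TM - unc c ` K" for q using f0[of q] that by (simp add: F_def)
      then have "deriv_along A t0 ?X (F n) p = deriv_along A t0 ?X (\<lambda>p. 0) p"
        by (rule deriv_along_cong[OF FC TK pT])
      then show ?thesis using False deriv_along_0 p by (simp add: space_mu)
    qed
    ultimately show ?thesis by (simp cong: Bochner_Integration.integral_cong)
  qed
  define K2 where "K2 = cball (fst q0) r \<times> cball (fst (snd q0)) r"
  have K2: "compact K2" "K2 \<subseteq> im c \<times> UNIV" using r(3) by (auto simp: K2_def compact_Times)
  obtain M where M: "M \<ge> 0" "\<And>y w t. (y, w) \<in> K2 \<Longrightarrow> 0 \<le> t \<Longrightarrow> t \<le> t0 \<Longrightarrow> \<bar>lc c f (y, w, t)\<bar> \<le> M * t"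
     "\<And>y w t. (y, w) \<in> K2 \<Longrightarrow> 0 \<le> t \<Longrightarrow> t \<le> t0 \<Longrightarrow> \<bar>lc c f (y, w, t)\<bar> \<le> M * (t0 - t)"
    using vanishes_bound[OF f c(1) K2] by blast
  have Mf: "\<bar>f p\<bar> \<le> M * snd (snd p) \<and> \<bar>f p\<bar> \<le> M * (t0 - snd (snd p))" if p: "p \<in> TM" for p
  proof (cases "p \<in> unc c ` K")
    case True
    then obtain q where q: "q \<in> K" "p = unc c q" by blast
    then have qc: "q \<in> ci c" "dist q0 q \<le> r" by (simp_all add: K_def)
    have "dist (fst q0) (fst q) \<le> r" "dist (fst (snd q0)) (fst (snd q)) \<le> r"
      using qc(2) dist_fst_le[of q0 q] dist_snd_le[of q0 q] dist_fst_le[of "snd q0" "snd q"] by linarith+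
    then have "(fst q, fst (snd q)) \<in> K2" by (simp add: K2_def)
    moreover have "lc c f (fst q, fst (snd q), snd (snd q)) = f p" using q by (simp add: loc_def)
    moreover have "snd (snd p) = snd (snd q)" using q(2) unc_eq[OF c(1) qc(1)] by simp
    ultimately show ?thesis using M(2,3)[of "fst q" "fst (snd q)" "snd (snd q)"] qc(1) by (simp add: ci_iff)
  next
    case False
    then show ?thesis using f0 M(1) p by (simp add: TM_iff)
  qed
  obtain S where S: "\<And>n t y M. 0 \<le> M \<Longrightarrow> 0 \<le> t \<Longrightarrow> t \<le> t0 \<Longrightarrow> \<bar>y\<bar> \<le> M * t \<Longrightarrow> \<bar>y\<bar> \<le> M * (t0 - t) \<Longrightarrow> \<bar>theta' n t * y\<bar> \<le> S * M"
    using theta'_bound by blast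
  have DF: "deriv_along A t0 ?X (F n) p = theta n (snd (snd p)) * deriv_along A t0 ?X f p + theta' n (snd (snd p)) * f p"
    if p: "p \<in> TM" for n p
    unfolding F_def
    using deriv_along_mult[where X="?X", OF Ck_TMI_time[OF Ck_theta[of _ n]] f(1) p] deriv_along_time[where X="?X", OF p theta_deriv[of n]]
    by (simp add: second_order_field_def)
  note iD = integrable_deriv_along(1)[OF nX f(1)]
  have "(\<lambda>n. LINT p|\<mu>. deriv_along A t0 ?X (F (Suc n)) p) \<longlonglongrightarrow> (LINT p|\<mu>. deriv_along A t0 ?X f p)"
  proof (rule integral_dominated_convergence[where w="\<lambda>p. \<bar>deriv_along A t0 ?X f p\<bar> + S * M"])
    show "deriv_along A t0 ?X f \<in> borel_measurable \<mu>" using iD by simp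
    show "deriv_along A t0 ?X (F (Suc n)) \<in> borel_measurable \<mu>" for n
      using integrable_deriv_along(1)[OF nX FC] by simp
    show "integrable \<mu> (\<lambda>p. \<bar>deriv_along A t0 ?X f p\<bar> + S * M)"
      by (intro Bochner_Integration.integrable_add integrable_abs iD finite_measure.integrable_const[OF finite_mu])
    show "AE p in \<mu>. norm (deriv_along A t0 ?X (F (Suc n)) p) \<le> \<bar>deriv_along A t0 ?X f p\<bar> + S * M" for n
    proof (rule AE_I2)
      fix p assume "p \<in> space \<mu>"
      then have p: "p \<in> TM" by (simp add: space_mu)
      have "\<bar>theta (Suc n) (snd (snd p)) * deriv_along A t0 ?X f p\<bar> \<le> 1 * \<bar>deriv_along A t0 ?X f p\<bar>"
        unfolding abs_mult using theta_range[of "Suc n" "snd (snd p)"] by (intro mult_right_mono) auto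
      moreover have "\<bar>theta' (Suc n) (snd (snd p)) * f p\<bar> \<le> S * M"
        using S[OF M(1), of "snd (snd p)" "f p" "Suc n"] Mf[OF p] p by (simp add: TM_iff)
      ultimately show "norm (deriv_along A t0 ?X (F (Suc n)) p) \<le> \<bar>deriv_along A t0 ?X f p\<bar> + S * M"
        unfolding DF[OF p] by simp
    qed
    show "AE p in \<mu>. (\<lambda>n. deriv_along A t0 ?X (F (Suc n)) p) \<longlonglongrightarrow> deriv_along A t0 ?X f p"
      using AE_interior[OF C] AE_space
    proof eventually_elim
      case (elim p)
      have "\<forall>\<^sub>F n in sequentially. deriv_along A t0 ?X (F n) p = deriv_along A t0 ?X f p"
        using theta_eventually[of "snd (snd p)"] elim
        by (auto elim!: eventually_mono simp: DF space_mu)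
      then show ?case by (rule LIMSEQ_Suc[OF tendsto_eventually])
    qed
  qed
  then show ?thesis using int_F by (simp add: LIMSEQ_const_iff)
qed

lemma vanishes_mult: "vanishes_at_ends A t0 f \<Longrightarrow> vanishes_at_ends A t0 (\<lambda>p. u p * f p :: real)"
  unfolding vanishes_at_ends_def by fastforce

text \<open>This extension is used for L_v F, and for functions composed with a displacement of the
  base points by \<open>F\<close>; both are C^1 and in general no better.\<close>

lemma second_derivative_C1:
  assumes C: "second_derivative A t0 \<mu> C" and f: "Ck_TMI A t0 (Suc 0) f" "vanishes_at_ends A t0 f"
  shows "(LINT p|\<mu>. deriv_along A t0 (second_order_field C) f p) = 0"
proof -
  let ?X = "second_order_field C"
  note nX = second_derivative_nice[OF C]
  let ?G = "\<lambda>f. Ck_TMI A t0 (Suc 0) f \<and> vanishes_at_ends A t0 f"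
  show ?thesis
  proof (rule localize[where S=supp and G="?G" and \<Lambda>="\<lambda>f. LINT p|\<mu>. deriv_along A t0 ?X f p", OF supp_compact])
    fix f u assume "?G f" "smooth_TMI A t0 u"
    then show "?G (\<lambda>p. u p * f p)" using Ck_TMI_mult vanishes_mult unfolding smooth_TMI_def by blast
  next
    fix f g assume fg: "?G f" "?G g"
    have "(LINT p|\<mu>. deriv_along A t0 ?X (\<lambda>p. f p + g p) p) = (LINT p|\<mu>. deriv_along A t0 ?X f p + deriv_along A t0 ?X g p)"
      by (rule Bochner_Integration.integral_cong[OF refl]) (use fg deriv_along_add[where k=0] in \<open>simp add: space_mu\<close>)
    also have "\<dots> = (LINT p|\<mu>. deriv_along A t0 ?X f p) + (LINT p|\<mu>. deriv_along A t0 ?X g p)"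
      by (rule Bochner_Integration.integral_add) (use fg integrable_deriv_along(1)[OF nX] in blast)+
    finally show "(LINT p|\<mu>. deriv_along A t0 ?X (\<lambda>p. f p + g p) p) = (LINT p|\<mu>. deriv_along A t0 ?X f p) + (LINT p|\<mu>. deriv_along A t0 ?X g p)" .
  next
    fix f U assume f: "?G f" and U: "openin top U" "supp \<subseteq> U" and z: "\<And>p. p \<in> U \<Longrightarrow> f p = 0"
    have "deriv_along A t0 ?X f p = 0" if p: "p \<in> supp" for p
    proof -
      have "deriv_along A t0 ?X f p = deriv_along A t0 ?X (\<lambda>p. 0) p"
        by (rule deriv_along_cong[of 0 f, OF _ U(1)]) (use f U(2) p z in blast)+
      moreover have "p \<in> TM" using supp_TM p by blast
      ultimately show ?thesis using deriv_along_0 by simp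
    qed
    then have "AE p in \<mu>. deriv_along A t0 ?X f p = 0" using AE_supp by (auto elim: AE_mp)
    then show "(LINT p|\<mu>. deriv_along A t0 ?X f p) = 0" by (rule integral_eq_zero_AE)
  next
    fix p assume "p \<in> supp"
    then have p: "p \<in> TM" using supp_TM by blast
    obtain c where c: "c \<in> A" "p \<in> cd c" using exists_cd[OF p] by blast
    obtain r where r: "r > 0" "compact (ci c \<inter> cball (coord c p) r)" "unc c ` (ci c \<inter> cball (coord c p) r) \<subseteq> cd c"
      "cball (fst (coord c p)) r \<subseteq> im c"
      by (rule compact_box[OF c openin_cd[OF c(1)] c(2)])
    let ?U = "unc c ` (ci c \<inter> ball (coord c p) r)"
    have "openin top ?U" by (rule openin_image[OF c(1)]) auto
    moreover have "p \<in> ?U"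
      by (rule image_eqI[of p "unc c" "coord c p"]) (use c coord_in unc_coord r(1) in simp_all)
    moreover have "(LINT p|\<mu>. deriv_along A t0 ?X f p) = 0" if "?G f" "\<And>q. q \<notin> ?U \<Longrightarrow> f q = 0" for f
    proof (rule second_derivative_C1_local[OF C _ _ c(1) coord_in[OF c(2)] r(1,2,4)])
      show "f q = 0" if "q \<notin> unc c ` (ci c \<inter> cball (coord c p) r)" for q
        using that \<open>\<And>q. q \<notin> ?U \<Longrightarrow> f q = 0\<close>[of q] ball_subset_cball[of "coord c p" r] by blast
    qed (use that in auto)
    ultimately show "\<exists>U. openin top U \<and> p \<in> U \<and> (\<forall>f. ?G f \<longrightarrow> (\<forall>q. q \<notin> U \<longrightarrow> f q = 0) \<longrightarrow> (LINT p|\<mu>. deriv_along A t0 ?X f p) = 0)"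
      by blast
  qed (use f in auto)
qed

end

section \<open>Derivatives along the fibers\<close>

context mfd
begin

text \<open>Differentiability is imposed only along the fibers, with the fiber derivative given as a
  covector \<open>\<omega> c\<close> in each chart. This is the class in which fiber primitives of
  L_vv F are found.\<close>

definition fib :: "(('m, 'n) point \<Rightarrow> real) \<Rightarrow> (('m, 'n) chart \<Rightarrow> ('m, 'n) point \<Rightarrow> real^'n) \<Rightarrow> bool" where
  "fib f \<omega> \<longleftrightarrow> (\<forall>c\<in>A. continuous_on (ci c) (lc c f) \<and> continuous_on (ci c) (lc c (\<omega> c)) \<and>
     (\<forall>q\<in>ci c. ((\<lambda>w. lc c f (fst q, w, snd (snd q))) has_derivative (\<lambda>h. lc c (\<omega> c) q \<bullet> h)) (at (fst (snd q)))))"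

definition vert :: "(('m, 'n) chart \<Rightarrow> ('m, 'n) point \<Rightarrow> real^'n) \<Rightarrow> (('m, 'n) chart \<Rightarrow> ('m, 'n) point \<Rightarrow> real^'n) \<Rightarrow> ('m, 'n) point \<Rightarrow> real" where
  "vert \<omega> W p = \<omega> (chart_at A p) p \<bullet> W (chart_at A p) p"

definition vertical :: "(('m, 'n) chart \<Rightarrow> ('m, 'n) point \<Rightarrow> real^'n) \<Rightarrow> ('m, 'n) vfield" where
  "vertical W c p = (0, W c p, 0)"

lemma fibD:
  assumes "fib f \<omega>" "c \<in> A"
  shows "continuous_on (ci c) (lc c f)" "continuous_on (ci c) (lc c (\<omega> c))"
    "q \<in> ci c \<Longrightarrow> ((\<lambda>w. lc c f (fst q, w, snd (snd q))) has_derivative (\<lambda>h. lc c (\<omega> c) q \<bullet> h)) (at (fst (snd q)))"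
  using assms unfolding fib_def by blast+

lemma fib_at:
  assumes "fib f \<omega>" "c \<in> A" "p \<in> cd c"
  shows "((\<lambda>w. lc c f (fst (coord c p), w, snd (snd p))) has_derivative (\<lambda>h. \<omega> c p \<bullet> h)) (at (fst (snd (coord c p))))"
  using fibD(3)[OF assms(1,2) coord_in[OF assms(3)]] lc_coord[OF assms(2,3), of "\<omega> c"] by (simp add: coord_def)

lemma inner_fun_eq: "(\<lambda>h. a \<bullet> h) = (\<lambda>h. b \<bullet> h) \<Longrightarrow> a = (b :: real^'n)"
  by (metis vector_eq_rdot inner_commute)

lemma fib_unique: "fib f \<omega> \<Longrightarrow> fib f \<omega>' \<Longrightarrow> c \<in> A \<Longrightarrow> p \<in> cd c \<Longrightarrow> \<omega> c p = \<omega>' c p"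
  by (rule inner_fun_eq, rule has_derivative_unique[OF fib_at fib_at])

lemma fib_eventually_0:
  assumes "fib f \<omega>" "c \<in> A" "p \<in> cd c"
    and "\<forall>\<^sub>F w in nhds (fst (snd (coord c p))). lc c f (fst (coord c p), w, snd (snd p)) = 0"
  shows "\<omega> c p = 0"
proof -
  have "((\<lambda>w. 0) has_derivative (\<lambda>h. \<omega> c p \<bullet> h)) (at (fst (snd (coord c p))))"
    by (rule has_derivative_transform_eventually[OF fib_at[OF assms(1-3)]])
      (use assms(4) eventually_nhds_x_imp_x in \<open>auto simp: eventually_at_filter elim: eventually_mono\<close>)
  from has_derivative_unique[OF this has_derivative_const]
  show ?thesis by (intro inner_fun_eq) simp
qed

lemma fib_0:
  assumes "fib f \<omega>" "c \<in> A" "p \<in> cd c" "openin top U" "p \<in> U" "\<And>q. q \<in> U \<Longrightarrow> f q = 0"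
  shows "\<omega> c p = 0"
proof (rule fib_eventually_0[OF assms(1-3)])
  let ?q = "coord c p"
  obtain S where S: "open S" "{q \<in> ci c. unc c q \<in> U} = ci c \<inter> S"
    using openin_chart[OF assms(4,2)] by (auto simp: openin_open)
  define m where "m = (\<lambda>w :: real^'n. (fst ?q, w, snd (snd p)))"
  have mc: "m w \<in> ci c" for w using coord_in[OF assms(3)] by (simp add: m_def ci_iff coord_def)
  have "?q = m (fst (snd ?q))" by (simp add: m_def coord_def)
  moreover have "?q \<in> {q \<in> ci c. unc c q \<in> U}" using coord_in[OF assms(3)] unc_coord[OF assms(2,3)] assms(5) by simp
  then have "?q \<in> S" unfolding S(2) by simp
  ultimately have "fst (snd ?q) \<in> m -` S" by simp
  moreover have "open (m -` S)" unfolding m_def by (intro open_vimage S(1) continuous_intros)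
  ultimately have "\<forall>\<^sub>F w in nhds (fst (snd ?q)). w \<in> m -` S" by (intro eventually_nhds_in_open)
  then have "\<forall>\<^sub>F w in nhds (fst (snd ?q)). lc c f (m w) = 0"
  proof (rule eventually_mono)
    fix w assume "w \<in> m -` S"
    then have "m w \<in> ci c \<inter> S" using mc[of w] by simp
    then have "unc c (m w) \<in> U" unfolding S(2)[symmetric] by simp
    then show "lc c f (m w) = 0" using assms(6) by (simp add: loc_def)
  qed
  then show "\<forall>\<^sub>F w in nhds (fst (snd ?q)). lc c f (fst ?q, w, snd (snd p)) = 0" by (simp add: m_def)
qed

lemma fib_end:
  assumes "fib f \<omega>" "c \<in> A" "p \<in> cd c" "vanishes_at_ends A t0 f" "snd (snd p) = 0 \<or> snd (snd p) = t0"
  shows "\<omega> c p = 0"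
proof (rule fib_eventually_0[OF assms(1-3)], rule always_eventually, rule allI)
  fix w :: "real^'n"
  let ?q = "(fst (coord c p), w, snd (snd p))"
  have q: "?q \<in> ci c" using coord_in[OF assms(3)] by (simp add: ci_iff coord_def)
  then show "lc c f ?q = 0"
    using assms(4,5) cd_TM[OF unc_in[OF assms(2) q]] unfolding vanishes_at_ends_def loc_def unc_eq[OF assms(2) q]
    by fastforce
qed

text \<open>Transition maps are linear on fibers, so a fiber derivative transforms as a covector and
  its pairing with a vertical field is independent of the chart.\<close>

lemma fib_J:
  assumes "fib f \<omega>" "c \<in> A" "d \<in> A" "p \<in> cd c" "p \<in> cd d"
  shows "\<omega> c p \<bullet> h = \<omega> d p \<bullet> J c d (fst (coord c p)) h"
proof -
  let ?q = "coord c p"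
  let ?y = "fst ?q"
  have q: "?q \<in> OV c d" using coord_OV assms by blast
  then have y: "?y \<in> ov c d" by (auto simp: OV_def)
  have Tq: "coord d p = T c d ?q" using T_coord[OF assms(2-5)] by simp
  have JD: "(J c d ?y has_derivative J c d ?y) (at w)" for w
    using linear_J[OF assms(2,3) y] by (simp add: linear_imp_has_derivative)
  have "((\<lambda>w. lc d f (fst (coord d p), w, snd (snd p))) has_derivative (\<lambda>h. \<omega> d p \<bullet> h)) (at (J c d ?y (fst (snd ?q))))"
    using fib_at[OF assms(1,3,5)] Tq by (simp add: T_def)
  from has_derivative_compose[OF JD this]
  have "((\<lambda>w. lc d f (fst (coord d p), J c d ?y w, snd (snd p))) has_derivative (\<lambda>h. \<omega> d p \<bullet> J c d ?y h)) (at (fst (snd ?q)))" .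
  moreover have "lc d f (fst (coord d p), J c d ?y w, snd (snd p)) = lc c f (?y, w, snd (snd p))" for w
  proof -
    have "(?y, w, snd (snd p)) \<in> OV c d" using q by (auto simp: OV_def coord_def)
    from lc_T[OF assms(2,3) this, of f] show ?thesis using Tq by (simp add: T_def)
  qed
  ultimately have "((\<lambda>w. lc c f (?y, w, snd (snd p))) has_derivative (\<lambda>h. \<omega> d p \<bullet> J c d ?y h)) (at (fst (snd ?q)))" by simp
  from has_derivative_unique[OF fib_at[OF assms(1,2,4)] this] show ?thesis by (rule fun_cong)
qed

lemma vertical_cov:
  assumes "cov (vertical W) p" "c \<in> A" "d \<in> A" "p \<in> cd c" "p \<in> cd d"
  shows "W d p = J c d (fst (coord c p)) (W c p)"
proof -
  have y: "fst (coord c p) \<in> ov c d" using coord_OV[OF assms(2,4,5)] by (auto simp: OV_def)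
  have "linear (J2 c d (fst (coord c p)) (fst (snd (coord c p))))"
    using J2_deriv[OF assms(2,3) y] has_derivative_linear by blast
  then have "J2 c d (fst (coord c p)) (fst (snd (coord c p))) 0 = 0" by (rule linear_0)
  moreover have "vertical W d p = DT c d (coord c p) (vertical W c p)"
    using assms unfolding cov_def by blast
  ultimately show ?thesis by (simp add: vertical_def DT_def)
qed

lemma vert_chart:
  assumes "fib f \<omega>" "cov (vertical W) p" "c \<in> A" "p \<in> cd c"
  shows "vert \<omega> W p = \<omega> c p \<bullet> W c p"
proof -
  have d: "p \<in> cd (chart_at A p)" using chart_at_cd cd_TM[OF assms(4)] by blast
  show ?thesis unfolding vert_def
    using fib_J[OF assms(1,3) chart_at(1) assms(4) d] vertical_cov[OF assms(2,3) chart_at(1) assms(4) d] by simp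
qed

lemma Basis_expand_fst_snd:
  fixes x :: "'n coords" shows "(\<Sum>b\<in>Basis. (x \<bullet> b) * (v \<bullet> fst (snd b))) = v \<bullet> fst (snd x)"
proof -
  have "linear (\<lambda>x :: 'n coords. v \<bullet> fst (snd x))"
    by (intro linearI) (simp_all add: inner_add_right)
  from linear_sum[OF this, of "\<lambda>b. (x \<bullet> b) *\<^sub>R b" Basis]
  show ?thesis by (simp add: euclidean_representation)
qed

definition vgrad :: "(('m, 'n) point \<Rightarrow> real) \<Rightarrow> ('m, 'n) chart \<Rightarrow> ('m, 'n) point \<Rightarrow> real^'n" where
  "vgrad f c p = (\<chi> i. dir_deriv (ci c) (lc c f) (dir_v i) (coord c p))"

lemma linear_dir_v:
  fixes D :: "'n coords \<Rightarrow> real"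
  assumes "linear D" shows "D (0, h, 0) = (\<chi> i. D (dir_v i)) \<bullet> h"
proof -
  have "linear (\<lambda>h. D (0, h, 0))"
    using linear_compose[OF _ assms, of "\<lambda>h. (0, h, 0)"] by (simp add: o_def linear_iff)
  from linear_expand[OF this, of h] have "D (0, h, 0) = (\<Sum>i\<in>UNIV. h $ i *\<^sub>R D (dir_v i))" .
  also have "\<dots> = (\<chi> i. D (dir_v i)) \<bullet> h" by (simp add: inner_vec_def mult.commute)
  finally show ?thesis .
qed

lemma C1_fib:
  assumes f: "Ck_TMI A t0 (Suc 0) f" shows "fib f (vgrad f)"
  unfolding fib_def
proof (intro ballI conjI)
  fix c assume c: "c \<in> A"
  have fc: "Ck_on (Suc 0) (lc c f) (ci c)" using f c by (simp add: Ck_TMI_def)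
  then show "continuous_on (ci c) (lc c f)" using Ck_on_imp_continuous by blast
  have "continuous_on (ci c) (\<lambda>q. \<chi> i. dir_deriv (ci c) (lc c f) (dir_v i) q)"
    using Ck_on_frechet(2)[OF fc thick_ci[OF c]] by (intro continuous_on_vec_lambda) simp
  then show "continuous_on (ci c) (lc c (vgrad f c))"
    by (rule continuous_on_eq) (simp add: loc_def vgrad_def coord_unc[OF c])
  fix q assume q: "q \<in> ci c"
  let ?D = "frechet_derivative (lc c f) (at q within ci c)"
  have D: "(lc c f has_derivative ?D) (at q within ci c)" using lc_deriv[OF f c q] .
  have "((\<lambda>w. (fst q, w, snd (snd q))) has_derivative (\<lambda>h. (0, h, 0))) (at (fst (snd q)) within UNIV)"
    by (intro has_derivative_Pair has_derivative_const has_derivative_ident)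
  moreover have "(lc c f has_derivative ?D) (at (fst q, fst (snd q), snd (snd q)) within (\<lambda>w. (fst q, w, snd (snd q))) ` UNIV)"
  proof (rule has_derivative_subset)
    show "(lc c f has_derivative ?D) (at (fst q, fst (snd q), snd (snd q)) within ci c)" using D by simp
    show "range (\<lambda>w. (fst q, w, snd (snd q))) \<subseteq> ci c" using q by (auto simp: ci_iff)
  qed
  ultimately have "((\<lambda>w. lc c f (fst q, w, snd (snd q))) has_derivative (\<lambda>h. ?D (0, h, 0))) (at (fst (snd q)))"
    using diff_chain_within by (fastforce simp: o_def)
  moreover have "?D (0, h, 0) = lc c (vgrad f c) q \<bullet> h" for h
    using linear_dir_v[OF has_derivative_linear[OF D], of h] by (simp add: loc_def vgrad_def coord_unc[OF c q])
  ultimately show "((\<lambda>w. lc c f (fst q, w, snd (snd q))) has_derivative (\<lambda>h. lc c (vgrad f c) q \<bullet> h)) (at (fst (snd q)))"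
    by simp
qed

lemma deriv_along_vertical:
  assumes f: "Ck_TMI A t0 (Suc 0) f" and p: "p \<in> TM"
  shows "deriv_along A t0 (vertical W) f p = vert (vgrad f) W p"
  using linear_dir_v[OF has_derivative_linear[OF lc_deriv_at[OF f p]], of "W (chart_at A p) p"]
  unfolding deriv_along_frechet vertical_def vert_def vgrad_def by simp

lemma fib_add:
  assumes "fib f \<omega>" "fib g \<omega>'" shows "fib (\<lambda>p. f p + g p) (\<lambda>c p. \<omega> c p + \<omega>' c p)"
  unfolding fib_def
proof (intro ballI conjI)
  fix c assume c: "c \<in> A"
  note f = fibD[OF assms(1) c] and g = fibD[OF assms(2) c]
  show "continuous_on (ci c) (lc c (\<lambda>p. f p + g p))"
    using continuous_on_add[OF f(1) g(1)] by (simp add: loc_def[abs_def])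
  show "continuous_on (ci c) (lc c (\<lambda>p. \<omega> c p + \<omega>' c p))"
    using continuous_on_add[OF f(2) g(2)] by (simp add: loc_def[abs_def])
  fix q assume q: "q \<in> ci c"
  show "((\<lambda>w. lc c (\<lambda>p. f p + g p) (fst q, w, snd (snd q))) has_derivative (\<lambda>h. lc c (\<lambda>p. \<omega> c p + \<omega>' c p) q \<bullet> h)) (at (fst (snd q)))"
    using has_derivative_add[OF f(3)[OF q] g(3)[OF q]] by (simp add: loc_def inner_add_left)
qed

lemma fib_mult:
  assumes "fib f \<omega>" "fib g \<omega>'" shows "fib (\<lambda>p. f p * g p) (\<lambda>c p. f p *\<^sub>R \<omega>' c p + g p *\<^sub>R \<omega> c p)"
  unfolding fib_def
proof (intro ballI conjI)
  fix c assume c: "c \<in> A"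
  note f = fibD[OF assms(1) c] and g = fibD[OF assms(2) c]
  show "continuous_on (ci c) (lc c (\<lambda>p. f p * g p))"
    using continuous_on_mult[OF f(1) g(1)] by (simp add: loc_def[abs_def])
  show "continuous_on (ci c) (lc c (\<lambda>p. f p *\<^sub>R \<omega>' c p + g p *\<^sub>R \<omega> c p))"
    using continuous_on_add[OF continuous_on_scaleR[OF f(1) g(2)] continuous_on_scaleR[OF g(1) f(2)]]
    by (simp add: loc_def[abs_def])
  fix q assume q: "q \<in> ci c"
  show "((\<lambda>w. lc c (\<lambda>p. f p * g p) (fst q, w, snd (snd q))) has_derivative
      (\<lambda>h. lc c (\<lambda>p. f p *\<^sub>R \<omega>' c p + g p *\<^sub>R \<omega> c p) q \<bullet> h)) (at (fst (snd q)))"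
    using has_derivative_mult[OF f(3)[OF q] g(3)[OF q]] by (simp add: loc_def inner_add_left mult.commute)
qed

end

context mfdm
begin

lemma vert_integrable:
  assumes f: "fib f \<omega>" and W: "nice (vertical W)"
  shows "integrable \<mu> (vert \<omega> W)"
proof (rule nice_integrable(1)[OF W])
  show "continuous_on (ci c) (\<lambda>q. lc c (\<omega> c) q \<bullet> fst (snd b))" if "c \<in> A" "b \<in> Basis" for c and b :: "'n coords"
    by (intro continuous_intros fibD(2)[OF f that(1)])
  show "vert \<omega> W p = (\<Sum>b\<in>Basis. (vertical W c p \<bullet> b) * (lc c (\<omega> c) (coord c p) \<bullet> fst (snd b)))"
    if "c \<in> A" "p \<in> cd c" for c p
  proof -
    have "cov (vertical W) p" using W cd_TM[OF that(2)] unfolding nice_def by blast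
    from vert_chart[OF f this that]
    show ?thesis unfolding Basis_expand_fst_snd by (simp add: vertical_def that)
  qed
qed

lemma vert_0:
  assumes "fib f \<omega>" "openin top U" "p \<in> U" "\<And>q. q \<in> U \<Longrightarrow> f q = 0"
  shows "vert \<omega> W p = 0"
proof -
  have "p \<in> TM" using assms(2,3) openin_subset topspace_top by blast
  from fib_0[OF assms(1) chart_at(1) chart_at_cd[OF this] assms(2,3,4)]
  show ?thesis by (simp add: vert_def)
qed

lemma openin_time: 
  fixes S :: "real set"
  assumes "open S" shows "openin top {p \<in> TM. snd (snd p) \<in> S}"
  unfolding openin_TMI_top
proof (intro conjI ballI)
  fix c assume c: "c \<in> A"
  have eq: "{q \<in> ci c. unc c q \<in> {p \<in> TM. snd (snd p) \<in> S}} = ci c \<inter> (\<lambda>q. snd (snd q)) -` S"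
    using cd_TM[OF unc_in[OF c]] by (simp add: set_eq_iff unc_eq[OF c] cong: conj_cong)
  show "openin (top_of_set (ci c)) {q \<in> ci c. unc c q \<in> {p \<in> TM. snd (snd p) \<in> S}}"
    unfolding eq by (intro continuous_openin_preimage_gen assms continuous_intros)
qed auto

text \<open>A function of time has no fiber derivative, so multiplying by \<open>theta n\<close>
  merely multiplies the integrand. In the limit the ends contribute nothing, since a function
  vanishing on a whole fiber has fiber derivative 0 there.\<close>

lemma vert_interior_reduction:
  assumes W: "nice (vertical W)"
    and loc: "\<And>p. p \<in> supp \<Longrightarrow> 0 < snd (snd p) \<Longrightarrow> snd (snd p) < t0 \<Longrightarrow>
      \<exists>U. openin top U \<and> p \<in> U \<and> (\<forall>f \<omega>. fib f \<omega> \<longrightarrow> (\<forall>q. q \<notin> U \<longrightarrow> f q = 0) \<longrightarrow> (LINT p|\<mu>. vert \<omega> W p) = 0)"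
    and f: "fib f \<omega>" "vanishes_at_ends A t0 f"
  shows "(LINT p|\<mu>. vert \<omega> W p) = 0"
proof -
  \<comment> \<open>\<open>localize\<close> works with functionals of \<open>f\<close> alone. The
    chosen fiber derivative agrees with any other one, by uniqueness of derivatives on the open
    fibers.\<close>
  define \<Lambda> where "\<Lambda> f = (LINT p|\<mu>. vert (SOME \<omega>. fib f \<omega>) W p)" for f
  have \<Lambda>: "\<Lambda> f = (LINT p|\<mu>. vert \<omega> W p)" if "fib f \<omega>" for f \<omega>
    unfolding \<Lambda>_def
  proof (rule Bochner_Integration.integral_cong[OF refl])
    fix p assume "p \<in> space \<mu>"
    then have p: "p \<in> TM" by (simp add: space_mu)
    show "vert (SOME \<omega>. fib f \<omega>) W p = vert \<omega> W p"
      using fib_unique[OF someI[of "fib f", OF that] that chart_at(1) chart_at_cd[OF p]] by (simp add: vert_def)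
  qed
  have C1: "Ck_TMI A t0 (Suc 0) u" if "smooth_TMI A t0 u" for u using that unfolding smooth_TMI_def by blast
  \<comment> \<open>First the functions carried by times in [1/n, t0 - 1/n]; this class is stable
    under multiplication by smooth functions, as \<open>localize\<close> demands.\<close>
  have van: "\<Lambda> f = 0" if n: "n > 0" and f: "\<exists>\<omega>. fib f \<omega>" "\<And>p. \<not> (1 / n \<le> snd (snd p) \<and> snd (snd p) \<le> t0 - 1 / n) \<Longrightarrow> f p = 0"
    for n :: nat and f
  proof -
    let ?G = "\<lambda>f. (\<exists>\<omega>. fib f \<omega>) \<and> (\<forall>p. \<not> (1 / n \<le> snd (snd p) \<and> snd (snd p) \<le> t0 - 1 / n) \<longrightarrow> f p = 0)"
    show ?thesis
    proof (rule localize[where S=supp and G="?G" and \<Lambda>=\<Lambda>, OF supp_compact])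
      fix f u assume f: "?G f" and u: "smooth_TMI A t0 u"
      then obtain \<omega> where "fib f \<omega>" by blast
      from fib_mult[OF C1_fib[OF C1[OF u]] this] f show "?G (\<lambda>p. u p * f p)" by auto
    next
      fix f g assume "?G f" "?G g"
      then obtain \<omega> \<omega>' where w: "fib f \<omega>" "fib g \<omega>'" by blast
      have "\<Lambda> (\<lambda>p. f p + g p) = (LINT p|\<mu>. vert \<omega> W p + vert \<omega>' W p)"
      proof -
        have e: "vert (\<lambda>c p. \<omega> c p + \<omega>' c p) W = (\<lambda>p. vert \<omega> W p + vert \<omega>' W p)"
          by (simp add: fun_eq_iff vert_def inner_add_left)
        show ?thesis unfolding \<Lambda>[OF fib_add[OF w]] by (simp only: e)
      qed
      also have "\<dots> = \<Lambda> f + \<Lambda> g"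
        unfolding \<Lambda>[OF w(1)] \<Lambda>[OF w(2)] by (rule Bochner_Integration.integral_add[OF vert_integrable[OF w(1) W] vert_integrable[OF w(2) W]])
      finally show "\<Lambda> (\<lambda>p. f p + g p) = \<Lambda> f + \<Lambda> g" .
    next
      fix f U assume f: "?G f" and U: "openin top U" "supp \<subseteq> U" and z: "\<And>p. p \<in> U \<Longrightarrow> f p = 0"
      obtain \<omega> where w: "fib f \<omega>" using f by blast
      have "vert \<omega> W p = 0" if "p \<in> supp" for p
        by (rule vert_0[OF w U(1) _ z]) (use U(2) that in blast)+
      then have "AE p in \<mu>. vert \<omega> W p = 0" using AE_supp by (auto elim: AE_mp)
      then show "\<Lambda> f = 0" unfolding \<Lambda>[OF w] by (rule integral_eq_zero_AE)
    next
      fix p assume p: "p \<in> supp"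
      then have pT: "p \<in> TM" using supp_TM by blast
      show "\<exists>U. openin top U \<and> p \<in> U \<and> (\<forall>f. ?G f \<longrightarrow> (\<forall>q. q \<notin> U \<longrightarrow> f q = 0) \<longrightarrow> \<Lambda> f = 0)"
      proof (cases "0 < snd (snd p) \<and> snd (snd p) < t0")
        case True
        then obtain U where "openin top U" "p \<in> U" "\<forall>f \<omega>. fib f \<omega> \<longrightarrow> (\<forall>q. q \<notin> U \<longrightarrow> f q = 0) \<longrightarrow> (LINT p|\<mu>. vert \<omega> W p) = 0"
          using loc[OF p] by blast
        then have "openin top U \<and> p \<in> U \<and> (\<forall>f. ?G f \<longrightarrow> (\<forall>q. q \<notin> U \<longrightarrow> f q = 0) \<longrightarrow> \<Lambda> f = 0)"
          using \<Lambda> by auto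
        then show ?thesis by blast
      next
        case False
        let ?U = "{p \<in> TM. snd (snd p) \<in> {..<1/n} \<union> {t0 - 1/n<..}}"
        have "snd (snd p) \<in> {..<1/n} \<union> {t0 - 1/n<..}" using False n pT by (auto simp: TM_iff)
        then have "p \<in> ?U" using pT by blast
        moreover have "openin top ?U" by (rule openin_time) auto
        moreover have "\<Lambda> f = 0" if Gf: "?G f" and fU: "\<And>q. q \<notin> ?U \<Longrightarrow> f q = 0" for f
        proof -
          have "f q = 0" for q
          proof (cases "q \<in> ?U")
            case True
            then have "\<not> (1 / n \<le> snd (snd q) \<and> snd (snd q) \<le> t0 - 1 / n)" by auto
            then show ?thesis using Gf by blast
          qed (use fU in blast)
          then have f0: "f = (\<lambda>p. 0)" by blast
          obtain \<omega> where w: "fib f \<omega>" using Gf by blast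
          have "vert \<omega> W q = 0" if "q \<in> space \<mu>" for q
            by (rule vert_0[OF w openin_topspace]) (use that f0 in \<open>simp_all add: space_mu topspace_top\<close>)
          then show ?thesis unfolding \<Lambda>[OF w] by (simp cong: Bochner_Integration.integral_cong)
        qed
        ultimately show ?thesis by blast
      qed
    qed (use f in blast)
  qed
  define F where "F n p = theta n (snd (snd p)) * f p" for n and p :: "('m, 'n) point"
  have thC: "Ck_TMI A t0 (Suc 0) (\<lambda>p. theta n (snd (snd p)))" for n by (intro Ck_TMI_time Ck_theta)
  have Ff: "fib (F n) (\<lambda>c p. theta n (snd (snd p)) *\<^sub>R \<omega> c p + f p *\<^sub>R vgrad (\<lambda>p. theta n (snd (snd p))) c p)" for n
    unfolding F_def using fib_mult[OF C1_fib[OF thC] f(1)] .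
  have vF: "vert (\<lambda>c p. theta n (snd (snd p)) *\<^sub>R \<omega> c p + f p *\<^sub>R vgrad (\<lambda>p. theta n (snd (snd p))) c p) W p
      = theta n (snd (snd p)) * vert \<omega> W p" if p: "p \<in> TM" for n p
  proof -
    have "deriv_along A t0 (vertical W) (\<lambda>p. theta n (snd (snd p))) p = 0"
      using deriv_along_time[OF p theta_deriv] by (simp add: vertical_def)
    then have "vert (vgrad (\<lambda>p. theta n (snd (snd p)))) W p = 0" using deriv_along_vertical[OF thC p] by simp
    then show ?thesis by (simp add: vert_def inner_add_left)
  qed
  have int0: "(LINT p|\<mu>. theta (Suc n) (snd (snd p)) * vert \<omega> W p) = 0" for n
  proof -
    have "\<Lambda> (F (Suc n)) = 0"
    proof (rule van[of "Suc n"])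
      show "F (Suc n) p = 0" if "\<not> (1 / real (Suc n) \<le> snd (snd p) \<and> snd (snd p) \<le> t0 - 1 / real (Suc n))" for p
        using theta_support[of "Suc n" "snd (snd p)"] that unfolding F_def by auto
    qed (use Ff in blast)+
    then have "(LINT p|\<mu>. vert (\<lambda>c p. theta (Suc n) (snd (snd p)) *\<^sub>R \<omega> c p + f p *\<^sub>R vgrad (\<lambda>p. theta (Suc n) (snd (snd p))) c p) W p) = 0"
      unfolding \<Lambda>[OF Ff] .
    moreover have "(LINT p|\<mu>. vert (\<lambda>c p. theta (Suc n) (snd (snd p)) *\<^sub>R \<omega> c p + f p *\<^sub>R vgrad (\<lambda>p. theta (Suc n) (snd (snd p))) c p) W p)
        = (LINT p|\<mu>. theta (Suc n) (snd (snd p)) * vert \<omega> W p)"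
      by (rule Bochner_Integration.integral_cong[OF refl]) (simp add: space_mu vF)
    ultimately show ?thesis by simp
  qed
  note iV = vert_integrable[OF f(1) W]
  have "(\<lambda>n. LINT p|\<mu>. theta (Suc n) (snd (snd p)) * vert \<omega> W p) \<longlonglongrightarrow> (LINT p|\<mu>. vert \<omega> W p)"
  proof (rule integral_dominated_convergence[where w="\<lambda>p. \<bar>vert \<omega> W p\<bar>"])
    show "vert \<omega> W \<in> borel_measurable \<mu>" using iV by simp
    show "(\<lambda>p. theta (Suc n) (snd (snd p)) * vert \<omega> W p) \<in> borel_measurable \<mu>" for n
    proof -
      have "vert (\<lambda>c p. theta (Suc n) (snd (snd p)) *\<^sub>R \<omega> c p + f p *\<^sub>R vgrad (\<lambda>p. theta (Suc n) (snd (snd p))) c p) W \<in> borel_measurable \<mu>"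
        using vert_integrable[OF Ff W] by simp
      then show ?thesis by (rule measurable_cong[THEN iffD1, rotated]) (simp add: space_mu vF)
    qed
    show "integrable \<mu> (\<lambda>p. \<bar>vert \<omega> W p\<bar>)" using iV by simp
    show "AE p in \<mu>. norm (theta (Suc n) (snd (snd p)) * vert \<omega> W p) \<le> \<bar>vert \<omega> W p\<bar>" for n
    proof (rule AE_I2)
      fix p
      have "\<bar>theta (Suc n) (snd (snd p))\<bar> * \<bar>vert \<omega> W p\<bar> \<le> 1 * \<bar>vert \<omega> W p\<bar>"
        using theta_range[of "Suc n" "snd (snd p)"] by (intro mult_right_mono) auto
      then show "norm (theta (Suc n) (snd (snd p)) * vert \<omega> W p) \<le> \<bar>vert \<omega> W p\<bar>" by (simp add: abs_mult)
    qed
    show "AE p in \<mu>. (\<lambda>n. theta (Suc n) (snd (snd p)) * vert \<omega> W p) \<longlonglongrightarrow> vert \<omega> W p"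
    proof (rule AE_I2)
      fix p assume "p \<in> space \<mu>"
      then have p: "p \<in> TM" by (simp add: space_mu)
      show "(\<lambda>n. theta (Suc n) (snd (snd p)) * vert \<omega> W p) \<longlonglongrightarrow> vert \<omega> W p"
      proof (cases "0 < snd (snd p) \<and> snd (snd p) < t0")
        case True
        then have "\<forall>\<^sub>F n in sequentially. theta n (snd (snd p)) * vert \<omega> W p = vert \<omega> W p"
          using eventually_mono[OF theta_eventually[of "snd (snd p)"]] by simp
        then show ?thesis by (rule LIMSEQ_Suc[OF tendsto_eventually])
      next
        case False
        then have "snd (snd p) = 0 \<or> snd (snd p) = t0" using p by (auto simp: TM_iff)
        from fib_end[OF f(1) chart_at(1) chart_at_cd[OF p] f(2) this]
        show ?thesis by (simp add: vert_def)
      qed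
    qed
  qed
  then show ?thesis using int0 by (simp add: LIMSEQ_const_iff)
qed

lemma dir_v_Basis: "range dir_v \<subseteq> (Basis :: 'n coords set)"
  by (auto simp: Basis_prod_def Basis_vec_def)

lemma Basis_not_dir_v: "b \<in> Basis - range dir_v \<Longrightarrow> fst (snd b) = (0 :: real^'n)"
  by (auto simp: Basis_prod_def Basis_vec_def)

text \<open>Near an interior point the function is extended by zero to the whole coordinate space.
  It has continuous derivatives in the fiber basis directions, which are the only ones in which a
  vertical field has components, so it can be mollified as in
  \<open>integral_interior\<close>.\<close>

lemma vert_smooth_vanish:
  assumes W: "nice (vertical W)"
    and sm: "\<And>f. smooth_TMI A t0 f \<Longrightarrow> vanishes_at_ends A t0 f \<Longrightarrow> (LINT p|\<mu>. deriv_along A t0 (vertical W) f p) = 0"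
    and f: "fib f \<omega>" "vanishes_at_ends A t0 f"
  shows "(LINT p|\<mu>. vert \<omega> W p) = 0"
proof (rule vert_interior_reduction[OF W _ f])
  fix p assume p: "p \<in> supp" "0 < snd (snd p)" "snd (snd p) < t0"
  then have pT: "p \<in> TM" using supp_TM by blast
  obtain c where c: "c \<in> A" "p \<in> cd c" using exists_cd[OF pT] by blast
  let ?U0 = "{p \<in> TM. snd (snd p) \<in> {0<..<t0}}"
  have U0: "openin top ?U0" by (rule openin_time) auto
  have pU0: "p \<in> ?U0" using p pT by simp
  obtain r where r: "r > 0" "compact (ci c \<inter> cball (coord c p) r)" "unc c ` (ci c \<inter> cball (coord c p) r) \<subseteq> ?U0"
    "cball (fst (coord c p)) r \<subseteq> im c"
    by (rule compact_box[OF c U0 pU0])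
  define K where "K = ci c \<inter> cball (coord c p) r"
  have K: "compact K" "K \<subseteq> ci c" using r by (auto simp: K_def)
  have KI: "K \<subseteq> interior_img c"
  proof
    fix q assume q: "q \<in> K"
    then have "unc c q \<in> ?U0" using r(3) unfolding K_def by blast
    moreover have qc: "q \<in> ci c" using q K(2) by blast
    ultimately have "0 < snd (snd q)" "snd (snd q) < t0" by (simp_all add: unc_eq[OF c(1) qc])
    moreover have "fst q \<in> im c" using qc by (simp add: ci_iff)
    ultimately show "q \<in> interior_img c" by (cases q) auto
  qed
  let ?U = "unc c ` (ci c \<inter> ball (coord c p) r)"
  have "openin top ?U" by (rule openin_image[OF c(1)]) auto
  moreover have "p \<in> ?U"
    by (rule image_eqI[of p "unc c" "coord c p"]) (use c coord_in unc_coord r(1) in simp_all)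
  moreover have "(LINT p|\<mu>. vert \<omega> W p) = 0" if fo: "fib f \<omega>" and fU: "\<And>q. q \<notin> ?U \<Longrightarrow> f q = 0" for f \<omega>
  proof -
    have f0: "f q = 0" if "q \<notin> unc c ` K" for q
      using fU[of q] that ball_subset_cball[of "coord c p" r] unfolding K_def by blast
    have TK: "openin top (TM - unc c ` K)"
      using closedin_unc[OF c(1) K] by (simp add: closedin_def topspace_top)
    have off: "unc c q \<in> TM - unc c ` K" if q: "q \<in> ci c" "q \<notin> K" for q
    proof -
      have "unc c q \<noteq> unc c z" if "z \<in> K" for z
      proof
        assume "unc c q = unc c z"
        then have "q = z" using coord_unc[OF c(1) q(1)] coord_unc[OF c(1), of z] K(2) that by auto
        then show False using q(2) that by simp
      qed
      then show ?thesis using cd_TM[OF unc_in[OF c(1) q(1)]] by blast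
    qed
    define g where "g q = (if q \<in> ci c then lc c f q else 0)" for q
    define g' where "g' b q = (if q \<in> ci c then lc c (\<omega> c) q \<bullet> fst (snd b) else 0)" for b q :: "'n coords"
    have g0: "g q = 0" if q: "q \<notin> K" for q
      using off[of q] f0[of "unc c q"] q by (auto simp: g_def loc_def)
    have g'0: "g' b q = 0" if q: "q \<notin> K" for b q
    proof (cases "q \<in> ci c")
      case True
      have "\<omega> c (unc c q) = 0"
        by (rule fib_0[OF fo c(1) unc_in[OF c(1) True] TK off[OF True q]]) (use f0 in blast)
      then show ?thesis by (simp add: g'_def loc_def)
    qed (simp add: g'_def)
    \<comment> \<open>The interior of the chart image and the complement of \<open>K\<close> are
      open and cover the whole space.\<close>
    have contI: "continuous_on UNIV h" if h: "\<And>q. q \<notin> K \<Longrightarrow> h q = 0" "continuous_on (ci c) h'" "\<And>q. q \<in> ci c \<Longrightarrow> h' q = h q"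
      for h h' :: "'n coords \<Rightarrow> real"
    proof -
      have "Ck_on 0 h UNIV"
      proof (rule Ck_on_local[OF thick_UNIV])
        fix q :: "'n coords"
        show "\<exists>U. openin (top_of_set UNIV) U \<and> q \<in> U \<and> Ck_on 0 h U"
        proof (cases "q \<in> interior_img c")
          case True
          have "Ck_on 0 h (interior_img c)"
            by (rule Ck_on_cong[of 0 h']) (use h continuous_on_subset[OF h(2) interior_img_subset] interior_img_subset[of c] in \<open>simp, blast\<close>)
          then show ?thesis using True open_interior_img[OF c(1)] by (intro exI[of _ "interior_img c"]) simp
        next
          case False
          then have "q \<in> - K" using KI by blast
          moreover have "Ck_on 0 h (- K)"
            by (rule Ck_on_cong[OF Ck_on_const[where c=0]]) (simp add: h(1))
          ultimately show ?thesis using compact_imp_closed[OF K(1)] by (intro exI[of _ "- K"]) (simp add: open_Compl)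
        qed
      qed
      then show ?thesis by simp
    qed
    have gc: "continuous_on UNIV g"
    proof (rule contI[of g "lc c f"])
      show "g q = 0" if "q \<notin> K" for q using g0[OF that] .
      show "lc c f q = g q" if "q \<in> ci c" for q using that by (simp add: g_def)
    qed (rule fibD(1)[OF fo c(1)])
    have g'c: "continuous_on UNIV (g' b)" for b
    proof (rule contI[of "g' b" "\<lambda>q. lc c (\<omega> c) q \<bullet> fst (snd b)"])
      show "g' b q = 0" if "q \<notin> K" for q using g'0[OF that] .
      show "lc c (\<omega> c) q \<bullet> fst (snd b) = g' b q" if "q \<in> ci c" for q using that by (simp add: g'_def)
    qed (intro continuous_intros fibD(2)[OF fo c(1)])
    have dg: "((\<lambda>s. g (q + s *\<^sub>R b)) has_real_derivative g' b q) (at 0)" if b: "b \<in> range dir_v" for b q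
    proof (cases "q \<in> K")
      case True
      then have qc: "q \<in> ci c" using K(2) by blast
      obtain i where i: "b = dir_v i" using b by blast
      have "q + s *\<^sub>R b \<in> ci c" for s using qc by (simp add: ci_iff i)
      moreover have "q + s *\<^sub>R b = (fst q, fst (snd q) + s *\<^sub>R axis i 1, snd (snd q))" for s
        by (cases q) (simp add: i)
      ultimately have "g (q + s *\<^sub>R b) = lc c f (fst q, fst (snd q) + s *\<^sub>R axis i 1, snd (snd q))" for s
        by (simp add: g_def)
      then show ?thesis
        using has_derivative_along_line[OF fibD(3)[OF fo c(1) qc], of "axis i 1"] by (simp add: g'_def qc i)
    next
      case False
      have "open ((\<lambda>s. q + s *\<^sub>R b) -` (- K))"
        by (intro open_vimage continuous_intros) (use compact_imp_closed[OF K(1)] in auto)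
      then have "\<forall>\<^sub>F s in nhds 0. s \<in> (\<lambda>s. q + s *\<^sub>R b) -` (- K)"
        by (intro eventually_nhds_in_open) (use False in auto)
      then have ev: "\<forall>\<^sub>F s in nhds 0. g (q + s *\<^sub>R b) = 0" by (rule eventually_mono) (use g0 in auto)
      show ?thesis unfolding g'0[OF False] by (subst DERIV_cong_ev[OF refl ev refl]) simp
    qed
    have "(LINT p|\<mu>. (if p \<in> cd c then \<Sum>b\<in>range dir_v. (vertical W c p \<bullet> b) * g' b (coord c p) else 0)) = 0"
    proof (rule integral_interior[where g=g and K=K, OF W dir_v_Basis _ sm c(1) K(1) KI gc g0 dg g'c])
      show "vertical W c p \<bullet> b = 0" if "b \<in> Basis - range dir_v" for p and b :: "'n coords"
        using Basis_not_dir_v[OF that] by (cases b) (auto simp: vertical_def)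
    qed
    moreover have "(if p \<in> cd c then \<Sum>b\<in>range dir_v. (vertical W c p \<bullet> b) * g' b (coord c p) else 0) = vert \<omega> W p"
      if "p \<in> space \<mu>" for p
    proof (cases "p \<in> cd c")
      case True
      have cv: "cov (vertical W) p" using W cd_TM[OF True] unfolding nice_def by blast
      have "(\<Sum>b\<in>range dir_v. (vertical W c p \<bullet> b) * g' b (coord c p))
          = (\<Sum>b\<in>Basis. (vertical W c p \<bullet> b) * (\<omega> c p \<bullet> fst (snd b)))"
        by (rule sum.mono_neutral_cong_left)
          (use dir_v_Basis Basis_not_dir_v lc_coord[OF c(1) True, of "\<omega> c"] coord_in[OF True] in \<open>auto simp: g'_def\<close>)
      also have "\<dots> = vert \<omega> W p"
        unfolding Basis_expand_fst_snd vert_chart[OF fo cv c(1) True] by (simp add: vertical_def)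
      finally show ?thesis using True by simp
    next
      case False
      have "p \<in> TM - unc c ` K" using that False unc_in[OF c(1)] K(2) by (simp add: space_mu) blast
      from vert_0[OF fo TK this, of W] show ?thesis using f0 False by auto
    qed
    ultimately show ?thesis by (simp cong: Bochner_Integration.integral_cong)
  qed
  ultimately show "\<exists>U. openin top U \<and> p \<in> U \<and> (\<forall>f \<omega>. fib f \<omega> \<longrightarrow> (\<forall>q. q \<notin> U \<longrightarrow> f q = 0) \<longrightarrow> (LINT p|\<mu>. vert \<omega> W p) = 0)"
    by blast
qed

end

section \<open>The Euler-Lagrange field\<close>

lemma matrix_inv_mult:
  fixes M :: "real^'n^'n"
  assumes "invertible M" shows "M ** matrix_inv M = mat 1" "matrix_inv M ** M = mat 1"
proof -
  have "\<exists>A'. M ** A' = mat 1 \<and> A' ** M = mat 1" using assms by (simp add: invertible_def)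
  then show "M ** matrix_inv M = mat 1" "matrix_inv M ** M = mat 1"
    unfolding matrix_inv_def by (metis (mono_tags, lifting) someI_ex)+
qed

text \<open>Cramer's rule expresses each column of the inverse by quotients of determinants, which
  are polynomials in the entries.\<close>

lemma continuous_on_matrix_inv:
  fixes M :: "'a::topological_space \<Rightarrow> real^'n^'n"
  assumes "\<And>i j. continuous_on S (\<lambda>q. M q $ i $ j)" "\<And>q. q \<in> S \<Longrightarrow> invertible (M q)"
  shows "continuous_on S (\<lambda>q. matrix_inv (M q) $ i $ k)"
proof -
  have cd: "continuous_on S (\<lambda>q. det (N q))" if "\<And>i j. continuous_on S (\<lambda>q. N q $ i $ j)" for N :: "'a \<Rightarrow> real^'n^'n"
    unfolding det_def by (intro continuous_intros that)
  have nz: "det (M q) \<noteq> 0" if "q \<in> S" for q using assms(2)[OF that] by (simp add: invertible_det_nz)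
  have "continuous_on S (\<lambda>q. det (\<chi> a j. if j = i then axis k 1 $ a else M q $ a $ j) / det (M q))"
  proof (intro continuous_on_divide cd assms(1))
    show "continuous_on S (\<lambda>q. (\<chi> a j. if j = i then axis k 1 $ a else M q $ a $ j) $ a $ j)" for a j
      by (cases "j = i") (simp_all add: assms(1))
  qed (use nz in auto)
  then show ?thesis
  proof (rule continuous_on_eq)
    fix q assume q: "q \<in> S"
    have "M q ** matrix_inv (M q) = mat 1" using matrix_inv_mult(1)[OF assms(2)[OF q]] .
    then have "M q *v (matrix_inv (M q) *v axis k 1) = axis k 1" by (simp add: matrix_vector_mul_assoc)
    then have "matrix_inv (M q) *v axis k 1 = (\<chi> i. det (\<chi> a j. if j = i then axis k 1 $ a else M q $ a $ j) / det (M q))"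
      using cramer[OF nz[OF q]] by blast
    moreover have "(matrix_inv (M q) *v axis k 1) $ i = matrix_inv (M q) $ i $ k"
      by (simp add: matrix_vector_mult_basis column_def)
    ultimately show "det (\<chi> a j. if j = i then axis k 1 $ a else M q $ a $ j) / det (M q) = matrix_inv (M q) $ i $ k"
      by simp
  qed
qed

section \<open>Transformation laws of accelerations and of variation fields\<close>

context mfd
begin

lemma DT_vert: "c \<in> A \<Longrightarrow> d \<in> A \<Longrightarrow> q \<in> OV c d \<Longrightarrow> DT c d q (0, h, 0) = (0, J c d (fst q) h, 0)"
proof -
  assume a: "c \<in> A" "d \<in> A" "q \<in> OV c d"
  then have y: "fst q \<in> ov c d" by (auto simp: OV_def)
  have "J2 c d (fst q) (fst (snd q)) 0 = 0"
    using J2_deriv[OF a(1,2) y] has_derivative_linear linear_0 by blast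
  moreover have "J c d (fst q) 0 = 0" using linear_J[OF a(1,2) y] linear_0 by blast
  ultimately show ?thesis by (simp add: DT_def)
qed

lemma J_surj:
  assumes "c \<in> A" "d \<in> A" "p \<in> cd c" "p \<in> cd d" shows "\<exists>h. J c d (fst (coord c p)) h = k"
proof -
  have x: "fst p \<in> fst c" "fst p \<in> fst d" using assms by (auto simp: cd_iff)
  have "J c d (snd c (fst p)) (J d c (snd d (fst p)) k) = k"
    using J_comp[OF assms(2,1,2) x(2,1,2)] J_self[OF assms(2) x(2)] by simp
  then show ?thesis by (auto simp: coord_def)
qed

lemma inner_J_eq:
  assumes "c \<in> A" "d \<in> A" "p \<in> cd c" "p \<in> cd d" "\<And>h. a \<bullet> J c d (fst (coord c p)) h = b \<bullet> J c d (fst (coord c p)) h"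
  shows "a = b"
  by (rule inner_fun_eq, rule ext) (use J_surj[OF assms(1-4)] assms(5) in metis)

text \<open>Accelerations transform affinely, with an inhomogeneous term that depends on position
  and velocity alone. The difference of two accelerations is therefore a vertical vector.\<close>

lemma cov_sof:
  assumes "c \<in> A" "d \<in> A" "p \<in> cd c" "p \<in> cd d"
  shows "second_order_field C d p = DT c d (coord c p) (second_order_field C c p) \<longleftrightarrow>
    C d p = J2 c d (fst (coord c p)) (fst (snd (coord c p))) (fst (snd (coord c p))) + J c d (fst (coord c p)) (C c p)"
proof -
  have "J c d (fst (coord c p)) (fst (snd p) c) = fst (snd p) d"
    using T_coord[OF assms] by (simp add: T_def coord_def)
  then show ?thesis by (simp add: second_order_field_def DT_def coord_def)
qed

text \<open>The field integrated in \<open>hor_variation\<close>. If curves with acceleration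
  \<open>C\<close> are displaced in direction \<open>F\<close>, their velocities change by the
  derivative of \<open>F\<close> along the second order field; this is the fiber component.\<close>

definition hor :: "(('m, 'n) point \<Rightarrow> ('m, 'n) tangent) \<Rightarrow> (('m, 'n) chart \<Rightarrow> ('m, 'n) point \<Rightarrow> real^'n) \<Rightarrow> ('m, 'n) vfield" where
  "hor F C c p = (F p c, dir_deriv (ci c) (lc c (\<lambda>p. F p c)) (second_order_field C c p) (coord c p), 0)"

lemma hor_deriv:
  assumes "horizontal_map A t0 F" "c \<in> A" "q \<in> ci c"
  shows "(lc c (\<lambda>p. F p c) has_derivative frechet_derivative (lc c (\<lambda>p. F p c)) (at q within ci c)) (at q within ci c)"
  using assms Ck_on_frechet(1)[OF _ thick_ci[OF assms(2)]] unfolding horizontal_map_def One_nat_def by blast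

lemma hor_J:
  assumes "horizontal_map A t0 F" "c \<in> A" "d \<in> A" "p \<in> cd c" "p \<in> cd d"
  shows "F p d = J c d (fst (coord c p)) (F p c)"
  using assms tangent_J[of "F p" "fst p" c d] cd_TM[OF assms(4)] unfolding horizontal_map_def by (simp add: cd_iff coord_def)

text \<open>The relation between the expressions of \<open>F\<close> in two charts is differentiated
  along the second order field in two ways. This yields a \<open>J2\<close> term with arguments (F,
  v), where the law to be shown has (v, F); symmetry of second derivatives identifies them.\<close>

lemma hor_cov:
  assumes F: "horizontal_map A t0 F" and C: "cov (second_order_field C) p"
  shows "cov (hor F C) p"
  unfolding cov_def
proof (intro ballI impI)
  fix c d assume c: "c \<in> A" and d: "d \<in> A" and pc: "p \<in> cd c" and pd: "p \<in> cd d"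
  let ?q = "coord c p" let ?y = "fst ?q" let ?w = "fst (snd ?q)"
  let ?X = "second_order_field C c p"
  let ?Fc = "lc c (\<lambda>p. F p c)" let ?Fd = "lc d (\<lambda>p. F p d)"
  have q: "?q \<in> OV c d" using coord_OV[OF c pc pd] .
  then have y: "?y \<in> ov c d" by (auto simp: OV_def)
  have qc: "?q \<in> ci c" using coord_in[OF pc] .
  have Tq: "T c d ?q = coord d p" using T_coord[OF c d pc pd] .
  have rel: "J c d (fst q) (?Fc q) = ?Fd (T c d q)" if qq: "q \<in> OV c d" for q
    using hor_J[OF F c d, of "unc c q"] qq OV_iff[OF c] unc_in[OF c] coord_unc[OF c] unc_T[OF c d qq] by (simp add: loc_def)
  let ?DFd = "frechet_derivative ?Fd (at (coord d p) within ci d)"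
  let ?DFc = "frechet_derivative ?Fc (at ?q within ci c)"
  have 1: "((\<lambda>q. J c d (fst q) (?Fc q)) has_derivative (\<lambda>h. ?DFd (DT c d ?q h))) (at ?q within ci c)"
    by (rule deriv_T[where g="?Fd" and f="\<lambda>q. J c d (fst q) (?Fc q)", OF c d q _ rel])
      (use hor_deriv[OF F d coord_in[OF pd]] Tq in simp_all)
  \<comment> \<open>With \<open>F\<close> put in place of the velocity, the fiber component of
    \<open>T\<close> is the transformed \<open>F\<close>, so \<open>T_deriv\<close> also
    differentiates \<open>F\<close> in the new chart.\<close>
  have q2: "(?y, ?Fc ?q, snd (snd ?q)) \<in> OV c d" using q by (auto simp: OV_def)
  have "((\<lambda>q. (fst q, ?Fc q, snd (snd q))) has_derivative (\<lambda>h. (fst h, ?DFc h, snd (snd h)))) (at ?q within ci c)"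
    by (intro has_derivative_Pair hor_deriv[OF F c qc] derivative_intros)
  from has_derivative_compose[OF this T_deriv[OF c d q2]]
  have "((\<lambda>q. T c d (fst q, ?Fc q, snd (snd q))) has_derivative
     (\<lambda>h. DT c d (?y, ?Fc ?q, snd (snd ?q)) (fst h, ?DFc h, snd (snd h)))) (at ?q within ci c)" .
  then have "((\<lambda>q. fst (snd (T c d (fst q, ?Fc q, snd (snd q))))) has_derivative
     (\<lambda>h. fst (snd (DT c d (?y, ?Fc ?q, snd (snd ?q)) (fst h, ?DFc h, snd (snd h)))))) (at ?q within ci c)"
    by (intro derivative_intros)
  then have 2: "((\<lambda>q. J c d (fst q) (?Fc q)) has_derivative (\<lambda>h. J2 c d ?y (?Fc ?q) (fst h) + J c d ?y (?DFc h))) (at ?q within ci c)"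
    by (simp add: T_def DT_def)
  have "(\<lambda>h. ?DFd (DT c d ?q h)) = (\<lambda>h. J2 c d ?y (?Fc ?q) (fst h) + J c d ?y (?DFc h))"
    using thick_frechet_derivative[OF thick_ci[OF c] qc 1] thick_frechet_derivative[OF thick_ci[OF c] qc 2] by simp
  then have "?DFd (DT c d ?q ?X) = J2 c d ?y (?Fc ?q) (fst ?X) + J c d ?y (?DFc ?X)" by (rule fun_cong)
  moreover have "second_order_field C d p = DT c d ?q ?X" using C c d pc pd unfolding cov_def by blast
  then have "DT c d ?q ?X = second_order_field C d p" by (rule sym)
  moreover have "fst ?X = ?w" by (simp add: second_order_field_def coord_def)
  ultimately have "?DFd (second_order_field C d p) = J2 c d ?y ?w (F p c) + J c d ?y (?DFc ?X)"
    using J2_sym[OF c d y, of "F p c" ?w] lc_coord[OF c pc, of "\<lambda>p. F p c"] by simp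
  then show "hor F C d p = DT c d ?q (hor F C c p)"
    using hor_J[OF F c d pc pd] by (simp add: hor_def DT_def)
qed

end

context mfdm
begin

text \<open>Invariance is tested on compactly supported functions, second derivatives on all smooth
  ones. Since the measure has compact support, localization bridges the gap.\<close>

lemma smooth_localize:
  assumes X: "nice X"
    and cs: "\<And>f. smooth_TMI A t0 f \<Longrightarrow> compactly_supported A t0 f \<Longrightarrow> vanishes_at_ends A t0 f \<Longrightarrow> (LINT p|\<mu>. deriv_along A t0 X f p) = 0"
    and f: "smooth_TMI A t0 f" "vanishes_at_ends A t0 f"
  shows "(LINT p|\<mu>. deriv_along A t0 X f p) = 0"
proof -
  let ?G = "\<lambda>f. smooth_TMI A t0 f \<and> vanishes_at_ends A t0 f"
  have C1: "Ck_TMI A t0 (Suc 0) u" if "smooth_TMI A t0 u" for u using that unfolding smooth_TMI_def by blast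
  show ?thesis
  proof (rule localize[where S=supp and G="?G" and \<Lambda>="\<lambda>f. LINT p|\<mu>. deriv_along A t0 X f p", OF supp_compact])
    fix f u assume "?G f" "smooth_TMI A t0 u"
    then show "?G (\<lambda>p. u p * f p)" using smooth_TMI_mult vanishes_mult by blast
  next
    fix f g assume fg: "?G f" "?G g"
    have "(LINT p|\<mu>. deriv_along A t0 X (\<lambda>p. f p + g p) p) = (LINT p|\<mu>. deriv_along A t0 X f p + deriv_along A t0 X g p)"
      by (rule Bochner_Integration.integral_cong[OF refl]) (use fg C1 deriv_along_add[where k=0] in \<open>simp add: space_mu\<close>)
    also have "\<dots> = (LINT p|\<mu>. deriv_along A t0 X f p) + (LINT p|\<mu>. deriv_along A t0 X g p)"
      by (rule Bochner_Integration.integral_add) (use fg C1 integrable_deriv_along(1)[OF X] in blast)+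
    finally show "(LINT p|\<mu>. deriv_along A t0 X (\<lambda>p. f p + g p) p) = (LINT p|\<mu>. deriv_along A t0 X f p) + (LINT p|\<mu>. deriv_along A t0 X g p)" .
  next
    fix f U assume f: "?G f" and U: "openin top U" "supp \<subseteq> U" and z: "\<And>p. p \<in> U \<Longrightarrow> f p = 0"
    have "deriv_along A t0 X f p = 0" if p: "p \<in> supp" for p
    proof -
      have "deriv_along A t0 X f p = deriv_along A t0 X (\<lambda>p. 0) p"
        by (rule deriv_along_cong[of 0 f, OF _ U(1)]) (use f C1 U(2) p z in blast)+
      moreover have "p \<in> TM" using supp_TM p by blast
      ultimately show ?thesis using deriv_along_0 by simp
    qed
    then have "AE p in \<mu>. deriv_along A t0 X f p = 0" using AE_supp by (auto elim: AE_mp)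
    then show "(LINT p|\<mu>. deriv_along A t0 X f p) = 0" by (rule integral_eq_zero_AE)
  next
    fix p assume "p \<in> supp"
    then have p: "p \<in> TM" using supp_TM by blast
    obtain c where c: "c \<in> A" "p \<in> cd c" using exists_cd[OF p] by blast
    obtain r where r: "r > 0" "compact (ci c \<inter> cball (coord c p) r)" "unc c ` (ci c \<inter> cball (coord c p) r) \<subseteq> cd c"
      "cball (fst (coord c p)) r \<subseteq> im c"
      by (rule compact_box[OF c openin_cd[OF c(1)] c(2)])
    let ?U = "unc c ` (ci c \<inter> ball (coord c p) r)" let ?K = "unc c ` (ci c \<inter> cball (coord c p) r)"
    have K: "compactin top ?K" by (rule compactin_unc[OF c(1) r(2)]) blast
    have "openin top ?U" by (rule openin_image[OF c(1)]) auto
    moreover have "p \<in> ?U"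
      by (rule image_eqI[of p "unc c" "coord c p"]) (use c coord_in unc_coord r(1) in simp_all)
    moreover have "(LINT p|\<mu>. deriv_along A t0 X f p) = 0" if Gf: "?G f" and fU: "\<And>q. q \<notin> ?U \<Longrightarrow> f q = 0" for f
    proof (rule cs)
      have UK: "?U \<subseteq> ?K" using ball_subset_cball[of "coord c p" r] by blast
      have "{p \<in> TM. f p \<noteq> 0} \<subseteq> ?K" using fU UK by blast
      then have "top closure_of {p \<in> TM. f p \<noteq> 0} \<subseteq> ?K"
        by (rule closure_of_minimal[OF _ compactin_imp_closedin[OF Hausdorff_top K]])
      then show "compactly_supported A t0 f"
        unfolding compactly_supported_def by (rule closed_compactin[OF K _ closedin_closure_of])
    qed (use Gf in auto)
    ultimately show "\<exists>U. openin top U \<and> p \<in> U \<and> (\<forall>f. ?G f \<longrightarrow> (\<forall>q. q \<notin> U \<longrightarrow> f q = 0) \<longrightarrow> (LINT p|\<mu>. deriv_along A t0 X f p) = 0)"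
      by blast
  qed (use f in auto)
qed

lemma hor_nice:
  assumes F: "horizontal_map A t0 F" and C: "second_derivative A t0 \<mu> C"
  shows "nice (hor F C)"
  unfolding nice_def
proof (intro conjI ballI allI impI)
  note nX = second_derivative_nice[OF C]
  show "cov (hor F C) p" if "p \<in> TM" for p
    using hor_cov[OF F] nX that unfolding nice_def by blast
  fix c assume c: "c \<in> A"
  let ?Fc = "lc c (\<lambda>p. F p c)"
  let ?X = "second_order_field C c"
  have FC: "Ck_on (Suc 0) ?Fc (ci c)" using F c unfolding horizontal_map_def One_nat_def by blast
  have cF: "continuous_on (ci c) ?Fc" using Ck_on_imp_continuous[OF FC] .
  have cD: "continuous_on (ci c) (dir_deriv (ci c) ?Fc b)" for b
    using Ck_on_frechet(2)[OF FC thick_ci[OF c]] by simp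
  define g where "g p = (?Fc (coord c p), \<Sum>b\<in>Basis. (?X p \<bullet> b) *\<^sub>R dir_deriv (ci c) ?Fc b (coord c p), 0 :: real)" for p
  have eq: "hor F C c p = g p" if p: "p \<in> cd c" for p
  proof -
    have l: "linear (frechet_derivative ?Fc (at (coord c p) within ci c))"
      using hor_deriv[OF F c coord_in[OF p]] has_derivative_linear by blast
    have "frechet_derivative ?Fc (at (coord c p) within ci c) (\<Sum>b\<in>Basis. (?X p \<bullet> b) *\<^sub>R b)
       = (\<Sum>b\<in>Basis. (?X p \<bullet> b) *\<^sub>R dir_deriv (ci c) ?Fc b (coord c p))"
      by (simp only: linear_sum[OF l] linear_scale[OF l])
    then have "dir_deriv (ci c) ?Fc (?X p) (coord c p) = (\<Sum>b\<in>Basis. (?X p \<bullet> b) *\<^sub>R dir_deriv (ci c) ?Fc b (coord c p))"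
      by (simp only: euclidean_representation)
    then show ?thesis using lc_coord[OF c p, of "\<lambda>p. F p c"] by (simp only: hor_def g_def)
  qed
  have [measurable]: "?X \<in> borel_measurable (restrict_space \<mu> (cd c))" using nX c unfolding nice_def by blast
  have "(\<lambda>p. ?X p \<bullet> b) \<in> borel_measurable (restrict_space \<mu> (cd c))" for b by measurable
  then have "g \<in> borel_measurable (restrict_space \<mu> (cd c))"
    unfolding g_def[abs_def]
    by (intro borel_measurable_Pair borel_measurable_sum borel_measurable_scaleR measurable_continuous_coord[OF c cF] measurable_continuous_coord[OF c cD] measurable_const) auto
  then show "hor F C c \<in> borel_measurable (restrict_space \<mu> (cd c))"
    by (rule measurable_cong[THEN iffD1, rotated]) (use eq in \<open>simp add: space_restrict_cd[OF c]\<close>)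
  fix K :: "'n coords set" assume K: "compact K \<and> K \<subseteq> ci c"
  let ?S = "unc c ` K \<inter> supp"
  have S: "?S \<subseteq> cd c" using K unc_in[OF c] by blast
  have bX: "bounded (?X ` ?S)" using nX c K unfolding nice_def by blast
  have bXb: "bounded ((\<lambda>p. ?X p \<bullet> b) ` ?S)" for b
    using bounded_linear_image[OF bX bounded_linear_inner_left, of b] by (simp add: image_image)
  have bXD: "bounded ((\<lambda>p. (?X p \<bullet> b) *\<^sub>R dir_deriv (ci c) ?Fc b (coord c p)) ` ?S)" for b
  proof -
    obtain B1 where "\<forall>y\<in>(\<lambda>p. ?X p \<bullet> b) ` ?S. norm y \<le> B1" using bXb[of b] unfolding bounded_iff by blast
    moreover have "bounded ((\<lambda>p. dir_deriv (ci c) ?Fc b (coord c p)) ` ?S)"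
      by (rule bounded_continuous_coord[OF c cD]) (use K in auto)
    then obtain B2 where "\<forall>y\<in>(\<lambda>p. dir_deriv (ci c) ?Fc b (coord c p)) ` ?S. norm y \<le> B2" unfolding bounded_iff by blast
    ultimately have B: "norm (?X p \<bullet> b) \<le> B1" "norm (dir_deriv (ci c) ?Fc b (coord c p)) \<le> B2" if "p \<in> ?S" for p
      using that by simp_all
    have "norm ((?X p \<bullet> b) *\<^sub>R dir_deriv (ci c) ?Fc b (coord c p)) \<le> B1 * B2" if "p \<in> ?S" for p
      unfolding norm_scaleR using B[OF that] by (intro mult_mono) (auto intro: order_trans[OF norm_ge_zero])
    then show ?thesis unfolding bounded_iff by blast
  qed
  have bs: "bounded ((\<lambda>p. \<Sum>b\<in>I. (?X p \<bullet> b) *\<^sub>R dir_deriv (ci c) ?Fc b (coord c p)) ` ?S)" if "finite I" for I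
    using that
  proof (induction I rule: finite_induct)
    case (insert i I)
    then show ?case
      using bXD[of i] bounded_plus_comp[of "\<lambda>p. (?X p \<bullet> i) *\<^sub>R dir_deriv (ci c) ?Fc i (coord c p)" ?S "\<lambda>p. \<Sum>b\<in>I. (?X p \<bullet> b) *\<^sub>R dir_deriv (ci c) ?Fc b (coord c p)"]
      by simp
  qed (auto simp: image_constant_conv)
  have "bounded (g ` ?S)"
    unfolding g_def[abs_def] using K
    by (intro bounded_Pair_image bounded_continuous_coord[OF c cF] bs) (auto simp: image_constant_conv)
  moreover have "g ` ?S = hor F C c ` ?S"
  proof (rule image_cong[OF refl])
    fix p assume "p \<in> ?S"
    then have "p \<in> cd c" using S by blast
    from eq[OF this] show "g p = hor F C c p" by (rule sym)
  qed
  ultimately show "bounded (hor F C c ` ?S)" by simp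
qed

lemma base_loc_eq: "c \<in> A \<Longrightarrow> q \<in> ci c \<Longrightarrow> lc c (\<lambda>p. \<phi> (fst p, snd (snd p))) q = base_loc c \<phi> (fst q, snd (snd q))"
  by (simp add: loc_def base_loc_def unc_eq)

lemma base_smooth:
  assumes \<phi>: "smooth_MI A t0 \<phi>" shows "smooth_TMI A t0 (\<lambda>p. \<phi> (fst p, snd (snd p)))"
  unfolding smooth_TMI_def Ck_TMI_def
proof (intro allI ballI)
  fix k c assume c: "c \<in> A"
  have "Ck_on k (\<lambda>q :: 'n coords. base_loc c \<phi> (fst q, snd (snd q))) (ci c)"
    by (rule Ck_on_compose[where T="im c \<times> {0..t0}"])
      (use \<phi> c in \<open>auto intro!: Ck_on_Pair Ck_on_fst Ck_on_snd Ck_on_id simp: chart_img_def smooth_MI_def smooth_on_def\<close>)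
  then show "Ck_on k (lc c (\<lambda>p. \<phi> (fst p, snd (snd p)))) (ci c)" by (rule Ck_on_cong) (simp add: base_loc_eq[OF c])
qed

lemma base_deriv:
  assumes \<phi>: "smooth_MI A t0 \<phi>" and c: "c \<in> A" and q: "q \<in> ci c"
  shows "(lc c (\<lambda>p. \<phi> (fst p, snd (snd p))) has_derivative
    (\<lambda>h. dir_deriv (im c \<times> {0..t0}) (base_loc c \<phi>) (fst h, snd (snd h)) (fst q, snd (snd q)))) (at q within ci c)"
proof -
  let ?B = "im c \<times> {0..t0}"
  have sB: "Ck_on k (base_loc c \<phi>) ?B" for k using \<phi> c unfolding smooth_MI_def smooth_on_def by blast
  have qB: "(fst q, snd (snd q)) \<in> ?B" using q by (simp add: ci_iff)
  let ?D = "frechet_derivative (base_loc c \<phi>) (at (fst q, snd (snd q)) within ?B)"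
  have "(base_loc c \<phi> has_derivative ?D) (at (fst q, snd (snd q)) within ?B)"
    by (rule Ck_on_frechet(1)[OF sB[of "Suc 0"] _ qB]) (intro thick_Times thick_open open_im c thick_interval t0)
  then have "(base_loc c \<phi> has_derivative ?D) (at (fst q, snd (snd q)) within (\<lambda>q. (fst q, snd (snd q))) ` ci c)"
    by (rule has_derivative_subset) (auto simp: chart_img_def)
  moreover have "((\<lambda>q. (fst q, snd (snd q))) has_derivative (\<lambda>h. (fst h, snd (snd h)))) (at q within ci c)"
    by (intro derivative_intros)
  ultimately have "((\<lambda>q. base_loc c \<phi> (fst q, snd (snd q))) has_derivative (\<lambda>h. ?D (fst h, snd (snd h)))) (at q within ci c)"
    using diff_chain_within by (fastforce simp: o_def)
  then show ?thesis
    by (rule has_derivative_transform[OF q, rotated]) (simp add: base_loc_eq[OF c])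
qed

lemma base_integrand:
  assumes \<phi>: "smooth_MI A t0 \<phi>" and p: "p \<in> TM"
  shows "(let c = chart_at A p; (x, v, t) = p in
       dir_deriv ((snd c ` fst c) \<times> {0..t0}) (base_loc c \<phi>) (v c, 1) (snd c x, t))
    = deriv_along A t0 (second_order_field C) (\<lambda>p. \<phi> (fst p, snd (snd p))) p"
  using deriv_along_D[OF p base_deriv[OF \<phi> chart_at(1) coord_in[OF chart_at_cd[OF p]]], of "second_order_field C"]
  by (cases p) (simp add: second_order_field_def coord_def Let_def)

text \<open>A function on the base, pulled back to the tangent bundle, is constant on the fibers, so
  the acceleration term drops out of its derivative along the second order field.\<close>

lemma second_derivative_closed:
  assumes C: "second_derivative A t0 \<mu> C" shows "\<mu> \<in> closed_measures A t0"
  unfolding closed_measures_def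
proof (intro CollectI conjI radon allI impI)
  fix \<phi> assume \<phi>: "smooth_MI A t0 \<phi> \<and> (\<forall>x. \<phi> (x, 0) = 0 \<and> \<phi> (x, t0) = 0)"
  let ?f = "\<lambda>p :: ('m, 'n) point. \<phi> (fst p, snd (snd p))"
  have s: "smooth_TMI A t0 ?f" using base_smooth[of \<phi>] \<phi> by blast
  have v: "vanishes_at_ends A t0 ?f" using \<phi> by (auto simp: vanishes_at_ends_def)
  have "(LINT p|\<mu>. (let c = chart_at A p; (x, v, t) = p in
       dir_deriv ((snd c ` fst c) \<times> {0..t0}) (base_loc c \<phi>) (v c, 1) (snd c x, t)))
    = (LINT p|\<mu>. deriv_along A t0 (second_order_field C) ?f p)"
    by (rule Bochner_Integration.integral_cong[OF refl]) (use base_integrand \<phi> in \<open>simp add: space_mu\<close>)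
  also have "\<dots> = 0" using C s v unfolding second_derivative_def by blast
  finally show "(LINT p|\<mu>. (let c = chart_at A p; (x, v, t) = p in
       dir_deriv ((snd c ` fst c) \<times> {0..t0}) (base_loc c \<phi>) (v c, 1) (snd c x, t))) = 0" .
qed

end

section \<open>The Lagrangian, its momentum and the Euler-Lagrange acceleration\<close>

locale lag = mfdm A t0 \<mu> for A :: "('m::{second_countable_topology, t2_space}, 'n::finite) chart set" and t0 \<mu> +
  fixes L :: "('m, 'n) point \<Rightarrow> real" and V
  assumes C2: "C2_lipschitz A t0 L" and openV: "openin (TMI_top A t0) V"
    and inv: "Lvv_invertible_on A t0 L V" and suppV: "msupport A t0 \<mu> \<subseteq> V"
begin

definition D1 :: "('m, 'n) chart \<Rightarrow> 'n coords \<Rightarrow> 'n coords \<Rightarrow> real" where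
  "D1 c h = dir_deriv (ci c) (lc c L) h"

definition D2 :: "('m, 'n) chart \<Rightarrow> 'n coords \<Rightarrow> 'n coords \<Rightarrow> 'n coords \<Rightarrow> real" where
  "D2 c h k = dir_deriv (ci c) (D1 c h) k"

text \<open>In the chart \<open>c\<close>, \<open>P\<close> is the momentum L_v, \<open>Rx\<close>
  is L_x, and \<open>DP\<close> is the derivative of the momentum in all variables (x, v,
  t).\<close>

definition P :: "('m, 'n) chart \<Rightarrow> 'n coords \<Rightarrow> real^'n" where "P c q = (\<chi> i. D1 c (dir_v i) q)"
definition Rx :: "('m, 'n) chart \<Rightarrow> 'n coords \<Rightarrow> real^'n" where "Rx c q = (\<chi> i. D1 c (dir_x i) q)"
definition DP :: "('m, 'n) chart \<Rightarrow> 'n coords \<Rightarrow> 'n coords \<Rightarrow> real^'n" where "DP c q k = (\<chi> i. D2 c (dir_v i) k q)"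

abbreviation M where "M \<equiv> Lvv A t0 L"
abbreviation EL where "EL \<equiv> EL_accel A t0 L"

lemma L2: "c \<in> A \<Longrightarrow> Ck_on (Suc (Suc 0)) (lc c L) (ci c)"
  using C2 unfolding C2_lipschitz_def Ck_TMI_def numeral_2_eq_2 by blast

lemma L1: "Ck_TMI A t0 (Suc 0) L"
  unfolding Ck_TMI_def using L2 Ck_on_Suc_D by blast

lemma D1_C1: "c \<in> A \<Longrightarrow> Ck_on (Suc 0) (D1 c h) (ci c)"
  unfolding D1_def by (rule Ck_on_frechet(2)[OF L2 thick_ci])

lemma D2_cont: "c \<in> A \<Longrightarrow> continuous_on (ci c) (D2 c h k)"
proof -
  assume c: "c \<in> A"
  show ?thesis unfolding D2_def
    by (rule Ck_on_imp_continuous[of 0]) (rule Ck_on_frechet(2)[OF D1_C1[OF c] thick_ci[OF c]])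
qed

lemma L_deriv: "c \<in> A \<Longrightarrow> q \<in> ci c \<Longrightarrow> (lc c L has_derivative (\<lambda>h. D1 c h q)) (at q within ci c)"
  unfolding D1_def by (rule lc_deriv[OF L1])

lemma D1_deriv: "c \<in> A \<Longrightarrow> q \<in> ci c \<Longrightarrow> (D1 c h has_derivative (\<lambda>k. D2 c h k q)) (at q within ci c)"
  unfolding D2_def by (rule Ck_on_frechet(1)[OF D1_C1 thick_ci])

lemma linear_D1: "c \<in> A \<Longrightarrow> q \<in> ci c \<Longrightarrow> linear (\<lambda>h. D1 c h q)"
  using L_deriv has_derivative_linear by blast

lemma linear_D2: "c \<in> A \<Longrightarrow> q \<in> ci c \<Longrightarrow> linear (\<lambda>k. D2 c h k q)"
  using D1_deriv has_derivative_linear by blast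

lemma linear_dir_x:
  fixes D :: "'n coords \<Rightarrow> real"
  assumes "linear D" shows "D (h, 0, 0) = (\<chi> i. D (dir_x i)) \<bullet> h"
proof -
  have "linear (\<lambda>h. D (h, 0, 0))"
    using linear_compose[OF _ assms, of "\<lambda>h. (h, 0, 0)"] by (simp add: o_def linear_iff)
  from linear_expand[OF this, of h] have "D (h, 0, 0) = (\<Sum>i\<in>UNIV. h $ i *\<^sub>R D (dir_x i))" .
  also have "\<dots> = (\<chi> i. D (dir_x i)) \<bullet> h" by (simp add: inner_vec_def mult.commute)
  finally show ?thesis .
qed

lemma D1_split:
  assumes "c \<in> A" "q \<in> ci c" shows "D1 c (a, b, 0) q = Rx c q \<bullet> a + P c q \<bullet> b"
proof -
  have "D1 c ((a, 0, 0) + (0, b, 0)) q = D1 c (a, 0, 0) q + D1 c (0, b, 0) q"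
    by (rule linear_add[OF linear_D1[OF assms]])
  then show ?thesis
    using linear_dir_x[OF linear_D1[OF assms], of a] linear_dir_v[OF linear_D1[OF assms], of b]
    by (simp add: P_def Rx_def)
qed

lemma P_deriv: "c \<in> A \<Longrightarrow> q \<in> ci c \<Longrightarrow> (P c has_derivative DP c q) (at q within ci c)"
  unfolding has_derivative_componentwise_within[of "P c"]
proof
  fix b :: "real^'n" assume a: "c \<in> A" "q \<in> ci c" and "b \<in> Basis"
  then obtain i where "b = axis i 1" by (auto simp: Basis_vec_def)
  then show "((\<lambda>q. P c q \<bullet> b) has_derivative (\<lambda>k. DP c q k \<bullet> b)) (at q within ci c)"
    using D1_deriv[OF a, of "dir_v i"] by (simp add: P_def DP_def inner_axis)
qed

lemma P_C1: "c \<in> A \<Longrightarrow> Ck_on (Suc 0) (P c) (ci c)"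
  by (rule Ck_on_vec) (simp only: P_def vec_lambda_beta D1_C1)

lemma linear_DP: "c \<in> A \<Longrightarrow> q \<in> ci c \<Longrightarrow> linear (DP c q)"
  using P_deriv has_derivative_linear by blast

lemma DP_vert: 
  assumes "c \<in> A" "q \<in> ci c" shows "DP c q (0, k, 0) = M c q *v k"
proof -
  have "D2 c (dir_v i) (0, k, 0) q = (\<chi> j. D2 c (dir_v i) (dir_v j) q) \<bullet> k" for i
    by (rule linear_dir_v[OF linear_D2[OF assms]])
  then show ?thesis
    by (simp add: DP_def Lvv_def Let_def matrix_vector_mult_def inner_vec_def vec_eq_iff D1_def D2_def)
qed

text \<open>Symmetry is obtained on the slice of fixed time, which is open in (x, v); in this way it
  also holds at the end times, where the chart image is not open.\<close>

lemma D2_sym: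
  assumes c: "c \<in> A" and q: "q \<in> ci c"
  shows "D2 c (a, b, 0) (a', b', 0) q = D2 c (a', b', 0) (a, b, 0) q"
proof -
  define t where "t = snd (snd q)"
  let ?S = "im c \<times> (UNIV :: (real^'n) set)"
  let ?m = "\<lambda>z :: (real^'n) \<times> (real^'n). (fst z, snd z, t)"
  have S: "open ?S" using open_im[OF c] by (simp add: open_Times)
  have mS: "?m z \<in> ci c" if "z \<in> ?S" for z using that q by (auto simp: ci_iff t_def)
  have z0: "(fst q, fst (snd q)) \<in> ?S" using q by (simp add: ci_iff)
  have q_eq: "?m (fst q, fst (snd q)) = q" by (simp add: t_def)
  have ch: "((\<lambda>z. F (?m z)) has_derivative (\<lambda>h. G (fst h, snd h, 0))) (at z)"
    if z: "z \<in> ?S" and F: "(F has_derivative G) (at (?m z) within ci c)" for F :: "'n coords \<Rightarrow> real" and G z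
  proof -
    have "(F has_derivative G) (at (?m z) within ?m ` ?S)" by (rule has_derivative_subset[OF F]) (use mS in blast)
    moreover have "(?m has_derivative (\<lambda>h. (fst h, snd h, 0))) (at z within ?S)"
      by (intro has_derivative_Pair derivative_intros)
    ultimately have "((\<lambda>z. F (?m z)) has_derivative (\<lambda>h. G (fst h, snd h, 0))) (at z within ?S)"
      using diff_chain_within[of ?m "\<lambda>h. (fst h, snd h, 0)" z ?S F G] by (simp add: o_def)
    then show ?thesis using at_within_open[OF z S] by simp
  qed
  have cm: "continuous_on ?S (\<lambda>z. D2 c h k (?m z))" for h k
    by (rule continuous_on_compose2[OF D2_cont[OF c]]) (use mS in \<open>auto intro!: continuous_intros\<close>)
  have "D2 c (fst (a, b), snd (a, b), 0) (fst (a', b'), snd (a', b'), 0) (?m (fst q, fst (snd q)))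
      = D2 c (fst (a', b'), snd (a', b'), 0) (fst (a, b), snd (a, b), 0) (?m (fst q, fst (snd q)))"
    by (rule second_derivative_symmetric[where f="\<lambda>z. lc c L (?m z)" and D="\<lambda>z h. D1 c (fst h, snd h, 0) (?m z)"
        and E="\<lambda>z k. D2 c (fst (a, b), snd (a, b), 0) (fst k, snd k, 0) (?m z)"
        and F="\<lambda>z k. D2 c (fst (a', b'), snd (a', b'), 0) (fst k, snd k, 0) (?m z)"
        and h="(a, b)" and k="(a', b')", OF S z0])
      (intro ch L_deriv[OF c] D1_deriv[OF c] mS cm | assumption)+
  then show ?thesis unfolding q_eq by simp
qed

lemma M_sym: "c \<in> A \<Longrightarrow> q \<in> ci c \<Longrightarrow> transpose (M c q) = M c q"
  using D2_sym[of c q 0 _ 0 _] by (simp add: transpose_def vec_eq_iff Lvv_def Let_def D1_def D2_def)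

lemma M_inner: "c \<in> A \<Longrightarrow> q \<in> ci c \<Longrightarrow> (M c q *v a) \<bullet> b = a \<bullet> (M c q *v b)"
  using dot_lmul_matrix[of a "M c q" b] M_sym[of c q] transpose_matrix_vector[of "M c q" a] by simp

lemma M_cont: "c \<in> A \<Longrightarrow> continuous_on (ci c) (\<lambda>q. M c q $ i $ j)"
  using D2_cont[of c "dir_v i" "dir_v j"] by (simp add: Lvv_def Let_def D1_def[abs_def] D2_def)

lemma M_inv: "c \<in> A \<Longrightarrow> p \<in> V \<Longrightarrow> p \<in> cd c \<Longrightarrow> invertible (M c (coord c p))"
  using inv unfolding Lvv_invertible_on_def by blast

text \<open>The Euler-Lagrange equation: the derivative of \<open>L\<^sub>v\<close> along \<open>(v, EL, 1)\<close> is \<open>L\<^sub>x\<close>.\<close>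

lemma EL_eq:
  assumes c: "c \<in> A" and p: "p \<in> V" "p \<in> cd c"
  shows "DP c (coord c p) (second_order_field EL c p) = Rx c (coord c p)"
proof -
  let ?q = "coord c p" let ?v = "fst (snd p) c" let ?N = "matrix_inv (M c ?q)"
  have q: "?q \<in> ci c" using coord_in[OF p(2)] .
  define R where "R = Rx c ?q - DP c ?q (?v, 0, 1)"
  have Ri: "R $ i = D1 c (dir_x i) ?q - D2 c (dir_v i) dir_t ?q - (\<Sum>j\<in>UNIV. ?v $ j * D2 c (dir_x j) (dir_v i) ?q)" for i
  proof -
    have "D2 c (dir_v i) ((?v, 0, 0) + dir_t) ?q = D2 c (dir_v i) (?v, 0, 0) ?q + D2 c (dir_v i) dir_t ?q"
      by (rule linear_add[OF linear_D2[OF c q]])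
    moreover have "D2 c (dir_v i) (?v, 0, 0) ?q = (\<chi> j. D2 c (dir_v i) (dir_x j) ?q) \<bullet> ?v"
      by (rule linear_dir_x[OF linear_D2[OF c q]])
    moreover have "D2 c (dir_v i) (dir_x j) ?q = D2 c (dir_x j) (dir_v i) ?q" for j by (rule D2_sym[OF c q])
    ultimately show ?thesis
      by (simp add: R_def Rx_def DP_def inner_vec_def mult.commute)
  qed
  \<comment> \<open>\<open>EL_accel\<close> sums over the row index of the inverse matrix, which is
    an application of the transpose; by the symmetry of L_vv the transpose inverts L_vv as
    well.\<close>
  have e1: "EL c p = transpose ?N *v R"
  proof -
    have "EL c p $ k = (\<Sum>i\<in>UNIV. R $ i * ?N $ i $ k)" for k
      by (simp add: EL_accel_def Let_def Ri D1_def[abs_def] D2_def)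
    then show ?thesis by (simp add: vec_eq_iff matrix_vector_mult_def transpose_def mult.commute)
  qed
  have e2: "M c ?q ** transpose ?N = mat 1"
  proof -
    have "transpose (?N ** M c ?q) = mat 1" using matrix_inv_mult(2)[OF M_inv[OF c p]] by simp
    then show ?thesis using M_sym[OF c q] by (simp add: matrix_transpose_mul)
  qed
  have "M c ?q *v EL c p = R" by (simp only: e1 e2 matrix_vector_mul_assoc matrix_vector_mul_lid)
  moreover have "DP c ?q ((?v, 0, 1) + (0, EL c p, 0)) = DP c ?q (?v, 0, 1) + DP c ?q (0, EL c p, 0)"
    by (rule linear_add[OF linear_DP[OF c q]])
  ultimately show ?thesis using DP_vert[OF c q] by (simp add: second_order_field_def R_def)
qed

lemma M_cancel:
  assumes "c \<in> A" "p \<in> V" "p \<in> cd c" "M c (coord c p) *v a = M c (coord c p) *v b" shows "a = b"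
proof -
  have "matrix_inv (M c (coord c p)) *v (M c (coord c p) *v a) = matrix_inv (M c (coord c p)) *v (M c (coord c p) *v b)"
    using assms(4) by simp
  then show ?thesis using matrix_inv_mult(2)[OF M_inv[OF assms(1-3)]] by (simp add: matrix_vector_mul_assoc)
qed

lemma DP_sof_diff:
  assumes "c \<in> A" "p \<in> cd c"
  shows "DP c (coord c p) (second_order_field C c p) - DP c (coord c p) (second_order_field C' c p) = M c (coord c p) *v (C c p - C' c p)"
proof -
  have "second_order_field C c p - second_order_field C' c p = (0, C c p - C' c p, 0)"
    by (simp add: second_order_field_def)
  then show ?thesis
    using linear_diff[OF linear_DP[OF assms(1) coord_in[OF assms(2)]], of "second_order_field C c p" "second_order_field C' c p"]
      DP_vert[OF assms(1) coord_in[OF assms(2)]] by simp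
qed

lemma D1_T:
  assumes c: "c \<in> A" and d: "d \<in> A" and q: "q \<in> OV c d"
  shows "D1 c h q = D1 d (DT c d q h) (T c d q)"
proof -
  have qc: "q \<in> ci c" "T c d q \<in> ci d" using q OV_subset[OF c] T_in[OF c d q] OV_subset[OF d] by blast+
  have "(lc c L has_derivative (\<lambda>h. D1 d (DT c d q h) (T c d q))) (at q within ci c)"
    by (rule deriv_T[where g="lc d L" and D="\<lambda>h. D1 d h (T c d q)", OF c d q L_deriv[OF d qc(2)]]) (rule lc_T[OF c d])
  from thick_frechet_derivative[OF thick_ci[OF c] qc(1) this]
  show ?thesis by (simp add: D1_def)
qed

lemma P_J:
  assumes c: "c \<in> A" and d: "d \<in> A" and q: "q \<in> OV c d"
  shows "P c q \<bullet> h = P d (T c d q) \<bullet> J c d (fst q) h"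
proof -
  have qc: "q \<in> ci c" "T c d q \<in> ci d" using q OV_subset[OF c] T_in[OF c d q] OV_subset[OF d] by blast+
  show ?thesis
    using D1_T[OF c d q, of "(0, h, 0)"] D1_split[OF c qc(1), of 0 h] D1_split[OF d qc(2), of 0 "J c d (fst q) h"]
    by (simp add: DT_vert[OF c d q])
qed

lemma Rx_J:
  assumes c: "c \<in> A" and d: "d \<in> A" and q: "q \<in> OV c d"
  shows "Rx c q \<bullet> a = Rx d (T c d q) \<bullet> J c d (fst q) a + P d (T c d q) \<bullet> J2 c d (fst q) (fst (snd q)) a"
proof -
  have qc: "q \<in> ci c" "T c d q \<in> ci d" using q OV_subset[OF c] T_in[OF c d q] OV_subset[OF d] by blast+
  have "J c d (fst q) 0 = 0" using linear_0[OF linear_J[OF c d]] q by (auto simp: OV_def)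
  then have "DT c d q (a, 0, 0) = (J c d (fst q) a, J2 c d (fst q) (fst (snd q)) a, 0)" by (simp add: DT_def)
  then show ?thesis
    using D1_T[OF c d q, of "(a, 0, 0)"] D1_split[OF c qc(1), of a 0] by (simp add: D1_split[OF d qc(2)])
qed

text \<open>The momentum transforms as a covector. Differentiating this law along \<open>X\<close>
  also differentiates the Jacobian, and this gives the \<open>J2\<close> term.\<close>

lemma DP_J:
  assumes c: "c \<in> A" and d: "d \<in> A" and q: "q \<in> OV c d"
  shows "DP c q X \<bullet> h = DP d (T c d q) (DT c d q X) \<bullet> J c d (fst q) h + P d (T c d q) \<bullet> J2 c d (fst q) h (fst X)"
proof -
  have qc: "q \<in> ci c" "T c d q \<in> ci d" using q OV_subset[OF c] T_in[OF c d q] OV_subset[OF d] by blast+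
  have y: "fst q \<in> ov c d" using q by (auto simp: OV_def)
  note wi = at_within_openin[OF openin_OV[OF c d] q]
  have 1: "((\<lambda>q. P c q \<bullet> h) has_derivative (\<lambda>X. DP c q X \<bullet> h)) (at q within ci c)"
    by (intro has_derivative_inner_left P_deriv c qc)
  have 2: "((\<lambda>q. P d (T c d q)) has_derivative (\<lambda>X. DP d (T c d q) (DT c d q X))) (at q within ci c)"
    by (rule deriv_T[where g="P d", OF c d q P_deriv[OF d qc(2)]]) simp
  have 3: "((\<lambda>q. J c d (fst q) h) has_derivative (\<lambda>X. J2 c d (fst q) h (fst X))) (at q within ci c)"
    by (rule has_derivative_compose[where f=fst and g="\<lambda>y. J c d y h", OF _ J2_deriv[OF c d y]])
      (auto intro!: derivative_eq_intros)
  have "((\<lambda>q. P d (T c d q) \<bullet> J c d (fst q) h) has_derivative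
     (\<lambda>X. P d (T c d q) \<bullet> J2 c d (fst q) h (fst X) + DP d (T c d q) (DT c d q X) \<bullet> J c d (fst q) h)) (at q within OV c d)"
    unfolding wi by (rule has_derivative_inner[OF 2 3])
  then have "((\<lambda>q. P c q \<bullet> h) has_derivative
     (\<lambda>X. P d (T c d q) \<bullet> J2 c d (fst q) h (fst X) + DP d (T c d q) (DT c d q X) \<bullet> J c d (fst q) h)) (at q within OV c d)"
    by (rule has_derivative_transform[OF q, rotated]) (rule P_J[OF c d])
  note 4 = this[unfolded wi]
  have "(\<lambda>X. P d (T c d q) \<bullet> J2 c d (fst q) h (fst X) + DP d (T c d q) (DT c d q X) \<bullet> J c d (fst q) h) = (\<lambda>X. DP c q X \<bullet> h)"
    by (rule trans[OF sym[OF thick_frechet_derivative[OF thick_ci[OF c] qc(1) 4]] thick_frechet_derivative[OF thick_ci[OF c] qc(1) 1]])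
  from fun_cong[OF this, of X] show ?thesis by simp
qed

text \<open>The field transported from chart \<open>c\<close> satisfies the Euler-Lagrange equation
  of chart \<open>d\<close>: the \<open>J2\<close> terms in the laws for the derivative of L_v and
  for L_x coincide by symmetry. As L_vv is invertible at \<open>p\<close>, the equation determines
  the acceleration.\<close>

lemma EL_cov:
  assumes p: "p \<in> V" and c: "c \<in> A" "p \<in> cd c" and d: "d \<in> A" "p \<in> cd d"
  shows "second_order_field EL d p = DT c d (coord c p) (second_order_field EL c p)"
proof -
  let ?q = "coord c p" let ?X = "second_order_field EL c p"
  have q: "?q \<in> OV c d" using coord_OV[OF c d(2)] .
  have y: "fst ?q \<in> ov c d" using q by (auto simp: OV_def)
  have Tq: "T c d ?q = coord d p" using T_coord[OF c(1) d(1) c(2) d(2)] .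
  have v: "fst ?X = fst (snd ?q)" by (simp add: second_order_field_def coord_def)
  have "DP d (coord d p) (DT c d ?q ?X) \<bullet> J c d (fst ?q) h = Rx d (coord d p) \<bullet> J c d (fst ?q) h" for h
    using DP_J[OF c(1) d(1) q, of ?X h] Rx_J[OF c(1) d(1) q, of h] EL_eq[OF c(1) p c(2)] J2_sym[OF c(1) d(1) y, of h "fst (snd ?q)"] v Tq
    by simp
  then have e: "DP d (coord d p) (DT c d ?q ?X) = Rx d (coord d p)"
    by (rule inner_J_eq[OF c(1) d(1) c(2) d(2)])
  \<comment> \<open>The transported field again has base component the velocity and time component
    1, so only its acceleration remains to be compared.\<close>
  define a where "a = fst (snd (DT c d ?q ?X))"
  have X': "DT c d ?q ?X = second_order_field (\<lambda>_ _. a) d p"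
    using T_coord[OF c(1) d(1) c(2) d(2)]
    by (simp add: a_def second_order_field_def DT_def T_def coord_def)
  have "M d (coord d p) *v (a - EL d p) = 0"
    using DP_sof_diff[OF d, of "\<lambda>_ _. a" EL] e EL_eq[OF d(1) p d(2)] X' by simp
  then have "M d (coord d p) *v a = M d (coord d p) *v EL d p" by (simp add: matrix_vector_mult_diff_distrib)
  then have "a = EL d p" by (rule M_cancel[OF d(1) p d(2)])
  then show ?thesis using X' by (simp add: second_order_field_def)
qed

lemma EL_cont: 
  assumes c: "c \<in> A" shows "continuous_on {q \<in> ci c. unc c q \<in> V} (\<lambda>q. EL c (unc c q))"
proof -
  let ?S = "{q \<in> ci c. unc c q \<in> V}"
  have inv': "invertible (M c q)" if "q \<in> ?S" for q
    using M_inv[OF c, of "unc c q"] that unc_in[OF c] coord_unc[OF c] by simp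
  have S: "?S \<subseteq> ci c" by blast
  note cs = continuous_on_subset[OF _ S]
  have "continuous_on ?S (\<lambda>q. \<chi> k. \<Sum>i\<in>UNIV.
        (D1 c (dir_x i) q - D2 c (dir_v i) dir_t q - (\<Sum>j\<in>UNIV. fst (snd q) $ j * D2 c (dir_x j) (dir_v i) q))
        * matrix_inv (M c q) $ i $ k)"
    by (intro continuous_on_vec_lambda continuous_intros continuous_on_matrix_inv inv' cs[OF M_cont[OF c]] cs[OF D2_cont[OF c]]
        cs[OF Ck_on_imp_continuous[OF D1_C1[OF c]]])
  then show ?thesis
  proof (rule continuous_on_eq)
    fix q assume q: "q \<in> ?S"
    then have "coord c (unc c q) = q" using coord_unc[OF c] by blast
    moreover from this have "fst (snd (unc c q)) c = fst (snd q)" unfolding coord_def by (metis fst_conv snd_conv)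
    ultimately show "(\<chi> k. \<Sum>i\<in>UNIV.
        (D1 c (dir_x i) q - D2 c (dir_v i) dir_t q - (\<Sum>j\<in>UNIV. fst (snd q) $ j * D2 c (dir_x j) (dir_v i) q))
        * matrix_inv (M c q) $ i $ k) = EL c (unc c q)"
      by (simp add: EL_accel_def Let_def D1_def[abs_def] D2_def)
  qed
qed

text \<open>Regularity of the inverse of L_vv is available only where L_vv is invertible, hence the
  factor that restricts to \<open>V\<close>.\<close>

lemma EL_meas:
  assumes c: "c \<in> A" shows "(\<lambda>p. indicator V p *\<^sub>R EL c p) \<in> borel_measurable (restrict_space \<mu> (cd c))"
proof -
  let ?S = "{q \<in> ci c. unc c q \<in> V}"
  obtain O' where O': "open O'" "?S = ci c \<inter> O'" using openin_chart[OF openV c] by (auto simp: openin_open)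
  have "ci c = (im c \<times> UNIV) \<inter> (UNIV \<times> UNIV \<times> {0..t0})" by (auto simp: chart_img_def)
  moreover have "open (im c \<times> (UNIV :: ((real^'n) \<times> real) set))" using open_im[OF c] by (simp add: open_Times)
  moreover have "closed ((UNIV :: (real^'n) set) \<times> (UNIV :: (real^'n) set) \<times> {0..t0})" by (simp add: closed_Times)
  ultimately have "ci c \<in> sets borel" by (metis borel_closed borel_open sets.Int)
  then have "?S \<in> sets borel" unfolding O'(2) by (intro sets.Int) (use \<open>ci c \<in> sets borel\<close> borel_open[OF O'(1)] in auto)
  then have E: "(\<lambda>q. indicator ?S q *\<^sub>R EL c (unc c q)) \<in> borel_measurable borel"
    by (rule borel_measurable_continuous_on_indicator[OF _ EL_cont[OF c]])
  have m: "coord c \<in> borel_measurable (restrict_space \<mu> (cd c))"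
    using measurable_coord[OF c] by (simp add: measurable_restrict_space2_iff)
  have "(\<lambda>p. indicator ?S (coord c p) *\<^sub>R EL c (unc c (coord c p))) \<in> borel_measurable (restrict_space \<mu> (cd c))"
    by (rule measurable_compose[OF m E])
  then show ?thesis
    by (rule measurable_cong[THEN iffD1, rotated])
      (use coord_in unc_coord[OF c] in \<open>simp add: space_restrict_cd[OF c] indicator_def\<close>)
qed

text \<open>The part of the support over \<open>K\<close> is compact and contained in
  \<open>V\<close>, where the acceleration is continuous.\<close>

lemma EL_bounded:
  assumes c: "c \<in> A" and K: "compact K" "K \<subseteq> ci c" shows "bounded (EL c ` (unc c ` K \<inter> supp))"
proof -
  let ?S = "unc c ` K \<inter> supp"
  have "compactin top ?S" by (rule compact_Int_closedin[OF compactin_unc[OF c K] supp_closed])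
  moreover have Sc: "?S \<subseteq> cd c" using K(2) unc_in[OF c] by blast
  ultimately have cS: "compact (coord c ` ?S)" using compact_coord[OF c] by blast
  have sub: "coord c ` ?S \<subseteq> {q \<in> ci c. unc c q \<in> V}"
  proof
    fix q assume "q \<in> coord c ` ?S"
    then obtain p where p: "p \<in> ?S" "q = coord c p" by blast
    then have "p \<in> cd c" "p \<in> V" using Sc suppV by blast+
    then show "q \<in> {q \<in> ci c. unc c q \<in> V}" using p(2) coord_in unc_coord[OF c] by simp
  qed
  have "bounded ((\<lambda>q. EL c (unc c q)) ` coord c ` ?S)"
    by (rule compact_imp_bounded[OF compact_continuous_image[OF continuous_on_subset[OF EL_cont[OF c] sub] cS]])
  moreover have "(\<lambda>q. EL c (unc c q)) ` coord c ` ?S = EL c ` ?S"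
    unfolding image_image
  proof (rule image_cong[OF refl])
    fix p assume "p \<in> ?S"
    then have "p \<in> cd c" using Sc by blast
    then show "EL c (unc c (coord c p)) = EL c p" using unc_coord[OF c] by simp
  qed
  ultimately show ?thesis by simp
qed

text \<open>The inhomogeneous terms in the laws of both accelerations cancel, which leaves a
  vertical field. Cutting it off outside \<open>V\<close> makes it covariant and measurable
  everywhere, and changes nothing on the support.\<close>

definition W :: "(('m, 'n) chart \<Rightarrow> ('m, 'n) point \<Rightarrow> real^'n) \<Rightarrow> ('m, 'n) chart \<Rightarrow> ('m, 'n) point \<Rightarrow> real^'n" where
  "W C c p = indicator V p *\<^sub>R (EL c p - C c p)"

lemma W_nice:
  assumes X: "nice (second_order_field C)" and Cm: "\<And>c. c \<in> A \<Longrightarrow> C c \<in> borel_measurable (restrict_space \<mu> (cd c))"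
    and Cb: "\<And>c K. c \<in> A \<Longrightarrow> compact K \<Longrightarrow> K \<subseteq> ci c \<Longrightarrow> bounded (C c ` (unc c ` K \<inter> supp))"
  shows "nice (vertical (W C))"
  unfolding nice_def
proof (intro conjI ballI allI impI)
  fix p assume p: "p \<in> TM"
  show "cov (vertical (W C)) p"
    unfolding cov_def
  proof (intro ballI impI)
    fix c d assume c: "c \<in> A" and d: "d \<in> A" and pc: "p \<in> cd c" and pd: "p \<in> cd d"
    have q: "coord c p \<in> OV c d" using coord_OV[OF c pc pd] .
    then have l: "linear (J c d (fst (coord c p)))" using linear_J[OF c d] by (auto simp: OV_def)
    have "W C d p = J c d (fst (coord c p)) (W C c p)"
    proof (cases "p \<in> V")
      case True
      have "second_order_field C d p = DT c d (coord c p) (second_order_field C c p)"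
        using X p c d pc pd unfolding nice_def cov_def by blast
      then have 1: "C d p = J2 c d (fst (coord c p)) (fst (snd (coord c p))) (fst (snd (coord c p))) + J c d (fst (coord c p)) (C c p)"
        unfolding cov_sof[OF c d pc pd] .
      have 2: "EL d p = J2 c d (fst (coord c p)) (fst (snd (coord c p))) (fst (snd (coord c p))) + J c d (fst (coord c p)) (EL c p)"
        using EL_cov[OF True c pc d pd] unfolding cov_sof[OF c d pc pd] .
      have "EL d p - C d p = J c d (fst (coord c p)) (EL c p - C c p)"
        unfolding 1 2 linear_diff[OF l] by simp
      then show ?thesis using True by (simp add: W_def)
    next
      case False
      then show ?thesis using linear_0[OF l] by (simp add: W_def)
    qed
    then show "vertical (W C) d p = DT c d (coord c p) (vertical (W C) c p)"
      by (simp add: vertical_def DT_vert[OF c d q])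
  qed
next
  fix c assume c: "c \<in> A"
  have [measurable]: "C c \<in> borel_measurable (restrict_space \<mu> (cd c))" "(\<lambda>p. indicator V p *\<^sub>R EL c p) \<in> borel_measurable (restrict_space \<mu> (cd c))"
    using Cm[OF c] EL_meas[OF c] by auto
  have [measurable]: "(indicator V :: _ \<Rightarrow> real) \<in> borel_measurable (restrict_space \<mu> (cd c))"
    by (intro measurable_restrict_space1 borel_measurable_indicator open_sets openV)
  have "(\<lambda>p. indicator V p *\<^sub>R EL c p - indicator V p *\<^sub>R C c p) \<in> borel_measurable (restrict_space \<mu> (cd c))"
    by measurable
  then have "W C c \<in> borel_measurable (restrict_space \<mu> (cd c))"
    by (simp add: W_def[abs_def] scaleR_right_diff_distrib)
  then show "vertical (W C) c \<in> borel_measurable (restrict_space \<mu> (cd c))"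
    unfolding vertical_def[abs_def] by (intro borel_measurable_Pair measurable_const) auto
  fix K :: "'n coords set" assume K: "compact K \<and> K \<subseteq> ci c"
  let ?S = "unc c ` K \<inter> supp"
  obtain B1 B2 where B: "\<forall>y\<in>EL c ` ?S. norm y \<le> B1" "\<forall>y\<in>C c ` ?S. norm y \<le> B2"
    using EL_bounded[OF c] Cb[OF c] K unfolding bounded_iff by meson
  have "norm (W C c p) \<le> B1 + B2" if "p \<in> ?S" for p
  proof -
    have "norm (W C c p) \<le> norm (EL c p - C c p)" by (simp add: W_def indicator_def)
    also have "\<dots> \<le> norm (EL c p) + norm (C c p)" by (rule norm_triangle_ineq4)
    also have "\<dots> \<le> B1 + B2" using B that by (intro add_mono) auto
    finally show ?thesis .
  qed
  then have "bounded (W C c ` ?S)" unfolding bounded_iff by blast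
  then show "bounded (vertical (W C) c ` ?S)"
    unfolding vertical_def[abs_def] by (intro bounded_Pair_image) (auto simp: image_constant_conv)
qed

lemma W_nice': "second_derivative A t0 \<mu> C \<Longrightarrow> nice (vertical (W C))"
proof (rule W_nice)
  assume C: "second_derivative A t0 \<mu> C"
  show "nice (second_order_field C)" using second_derivative_nice[OF C] .
  fix c assume c: "c \<in> A"
  show "C c \<in> borel_measurable (restrict_space \<mu> (cd c))"
    using C c borel_measurable_TMI_borel unfolding second_derivative_def by blast
  fix K :: "'n coords set" assume K: "compact K" "K \<subseteq> ci c"
  have "compactin top (unc c ` K)" "unc c ` K \<subseteq> cd c" using compactin_unc[OF c] unc_in[OF c] K by blast+
  then show "bounded (C c ` (unc c ` K \<inter> supp))" using C c unfolding second_derivative_def by blast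
qed

text \<open>On \<open>V\<close> the Euler-Lagrange field is the field of \<open>C\<close> plus the
  vertical difference. The complement of \<open>V\<close> is null, so the integral of the first
  summand over \<open>V\<close> is the full one.\<close>

lemma V_EL_integral:
  assumes X: "nice (second_order_field C)" and W: "nice (vertical (W C))" and f: "Ck_TMI A t0 (Suc 0) f"
  shows "(LINT p:V|\<mu>. deriv_along A t0 (EL_field A t0 L) f p) =
    (LINT p|\<mu>. deriv_along A t0 (second_order_field C) f p) + (LINT p|\<mu>. deriv_along A t0 (vertical (W C)) f p)"
proof -
  have pt: "indicator V p *\<^sub>R deriv_along A t0 (EL_field A t0 L) f p =
     indicator V p *\<^sub>R deriv_along A t0 (second_order_field C) f p + deriv_along A t0 (vertical (W C)) f p" if p: "p \<in> TM" for p
  proof -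
    let ?c = "chart_at A p"
    let ?D = "frechet_derivative (lc ?c f) (at (coord ?c p) within ci ?c)"
    have l: "linear ?D" using lc_deriv_at[OF f p] has_derivative_linear by blast
    show ?thesis
    proof (cases "p \<in> V")
      case True
      have "second_order_field EL ?c p = second_order_field C ?c p + vertical (W C) ?c p"
        using True by (simp add: second_order_field_def vertical_def W_def)
      then have "?D (second_order_field EL ?c p) = ?D (second_order_field C ?c p) + ?D (vertical (W C) ?c p)"
        by (simp only: linear_add[OF l])
      then show ?thesis using True by (simp add: EL_field_def deriv_along_frechet)
    next
      case False
      then have "vertical (W C) ?c p = 0" by (simp add: vertical_def W_def zero_prod_def)
      then show ?thesis using False linear_0[OF l] by (simp add: deriv_along_frechet)
    qed
  qed
  note i1 = integrable_deriv_along(1)[OF X f] and i2 = integrable_deriv_along(1)[OF W f]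
  have i3: "integrable \<mu> (\<lambda>p. indicator V p *\<^sub>R deriv_along A t0 (second_order_field C) f p)"
    by (rule integrable_mult_indicator[OF open_sets[OF openV] i1])
  have "(LINT p:V|\<mu>. deriv_along A t0 (EL_field A t0 L) f p) =
     (LINT p|\<mu>. indicator V p *\<^sub>R deriv_along A t0 (second_order_field C) f p + deriv_along A t0 (vertical (W C)) f p)"
    unfolding set_lebesgue_integral_def by (rule Bochner_Integration.integral_cong[OF refl]) (simp only: pt space_mu)
  also have "\<dots> = (LINT p|\<mu>. indicator V p *\<^sub>R deriv_along A t0 (second_order_field C) f p) + (LINT p|\<mu>. deriv_along A t0 (vertical (W C)) f p)"
    by (rule Bochner_Integration.integral_add[OF i3 i2])
  also have "(LINT p|\<mu>. indicator V p *\<^sub>R deriv_along A t0 (second_order_field C) f p) = (LINT p|\<mu>. deriv_along A t0 (second_order_field C) f p)"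
  proof (rule integral_cong_AE)
    show "AE p in \<mu>. indicator V p *\<^sub>R deriv_along A t0 (second_order_field C) f p = deriv_along A t0 (second_order_field C) f p"
      using AE_supp by (rule AE_mp) (use suppV in \<open>auto intro!: AE_I2\<close>)
  qed (use i1 i3 in simp_all)
  finally show ?thesis .
qed

lemma EL_invariant_iff:
  assumes C: "second_derivative A t0 \<mu> C"
  shows "EL_invariant A t0 L V \<mu> \<longleftrightarrow>
    (\<forall>f. smooth_TMI A t0 f \<and> vanishes_at_ends A t0 f \<longrightarrow> (LINT p|\<mu>. deriv_along A t0 (vertical (W C)) f p) = 0)"
proof -
  have eq: "(LINT p:V|\<mu>. deriv_along A t0 (EL_field A t0 L) f p) = (LINT p|\<mu>. deriv_along A t0 (vertical (W C)) f p)"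
    if "smooth_TMI A t0 f" "vanishes_at_ends A t0 f" for f
  proof -
    have "Ck_TMI A t0 (Suc 0) f" using that(1) unfolding smooth_TMI_def by blast
    from V_EL_integral[OF second_derivative_nice[OF C] W_nice'[OF C] this]
    show ?thesis using C that unfolding second_derivative_def by simp
  qed
  show ?thesis
  proof
    assume "EL_invariant A t0 L V \<mu>"
    then show "\<forall>f. smooth_TMI A t0 f \<and> vanishes_at_ends A t0 f \<longrightarrow> (LINT p|\<mu>. deriv_along A t0 (vertical (W C)) f p) = 0"
      using smooth_localize[OF W_nice'[OF C]] eq unfolding EL_invariant_def by metis
  next
    assume "\<forall>f. smooth_TMI A t0 f \<and> vanishes_at_ends A t0 f \<longrightarrow> (LINT p|\<mu>. deriv_along A t0 (vertical (W C)) f p) = 0"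
    then show "EL_invariant A t0 L V \<mu>" unfolding EL_invariant_def using eq by metis
  qed
qed

definition wF :: "(('m, 'n) point \<Rightarrow> ('m, 'n) tangent) \<Rightarrow> ('m, 'n) chart \<Rightarrow> ('m, 'n) point \<Rightarrow> real^'n" where
  "wF F c p = M c (coord c p) *v F p c"

text \<open>L_vv F is the derivative of the momentum along the vertical vector with component
  \<open>F\<close>. For a vertical vector the base point stays fixed and the \<open>J2\<close> term
  of \<open>DP_J\<close> is 0.\<close>

lemma wF_J:
  assumes F: "horizontal_map A t0 F" and c: "c \<in> A" "p \<in> cd c" and d: "d \<in> A" "p \<in> cd d"
  shows "wF F c p \<bullet> h = wF F d p \<bullet> J c d (fst (coord c p)) h"
proof -
  let ?q = "coord c p"
  have q: "?q \<in> OV c d" using coord_OV[OF c d(2)] .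
  then have y: "fst ?q \<in> ov c d" by (auto simp: OV_def)
  have z: "J2 c d (fst ?q) h 0 = 0" using linear_0[OF has_derivative_linear[OF J2_deriv[OF c(1) d(1) y]]] .
  have "DP c ?q (0, F p c, 0) \<bullet> h = DP d (T c d ?q) (0, J c d (fst ?q) (F p c), 0) \<bullet> J c d (fst ?q) h"
    using DP_J[OF c(1) d(1) q, of "(0, F p c, 0)" h] z by (simp add: DT_vert[OF c(1) d(1) q])
  then show ?thesis
    using DP_vert[OF c(1) coord_in[OF c(2)]] DP_vert[OF d(1) coord_in[OF d(2)]] T_coord[OF c(1) d(1) c(2) d(2)] hor_J[OF F c(1) d(1) c(2) d(2)]
    by (simp add: wF_def)
qed

lemma wF_cont:
  assumes F: "horizontal_map A t0 F" and c: "c \<in> A" shows "continuous_on (ci c) (lc c (wF F c))"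
proof -
  have "continuous_on (ci c) (lc c (\<lambda>p. F p c))"
    using F c unfolding horizontal_map_def One_nat_def by (blast intro: Ck_on_imp_continuous)
  then have "continuous_on (ci c) (\<lambda>q. \<chi> i. \<Sum>j\<in>UNIV. M c q $ i $ j * lc c (\<lambda>p. F p c) q $ j)"
    by (intro continuous_on_vec_lambda continuous_intros M_cont c)
  then show ?thesis
    by (rule continuous_on_eq) (simp add: loc_def wF_def matrix_vector_mult_def coord_unc[OF c])
qed

lemma vert_wF_integrable:
  assumes F: "horizontal_map A t0 F" and W: "nice (vertical W')"
  shows "integrable \<mu> (vert (wF F) W')"
proof (rule nice_integrable(1)[OF W])
  show "continuous_on (ci c) (\<lambda>q. lc c (wF F c) q \<bullet> fst (snd b))" if "c \<in> A" "b \<in> Basis" for c and b :: "'n coords"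
    by (intro continuous_intros wF_cont[OF F that(1)])
  fix c p assume c: "c \<in> A" and p: "p \<in> cd c"
  have d: "p \<in> cd (chart_at A p)" using chart_at_cd cd_TM[OF p] by blast
  have "cov (vertical W') p" using W cd_TM[OF p] unfolding nice_def by blast
  from wF_J[OF F c p chart_at(1) d, of "W' c p"] vertical_cov[OF this c chart_at(1) p d]
  have "vert (wF F) W' p = wF F c p \<bullet> W' c p" by (simp add: vert_def)
  then show "vert (wF F) W' p = (\<Sum>b\<in>Basis. (vertical W' c p \<bullet> b) * (lc c (wF F c) (coord c p) \<bullet> fst (snd b)))"
    unfolding Basis_expand_fst_snd by (simp add: vertical_def c p)
qed

lemma hor_end:
  assumes F: "horizontal_map A t0 F" and p: "p \<in> TM" "snd (snd p) = 0 \<or> snd (snd p) = t0" shows "F p c = 0"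
proof -
  have "\<forall>(x, v, t)\<in>TM. t = 0 \<or> t = t0 \<longrightarrow> (\<forall>c. F (x, v, t) c = 0)" using F unfolding horizontal_map_def by blast
  from bspec[OF this p(1)] p(2) show ?thesis by (cases p, cases c) auto
qed

lemma vanishesI:
  assumes "\<And>p. p \<in> TM \<Longrightarrow> snd (snd p) = 0 \<or> snd (snd p) = t0 \<Longrightarrow> f p = 0" shows "vanishes_at_ends A t0 f"
  unfolding vanishes_at_ends_def
proof
  fix p assume p: "p \<in> TM"
  show "case p of (x, v, t) \<Rightarrow> t = 0 \<or> t = t0 \<longrightarrow> f (x, v, t) = 0" using assms[OF p] by (cases p) auto
qed

text \<open>The function \<open>G\<close> below is L_v F. Subtracting its derivative along the field
  of \<open>C\<close> from the derivative of L along the variation leaves F paired with L_x minus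
  the derivative of L_v along that field. By the Euler-Lagrange equation L_x is the derivative of
  L_v along the Euler-Lagrange field; the two fields differ vertically, by the difference of
  accelerations, on which the derivative of L_v is L_vv.\<close>

lemma hor_variation_L:
  assumes F: "horizontal_map A t0 F" and C: "second_derivative A t0 \<mu> C"
  shows "hor_variation A t0 F \<mu> C L = (LINT p|\<mu>. vert (wF F) (W C) p)"
proof -
  define G where "G p = F p (chart_at A p) \<bullet> P (chart_at A p) (coord (chart_at A p) p)" for p
  have Gc: "lc c G q = lc c (\<lambda>p. F p c) q \<bullet> P c q" if c: "c \<in> A" and q: "q \<in> ci c" for c q
  proof -
    let ?p = "unc c q" let ?d = "chart_at A ?p"
    have p: "?p \<in> cd c" "coord c ?p = q" using unc_in[OF c q] coord_unc[OF c q] by auto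
    have d: "?p \<in> cd ?d" using chart_at_cd cd_TM[OF p(1)] by blast
    have qO: "q \<in> OV c ?d" using coord_OV[OF c p(1) d] p(2) by simp
    show ?thesis
      using P_J[OF c chart_at(1) qO, of "F ?p c"] hor_J[OF F c chart_at(1) p(1) d] T_coord[OF c chart_at(1) p(1) d] p(2)
      by (simp add: loc_def G_def inner_commute)
  qed
  have FC: "Ck_on (Suc 0) (lc c (\<lambda>p. F p c)) (ci c)" if "c \<in> A" for c
    using F that unfolding horizontal_map_def One_nat_def by blast
  have G1: "Ck_TMI A t0 (Suc 0) G"
    unfolding Ck_TMI_def
  proof
    fix c assume c: "c \<in> A"
    show "Ck_on (Suc 0) (lc c G) (ci c)"
      by (rule Ck_on_cong[OF Ck_on_inner[OF FC[OF c] P_C1[OF c]]]) (simp add: Gc[OF c])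
  qed
  have Gv: "vanishes_at_ends A t0 G"
    by (rule vanishesI) (simp add: G_def hor_end[OF F])
  note A0 = second_derivative_C1[OF C G1 Gv]
  note nX = second_derivative_nice[OF C] and nW = W_nice'[OF C]
  have iG: "integrable \<mu> (deriv_along A t0 (second_order_field C) G)" using integrable_deriv_along(1)[OF nX G1] .
  have iw: "integrable \<mu> (vert (wF F) (W C))" using vert_wF_integrable[OF F nW] .
  have iH: "integrable \<mu> (deriv_along A t0 (hor F C) L)" using integrable_deriv_along(1)[OF hor_nice[OF F C] L1] .
  have pt: "deriv_along A t0 (hor F C) L p = deriv_along A t0 (second_order_field C) G p + vert (wF F) (W C) p" if p: "p \<in> supp" for p
  proof -
    have pT: "p \<in> TM" and pV: "p \<in> V" using p supp_TM suppV by blast+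
    let ?c = "chart_at A p" let ?q = "coord ?c p" let ?X = "second_order_field C ?c p"
    let ?Fc = "lc ?c (\<lambda>p. F p ?c)"
    let ?DF = "frechet_derivative ?Fc (at ?q within ci ?c)"
    note c = chart_at(1)[of p] chart_at_cd[OF pT]
    note q = coord_in[OF c(2)]
    have "deriv_along A t0 (hor F C) L p = D1 ?c (F p ?c, ?DF ?X, 0) ?q"
      using deriv_along_D[OF pT L_deriv[OF c(1) q], of "hor F C"] by (simp add: hor_def)
    then have 1: "deriv_along A t0 (hor F C) L p = Rx ?c ?q \<bullet> F p ?c + P ?c ?q \<bullet> ?DF ?X"
      by (simp add: D1_split[OF c(1) q])
    have "((\<lambda>q. ?Fc q \<bullet> P ?c q) has_derivative (\<lambda>h. ?Fc ?q \<bullet> DP ?c ?q h + ?DF h \<bullet> P ?c ?q)) (at ?q within ci ?c)"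
      by (rule has_derivative_inner[OF hor_deriv[OF F c(1) q] P_deriv[OF c(1) q]])
    then have "(lc ?c G has_derivative (\<lambda>h. ?Fc ?q \<bullet> DP ?c ?q h + ?DF h \<bullet> P ?c ?q)) (at ?q within ci ?c)"
      by (rule has_derivative_transform[OF q, rotated]) (rule Gc[OF c(1)])
    from deriv_along_D[OF pT this, of "second_order_field C"]
    have 2: "deriv_along A t0 (second_order_field C) G p = F p ?c \<bullet> DP ?c ?q ?X + ?DF ?X \<bullet> P ?c ?q"
      using lc_coord[OF c, of "\<lambda>p. F p ?c"] by simp
    have "vert (wF F) (W C) p = F p ?c \<bullet> (M ?c ?q *v (EL ?c p - C ?c p))"
      using pV M_inner[OF c(1) q] by (simp add: vert_def wF_def W_def)
    also have "\<dots> = F p ?c \<bullet> (Rx ?c ?q - DP ?c ?q ?X)"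
      using DP_sof_diff[OF c, of EL C] EL_eq[OF c(1) pV c(2)] by simp
    finally show ?thesis unfolding 1 2 by (simp add: inner_diff_right inner_commute)
  qed
  have "hor_variation A t0 F \<mu> C L = (LINT p|\<mu>. deriv_along A t0 (hor F C) L p)"
    unfolding hor_variation_def hor_def by simp
  also have "\<dots> = (LINT p|\<mu>. deriv_along A t0 (second_order_field C) G p + vert (wF F) (W C) p)"
  proof (rule integral_cong_AE)
    show "AE p in \<mu>. deriv_along A t0 (hor F C) L p = deriv_along A t0 (second_order_field C) G p + vert (wF F) (W C) p"
      using AE_supp by (rule AE_mp) (use pt in \<open>auto intro!: AE_I2\<close>)
  qed (use iH iG iw in simp_all)
  also have "\<dots> = (LINT p|\<mu>. vert (wF F) (W C) p)"
    using A0 by (simp add: Bochner_Integration.integral_add[OF iG iw])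
  finally show ?thesis .
qed

end

section \<open>A measurable second order field on the whole tangent bundle\<close>

context mfdm
begin

lemma borel_ci: "c \<in> A \<Longrightarrow> ci c \<in> sets borel"
proof -
  assume c: "c \<in> A"
  have "ci c = (im c \<times> UNIV) \<inter> (UNIV \<times> UNIV \<times> {0..t0})" by (auto simp: chart_img_def)
  moreover have "open (im c \<times> (UNIV :: ((real^'n) \<times> real) set))" using open_im[OF c] by (simp add: open_Times)
  moreover have "closed ((UNIV :: (real^'n) set) \<times> (UNIV :: (real^'n) set) \<times> {0..t0})" by (simp add: closed_Times)
  ultimately show "ci c \<in> sets borel" by (metis borel_closed borel_open sets.Int)
qed

lemma borel_openin_ci:
  assumes c: "c \<in> A" and S: "openin (top_of_set (ci c)) S" shows "S \<in> sets borel"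
proof -
  obtain O' where O': "open O'" "S = ci c \<inter> O'" using S by (auto simp: openin_open)
  show ?thesis unfolding O'(2) by (intro sets.Int) (use borel_ci[OF c] borel_open[OF O'(1)] in auto)
qed

lemma measurable_coord_indicator:
  fixes g :: "'n coords \<Rightarrow> real^'n"
  assumes c: "c \<in> A" and S: "openin (top_of_set (ci c)) S" and g: "continuous_on S g"
  shows "(\<lambda>p. indicator S (coord c p) *\<^sub>R g (coord c p)) \<in> borel_measurable (restrict_space \<mu> (cd c))"
proof -
  have E: "(\<lambda>q. indicator S q *\<^sub>R g q) \<in> borel_measurable borel"
    by (rule borel_measurable_continuous_on_indicator[OF borel_openin_ci[OF c S] g])
  have m: "coord c \<in> borel_measurable (restrict_space \<mu> (cd c))"
    using measurable_coord[OF c] by (simp add: measurable_restrict_space2_iff)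
  show ?thesis by (rule measurable_compose[OF m E])
qed

lemma DT_comp:
  assumes e: "e \<in> A" "p \<in> cd e" and c: "c \<in> A" "p \<in> cd c" and d: "d \<in> A" "p \<in> cd d"
  shows "DT c d (coord c p) (DT e c (coord e p) h) = DT e d (coord e p) h"
proof -
  have D: "((\<lambda>q. coord d (unc c q)) has_derivative DT c d (coord c p)) (at (coord c p) within ci c)"
    if c: "c \<in> A" "p \<in> cd c" for c
  proof -
    have q: "coord c p \<in> OV c d" using coord_OV[OF c d(2)] .
    have "((\<lambda>q. coord d (unc c q)) has_derivative DT c d (coord c p)) (at (coord c p) within OV c d)"
      by (rule has_derivative_transform[OF q T_unc[OF c(1) d(1)] T_deriv[OF c(1) d(1) q]])
    then show ?thesis unfolding at_within_openin[OF openin_OV[OF c(1) d(1)] q] .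
  qed
  have q: "coord e p \<in> OV e c" using coord_OV[OF e c(2)] .
  have "((\<lambda>q. coord d (unc e q)) has_derivative (\<lambda>h. DT c d (coord c p) (DT e c (coord e p) h))) (at (coord e p) within ci e)"
    by (rule deriv_T[where g="\<lambda>q. coord d (unc c q)", OF e(1) c(1) q])
      (use D[OF c] T_coord[OF e(1) c(1) e(2) c(2)] unc_T[OF e(1) c(1)] in simp_all)
  from trans[OF sym[OF thick_frechet_derivative[OF thick_ci[OF e(1)] coord_in[OF e(2)] this]]
      thick_frechet_derivative[OF thick_ci[OF e(1)] coord_in[OF e(2)] D[OF e]]]
  show ?thesis by (rule fun_cong)
qed

lemma continuous_on_spray:
  assumes e: "e \<in> A" and c: "c \<in> A"
  shows "continuous_on (OV e c) (\<lambda>q. J2 e c (fst q) (fst (snd q)) (fst (snd q)))"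
proof -
  have "continuous_on (OV e c) (\<lambda>q. \<Sum>i\<in>UNIV. fst (snd q) $ i *\<^sub>R (\<Sum>j\<in>UNIV. fst (snd q) $ j *\<^sub>R J2 e c (fst q) (axis j 1) (axis i 1)))"
    by (intro continuous_intros continuous_on_compose2[OF Ck_on_imp_continuous[OF Ck_J2[OF e c]]]) (auto simp: OV_def)
  then show ?thesis
  proof (rule continuous_on_eq)
    fix q assume "q \<in> OV e c"
    then have y: "fst q \<in> ov e c" by (auto simp: OV_def)
    show "(\<Sum>i\<in>UNIV. fst (snd q) $ i *\<^sub>R (\<Sum>j\<in>UNIV. fst (snd q) $ j *\<^sub>R J2 e c (fst q) (axis j 1) (axis i 1)))
       = J2 e c (fst q) (fst (snd q)) (fst (snd q))"
      by (simp only: J2_sum[OF e c y, of "fst (snd q)"] J2_sym[OF e c y, of "axis _ 1" "fst (snd q)"])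
  qed
qed

text \<open>A second derivative has to be covariant on the whole space, while the Euler-Lagrange
  acceleration is available on \<open>V\<close> only. Off \<open>V\<close> it is completed by this
  field, which has zero acceleration in the first chart of a countable enumeration that contains the
  point. It is measurable because it is pieced together from countably many continuous expressions
  on measurable sets.\<close>

lemma exists_spray:
  shows "\<exists>S. (\<forall>p\<in>TM. cov (second_order_field S) p) \<and> (\<forall>c\<in>A. S c \<in> borel_measurable (restrict_space \<mu> (cd c)))"
proof -
  obtain B where B: "countable B" "B \<subseteq> A" "TM \<subseteq> \<Union> (cd ` B)" using countable_charts by blast
  obtain c0 where c0: "c0 \<in> A" using exists_chart by blast
  \<comment> \<open>Inserting \<open>c0\<close> makes the set nonempty, so that
    \<open>from_nat_into\<close> yields members of it.\<close>
  define b where "b = from_nat_into (insert c0 B)"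
  have b: "b n \<in> A" for n
  proof -
    have "from_nat_into (insert c0 B) n \<in> insert c0 B" by (rule from_nat_into) simp
    then show ?thesis unfolding b_def by (rule subsetD[OF insert_subsetI[OF c0 B(2)]])
  qed
  have bex: "\<exists>n. p \<in> cd (b n)" if "p \<in> TM" for p
  proof -
    have "p \<in> \<Union> (cd ` B)" by (rule subsetD[OF B(3) that])
    then obtain c where cB: "c \<in> B" and c2: "p \<in> cd c" by (rule UN_E)
    have c: "c \<in> insert c0 B" using cB by (rule insertI2)
    obtain n where "from_nat_into (insert c0 B) n = c" using from_nat_into_surj[OF countable_insert[OF B(1)] c] by blast
    then have "p \<in> cd (b n)" using c2 by (simp only: b_def)
    then show ?thesis by (rule exI)
  qed
  define idx where "idx p = (LEAST n. p \<in> cd (b n))" for p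
  have bi: "p \<in> cd (b (idx p))" if "p \<in> TM" for p
    unfolding idx_def by (rule LeastI_ex[OF bex[OF that]])
  define S where "S c p = fst (snd (DT (b (idx p)) c (coord (b (idx p)) p) (fst (snd p) (b (idx p)), 0, 1)))" for c p
  have sS: "second_order_field S c p = DT (b (idx p)) c (coord (b (idx p)) p) (fst (snd p) (b (idx p)), 0, 1)"
    if c: "c \<in> A" "p \<in> cd c" for c p
    using T_coord[OF b c(1) bi[OF cd_TM[OF c(2)]] c(2)]
    by (simp add: second_order_field_def S_def DT_def T_def coord_def)
  show ?thesis
  proof (intro exI conjI ballI)
    show "cov (second_order_field S) p" if p: "p \<in> TM" for p
      unfolding cov_def using sS DT_comp[OF b bi[OF p]] by simp
    fix c assume c: "c \<in> A"
    let ?R = "restrict_space \<mu> (cd c)"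
    define g where "g n p = (indicator (OV c (b n)) (coord c p) :: real) *\<^sub>R J2 (b n) c (fst (T c (b n) (coord c p)))
        (fst (snd (T c (b n) (coord c p)))) (fst (snd (T c (b n) (coord c p))))" for n p
    have gm: "g n \<in> borel_measurable ?R" for n
      unfolding g_def
    proof (rule measurable_coord_indicator[OF c openin_OV[OF c b], where g="\<lambda>q. J2 (b n) c (fst (T c (b n) q))
        (fst (snd (T c (b n) q))) (fst (snd (T c (b n) q)))"])
      show "continuous_on (OV c (b n)) (\<lambda>q. J2 (b n) c (fst (T c (b n) q)) (fst (snd (T c (b n) q))) (fst (snd (T c (b n) q))))"
        by (rule continuous_on_compose2[OF continuous_on_spray[OF b c] Ck_on_imp_continuous[OF Ck_T[OF c b]]])
          (use T_in[OF c b] in blast)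
    qed
    have pm: "Measurable.pred ?R (\<lambda>p. p \<in> cd (b n))" for n
    proof -
      have "Measurable.pred \<mu> (\<lambda>p. p \<in> cd (b n))"
        using cd_sets[OF b] by (simp add: pred_def space_mu Collect_conj_eq cd_Int_space[OF b, unfolded space_mu] Int_commute[of TM])
      then show ?thesis by (rule measurable_restrict_space1)
    qed
    have "idx \<in> measurable ?R (count_space UNIV)"
      unfolding idx_def by (rule measurable_Least[OF pm])
    then have "(\<lambda>p. g (idx p) p) \<in> borel_measurable ?R"
      by (rule measurable_compose_countable[OF gm])
    then show "S c \<in> borel_measurable ?R"
    proof (rule measurable_cong[THEN iffD1, rotated])
      fix p assume "p \<in> space ?R"
      then have p: "p \<in> cd c" using space_restrict_cd[OF c] by simp
      let ?e = "b (idx p)"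
      have pe: "p \<in> cd ?e" using bi[OF cd_TM[OF p]] .
      have y: "fst (coord ?e p) \<in> ov ?e c" using coord_OV[OF b pe p] by (auto simp: OV_def)
      have "J ?e c (fst (coord ?e p)) 0 = 0" using linear_0[OF linear_J[OF b c y]] .
      then show "g (idx p) p = S c p"
        using coord_OV[OF c p pe] T_coord[OF c b p pe] by (simp add: g_def S_def DT_def) (simp add: coord_def)
    qed
  qed
qed

end

section \<open>Invariant measures have closed velocities and are critical\<close>

context lag
begin

text \<open>The acceleration is the Euler-Lagrange one on \<open>V\<close>, so the vertical
  difference is 0 everywhere, and invariance is the required identity for compactly supported
  functions. Boundedness is asked only on the support, which lies in \<open>V\<close>.\<close>

lemma EL_second_derivative:
  assumes inv: "EL_invariant A t0 L V \<mu>"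
  shows "\<exists>C. second_derivative A t0 \<mu> C"
proof -
  obtain S where S0: "(\<forall>p\<in>TM. cov (second_order_field S) p) \<and> (\<forall>c\<in>A. S c \<in> borel_measurable (restrict_space \<mu> (cd c)))"
    using exists_spray by (rule exE)
  have S: "p \<in> TM \<Longrightarrow> cov (second_order_field S) p" "c \<in> A \<Longrightarrow> S c \<in> borel_measurable (restrict_space \<mu> (cd c))" for p c
    by (erule bspec[OF conjunct1[OF S0]], erule bspec[OF conjunct2[OF S0]])
  define C where "C c p = (if p \<in> V then EL c p else S c p)" for c p
  have covC: "cov (second_order_field C) p" if p: "p \<in> TM" for p
  proof (cases "p \<in> V")
    case True
    then have e: "second_order_field C d p = second_order_field EL d p" for d by (simp add: second_order_field_def C_def)
    show ?thesis unfolding cov_def e using EL_cov[OF True] by blast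
  next
    case False
    then have e: "second_order_field C d p = second_order_field S d p" for d by (simp add: second_order_field_def C_def)
    show ?thesis using S(1)[OF p] unfolding cov_def e .
  qed
  have Cm: "C c \<in> borel_measurable (restrict_space \<mu> (cd c))" if c: "c \<in> A" for c
  proof -
    have [measurable]: "S c \<in> borel_measurable (restrict_space \<mu> (cd c))" "(\<lambda>p. indicator V p *\<^sub>R EL c p) \<in> borel_measurable (restrict_space \<mu> (cd c))"
      using S(2)[OF c] EL_meas[OF c] by auto
    have [measurable]: "(indicator V :: _ \<Rightarrow> real) \<in> borel_measurable (restrict_space \<mu> (cd c))"
      by (intro measurable_restrict_space1 borel_measurable_indicator open_sets openV)
    have "(\<lambda>p. indicator V p *\<^sub>R EL c p + (1 - indicator V p) *\<^sub>R S c p) \<in> borel_measurable (restrict_space \<mu> (cd c))"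
      by measurable
    moreover have "(\<lambda>p. indicator V p *\<^sub>R EL c p + (1 - indicator V p) *\<^sub>R S c p) = C c"
      by (simp add: fun_eq_iff C_def)
    ultimately show ?thesis by simp
  qed
  have Cb: "bounded (C c ` (unc c ` K \<inter> supp))" if "c \<in> A" "compact K" "K \<subseteq> ci c" for c K
  proof -
    have "C c ` (unc c ` K \<inter> supp) = EL c ` (unc c ` K \<inter> supp)"
      by (rule image_cong[OF refl]) (use suppV in \<open>auto simp: C_def\<close>)
    then show ?thesis using EL_bounded[OF that] by simp
  qed
  note nX = sof_nice[OF covC Cm Cb] and nW = W_nice[OF sof_nice[OF covC Cm Cb] Cm Cb]
  have "(LINT p|\<mu>. deriv_along A t0 (second_order_field C) f p) = 0"
    if f: "smooth_TMI A t0 f" "vanishes_at_ends A t0 f" for f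
  proof (rule smooth_localize[OF nX _ f])
    fix f assume f: "smooth_TMI A t0 f" "compactly_supported A t0 f" "vanishes_at_ends A t0 f"
    then have f1: "Ck_TMI A t0 (Suc 0) f" unfolding smooth_TMI_def by blast
    have W0: "W C c p = 0" for c p by (simp add: W_def C_def)
    have "(LINT p|\<mu>. deriv_along A t0 (vertical (W C)) f p) = (LINT p|\<mu>. 0)"
      by (rule Bochner_Integration.integral_cong[OF refl]) (simp add: space_mu deriv_along_vertical[OF f1] vert_def W0)
    then show "(LINT p|\<mu>. deriv_along A t0 (second_order_field C) f p) = 0"
      using V_EL_integral[OF nX nW f1] inv f unfolding EL_invariant_def by simp
  qed
  moreover have "bounded (C c ` (K \<inter> supp))" if c: "c \<in> A" and K: "compactin top K" "K \<subseteq> cd c" for c K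
  proof -
    have "unc c ` coord c ` K = K" using K(2) unc_coord[OF c] by (force simp: image_image)
    moreover have "coord c ` K \<subseteq> ci c" using K(2) coord_in by blast
    ultimately show ?thesis using Cb[OF c compact_coord[OF c K]] by simp
  qed
  ultimately have "second_derivative A t0 \<mu> C"
    unfolding second_derivative_def vector_field_cov borel_measurable_TMI_borel using covC Cm by blast
  then show ?thesis by blast
qed

lemma EL_critical:
  assumes inv: "EL_invariant A t0 L V \<mu>"
  shows "horizontally_critical A t0 L \<mu>"
  unfolding horizontally_critical_def
proof (intro allI impI)
  fix \<mu>s \<eta> assume "exact_horizontal_variation A t0 L \<mu> \<mu>s \<eta>"
  then have "\<eta> \<in> Theta A t0 L \<mu>" unfolding exact_horizontal_variation_def by blast
  then obtain F C where \<eta>: "\<eta> = hor_variation A t0 F \<mu> C" and C: "second_derivative A t0 \<mu> C"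
    and F: "horizontal_map A t0 F" and cl: "fiber_closed A t0 L F" unfolding Theta_def by blast
  \<comment> \<open>The fiber primitive, integrated along rays from the zero section. Transition
    maps are linear on fibers and preserve these rays, so the primitives in different charts agree
    and define one function.\<close>
  define U where "U c q = integral (cbox 0 1) (\<lambda>s. lc c (wF F c) (fst q, s *\<^sub>R fst (snd q), snd (snd q)) \<bullet> fst (snd q))"
    for c and q :: "'n coords"
  define u where "u p = U (chart_at A p) (coord (chart_at A p) p)" for p
  have U_eq: "U c (coord c p) = U d (coord d p)" if c: "c \<in> A" "p \<in> cd c" and d: "d \<in> A" "p \<in> cd d" for c d p
    unfolding U_def
  proof (rule Henstock_Kurzweil_Integration.integral_cong)
    fix s :: real
    let ?q = "coord c p" let ?qs = "(fst ?q, s *\<^sub>R fst (snd ?q), snd (snd ?q))"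
    have q: "?q \<in> OV c d" using coord_OV[OF c d(2)] .
    then have y: "fst ?q \<in> ov c d" by (auto simp: OV_def)
    have qs: "?qs \<in> OV c d" using q by (auto simp: OV_def)
    have qc: "?qs \<in> ci c" using qs OV_subset[OF c(1)] by blast
    have ps: "unc c ?qs \<in> cd c" "unc c ?qs \<in> cd d" using unc_in[OF c(1) qc] qs OV_iff[OF c(1)] by blast+
    have Tq: "coord d p = T c d ?q" using T_coord[OF c(1) d(1) c(2) d(2)] by simp
    have Ts: "T c d ?qs = (fst (coord d p), s *\<^sub>R fst (snd (coord d p)), snd (snd (coord d p)))"
      unfolding Tq using linear_scale[OF linear_J[OF c(1) d(1) y]] by (simp add: T_def)
    have "wF F c (unc c ?qs) \<bullet> fst (snd ?q) = wF F d (unc c ?qs) \<bullet> J c d (fst ?q) (fst (snd ?q))"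
      using wF_J[OF F c(1) ps(1) d(1) ps(2), of "fst (snd ?q)"] coord_unc[OF c(1) qc] by simp
    moreover have "unc d (T c d ?qs) = unc c ?qs" using unc_T[OF c(1) d(1) qs] .
    moreover have "J c d (fst ?q) (fst (snd ?q)) = fst (snd (coord d p))" unfolding Tq by (simp add: T_def)
    ultimately show "lc c (wF F c) ?qs \<bullet> fst (snd ?q)
      = lc d (wF F d) (fst (coord d p), s *\<^sub>R fst (snd (coord d p)), snd (snd (coord d p))) \<bullet> fst (snd (coord d p))"
      unfolding loc_def Ts by simp
  qed
  have lu: "lc c u q = U c q" if c: "c \<in> A" and q: "q \<in> ci c" for c q
    using U_eq[OF chart_at(1) chart_at_cd[OF cd_TM[OF unc_in[OF c q]]] c unc_in[OF c q]] coord_unc[OF c q]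
    by (simp add: loc_def u_def)
  have fu: "fib u (wF F)"
    unfolding fib_def
  proof (intro ballI conjI)
    fix c assume c: "c \<in> A"
    show "continuous_on (ci c) (lc c (wF F c))" using wF_cont[OF F c] .
    have "continuous_on (ci c) (U c)"
      unfolding U_def
    proof (rule integral_continuous_on_param)
      show "continuous_on (ci c \<times> cbox 0 1) (\<lambda>(q, s :: real). lc c (wF F c) (fst q, s *\<^sub>R fst (snd q), snd (snd q)) \<bullet> fst (snd q))"
        unfolding case_prod_beta
        by (intro continuous_intros continuous_on_compose2[OF wF_cont[OF F c]]) (auto simp: ci_iff)
    qed
    then show "continuous_on (ci c) (lc c u)" by (rule continuous_on_eq) (simp add: lu[OF c])
    fix q assume q: "q \<in> ci c"
    define \<omega> where "\<omega> w = lc c (wF F c) (fst q, w, snd (snd q))" for w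
    have qw: "(fst q, w, snd (snd q)) \<in> ci c" for w using q by (simp add: ci_iff)
    have "\<omega> = (\<lambda>w. M c (fst q, w, snd (snd q)) *v lc c (\<lambda>p. F p c) (fst q, w, snd (snd q)))"
      by (simp add: fun_eq_iff \<omega>_def loc_def wF_def coord_unc[OF c qw])
    moreover have "closed_1form (\<lambda>w. M c (fst q, w, snd (snd q)) *v lc c (\<lambda>p. F p c) (fst q, w, snd (snd q)))"
      by (rule cl[unfolded fiber_closed_def, THEN bspec, OF c, THEN bspec, THEN bspec]) (use q in \<open>simp_all add: ci_iff\<close>)
    ultimately have "closed_1form \<omega>" by simp
    moreover have "continuous_on UNIV \<omega>"
      unfolding \<omega>_def by (rule continuous_on_compose2[OF wF_cont[OF F c]]) (use qw in \<open>auto intro!: continuous_intros\<close>)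
    ultimately have "((\<lambda>x. integral (cbox 0 1) (\<lambda>s::real. \<omega> (s *\<^sub>R x) \<bullet> x)) has_derivative (\<lambda>h. \<omega> (fst (snd q)) \<bullet> h)) (at (fst (snd q)))"
      by (intro closed_1form_primitive)
    moreover have "(\<lambda>w. lc c u (fst q, w, snd (snd q))) = (\<lambda>x. integral (cbox 0 1) (\<lambda>s::real. \<omega> (s *\<^sub>R x) \<bullet> x))"
      by (simp add: fun_eq_iff lu[OF c qw] U_def \<omega>_def)
    moreover have "lc c (wF F c) q = \<omega> (fst (snd q))" by (simp add: \<omega>_def)
    ultimately show "((\<lambda>w. lc c u (fst q, w, snd (snd q))) has_derivative (\<lambda>h. lc c (wF F c) q \<bullet> h)) (at (fst (snd q)))"
      by simp
  qed
  have uv: "vanishes_at_ends A t0 u"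
  proof (rule vanishesI)
    fix p assume p: "p \<in> TM" "snd (snd p) = 0 \<or> snd (snd p) = t0"
    let ?c = "chart_at A p" let ?q = "coord ?c p"
    have "lc ?c (wF F ?c) (fst ?q, w, snd (snd ?q)) = 0" for w
    proof -
      have q: "(fst ?q, w, snd (snd ?q)) \<in> ci ?c" using coord_in[OF chart_at_cd[OF p(1)]] by (simp add: ci_iff)
      have "F (unc ?c (fst ?q, w, snd (snd ?q))) ?c = 0"
        by (rule hor_end[OF F cd_TM[OF unc_in[OF chart_at(1) q]]]) (use p(2) in \<open>simp add: unc_eq[OF chart_at(1) q]\<close>, simp add: coord_def)
      then show ?thesis by (simp add: loc_def wF_def)
    qed
    then show "u p = 0" by (simp add: u_def U_def)
  qed
  have "(LINT p|\<mu>. vert (wF F) (W C) p) = 0"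
    by (rule vert_smooth_vanish[OF W_nice'[OF C] _ fu uv]) (use inv[unfolded EL_invariant_iff[OF C]] in blast)
  then show "\<eta> L = 0" unfolding \<eta> hor_variation_L[OF F C] .
qed

end

section \<open>Existence of horizontal variations\<close>

context mfdm
begin

lemma measurable_continuous_TMI:
  assumes "Ck_TMI A t0 0 g" shows "g \<in> borel_measurable \<mu>"
proof (rule measurable_chartI)
  fix c assume c: "c \<in> A"
  have "continuous_on (ci c) (lc c g)" using assms c unfolding Ck_TMI_def by simp
  from measurable_continuous_coord[OF c this]
  show "g \<in> borel_measurable (restrict_space \<mu> (cd c))"
    by (rule measurable_cong[THEN iffD1, rotated]) (simp add: space_restrict_cd[OF c] c)
qed

lemma measurable_into_TMI:
  assumes "f \<in> space N \<rightarrow> TM" "\<And>U. openin top U \<Longrightarrow> f -` U \<inter> space N \<in> sets N"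
  shows "f \<in> measurable N \<mu>"
proof -
  have "f \<in> measurable N (TMI_borel A t0)"
    unfolding TMI_borel_def
    by (rule measurable_measure_of) (use assms openin_subset[of top] topspace_top in auto)
  then show ?thesis using measurable_cong_sets[OF refl sets_mu, of N] by simp
qed

lemma closedin_msupport: "closedin top (msupport A t0 \<nu>)"
proof -
  have "TM - msupport A t0 \<nu> = \<Union> {U. openin top U \<and> emeasure \<nu> U = 0}"
    using openin_subset[of top] topspace_top unfolding msupport_def by blast
  moreover have "openin top (\<Union> {U. openin top U \<and> emeasure \<nu> U = 0})" by (rule openin_Union) blast
  ultimately show ?thesis using topspace_top by (auto simp: closedin_def msupport_def)
qed

end

text \<open>The criticality argument produces only maps \<open>F\<close> carried by a compact set of
  one chart. For these the variation can move points along straight lines in the coordinates of that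
  chart and leave all other points fixed.\<close>

locale hvar = mfdm A t0 \<mu> for A :: "('m::{second_countable_topology, t2_space}, 'n::finite) chart set" and t0 \<mu> +
  fixes C F c K
  assumes C: "second_derivative A t0 \<mu> C" and F: "horizontal_map A t0 F" and c: "c \<in> A"
    and K: "compact K" "K \<subseteq> ci c" and F0: "\<And>p d. p \<notin> unc c ` K \<Longrightarrow> F p d = 0"
begin

abbreviation "Z \<equiv> hor F C c"

definition Tr where "Tr s p = (if p \<in> cd c then unc c (coord c p + s *\<^sub>R Z p) else p)"

lemma TK: "openin top (TM - unc c ` K)"
  using closedin_unc[OF c K] by (simp add: closedin_def topspace_top)

lemma hor_0:
  assumes d: "d \<in> A" "p \<in> cd d" and p: "p \<notin> unc c ` K" shows "hor F C d p = 0"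
proof -
  have pU: "p \<in> TM - unc c ` K" using p cd_TM[OF d(2)] by blast
  have "(lc d (\<lambda>p. F p d) has_derivative (\<lambda>h. 0)) (at (coord d p) within ci d)"
    by (rule lc_has_derivative_cong[OF d TK pU, where f="\<lambda>p. 0"]) (simp_all add: F0 loc_def)
  from thick_frechet_derivative[OF thick_ci[OF d(1)] coord_in[OF d(2)] this]
  show ?thesis by (simp add: hor_def F0[OF p] zero_prod_def)
qed

lemma Z_simps: "fst (Z p) = F p c" "snd (snd (Z p)) = 0" by (simp_all add: hor_def)

lemma Tr_simps: "p \<notin> cd c \<Longrightarrow> Tr s p = p" "p \<in> cd c \<Longrightarrow> Tr s p = unc c (coord c p + s *\<^sub>R Z p)"
  by (simp_all add: Tr_def)

lemma Tr_outside: "p \<in> TM \<Longrightarrow> p \<notin> unc c ` K \<Longrightarrow> Tr s p = p"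
  using hor_0[OF c] unc_coord[OF c] by (cases "p \<in> cd c") (simp_all add: Tr_def)

text \<open>The displacement of base points is bounded over all of \<open>K\<close>, which keeps
  every point of the chart inside it for small \<open>s\<close>. The displacement of velocities
  involves \<open>C\<close> and is bounded on the support only, which suffices for a compact set
  that catches the moved part of the support.\<close>

lemma exists_range:
  "\<exists>s0 K2. s0 > 0 \<and> compact K2 \<and> K2 \<subseteq> ci c \<and> (\<forall>p\<in>cd c. \<forall>s. \<bar>s\<bar> \<le> s0 \<longrightarrow> coord c p + s *\<^sub>R Z p \<in> ci c) \<and>
    (\<forall>p\<in>unc c ` K \<inter> supp. \<forall>s. \<bar>s\<bar> \<le> s0 \<longrightarrow> coord c p + s *\<^sub>R Z p \<in> K2)"
proof -
  let ?Fc = "lc c (\<lambda>p. F p c)"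
  have K1: "compact (fst ` K)" by (intro compact_continuous_image continuous_intros K)
  have K1im: "fst ` K \<subseteq> im c"
  proof
    fix y assume "y \<in> fst ` K"
    then obtain q where "q \<in> K" "y = fst q" by blast
    then show "y \<in> im c" using subsetD[OF K(2), of q] by (simp only: ci_iff)
  qed
  obtain d where d: "d > 0" "compact {x. \<exists>y\<in>fst ` K. dist x y \<le> d}" "{x. \<exists>y\<in>fst ` K. dist x y \<le> d} \<subseteq> im c"
    by (rule compact_neighbourhood[OF K1 open_im[OF c] K1im])
  define N where "N = {x. \<exists>y\<in>fst ` K. dist x y \<le> d}"
  have "continuous_on (ci c) ?Fc"
    using F c unfolding horizontal_map_def One_nat_def by (blast intro: Ck_on_imp_continuous)
  then have "compact (?Fc ` K)" using K by (intro compact_continuous_image) (rule continuous_on_subset)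
  then obtain B1 where B1: "B1 > 0" "\<forall>x\<in>?Fc ` K. norm x \<le> B1" using compact_imp_bounded bounded_pos by blast
  have "bounded (Z ` (unc c ` K \<inter> supp))" using hor_nice[OF F C] c K unfolding nice_def by blast
  then obtain B2 where B2: "B2 > 0" "\<forall>x\<in>Z ` (unc c ` K \<inter> supp). norm x \<le> B2" using bounded_pos by blast
  have "bounded ((\<lambda>q. fst (snd q)) ` K)" by (intro compact_imp_bounded compact_continuous_image continuous_intros K)
  then obtain B3 where B3: "B3 > 0" "\<forall>x\<in>(\<lambda>q. fst (snd q)) ` K. norm x \<le> B3" using bounded_pos by blast
  \<comment> \<open>The base point moves by at most s0 * B1 = d, hence stays in the compact
    neighbourhood \<open>N\<close> of the projection of \<open>K\<close>.\<close>
  define s0 where "s0 = d / B1"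
  have s0: "s0 > 0" using d B1 by (simp add: s0_def)
  define K2 where "K2 = N \<times> cball (0::real^'n) (B3 + s0 * B2) \<times> {0..t0}"
  have base: "fst (coord c p) + s *\<^sub>R F p c \<in> N" if p: "p \<in> cd c" "p \<in> unc c ` K" and s: "\<bar>s\<bar> \<le> s0" for p s
  proof -
    have qK: "coord c p \<in> K" using p(2) coord_unc[OF c] K(2) by auto
    have "norm (F p c) \<le> B1" using B1(2) qK lc_coord[OF c p(1), of "\<lambda>p. F p c"] by fastforce
    then have "\<bar>s\<bar> * norm (F p c) \<le> s0 * B1" using s s0 by (intro mult_mono) auto
    also have "s0 * B1 = d" using B1 by (simp add: s0_def)
    finally have "dist (fst (coord c p) + s *\<^sub>R F p c) (fst (coord c p)) \<le> d" by (simp add: dist_norm)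
    then show ?thesis using qK unfolding N_def by blast
  qed
  have in_ci: "coord c p + s *\<^sub>R Z p \<in> ci c" if p: "p \<in> cd c" and s: "\<bar>s\<bar> \<le> s0" for p s
  proof (cases "p \<in> unc c ` K")
    case True
    then have "fst (coord c p) + s *\<^sub>R F p c \<in> im c" using base[OF p True s] d(3) unfolding N_def by blast
    then show ?thesis using coord_in[OF p] by (simp add: ci_iff Z_simps)
  next
    case False
    then show ?thesis using hor_0[OF c p False] coord_in[OF p] by simp
  qed
  have in_K2: "coord c p + s *\<^sub>R Z p \<in> K2" if p: "p \<in> unc c ` K \<inter> supp" and s: "\<bar>s\<bar> \<le> s0" for p s
  proof -
    have pc: "p \<in> cd c" using p unc_in[OF c] K(2) by blast
    have qK: "coord c p \<in> K" using p coord_unc[OF c] K(2) by auto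
    have w: "norm (fst (snd (coord c p))) \<le> B3" using B3(2) qK by blast
    have "norm (Z p) \<le> B2" using B2(2) p by blast
    then have "norm (fst (snd (Z p))) \<le> B2"
      using norm_fst_le[of "fst (snd (Z p))" "snd (snd (Z p))"] norm_snd_le[of "snd (Z p)" "fst (Z p)"] by simp
    then have "\<bar>s\<bar> * norm (fst (snd (Z p))) \<le> s0 * B2" using s s0 by (intro mult_mono) auto
    then have "norm (fst (snd (coord c p)) + s *\<^sub>R fst (snd (Z p))) \<le> B3 + s0 * B2"
      using w norm_triangle_ineq[of "fst (snd (coord c p))" "s *\<^sub>R fst (snd (Z p))"] by simp
    then show ?thesis
      using base[OF pc _ s] p coord_in[OF pc] by (auto simp: K2_def mem_Times_iff Z_simps ci_iff)
  qed
  have K2c: "compact K2" unfolding K2_def N_def by (intro compact_Times d(2)) auto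
  have K2s: "K2 \<subseteq> ci c" using d(3) unfolding K2_def N_def[symmetric] by (auto simp: ci_iff)
  show ?thesis
    by (intro exI[of _ s0] exI[of _ K2] conjI ballI allI impI s0 K2c K2s) (erule (1) in_ci, erule (1) in_K2)
qed

end

section \<open>Image measures under small displacements\<close>

locale hvar2 = hvar A t0 \<mu> C F c K for A :: "('m::{second_countable_topology, t2_space}, 'n::finite) chart set" and t0 \<mu> C F c K +
  fixes s0 :: real and K2
  assumes s0: "s0 > 0" and K2: "compact K2" "K2 \<subseteq> ci c"
    and in_ci: "\<And>p s. p \<in> cd c \<Longrightarrow> \<bar>s\<bar> \<le> s0 \<Longrightarrow> coord c p + s *\<^sub>R Z p \<in> ci c"
    and in_K2: "\<And>p s. p \<in> unc c ` K \<Longrightarrow> p \<in> supp \<Longrightarrow> \<bar>s\<bar> \<le> s0 \<Longrightarrow> coord c p + s *\<^sub>R Z p \<in> K2"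
begin

lemma Tr_cd: "p \<in> cd c \<Longrightarrow> \<bar>s\<bar> \<le> s0 \<Longrightarrow> Tr s p \<in> cd c"
  using unc_in[OF c in_ci] by (simp add: Tr_simps)

lemma Tr_TM: "p \<in> TM \<Longrightarrow> \<bar>s\<bar> \<le> s0 \<Longrightarrow> Tr s p \<in> TM"
  using cd_TM[OF Tr_cd] by (cases "p \<in> cd c") (simp_all add: Tr_simps)

lemma coord_Tr: "p \<in> cd c \<Longrightarrow> \<bar>s\<bar> \<le> s0 \<Longrightarrow> coord c (Tr s p) = coord c p + s *\<^sub>R Z p"
  using in_ci coord_unc[OF c] by (simp add: Tr_simps)

lemma lc_Tr: "p \<in> cd c \<Longrightarrow> g (Tr s p) = lc c g (coord c p + s *\<^sub>R Z p)"
  by (simp add: Tr_simps loc_def)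

lemma Tr_measurable:
  assumes s: "\<bar>s\<bar> \<le> s0" shows "Tr s \<in> measurable \<mu> \<mu>"
proof -
  let ?R = "restrict_space \<mu> (cd c)"
  have [measurable]: "coord c \<in> borel_measurable ?R"
    using measurable_coord[OF c] by (simp add: measurable_restrict_space2_iff)
  have [measurable]: "Z \<in> borel_measurable ?R" using hor_nice[OF F C] c unfolding nice_def by blast
  have m: "(\<lambda>p. coord c p + s *\<^sub>R Z p) \<in> borel_measurable ?R" by measurable
  have 1: "(\<lambda>p. unc c (coord c p + s *\<^sub>R Z p)) \<in> measurable ?R \<mu>"
  proof (rule measurable_into_TMI)
    show "(\<lambda>p. unc c (coord c p + s *\<^sub>R Z p)) \<in> space ?R \<rightarrow> TM"
    proof
      fix p assume "p \<in> space ?R"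
      then have "p \<in> cd c" using space_restrict_cd[OF c] by simp
      then show "unc c (coord c p + s *\<^sub>R Z p) \<in> TM" using cd_TM[OF unc_in[OF c in_ci[OF _ s]]] by simp
    qed
    fix U assume U: "openin top U"
    have "{q \<in> ci c. unc c q \<in> U} \<in> sets borel" by (rule borel_openin_ci[OF c openin_chart[OF U c]])
    from measurable_sets[OF m this]
    have "(\<lambda>p. coord c p + s *\<^sub>R Z p) -` {q \<in> ci c. unc c q \<in> U} \<inter> space ?R \<in> sets ?R" .
    moreover have "(\<lambda>p. coord c p + s *\<^sub>R Z p) -` {q \<in> ci c. unc c q \<in> U} \<inter> space ?R
        = (\<lambda>p. unc c (coord c p + s *\<^sub>R Z p)) -` U \<inter> space ?R"
      using in_ci[OF _ s] by (auto simp: space_restrict_cd[OF c])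
    ultimately show "(\<lambda>p. unc c (coord c p + s *\<^sub>R Z p)) -` U \<inter> space ?R \<in> sets ?R" by simp
  qed
  have 2: "(\<lambda>p. p) \<in> measurable (restrict_space \<mu> {p. p \<notin> cd c}) \<mu>"
    by (intro measurable_restrict_space1 measurable_ident_sets[OF refl])
  have "{p \<in> space \<mu>. p \<in> cd c} \<in> sets \<mu>" using cd_Int_space[OF c] by (simp add: Collect_conj_eq Int_commute)
  from measurable_If_restrict_space_iff[OF this, of "\<lambda>p. unc c (coord c p + s *\<^sub>R Z p)" "\<lambda>p. p" \<mu>] 1 2
  show ?thesis unfolding Tr_def[abs_def] by simp
qed

text \<open>A common compact set for all small parameters: it contains the moved support by
  \<open>Tr_S\<close>, hence the supports of the image measures.\<close>

definition S where "S = supp \<union> unc c ` K2"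

lemma S_compact: "compactin top S"
  unfolding S_def by (rule compactin_Un[OF supp_compact compactin_unc[OF c K2]])

lemma Tr_S: "p \<in> supp \<Longrightarrow> \<bar>s\<bar> \<le> s0 \<Longrightarrow> Tr s p \<in> S"
proof -
  assume p: "p \<in> supp" "\<bar>s\<bar> \<le> s0"
  show "Tr s p \<in> S"
  proof (cases "p \<in> unc c ` K")
    case True
    then have "p \<in> cd c" using unc_in[OF c] K(2) by blast
    then show ?thesis using in_K2[OF True p] unfolding S_def by (simp add: Tr_simps)
  next
    case False
    then have "Tr s p = p" using Tr_outside supp_TM p(1) by blast
    then show ?thesis using p(1) by (simp add: S_def)
  qed
qed

definition \<nu> where "\<nu> s = distr \<mu> \<mu> (Tr s)"

lemma \<nu>_radon:
  assumes s: "\<bar>s\<bar> \<le> s0" shows "compact_radon_measure A t0 (\<nu> s)"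
  unfolding compact_radon_measure_def
proof (intro conjI allI impI)
  note m = Tr_measurable[OF s]
  show "sets (\<nu> s) = sets (TMI_borel A t0)" by (simp add: \<nu>_def sets_mu)
  interpret finite_measure \<mu> by (rule finite_mu)
  interpret N: finite_measure "\<nu> s" unfolding \<nu>_def by (rule finite_measure_distr[OF m])
  show "emeasure (\<nu> s) K' < \<infinity>" for K' using N.emeasure_finite[of K'] by (metis infinity_ennreal_def less_top)
  have "msupport A t0 (\<nu> s) \<subseteq> S"
  proof
    fix p assume p: "p \<in> msupport A t0 (\<nu> s)"
    show "p \<in> S"
    proof (rule ccontr)
      assume "p \<notin> S"
      have U: "openin top (TM - S)"
        using compactin_imp_closedin[OF Hausdorff_top S_compact] by (simp add: closedin_def topspace_top)
      have "emeasure (\<nu> s) (TM - S) = emeasure \<mu> (Tr s -` (TM - S) \<inter> space \<mu>)"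
        unfolding \<nu>_def by (rule emeasure_distr[OF m open_sets[OF U]])
      also have "\<dots> = 0"
      proof -
        have "Tr s -` (TM - S) \<inter> space \<mu> \<subseteq> TM - supp"
        proof
          fix p assume "p \<in> Tr s -` (TM - S) \<inter> space \<mu>"
          then have "Tr s p \<notin> S" "p \<in> TM" by (simp_all add: space_mu)
          then show "p \<in> TM - supp" using Tr_S[OF _ s, of p] by blast
        qed
        moreover have "Tr s -` (TM - S) \<inter> space \<mu> \<in> sets \<mu>" by (rule measurable_sets[OF m open_sets[OF U]])
        ultimately show ?thesis using null_sets_subset[OF null_outside_supp] by blast
      qed
      finally show False using p U \<open>p \<notin> S\<close> unfolding msupport_def by blast
    qed
  qed
  then show "compactin top (msupport A t0 (\<nu> s))"
    using closed_compactin[OF S_compact _ closedin_msupport] by blast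
qed

text \<open>The displacement of the velocity is the derivative of the displacement of the base point
  along the field of \<open>C\<close>. So differentiating a function of (x, t) at the moved point,
  along the moved velocity, is differentiating its composite with x -> x + s F along that field. The
  composite is C^1 and vanishes at the ends because time is not moved, and
  \<open>second_derivative_C1\<close> applies.\<close>

lemma \<nu>_closed:
  assumes s: "\<bar>s\<bar> \<le> s0" shows "\<nu> s \<in> closed_measures A t0"
  unfolding closed_measures_def
proof (intro CollectI conjI \<nu>_radon[OF s] allI impI)
  fix \<phi> assume \<phi>': "smooth_MI A t0 \<phi> \<and> (\<forall>x. \<phi> (x, 0) = 0 \<and> \<phi> (x, t0) = 0)"
  then have \<phi>: "smooth_MI A t0 \<phi>" by blast
  let ?f = "\<lambda>p :: ('m, 'n) point. \<phi> (fst p, snd (snd p))"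
  let ?Fc = "lc c (\<lambda>p. F p c)"
  let ?X = "second_order_field C"
  have fs: "Ck_TMI A t0 k ?f" for k using base_smooth[OF \<phi>] unfolding smooth_TMI_def by blast
  have cov: "cov ?X p" if "p \<in> TM" for p using second_derivative_nice[OF C] that unfolding nice_def by blast
  \<comment> \<open>For functions of (x, t) it is enough to move the base point. This map involves
    \<open>F\<close> but not the merely measurable \<open>C\<close>, so it is C^1 although
    \<open>Tr s\<close> need not even be continuous.\<close>
  define m where "m q = (fst q + s *\<^sub>R ?Fc q, fst (snd q), snd (snd q))" for q
  define h where "h q = lc c ?f (m q) - lc c ?f q" for q
  have mq: "m q \<in> ci c" if q: "q \<in> ci c" for q
  proof -
    have "coord c (unc c q) + s *\<^sub>R Z (unc c q) \<in> ci c" by (rule in_ci[OF unc_in[OF c q] s])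
    then show ?thesis using q by (simp add: coord_unc[OF c q] ci_iff m_def Z_simps loc_def)
  qed
  have FC: "Ck_on (Suc 0) ?Fc (ci c)" using F c unfolding horizontal_map_def One_nat_def by blast
  have mC: "Ck_on (Suc 0) m (ci c)"
    unfolding m_def
    by (intro Ck_on_Pair Ck_on_add Ck_on_scaleR Ck_on_const FC Ck_on_fst Ck_on_snd Ck_on_id)
  have fC: "Ck_on (Suc 0) (lc c ?f) (ci c)" using fs c unfolding Ck_TMI_def by blast
  have hC: "Ck_on (Suc 0) h (ci c)"
    unfolding h_def by (intro Ck_on_diff fC Ck_on_compose[OF fC mC]) (use mq in blast)
  have F0': "?Fc q = 0" if q: "q \<in> ci c - K" for q
  proof -
    have "unc c q \<notin> unc c ` K"
    proof
      assume "unc c q \<in> unc c ` K"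
      then obtain z where z: "z \<in> K" "unc c q = unc c z" by blast
      have "q = z" using coord_unc[OF c, of q] coord_unc[OF c, of z] z q K(2) by auto
      then show False using z q by blast
    qed
    from F0[OF this] show ?thesis by (simp add: loc_def)
  qed
  have h0: "h q = 0" if "q \<in> ci c - K" for q using F0'[OF that] by (simp add: h_def m_def)
  \<comment> \<open>The composite with the moved base point, written as the original function plus a
    correction that vanishes off \<open>K\<close>; extension by zero of the correction makes it a
    global C^1 function.\<close>
  define \<Phi> where "\<Phi> p = ?f p + ext c h p" for p
  have \<Phi>C: "Ck_TMI A t0 (Suc 0) \<Phi>"
    unfolding \<Phi>_def by (rule Ck_TMI_add[OF fs Ck_TMI_ext[OF c K h0 hC]])
  have \<Phi>_eq: "lc c \<Phi> q = lc c ?f (m q)" if q: "q \<in> ci c" for q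
    using unc_in[OF c q] coord_unc[OF c q] by (simp add: loc_def \<Phi>_def ext_def h_def)
  have van: "vanishes_at_ends A t0 \<Phi>"
    unfolding vanishes_at_ends_def
  proof
    fix p assume p: "p \<in> TM"
    have "\<Phi> p = 0" if t: "snd (snd p) = 0 \<or> snd (snd p) = t0"
    proof (cases "p \<in> cd c")
      case True
      have "\<Phi> p = lc c ?f (m (coord c p))" using \<Phi>_eq[OF coord_in[OF True]] lc_coord[OF c True, of \<Phi>] by simp
      also have "\<dots> = base_loc c \<phi> (fst (m (coord c p)), snd (snd (m (coord c p))))"
        by (rule base_loc_eq[OF c mq[OF coord_in[OF True]]])
      also have "\<dots> = 0" using t \<phi>' by (auto simp: base_loc_def m_def coord_def)
      finally show ?thesis .
    next
      case False
      then show ?thesis using t \<phi>' by (auto simp: \<Phi>_def ext_def)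
    qed
    then show "case p of (x, v, t) \<Rightarrow> t = 0 \<or> t = t0 \<longrightarrow> \<Phi> (x, v, t) = 0" by (cases p) auto
  qed
  have pt: "deriv_along A t0 ?X ?f (Tr s p) = deriv_along A t0 ?X \<Phi> p" if p: "p \<in> TM" for p
  proof (cases "p \<in> cd c")
    case True
    let ?q = "coord c p"
    note q = coord_in[OF True]
    let ?D = "\<lambda>q k. dir_deriv (im c \<times> {0..t0}) (base_loc c \<phi>) k (fst q, snd (snd q))"
    have mT: "fst (m ?q) = fst (coord c (Tr s p))" "snd (snd (m ?q)) = snd (snd (coord c (Tr s p)))"
      unfolding coord_Tr[OF True s] using lc_coord[OF c True, of "\<lambda>p. F p c"] by (simp_all add: m_def Z_simps)
    have "deriv_along A t0 ?X ?f (Tr s p) = dir_deriv (ci c) (lc c ?f) (?X c (Tr s p)) (coord c (Tr s p))"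
      by (rule deriv_along_eq[OF fs cov[OF Tr_TM[OF p s]] c Tr_cd[OF True s]])
    also have "\<dots> = ?D (m ?q) (fst (snd (coord c (Tr s p))), 1)"
      using thick_frechet_derivative[OF thick_ci[OF c] coord_in[OF Tr_cd[OF True s]] base_deriv[OF \<phi> c coord_in[OF Tr_cd[OF True s]]]]
      unfolding mT by (simp add: second_order_field_def) (simp add: coord_def)
    also have "fst (snd (coord c (Tr s p))) = fst (snd ?q) + s *\<^sub>R dir_deriv (ci c) ?Fc (?X c p) ?q"
      unfolding coord_Tr[OF True s] by (simp add: hor_def)
    finally have 1: "deriv_along A t0 ?X ?f (Tr s p) = ?D (m ?q) (fst (snd ?q) + s *\<^sub>R dir_deriv (ci c) ?Fc (?X c p) ?q, 1)" .
    have "(m has_derivative (\<lambda>h. (fst h + s *\<^sub>R dir_deriv (ci c) ?Fc h ?q, fst (snd h), snd (snd h)))) (at ?q within ci c)"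
      unfolding m_def[abs_def]
      by (intro has_derivative_Pair has_derivative_add has_derivative_scaleR_right hor_deriv[OF F c q] derivative_intros)
    moreover have "(lc c ?f has_derivative (\<lambda>h. ?D (m ?q) (fst h, snd (snd h)))) (at (m ?q) within m ` ci c)"
      by (rule has_derivative_subset[OF base_deriv[OF \<phi> c mq[OF q]]]) (use mq in blast)
    ultimately have "((\<lambda>q. lc c ?f (m q)) has_derivative
        (\<lambda>h. ?D (m ?q) (fst h + s *\<^sub>R dir_deriv (ci c) ?Fc h ?q, snd (snd h)))) (at ?q within ci c)"
      using diff_chain_within[of m "\<lambda>h. (fst h + s *\<^sub>R dir_deriv (ci c) ?Fc h ?q, fst (snd h), snd (snd h))" ?q "ci c" "lc c ?f" "\<lambda>h. ?D (m ?q) (fst h, snd (snd h))"]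
      by (simp add: o_def)
    then have D\<Phi>: "(lc c \<Phi> has_derivative
        (\<lambda>h. ?D (m ?q) (fst h + s *\<^sub>R dir_deriv (ci c) ?Fc h ?q, snd (snd h)))) (at ?q within ci c)"
      by (rule has_derivative_transform[OF q, rotated]) (rule \<Phi>_eq)
    have "deriv_along A t0 ?X \<Phi> p = dir_deriv (ci c) (lc c \<Phi>) (?X c p) ?q"
      by (rule deriv_along_eq[OF \<Phi>C cov[OF p] c True])
    also have "\<dots> = ?D (m ?q) (fst (?X c p) + s *\<^sub>R dir_deriv (ci c) ?Fc (?X c p) ?q, snd (snd (?X c p)))"
      using thick_frechet_derivative[OF thick_ci[OF c] q D\<Phi>] by simp
    also have "fst (?X c p) = fst (snd ?q)" by (simp add: second_order_field_def coord_def)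
    also have "snd (snd (?X c p)) = 1" by (simp add: second_order_field_def)
    finally show ?thesis unfolding 1 by simp
  next
    case False
    have "p \<in> TM - unc c ` K" using p False unc_in[OF c] K(2) by blast
    moreover have "?f q = \<Phi> q" if "q \<in> TM - unc c ` K" for q
    proof -
      have "ext c h q = 0" by (rule ext_outside[where g=h and K=K, OF c h0]) (use that in simp_all)
      then show ?thesis by (simp add: \<Phi>_def)
    qed
    ultimately have "deriv_along A t0 ?X ?f p = deriv_along A t0 ?X \<Phi> p"
      by (intro deriv_along_cong[OF fs TK])
    then show ?thesis using False by (simp add: Tr_simps)
  qed
  have im: "deriv_along A t0 ?X ?f \<in> borel_measurable \<mu>"
    using integrable_deriv_along(1)[OF second_derivative_nice[OF C] fs] by simp
  have "(LINT p|\<nu> s. (let c = chart_at A p; (x, v, t) = p in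
       dir_deriv ((snd c ` fst c) \<times> {0..t0}) (base_loc c \<phi>) (v c, 1) (snd c x, t)))
    = (LINT p|\<nu> s. deriv_along A t0 ?X ?f p)"
    by (rule Bochner_Integration.integral_cong[OF refl]) (use base_integrand[OF \<phi>] in \<open>simp add: \<nu>_def space_mu\<close>)
  also have "\<dots> = (LINT p|\<mu>. deriv_along A t0 ?X ?f (Tr s p))"
    unfolding \<nu>_def by (rule integral_distr[OF Tr_measurable[OF s] im])
  also have "\<dots> = (LINT p|\<mu>. deriv_along A t0 ?X \<Phi> p)"
    by (rule Bochner_Integration.integral_cong[OF refl]) (simp add: space_mu pt)
  also have "\<dots> = 0" by (rule second_derivative_C1[OF C \<Phi>C van])
  finally show "(LINT p|\<nu> s. (let c = chart_at A p; (x, v, t) = p in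
       dir_deriv ((snd c ` fst c) \<times> {0..t0}) (base_loc c \<phi>) (v c, 1) (snd c x, t))) = 0" .
qed

text \<open>The family is indexed by all real numbers; parameters outside the admissible range are
  sent to 0, which leaves the derivative at 0 unchanged.\<close>

definition \<sigma> where "\<sigma> s = (if \<bar>s\<bar> < s0 then s else 0)" for s :: real

lemma \<sigma>: "\<bar>\<sigma> s\<bar> \<le> s0" "\<bar>\<sigma> s\<bar> \<le> \<bar>s\<bar>" "\<bar>\<sigma> s\<bar> < s0" using s0 by (auto simp: \<sigma>_def)

lemma Tr_zero: "p \<in> TM \<Longrightarrow> Tr 0 p = p" using unc_coord[OF c] by (simp add: Tr_def)

lemma line_deriv:
  assumes g: "Ck_TMI A t0 (Suc 0) g" and p: "p \<in> cd c" and s: "\<bar>s\<bar> < s0"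
  shows "((\<lambda>s. g (Tr s p)) has_real_derivative dir_deriv (ci c) (lc c g) (Z p) (coord c p + s *\<^sub>R Z p)) (at s)"
proof -
  let ?q = "coord c p" let ?S = "{-s0<..<s0}"
  have i: "?q + r *\<^sub>R Z p \<in> ci c" if "r \<in> ?S" for r using in_ci[OF p, of r] that by auto
  have sS: "s \<in> ?S" using s by auto
  let ?D = "frechet_derivative (lc c g) (at (?q + s *\<^sub>R Z p) within ci c)"
  have D: "(lc c g has_derivative ?D) (at (?q + s *\<^sub>R Z p) within (\<lambda>s. ?q + s *\<^sub>R Z p) ` ?S)"
    by (rule has_derivative_subset[OF lc_deriv[OF g c i[OF sS]]]) (use i in blast)
  have "((\<lambda>s. ?q + s *\<^sub>R Z p) has_derivative (\<lambda>r. r *\<^sub>R Z p)) (at s within ?S)"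
    by (auto intro!: derivative_eq_intros)
  from diff_chain_within[OF this D]
  have "((\<lambda>s. lc c g (?q + s *\<^sub>R Z p)) has_derivative (\<lambda>r. ?D (r *\<^sub>R Z p))) (at s within ?S)" by (simp add: o_def)
  moreover have "?D (r *\<^sub>R Z p) = ?D (Z p) * r" for r
    using linear_scale[OF has_derivative_linear[OF D]] by simp
  ultimately have "((\<lambda>s. lc c g (?q + s *\<^sub>R Z p)) has_derivative (\<lambda>r. ?D (Z p) * r)) (at s within ?S)" by simp
  then have "((\<lambda>s. lc c g (?q + s *\<^sub>R Z p)) has_real_derivative ?D (Z p)) (at s within ?S)"
    by (rule has_derivative_imp_has_field_derivative) simp
  then have "((\<lambda>s. lc c g (?q + s *\<^sub>R Z p)) has_real_derivative ?D (Z p)) (at s)"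
    using at_within_open[OF sS] by simp
  then show ?thesis by (simp add: lc_Tr[OF p])
qed

text \<open>The mean value inequality along the segments, which stay in the compact set
  \<open>K2\<close> for points of the moved part of the support. The bound dominates the difference
  quotients in \<open>\<nu>_deriv\<close>.\<close>

lemma line_bound:
  assumes g: "Ck_TMI A t0 (Suc 0) g"
  shows "\<exists>B. \<forall>p\<in>supp. \<forall>s. \<bar>s\<bar> < s0 \<longrightarrow> \<bar>g (Tr s p) - g p\<bar> \<le> B * \<bar>s\<bar>"
proof -
  have gC: "Ck_on (Suc 0) (lc c g) (ci c)" using g c unfolding Ck_TMI_def by blast
  have "\<exists>B. \<forall>q\<in>K2. \<bar>dir_deriv (ci c) (lc c g) b q\<bar> \<le> B" for b
  proof -
    have "continuous_on K2 (dir_deriv (ci c) (lc c g) b)"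
      using Ck_on_frechet(2)[OF gC thick_ci[OF c]] K2(2) continuous_on_subset by simp blast
    from compact_imp_bounded[OF compact_continuous_image[OF this K2(1)]]
    show ?thesis unfolding bounded_iff by auto
  qed
  then obtain Bd where Bd: "\<And>b q. q \<in> K2 \<Longrightarrow> \<bar>dir_deriv (ci c) (lc c g) b q\<bar> \<le> Bd b" by metis
  have "bounded (Z ` (unc c ` K \<inter> supp))" using hor_nice[OF F C] c K unfolding nice_def by blast
  then obtain BZ where BZ: "\<And>p. p \<in> unc c ` K \<Longrightarrow> p \<in> supp \<Longrightarrow> norm (Z p) \<le> BZ" unfolding bounded_iff by blast
  define B where "B = (\<Sum>b\<in>(Basis :: 'n coords set). \<bar>BZ\<bar> * \<bar>Bd b\<bar>)"
  have B0: "B \<ge> 0" unfolding B_def by (intro sum_nonneg) auto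
  have "\<bar>g (Tr s p) - g p\<bar> \<le> B * \<bar>s\<bar>" if p: "p \<in> supp" and s: "\<bar>s\<bar> < s0" for p s
  proof (cases "p \<in> unc c ` K")
    case True
    then have pc: "p \<in> cd c" using unc_in[OF c] K(2) by blast
    have "norm (g (Tr s p) - g (Tr 0 p)) \<le> B * norm (s - 0)"
    proof (rule field_differentiable_bound[where S="{-s0<..<s0}" and f'="\<lambda>s. dir_deriv (ci c) (lc c g) (Z p) (coord c p + s *\<^sub>R Z p)"])
      fix r assume "r \<in> {-s0<..<s0}"
      then have r: "\<bar>r\<bar> < s0" "\<bar>r\<bar> \<le> s0" by auto
      show "((\<lambda>s. g (Tr s p)) has_real_derivative dir_deriv (ci c) (lc c g) (Z p) (coord c p + r *\<^sub>R Z p)) (at r within {-s0<..<s0})"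
        by (rule DERIV_subset[OF line_deriv[OF g pc r(1)]]) simp
      let ?q = "coord c p + r *\<^sub>R Z p"
      have "dir_deriv (ci c) (lc c g) (Z p) ?q = (\<Sum>b\<in>Basis. (Z p \<bullet> b) * dir_deriv (ci c) (lc c g) b ?q)"
        by (rule frechet_expand[OF lc_deriv[OF g c in_ci[OF pc r(2)]]])
      also have "\<bar>\<dots>\<bar> \<le> B"
        unfolding B_def
      proof (rule order_trans[OF sum_abs], rule sum_mono)
        fix b :: "'n coords" assume b: "b \<in> Basis"
        have "\<bar>Z p \<bullet> b\<bar> \<le> \<bar>BZ\<bar>" using Basis_le_norm[OF b, of "Z p"] BZ[OF True p] by linarith
        moreover have "\<bar>dir_deriv (ci c) (lc c g) b ?q\<bar> \<le> \<bar>Bd b\<bar>"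
          using Bd[OF in_K2[OF True p r(2)], of b] by linarith
        ultimately show "\<bar>(Z p \<bullet> b) * dir_deriv (ci c) (lc c g) b ?q\<bar> \<le> \<bar>BZ\<bar> * \<bar>Bd b\<bar>"
          unfolding abs_mult by (intro mult_mono) auto
      qed
      finally show "norm (dir_deriv (ci c) (lc c g) (Z p) ?q) \<le> B" by simp
    qed (use s s0 in auto)
    then show ?thesis using Tr_zero[OF cd_TM[OF pc]] by simp
  next
    case False
    then have "Tr s p = p" using Tr_outside supp_TM p by blast
    then show ?thesis using B0 by simp
  qed
  then show ?thesis by blast
qed

lemma \<nu>_deriv:
  assumes g: "Ck_TMI A t0 (Suc 0) g"
  shows "((\<lambda>s. LINT p|\<nu> (\<sigma> s). g p) has_real_derivative hor_variation A t0 F \<mu> C g) (at 0)"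
proof -
  let ?D = "deriv_along A t0 (hor F C) g"
  have hv: "hor_variation A t0 F \<mu> C g = (LINT p|\<mu>. ?D p)" unfolding hor_variation_def hor_def by simp
  have g0: "Ck_TMI A t0 0 g" using g unfolding Ck_TMI_def by (blast intro: Ck_on_Suc_D)
  note gm = measurable_continuous_TMI[OF g0]
  obtain B where B: "\<And>p s. p \<in> supp \<Longrightarrow> \<bar>s\<bar> < s0 \<Longrightarrow> \<bar>g (Tr s p) - g p\<bar> \<le> B * \<bar>s\<bar>" using line_bound[OF g] by blast
  have gTm: "(\<lambda>p. g (Tr (\<sigma> s) p)) \<in> borel_measurable \<mu>" for s
    by (rule measurable_compose[OF Tr_measurable[OF \<sigma>(1)] gm])
  interpret finite_measure \<mu> by (rule finite_mu)
  have bg: "bounded (g ` supp)"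
  proof (rule bounded_suppI)
    fix d K' assume d: "d \<in> A" "compact K'" "K' \<subseteq> ci d"
    have "continuous_on (ci d) (lc d g)" using g0 d unfolding Ck_TMI_def by simp
    from bounded_continuous_coord[OF d(1) this d(2,3), of supp]
    have "bounded ((\<lambda>p. lc d g (coord d p)) ` (unc d ` K' \<inter> supp))" .
    moreover have "(\<lambda>p. lc d g (coord d p)) ` (unc d ` K' \<inter> supp) = g ` (unc d ` K' \<inter> supp)"
    proof (rule image_cong[OF refl])
      fix p assume "p \<in> unc d ` K' \<inter> supp"
      then have "p \<in> cd d" using unc_in[OF d(1)] d(3) by blast
      then show "lc d g (coord d p) = g p" by (rule lc_coord[OF d(1)])
    qed
    ultimately show "bounded (g ` (unc d ` K' \<inter> supp))" by simp
  qed
  have ig: "integrable \<mu> g" by (rule integrable_bounded[OF gm bg])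
  obtain Bg where Bg: "\<And>p. p \<in> supp \<Longrightarrow> \<bar>g p\<bar> \<le> Bg" using bg unfolding bounded_iff by auto
  have diffb: "\<bar>g (Tr (\<sigma> s) p) - g p\<bar> \<le> \<bar>B\<bar> * \<bar>s\<bar>" if "p \<in> supp" for p s
  proof -
    have "\<bar>g (Tr (\<sigma> s) p) - g p\<bar> \<le> B * \<bar>\<sigma> s\<bar>" by (rule B[OF that \<sigma>(3)])
    also have "\<dots> \<le> \<bar>B\<bar> * \<bar>s\<bar>" using \<sigma>(2)[of s] by (intro mult_mono) auto
    finally show ?thesis .
  qed
  have igT: "integrable \<mu> (\<lambda>p. g (Tr (\<sigma> s) p))" for s
  proof (rule integrable_bounded[OF gTm])
    have bd: "\<bar>g (Tr (\<sigma> s) p)\<bar> \<le> \<bar>B\<bar> * \<bar>s\<bar> + Bg" if "p \<in> supp" for p using diffb[OF that, of s] Bg[OF that] by linarith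
    show "bounded ((\<lambda>p. g (Tr (\<sigma> s) p)) ` supp)"
    proof (rule boundedI)
      fix x assume "x \<in> (\<lambda>p. g (Tr (\<sigma> s) p)) ` supp"
      then obtain p where "p \<in> supp" "x = g (Tr (\<sigma> s) p)" by blast
      then show "norm x \<le> \<bar>B\<bar> * \<bar>s\<bar> + Bg" using bd[of p] by simp
    qed
  qed
  have int_eq: "(LINT p|\<nu> (\<sigma> s). g p) = (LINT p|\<mu>. g (Tr (\<sigma> s) p))" for s
    unfolding \<nu>_def by (rule integral_distr[OF Tr_measurable[OF \<sigma>(1)] gm])
  have "(LINT p|\<mu>. g (Tr (\<sigma> 0) p)) = (LINT p|\<mu>. g p)"
    by (rule Bochner_Integration.integral_cong[OF refl]) (simp add: space_mu \<sigma>_def Tr_zero)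
  then have q_eq: "((LINT p|\<nu> (\<sigma> s). g p) - (LINT p|\<nu> (\<sigma> 0). g p)) / s = (LINT p|\<mu>. (g (Tr (\<sigma> s) p) - g p) / s)" for s
    by (simp add: int_eq Bochner_Integration.integral_diff[OF igT ig])
  have "((\<lambda>s. ((LINT p|\<nu> (\<sigma> s). g p) - (LINT p|\<nu> (\<sigma> 0). g p)) / (s - 0)) \<longlongrightarrow> (LINT p|\<mu>. ?D p)) (at 0)"
    unfolding tendsto_at_iff_sequentially
  proof (intro allI impI)
    fix X :: "nat \<Rightarrow> real" assume X: "\<forall>i. X i \<in> UNIV - {0}" "X \<longlonglongrightarrow> 0"
    have "(\<lambda>n. LINT p|\<mu>. (g (Tr (\<sigma> (X n)) p) - g p) / X n) \<longlonglongrightarrow> (LINT p|\<mu>. ?D p)"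
    proof (rule integral_dominated_convergence[where w="\<lambda>p. \<bar>B\<bar>"])
      show "?D \<in> borel_measurable \<mu>" using integrable_deriv_along(1)[OF hor_nice[OF F C] g] by simp
      show "(\<lambda>p. (g (Tr (\<sigma> (X n)) p) - g p) / X n) \<in> borel_measurable \<mu>" for n
        by (intro borel_measurable_divide borel_measurable_diff gTm gm measurable_const) auto
      show "integrable \<mu> (\<lambda>p. \<bar>B\<bar>)" by simp
      show "AE p in \<mu>. norm ((g (Tr (\<sigma> (X n)) p) - g p) / X n) \<le> \<bar>B\<bar>" for n
        using AE_supp
      proof (rule AE_mp, intro AE_I2 impI)
        fix p assume "p \<in> supp"
        from diffb[OF this, of "X n"] X(1)
        show "norm ((g (Tr (\<sigma> (X n)) p) - g p) / X n) \<le> \<bar>B\<bar>" by (simp add: abs_divide divide_le_eq)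
      qed
      show "AE p in \<mu>. (\<lambda>n. (g (Tr (\<sigma> (X n)) p) - g p) / X n) \<longlonglongrightarrow> ?D p"
      proof (rule AE_I2)
        fix p assume "p \<in> space \<mu>"
        then have p: "p \<in> TM" by (simp add: space_mu)
        show "(\<lambda>n. (g (Tr (\<sigma> (X n)) p) - g p) / X n) \<longlonglongrightarrow> ?D p"
        proof (cases "p \<in> cd c")
          case True
          have "cov (hor F C) p" using hor_nice[OF F C] p unfolding nice_def by blast
          from deriv_along_eq[OF g this c True]
          have "((\<lambda>s. g (Tr s p)) has_real_derivative ?D p) (at 0)"
            using line_deriv[OF g True, of 0] s0 by simp
          then have "((\<lambda>s. (g (Tr s p) - g (Tr 0 p)) / (s - 0)) \<longlongrightarrow> ?D p) (at 0)" by (simp only: has_field_derivative_iff)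
          then have "(\<lambda>n. (g (Tr (X n) p) - g p) / X n) \<longlonglongrightarrow> ?D p"
            using X Tr_zero[OF p] unfolding tendsto_at_iff_sequentially by (auto simp: o_def)
          moreover have "\<forall>\<^sub>F n in sequentially. (g (Tr (X n) p) - g p) / X n = (g (Tr (\<sigma> (X n)) p) - g p) / X n"
          proof (rule eventually_mono)
            show "\<forall>\<^sub>F n in sequentially. dist (X n) 0 < s0" using X(2) s0 by (simp add: tendsto_iff)
          qed (simp add: \<sigma>_def)
          ultimately show ?thesis by (rule Lim_transform_eventually)
        next
          case False
          let ?d = "chart_at A p"
          have "p \<notin> unc c ` K" using False unc_in[OF c] K(2) by blast
          from hor_0[OF chart_at(1) chart_at_cd[OF p] this]
          have "?D p = 0" using linear_0[OF has_derivative_linear[OF lc_deriv_at[OF g p]]] by (simp add: deriv_along_frechet)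
          then show ?thesis using False by (simp add: Tr_simps)
        qed
      qed
    qed
    then show "((\<lambda>s. ((LINT p|\<nu> (\<sigma> s). g p) - (LINT p|\<nu> (\<sigma> 0). g p)) / (s - 0)) \<circ> X) \<longlonglongrightarrow> (LINT p|\<mu>. ?D p)"
      by (simp add: o_def q_eq)
  qed
  then show ?thesis unfolding hv by (simp only: has_field_derivative_iff)
qed

lemma \<nu>_0: "\<nu> (\<sigma> 0) = \<mu>"
proof -
  have "\<nu> (\<sigma> 0) = distr \<mu> \<mu> (\<lambda>p. p)" unfolding \<nu>_def \<sigma>_def by (rule distr_cong) (simp_all add: Tr_zero space_mu)
  then show ?thesis by simp
qed

end

context hvar
begin

lemma exists_variation:
  "\<exists>\<mu>s. range \<mu>s \<subseteq> closed_measures A t0 \<and> \<mu>s 0 = \<mu> \<and>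
    (\<forall>g. smooth_TMI A t0 g \<longrightarrow> ((\<lambda>s. LINT p|\<mu>s s. g p) has_real_derivative hor_variation A t0 F \<mu> C g) (at 0))"
proof -
  obtain s0 K2 where e: "s0 > 0 \<and> compact K2 \<and> K2 \<subseteq> ci c \<and> (\<forall>p\<in>cd c. \<forall>s. \<bar>s\<bar> \<le> s0 \<longrightarrow> coord c p + s *\<^sub>R Z p \<in> ci c) \<and>
    (\<forall>p\<in>unc c ` K \<inter> supp. \<forall>s. \<bar>s\<bar> \<le> s0 \<longrightarrow> coord c p + s *\<^sub>R Z p \<in> K2)"
    using exists_range by (elim exE)
  interpret hvar2 A t0 \<mu> C F c K s0 K2
  proof unfold_locales
    note e' = e[THEN conjunct2] and e'' = e[THEN conjunct2, THEN conjunct2, THEN conjunct2]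
    show "s0 > 0" by (rule e[THEN conjunct1])
    show "compact K2" by (rule e'[THEN conjunct1])
    show "K2 \<subseteq> ci c" by (rule e'[THEN conjunct2, THEN conjunct1])
    have e4: "\<forall>p\<in>cd c. \<forall>s. \<bar>s\<bar> \<le> s0 \<longrightarrow> coord c p + s *\<^sub>R Z p \<in> ci c"
      and e5: "\<forall>p\<in>unc c ` K \<inter> supp. \<forall>s. \<bar>s\<bar> \<le> s0 \<longrightarrow> coord c p + s *\<^sub>R Z p \<in> K2"
      by (rule e''[THEN conjunct1], rule e''[THEN conjunct2])
    show "coord c p + s *\<^sub>R Z p \<in> ci c" if "p \<in> cd c" "\<bar>s\<bar> \<le> s0" for p s
      by (rule e4[rule_format, OF that])
    show "coord c p + s *\<^sub>R Z p \<in> K2" if "p \<in> unc c ` K" "p \<in> supp" "\<bar>s\<bar> \<le> s0" for p s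
      by (rule e5[rule_format, OF IntI[OF that(1,2)] that(3)])
  qed
  have "range (\<lambda>s. \<nu> (\<sigma> s)) \<subseteq> closed_measures A t0" using \<nu>_closed[OF \<sigma>(1)] by blast
  moreover have "((\<lambda>s. LINT p|\<nu> (\<sigma> s). g p) has_real_derivative hor_variation A t0 F \<mu> C g) (at 0)" if "smooth_TMI A t0 g" for g
    by (rule \<nu>_deriv) (use that in \<open>simp only: smooth_TMI_def\<close>)
  ultimately show ?thesis by (intro exI[of _ "\<lambda>s. \<nu> (\<sigma> s)"] conjI allI impI \<nu>_0)
qed

end

section \<open>The Legendre transform\<close>

context lag
begin

text \<open>Criticality speaks only of derivatives of actual families of closed measures; the family
  needed for this \<open>F\<close> is provided by the image measures above.\<close>

lemma critical_vert_0:
  assumes C: "second_derivative A t0 \<mu> C" and crit: "horizontally_critical A t0 L \<mu>"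
    and F: "horizontal_map A t0 F" and cl: "fiber_closed A t0 L F"
    and c: "c \<in> A" and K: "compact K" "K \<subseteq> ci c" and F0: "\<And>p d. p \<notin> unc c ` K \<Longrightarrow> F p d = 0"
  shows "(LINT p|\<mu>. vert (wF F) (W C) p) = 0"
proof -
  have h: "hvar A t0 \<mu> C F c K"
    by (intro hvar.intro hvar_axioms.intro mfdm_axioms C F c K) (rule F0)
  obtain \<mu>s where \<mu>s: "range \<mu>s \<subseteq> closed_measures A t0 \<and> \<mu>s 0 = \<mu> \<and>
    (\<forall>g. smooth_TMI A t0 g \<longrightarrow> ((\<lambda>s. LINT p|\<mu>s s. g p) has_real_derivative hor_variation A t0 F \<mu> C g) (at 0))"
    using hvar.exists_variation[OF h] by (rule exE)
  have "\<mu> \<in> closed_velocity_measures A t0"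
    unfolding closed_velocity_measures_def using second_derivative_closed[OF C] C by (intro CollectI conjI exI)
  then have "hor_variation A t0 F \<mu> C \<in> Theta A t0 L \<mu>"
    unfolding Theta_def using C F cl by (intro CollectI exI[of _ F] exI[of _ C] conjI refl)
  then have "exact_horizontal_variation A t0 L \<mu> \<mu>s (hor_variation A t0 F \<mu> C)"
    unfolding exact_horizontal_variation_def using \<mu>s by (elim conjE, intro conjI)
  then have "hor_variation A t0 F \<mu> C L = 0" using crit unfolding horizontally_critical_def by (elim allE impE) assumption+
  then show ?thesis unfolding hor_variation_L[OF F C] .
qed

lemma vert_wF_chart:
  assumes F: "horizontal_map A t0 F" and W: "nice (vertical W')" and c: "c \<in> A" and p: "p \<in> cd c"
  shows "vert (wF F) W' p = wF F c p \<bullet> W' c p"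
proof -
  have d: "p \<in> cd (chart_at A p)" using chart_at_cd cd_TM[OF p] by blast
  have "cov (vertical W') p" using W cd_TM[OF p] unfolding nice_def by blast
  from wF_J[OF F c p chart_at(1) d, of "W' c p"] vertical_cov[OF this c chart_at(1) p d]
  show ?thesis by (simp add: vert_def)
qed

definition Leg :: "('m, 'n) chart \<Rightarrow> 'n coords \<Rightarrow> 'n coords" where
  "Leg c q = (fst q, P c q, snd (snd q))"

definition DL :: "('m, 'n) chart \<Rightarrow> 'n coords \<Rightarrow> 'n coords \<Rightarrow> 'n coords" where
  "DL c q h = (fst h, DP c q h, snd (snd h))"

lemma Leg_deriv: "c \<in> A \<Longrightarrow> q \<in> ci c \<Longrightarrow> (Leg c has_derivative DL c q) (at q within ci c)"
  unfolding Leg_def[abs_def] DL_def[abs_def] by (intro has_derivative_Pair P_deriv derivative_intros)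

lemma M_invertible: "c \<in> A \<Longrightarrow> q \<in> ci c \<Longrightarrow> unc c q \<in> V \<Longrightarrow> invertible (M c q)"
  using M_inv[of c "unc c q"] unc_in[of c q] coord_unc[of c q] by simp

text \<open>The Legendre map is C^1, and its derivative is block triangular with L_vv as the only
  nontrivial diagonal block, hence injective on \<open>V\<close>. The time is taken in the interior
  so that the inverse function theorem has an open domain.\<close>

lemma exists_Leg_inverse:
  assumes c: "c \<in> A" and p: "p \<in> cd c" "p \<in> V" "0 < snd (snd p)" "snd (snd p) < t0"
  shows "\<exists>U' V' g g'. open U' \<and> coord c p \<in> U' \<and> U' \<subseteq> interior_img c \<and> (\<forall>q\<in>U'. unc c q \<in> V) \<and>
    open V' \<and> homeomorphism U' V' (Leg c) g \<and> (\<forall>y\<in>V'. (g has_derivative g' y) (at y)) \<and>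
    (\<forall>y\<in>V'. \<forall>h. DL c (g y) (g' y h) = h)"
proof -
  obtain S where S: "open S" "{q \<in> ci c. unc c q \<in> V} = ci c \<inter> S"
    using openin_chart[OF openV c] by (auto simp: openin_open)
  define Q where "Q = interior_img c \<inter> S"
  have oQ: "open Q" unfolding Q_def by (intro open_Int S open_interior_img c)
  have Qci: "q \<in> ci c" if "q \<in> Q" for q using that interior_img_subset[of c] unfolding Q_def by blast
  have QV: "unc c q \<in> V" if "q \<in> Q" for q
  proof -
    have "q \<in> ci c \<inter> S" using that Qci[OF that] unfolding Q_def by blast
    then show ?thesis unfolding S(2)[symmetric] by blast
  qed
  have "coord c p \<in> {q \<in> ci c. unc c q \<in> V}" using coord_in[OF p(1)] unc_coord[OF c p(1)] p(2) by simp
  then have pQ: "coord c p \<in> Q" unfolding S(2) Q_def using coord_interior[OF p(1,3,4)] by blast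
  have bl: "bounded_linear (DL c q)" if "q \<in> Q" for q
    using Leg_deriv[OF c Qci[OF that]] by (rule has_derivative_bounded_linear)
  have ap: "blinfun_apply (Blinfun (DL c q)) = DL c q" if "q \<in> Q" for q
    by (rule bounded_linear_Blinfun_apply[OF bl[OF that]])
  have der: "(Leg c has_derivative blinfun_apply (Blinfun (DL c q))) (at q)" if "q \<in> Q" for q
  proof -
    have "(Leg c has_derivative DL c q) (at q within Q)"
      by (rule has_derivative_subset[OF Leg_deriv[OF c Qci[OF that]]]) (use Qci in blast)
    then show ?thesis unfolding ap[OF that] using at_within_open[OF that oQ] by simp
  qed
  have cont: "continuous_on Q (\<lambda>q. Blinfun (DL c q))"
  proof (rule continuous_on_blinfun_componentwise)
    fix b :: "'n coords"
    have "continuous_on Q (\<lambda>q. \<chi> i. D2 c (dir_v i) b q)"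
      by (intro continuous_on_vec_lambda continuous_on_subset[OF D2_cont[OF c]]) (use Qci in blast)
    from continuous_on_Pair[OF continuous_on_const continuous_on_Pair[OF this continuous_on_const]]
    have "continuous_on Q (\<lambda>q. (fst b, \<chi> i. D2 c (dir_v i) b q, snd (snd b)))" .
    then show "continuous_on Q (\<lambda>q. blinfun_apply (Blinfun (DL c q)) b)"
      by (rule continuous_on_eq) (simp add: ap DL_def DP_def)
  qed
  let ?q = "coord c p"
  have lin: "linear (DL c ?q)" using bl[OF pQ] by (rule bounded_linear.linear)
  have "inj (DL c ?q)"
    unfolding linear_injective_0[OF lin]
  proof (intro allI impI)
    fix h assume h: "DL c ?q h = 0"
    obtain a k r where hk: "h = (a, k, r)" by (cases h)
    then have z: "a = 0" "r = 0" using h by (simp_all add: DL_def zero_prod_def)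
    then have "DP c ?q (0, k, 0) = 0" using h hk by (simp add: DL_def zero_prod_def)
    then have "M c ?q *v k = M c ?q *v 0" using DP_vert[OF c Qci[OF pQ]] by simp
    then have "k = 0" by (rule M_cancel[OF c p(2,1)])
    then show "h = 0" using z hk by (simp add: zero_prod_def)
  qed
  then obtain G where G: "linear G" "G \<circ> DL c ?q = id" using linear_injective_left_inverse[OF lin] by blast
  have inv': "Blinfun G o\<^sub>L Blinfun (DL c ?q) = id_blinfun"
  proof (rule blinfun_eqI)
    fix h
    have "blinfun_apply (Blinfun G) = G"
      by (rule bounded_linear_Blinfun_apply) (use G(1) linear_conv_bounded_linear in blast)
    then show "blinfun_apply (Blinfun G o\<^sub>L Blinfun (DL c ?q)) h = blinfun_apply id_blinfun h"
      using fun_cong[OF G(2), of h] by (simp add: ap[OF pQ])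
  qed
  show ?thesis
  proof (rule inverse_function_theorem[OF oQ der cont pQ inv'])
    fix U' V' g g' assume I: "open U'" "U' \<subseteq> Q" "?q \<in> U'" "open V'" "Leg c ?q \<in> V'" "homeomorphism U' V' (Leg c) g"
      "\<And>y. y \<in> V' \<Longrightarrow> (g has_derivative (g' y)) (at y)"
      "\<And>y. y \<in> V' \<Longrightarrow> g' y = inv (blinfun_apply (Blinfun (DL c (g y))))"
      "\<And>y. y \<in> V' \<Longrightarrow> bij (blinfun_apply (Blinfun (DL c (g y))))"
    show ?thesis
    proof (intro exI conjI ballI allI)
      show "open U'" "?q \<in> U'" "open V'" "homeomorphism U' V' (Leg c) g" by (rule I)+
      show "(g has_derivative g' y) (at y)" if "y \<in> V'" for y by (rule I(7)[OF that])
      show "U' \<subseteq> interior_img c" using I(2) unfolding Q_def by blast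
      show "unc c q \<in> V" if "q \<in> U'" for q using QV I(2) that by blast
      fix y h assume y: "y \<in> V'"
      have "g y \<in> U'" using homeomorphism_image2[OF I(6)] y by blast
      then have "g y \<in> Q" using I(2) by blast
      from surj_f_inv_f[OF bij_is_surj[OF I(9)[OF y]], of h] I(8)[OF y]
      show "DL c (g y) (g' y h) = h" unfolding ap[OF \<open>g y \<in> Q\<close>] by simp
    qed
  qed
qed

end

section \<open>Horizontal maps built from functions of position, momentum and time\<close>

locale leg = lag A t0 \<mu> L V for A :: "('m::{second_countable_topology, t2_space}, 'n::finite) chart set" and t0 \<mu> L V +
  fixes c U' V' and g :: "'n coords \<Rightarrow> 'n coords" and g'
  assumes c: "c \<in> A" and oU: "open U'" and UI: "U' \<subseteq> interior_img c" and UV: "\<And>q. q \<in> U' \<Longrightarrow> unc c q \<in> V"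
    and oV: "open V'" and hom: "homeomorphism U' V' (Leg c) g"
    and g_deriv: "\<And>y. y \<in> V' \<Longrightarrow> (g has_derivative g' y) (at y)"
    and DLg: "\<And>y h. y \<in> V' \<Longrightarrow> DL c (g y) (g' y h) = h"
begin

lemma Uci: "U' \<subseteq> ci c" using UI interior_img_subset[of c] by (rule order_trans)

lemma g_in: "y \<in> V' \<Longrightarrow> g y \<in> U'" using homeomorphism_image2[OF hom] by blast
lemma Leg_in: "q \<in> U' \<Longrightarrow> Leg c q \<in> V'" using homeomorphism_image1[OF hom] by blast
lemma g_Leg: "q \<in> U' \<Longrightarrow> g (Leg c q) = q" by (rule homeomorphism_apply1[OF hom])
lemma Leg_g: "y \<in> V' \<Longrightarrow> Leg c (g y) = y" by (rule homeomorphism_apply2[OF hom])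
lemma g_cont: "continuous_on V' g" by (rule homeomorphism_cont2[OF hom])

lemma g_simps: "y \<in> V' \<Longrightarrow> fst (g y) = fst y" "y \<in> V' \<Longrightarrow> snd (snd (g y)) = snd (snd y)"
proof -
  assume y: "y \<in> V'"
  from Leg_g[OF y] have "fst (Leg c (g y)) = fst y" "snd (snd (Leg c (g y))) = snd (snd y)" by simp_all
  then show "fst (g y) = fst y" "snd (snd (g y)) = snd (snd y)" by (simp_all add: Leg_def)
qed

lemma Uci': "q \<in> U' \<Longrightarrow> q \<in> ci c" using Uci by blast

lemma openin_U: "openin (top_of_set (ci c)) U'" by (rule open_subset[OF Uci oU])

text \<open>The fiber slot of the argument of \<open>u\<close> holds a momentum, so
  \<open>dir_v\<close> here means differentiation in p; the result, a gradient in a covector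
  variable, has the type of a velocity.\<close>

definition \<phi> :: "('n coords \<Rightarrow> real) \<Rightarrow> 'n coords \<Rightarrow> real^'n" where
  "\<phi> u q = (\<chi> i. dir_deriv UNIV u (dir_v i) (Leg c q))"

definition Ff :: "('n coords \<Rightarrow> real) \<Rightarrow> ('m, 'n) point \<Rightarrow> ('m, 'n) tangent" where
  "Ff u p = (if p \<in> cd c \<and> coord c p \<in> U' then lift c (fst p) (\<phi> u (coord c p)) else (\<lambda>d. 0))"

lemma lift_0: "c' \<in> A \<Longrightarrow> x \<in> fst c' \<Longrightarrow> lift c' x 0 = (\<lambda>d. 0)"
proof
  fix d assume c': "c' \<in> A" "x \<in> fst c'"
  show "lift c' x 0 d = 0"
  proof (cases "d \<in> A \<and> x \<in> fst d")
    case True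
    then have "snd c' x \<in> ov c' d" using c'(2) by (auto simp: ov_def)
    then show ?thesis using linear_0[OF linear_J[OF c'(1)]] True by (simp add: lift_def)
  next
    case False
    then show ?thesis unfolding lift_def by (rule if_not_P)
  qed
qed

lemma Ff_c: "p \<in> cd c \<Longrightarrow> coord c p \<in> U' \<Longrightarrow> Ff u p c = \<phi> u (coord c p)"
  using lift_same[OF c] by (simp add: Ff_def cd_iff)

context
  fixes u :: "'n coords \<Rightarrow> real" and KN :: "'n coords set"
  assumes u: "smooth_on u UNIV" and KN: "compact KN" "KN \<subseteq> V'" and u_supp: "\<forall>x. x \<notin> KN \<longrightarrow> u x = 0"
begin

lemma u0: "x \<notin> KN \<Longrightarrow> u x = 0" using u_supp by blast

lemma Ck_u: "Ck_on k u UNIV" using u by (rule smooth_onD)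

lemma KK: "compact (g ` KN)" "g ` KN \<subseteq> U'" "g ` KN \<subseteq> ci c"
proof -
  show "compact (g ` KN)" by (rule compact_continuous_image[OF continuous_on_subset[OF g_cont KN(2)] KN(1)])
  show "g ` KN \<subseteq> U'" using g_in KN(2) by blast
  then show "g ` KN \<subseteq> ci c" using Uci by (rule order_trans)
qed

lemma TKK: "openin top (TM - unc c ` (g ` KN))"
  using closedin_unc[OF c KK(1,3)] by (simp add: closedin_def topspace_top)

lemma Leg_notin: "q \<in> U' \<Longrightarrow> q \<notin> g ` KN \<Longrightarrow> Leg c q \<notin> KN"
  using g_Leg[of q] by (metis imageI)

lemma \<phi>_0: "q \<in> U' \<Longrightarrow> q \<notin> g ` KN \<Longrightarrow> \<phi> u q = 0"
  using dir_deriv_zero_outside[OF Ck_u KN(1) u0 Leg_notin] by (simp add: \<phi>_def vec_eq_iff)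

lemma Ff_0: "p \<notin> unc c ` (g ` KN) \<Longrightarrow> Ff u p d = 0"
proof -
  assume p: "p \<notin> unc c ` (g ` KN)"
  show "Ff u p d = 0"
  proof (cases "p \<in> cd c \<and> coord c p \<in> U'")
    case True
    then have "coord c p \<notin> g ` KN" using p unc_coord[OF c, of p] by (metis imageI)
    then have "\<phi> u (coord c p) = 0" using \<phi>_0 True by blast
    then show ?thesis using lift_0[OF c, of "fst p"] True by (simp add: Ff_def cd_iff)
  next
    case False
    then show ?thesis by (simp only: Ff_def if_False)
  qed
qed

lemma Leg_C1: "Ck_on (Suc 0) (Leg c) U'"
  unfolding Leg_def[abs_def]
  by (intro Ck_on_Pair Ck_on_fst Ck_on_snd Ck_on_id Ck_on_subset[OF P_C1[OF c] Uci])

lemma \<phi>_C1: "Ck_on (Suc 0) (\<phi> u) U'"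
proof (rule Ck_on_vec)
  fix i
  have "Ck_on (Suc 0) (\<lambda>q. dir_deriv UNIV u (dir_v i) (Leg c q)) U'"
    by (rule Ck_on_compose[OF smooth_dir_deriv_UNIV[OF Ck_u] Leg_C1]) blast
  then show "Ck_on (Suc 0) (\<lambda>q. \<phi> u q $ i) U'" by (simp only: \<phi>_def vec_lambda_beta)
qed

lemma KK_cd: "p \<in> unc c ` (g ` KN) \<Longrightarrow> p \<in> cd c \<and> coord c p \<in> g ` KN \<and> coord c p \<in> U'"
proof -
  assume "p \<in> unc c ` (g ` KN)"
  then obtain q where q: "q \<in> g ` KN" "p = unc c q" by (rule imageE) blast
  have qc: "q \<in> ci c" using q(1) KK(3) by blast
  show ?thesis using q unc_in[OF c qc] coord_unc[OF c qc] KK(2) by blast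
qed

lemma Ff_horizontal: "horizontal_map A t0 (Ff u)"
  unfolding horizontal_map_def
proof (intro conjI ballI)
  fix p assume p: "p \<in> TM"
  show "Ff u p \<in> tangent_space A (fst p)"
  proof (cases "p \<in> cd c \<and> coord c p \<in> U'")
    case True
    then show ?thesis using lift_tangent[OF c, of "fst p"] by (simp add: Ff_def cd_iff)
  next
    case False
    then show ?thesis
      using lift_tangent[OF chart_at(1,2), of p 0] lift_0[OF chart_at(1,2), of p] unfolding Ff_def by (simp only: if_False)
  qed
next
  fix d assume d: "d \<in> A"
  show "Ck_on 1 (lc d (\<lambda>p. Ff u p d)) (ci d)"
    unfolding One_nat_def
  proof (rule Ck_chart_local[OF d])
    fix p assume p: "p \<in> cd d"
    show "\<exists>e\<in>A. \<exists>W. p \<in> cd e \<and> openin (top_of_set (ci e)) W \<and> coord e p \<in> W \<and> Ck_on (Suc 0) (lc e (\<lambda>p. Ff u p d)) W"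
    proof (cases "p \<in> unc c ` (g ` KN)")
      case True
      note pc = KK_cd[OF True]
      let ?W = "OV c d \<inter> U'"
      have "openin (top_of_set (ci c)) ?W" by (intro openin_Int openin_OV c d openin_U)
      moreover have "coord c p \<in> ?W" using pc coord_OV[OF c _ p] by blast
      moreover have "Ck_on (Suc 0) (lc c (\<lambda>p. Ff u p d)) ?W"
      proof (rule Ck_on_cong)
        show "Ck_on (Suc 0) (\<lambda>q. \<Sum>i\<in>UNIV. \<phi> u q $ i *\<^sub>R J c d (fst q) (axis i 1)) ?W"
        proof (intro Ck_on_sum Ck_on_scaleR Ck_on_nth)
          show "Ck_on (Suc 0) (\<phi> u) ?W" by (rule Ck_on_subset[OF \<phi>_C1]) blast
          show "Ck_on (Suc 0) (\<lambda>q. J c d (fst q) (axis i 1)) ?W" for i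
            by (rule Ck_on_compose[OF Ck_J[OF c d] Ck_on_fst[OF Ck_on_id]]) (auto simp: OV_def)
        qed
        fix q assume q: "q \<in> ?W"
        then have qc: "q \<in> ci c" and y: "fst q \<in> ov c d" using Uci by (auto simp: OV_def)
        have x: "unc c q \<in> cd d" using q OV_iff[OF c] by blast
        have "snd c (fst (unc c q)) = fst (coord c (unc c q))" by (simp add: coord_def)
        then have "snd c (fst (unc c q)) = fst q" using coord_unc[OF c qc] by simp
        then have "lc c (\<lambda>p. Ff u p d) q = J c d (fst q) (\<phi> u q)"
          using q unc_in[OF c qc] coord_unc[OF c qc] x d by (simp add: loc_def Ff_def lift_def cd_iff)
        then show "(\<Sum>i\<in>UNIV. \<phi> u q $ i *\<^sub>R J c d (fst q) (axis i 1)) = lc c (\<lambda>p. Ff u p d) q"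
          using J_sum[OF c d y, of "\<phi> u q"] by simp
      qed
      ultimately show ?thesis using c pc by blast
    next
      case False
      let ?W = "{q \<in> ci d. unc d q \<in> TM - unc c ` (g ` KN)}"
      have "openin (top_of_set (ci d)) ?W" by (rule openin_chart[OF TKK d])
      moreover have "coord d p \<in> ?W" using coord_in[OF p] unc_coord[OF d p] False cd_TM[OF p] by simp
      moreover have "Ck_on (Suc 0) (lc d (\<lambda>p. Ff u p d)) ?W"
        by (rule Ck_on_cong[OF Ck_on_const[of _ 0]]) (use Ff_0 in \<open>simp add: loc_def\<close>)
      ultimately show ?thesis using d p by blast
    qed
  qed
next
  fix p assume p: "p \<in> TM"
  have "Ff u p d = 0" if "snd (snd p) = 0 \<or> snd (snd p) = t0" for d
  proof -
    have "coord c p \<notin> U'"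
    proof
      assume "coord c p \<in> U'"
      then have "coord c p \<in> interior_img c" using UI by blast
      then have "0 < snd (snd p)" "snd (snd p) < t0" by (auto simp: coord_def)
      then show False using that by simp
    qed
    then show ?thesis by (simp add: Ff_def)
  qed
  then show "case p of (x, v, t) \<Rightarrow> t = 0 \<or> t = t0 \<longrightarrow> (\<forall>c. Ff u (x, v, t) c = 0)"
    unfolding case_prod_beta prod.collapse by blast
qed

definition uf where "uf = ext c (\<lambda>q. if q \<in> U' then u (Leg c q) else 0)"

lemma uf_zero: "q \<in> ci c - g ` KN \<Longrightarrow> (if q \<in> U' then u (Leg c q) else 0) = 0"
  using u0[OF Leg_notin] by simp

lemma uf_C1: "Ck_TMI A t0 (Suc 0) uf"
  unfolding uf_def
proof (rule Ck_TMI_ext[OF c KK(1,3) uf_zero])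
  show "Ck_on (Suc 0) (\<lambda>q. if q \<in> U' then u (Leg c q) else 0) (ci c)"
  proof (rule Ck_on_local[OF thick_ci[OF c]])
    fix q assume q: "q \<in> ci c"
    show "\<exists>W. openin (top_of_set (ci c)) W \<and> q \<in> W \<and> Ck_on (Suc 0) (\<lambda>q. if q \<in> U' then u (Leg c q) else 0) W"
    proof (cases "q \<in> U'")
      case True
      have "Ck_on (Suc 0) (\<lambda>q. u (Leg c q)) U'" by (rule Ck_on_compose[OF Ck_u Leg_C1]) blast
      then have "Ck_on (Suc 0) (\<lambda>q. if q \<in> U' then u (Leg c q) else 0) U'" by (rule Ck_on_cong) simp
      then show ?thesis using True openin_U by blast
    next
      case False
      let ?W = "ci c \<inter> - (g ` KN)"
      have "openin (top_of_set (ci c)) ?W"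
        by (rule openin_open_Int) (use compact_imp_closed[OF KK(1)] in \<open>simp add: open_Compl\<close>)
      moreover have "q \<in> ?W" using q False KK(2) by blast
      moreover have "Ck_on (Suc 0) (\<lambda>q. if q \<in> U' then u (Leg c q) else 0) ?W"
        by (rule Ck_on_cong[OF Ck_on_const[of _ 0]]) (use u0[OF Leg_notin] in simp)
      ultimately show ?thesis by blast
    qed
  qed
qed

text \<open>By the chain rule the fiber gradient of u(x, L_v, t) is the symmetric matrix L_vv
  applied to the momentum gradient of \<open>u\<close>. Thus L_vv F is a fiber gradient by
  construction, and closedness of the form follows.\<close>

lemma uf_grad:
  assumes d: "d \<in> A" and p: "p \<in> cd d" shows "vgrad uf d p = wF (Ff u) d p"
proof (cases "p \<in> unc c ` (g ` KN)")
  case True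
  have pc: "p \<in> cd c" and qU: "coord c p \<in> U'" using KK_cd[OF True] by blast+
  let ?q = "coord c p"
  have q: "?q \<in> ci c" using coord_in[OF pc] .
  let ?D = "frechet_derivative u (at (Leg c ?q))"
  have Du: "(u has_derivative ?D) (at (Leg c ?q))" by (rule dir_deriv_UNIV_linear[OF Ck_u])
  have eq: "u (Leg c q) = lc c uf q" if "q \<in> U'" for q
    using that unc_in[OF c Uci'[OF that]] coord_unc[OF c Uci'[OF that]] by (simp add: loc_def uf_def ext_def)
  have "((\<lambda>q. u (Leg c q)) has_derivative (\<lambda>h. ?D (DL c ?q h))) (at ?q within ci c)"
    by (rule has_derivative_compose[OF Leg_deriv[OF c q] Du])
  then have "((\<lambda>q. u (Leg c q)) has_derivative (\<lambda>h. ?D (DL c ?q h))) (at ?q within U')"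
    unfolding at_within_openin[OF openin_U qU] .
  then have "(lc c uf has_derivative (\<lambda>h. ?D (DL c ?q h))) (at ?q within U')"
    by (rule has_derivative_transform[OF qU, rotated]) (rule eq[symmetric])
  then have D: "(lc c uf has_derivative (\<lambda>h. ?D (DL c ?q h))) (at ?q within ci c)"
    unfolding at_within_openin[OF openin_U qU] .
  have "?D (DL c ?q (dir_v i)) = (M c ?q *v \<phi> u ?q) $ i" for i
  proof -
    have "DL c ?q (dir_v i) = (0, M c ?q *v axis i 1, 0)" using DP_vert[OF c q] by (simp add: DL_def)
    then have "?D (DL c ?q (dir_v i)) = (\<chi> i. ?D (dir_v i)) \<bullet> (M c ?q *v axis i 1)"
      using linear_dir_v[OF has_derivative_linear[OF Du], of "M c ?q *v axis i 1"] by simp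
    also have "\<dots> = (M c ?q *v \<phi> u ?q) \<bullet> axis i 1" unfolding M_inner[OF c q] by (simp add: \<phi>_def)
    finally show ?thesis by (simp add: inner_axis)
  qed
  then have 1: "vgrad uf c p = wF (Ff u) c p"
    using thick_frechet_derivative[OF thick_ci[OF c] q D] by (simp add: vgrad_def wF_def Ff_c[OF pc qU] vec_eq_iff)
  show ?thesis
  proof (rule inner_J_eq[OF c d pc p])
    fix h
    show "vgrad uf d p \<bullet> J c d (fst ?q) h = wF (Ff u) d p \<bullet> J c d (fst ?q) h"
      using fib_J[OF C1_fib[OF uf_C1] c d pc p, of h] wF_J[OF Ff_horizontal c pc d p, of h] 1 by simp
  qed
next
  case False
  have "p \<in> TM - unc c ` (g ` KN)" using False cd_TM[OF p] by blast
  moreover have "uf q = 0" if "q \<in> TM - unc c ` (g ` KN)" for q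
    unfolding uf_def by (rule ext_outside[where K="g ` KN", OF c uf_zero]) (use that in blast)+
  ultimately have "vgrad uf d p = 0" by (intro fib_0[OF C1_fib[OF uf_C1] d p TKK])
  then show ?thesis using Ff_0[OF False] by (simp add: wF_def)
qed

lemma Ff_closed: "fiber_closed A t0 L (Ff u)"
  unfolding fiber_closed_def
proof (intro ballI)
  fix d y t assume d: "d \<in> A" and y: "y \<in> im d" and t: "t \<in> {0..t0}"
  have q: "(y, w, t) \<in> ci d" for w using y t by (simp add: ci_iff)
  define \<omega> where "\<omega> w = lc d (wF (Ff u) d) (y, w, t)" for w
  have e: "\<omega> = (\<lambda>w. M d (y, w, t) *v lc d (\<lambda>p. Ff u p d) (y, w, t))"
    by (simp add: fun_eq_iff \<omega>_def loc_def wF_def coord_unc[OF d q])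
  have "closed_1form \<omega>"
  proof (rule gradient_closed_1form)
    show "continuous_on UNIV \<omega>"
      unfolding \<omega>_def by (rule continuous_on_compose2[OF wF_cont[OF Ff_horizontal d]]) (use q in \<open>auto intro!: continuous_intros\<close>)
    fix w
    have "lc d (vgrad uf d) (y, w, t) = \<omega> w" using uf_grad[OF d unc_in[OF d q]] by (simp add: \<omega>_def loc_def)
    then show "((\<lambda>w. lc d uf (y, w, t)) has_derivative (\<lambda>h. \<omega> w \<bullet> h)) (at w)"
      using fibD(3)[OF C1_fib[OF uf_C1] d q[of w]] by simp
  qed
  then show "closed_1form (\<lambda>w. M d (y, w, t) *v lc d (\<lambda>p. Ff u p d) (y, w, t))" unfolding e .
qed

end

text \<open>In Legendre coordinates \<open>f\<close> has the continuous momentum gradient \<beta> =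
  L_vv^-1 \<omega>. A smooth \<open>u\<close> with nearly the same momentum gradient yields an
  admissible \<open>F\<close> for which L_vv F is uniformly close to \<omega> on the support, so the
  integral of \<omega> against the bounded field \<open>W C\<close> is arbitrarily small.\<close>

lemma critical_local:
  assumes C: "second_derivative A t0 \<mu> C" and crit: "horizontally_critical A t0 L \<mu>"
    and fo: "fib f \<omega>" and K: "compact K" "K \<subseteq> U'" and f0: "\<And>p. p \<notin> unc c ` K \<Longrightarrow> f p = 0"
  shows "(LINT p|\<mu>. vert \<omega> (W C) p) = 0"
proof -
  note nW = W_nice'[OF C]
  have Kci: "K \<subseteq> ci c" using K(2) Uci by (rule order_trans)
  have TK: "openin top (TM - unc c ` K)"
    using closedin_unc[OF c K(1) Kci] by (simp add: closedin_def topspace_top)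
  have off: "unc c q \<in> TM - unc c ` K" if q: "q \<in> ci c" "q \<notin> K" for q
  proof -
    have "unc c q \<noteq> unc c z" if "z \<in> K" for z
    proof
      assume "unc c q = unc c z"
      then have "q = z" using coord_unc[OF c q(1)] coord_unc[OF c, of z] Kci that by auto
      then show False using q(2) that by simp
    qed
    then show ?thesis using cd_TM[OF unc_in[OF c q(1)]] by blast
  qed
  have fz: "lc c f q = 0" if "q \<in> ci c" "q \<notin> K" for q
    using off[OF that] f0[of "unc c q"] by (simp add: loc_def)
  have wz: "lc c (\<omega> c) q = 0" if "q \<in> ci c" "q \<notin> K" for q
    unfolding loc_def by (rule fib_0[OF fo c unc_in[OF c that(1)] TK off[OF that]]) (use f0 in blast)
  have Minv: "invertible (M c q)" if "q \<in> U'" for q by (rule M_invertible[OF c Uci'[OF that] UV[OF that]])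
  define \<beta> where "\<beta> q = matrix_inv (M c q) *v lc c (\<omega> c) q" for q
  have M\<beta>: "M c q *v \<beta> q = lc c (\<omega> c) q" if "q \<in> U'" for q
    using matrix_inv_mult(1)[OF Minv[OF that]] by (simp add: \<beta>_def matrix_vector_mul_assoc)
  have \<beta>c: "continuous_on U' \<beta>"
  proof -
    have "continuous_on U' (\<lambda>q. \<chi> i. \<Sum>j\<in>UNIV. matrix_inv (M c q) $ i $ j * lc c (\<omega> c) q $ j)"
      by (intro continuous_on_vec_lambda continuous_intros continuous_on_matrix_inv Minv
          continuous_on_subset[OF M_cont[OF c] Uci] continuous_on_subset[OF fibD(2)[OF fo c] Uci])
    then show ?thesis by (rule continuous_on_eq) (simp add: \<beta>_def matrix_vector_mult_def)
  qed
  define KV where "KV = Leg c ` K"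
  have KV: "compact KV" "KV \<subseteq> V'"
    unfolding KV_def using K Leg_in compact_continuous_image[OF continuous_on_subset[OF homeomorphism_cont1[OF hom] K(2)] K(1)] by blast+
  have gK: "g y \<notin> K" if "y \<in> V'" "y \<notin> KV" for y
    using Leg_g[OF that(1)] that(2) unfolding KV_def by (metis imageI)
  define uu where "uu y = (if y \<in> V' then lc c f (g y) else 0)" for y
  define f' where "f' b y = (if y \<in> V' then \<beta> (g y) \<bullet> fst (snd b) else 0)" for b y :: "'n coords"
  have uu0: "uu y = 0" if "y \<notin> KV" for y
    using fz[OF Uci'[OF g_in] gK[OF _ that]] by (simp add: uu_def)
  have f'0: "f' b y = 0" if "y \<notin> KV" for b y
    using wz[OF Uci'[OF g_in] gK[OF _ that]] by (simp add: f'_def \<beta>_def)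
  have contV: "continuous_on UNIV h" if h: "continuous_on V' h" "\<And>y. y \<notin> KV \<Longrightarrow> h y = 0" for h :: "'n coords \<Rightarrow> real"
  proof -
    have "continuous_on (- KV) (\<lambda>y. 0 :: real)" by simp
    then have "continuous_on (- KV) h" by (rule continuous_on_eq) (simp add: h(2))
    then have "continuous_on (V' \<union> - KV) h"
      by (intro continuous_on_open_Un oV h(1)) (use compact_imp_closed[OF KV(1)] in \<open>simp add: open_Compl\<close>)
    moreover have "V' \<union> - KV = UNIV" using KV(2) by blast
    ultimately show ?thesis by simp
  qed
  have uuc: "continuous_on UNIV uu"
  proof (rule contV[OF _ uu0])
    have "continuous_on V' (\<lambda>y. lc c f (g y))"
      by (rule continuous_on_compose2[OF fibD(1)[OF fo c] g_cont]) (use Uci' g_in in blast)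
    then show "continuous_on V' uu" by (rule continuous_on_eq) (simp add: uu_def)
  qed
  have f'c: "continuous_on UNIV (f' b)" for b
  proof (rule contV[OF _ f'0])
    have "continuous_on V' (\<lambda>y. \<beta> (g y) \<bullet> fst (snd b))"
      by (intro continuous_intros continuous_on_compose2[OF \<beta>c g_cont]) (use g_in in blast)
    then show "continuous_on V' (f' b)" by (rule continuous_on_eq) (simp add: f'_def)
  qed
  have du: "((\<lambda>s. uu (y + s *\<^sub>R b)) has_real_derivative f' b y) (at 0)" if b: "b \<in> range dir_v" for b y
  proof (cases "y \<in> V'")
    case True
    obtain i where i: "b = dir_v i" using b by blast
    let ?q = "g y"
    have qU: "?q \<in> U'" using g_in[OF True] .
    \<comment> \<open>Along s -> g (y + s b) only the fiber coordinate moves, since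
      \<open>Leg\<close> preserves position and time. Its velocity \<open>k\<close> at s = 0 is
      mapped by L_vv to the basis vector, so the derivative of \<open>uu\<close> is \<omega>
      \<bullet> k = \<beta> \<bullet> L_vv k, a component of \<beta>.\<close>
    define k where "k = fst (snd (g' y b))"
    have "DL c ?q (g' y b) = b" by (rule DLg[OF True])
    then have "fst (g' y b) = 0" "snd (snd (g' y b)) = 0" "DP c ?q (g' y b) = axis i 1"
      by (simp_all add: DL_def i)
    then have "DP c ?q (0, k, 0) = axis i 1" by (cases "g' y b") (simp add: k_def)
    then have Mk: "M c ?q *v k = axis i 1" using DP_vert[OF c Uci'[OF qU]] by simp
    define \<gamma> where "\<gamma> s = fst (snd (g (y + s *\<^sub>R b)))" for s :: real
    have l: "linear (g' y)" using has_derivative_linear[OF g_deriv[OF True]] .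
    have "((\<lambda>s::real. y + s *\<^sub>R b) has_derivative (\<lambda>s. s *\<^sub>R b)) (at 0)"
      by (auto intro!: derivative_eq_intros)
    moreover have "(g has_derivative g' y) (at (y + 0 *\<^sub>R b))" using g_deriv[OF True] by simp
    ultimately have "((\<lambda>s. g (y + s *\<^sub>R b)) has_derivative (\<lambda>s. g' y (s *\<^sub>R b))) (at 0)"
      by (rule has_derivative_compose)
    then have "((\<lambda>s. fst (snd (g (y + s *\<^sub>R b)))) has_derivative (\<lambda>s. fst (snd (g' y (s *\<^sub>R b))))) (at 0)"
      by (intro has_derivative_fst has_derivative_snd)
    then have \<gamma>': "(\<gamma> has_derivative (\<lambda>s. s *\<^sub>R k)) (at 0)"
      unfolding \<gamma>_def[abs_def] k_def linear_scale[OF l] by simp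
    have "((\<lambda>w. lc c f (fst ?q, w, snd (snd ?q))) has_derivative (\<lambda>h. lc c (\<omega> c) ?q \<bullet> h)) (at (\<gamma> 0))"
      using fibD(3)[OF fo c Uci'[OF qU]] by (simp add: \<gamma>_def)
    from has_derivative_compose[OF \<gamma>' this]
    have "((\<lambda>s. lc c f (fst ?q, \<gamma> s, snd (snd ?q))) has_derivative (\<lambda>s. lc c (\<omega> c) ?q \<bullet> (s *\<^sub>R k))) (at 0)" .
    then have d0: "((\<lambda>s. lc c f (fst ?q, \<gamma> s, snd (snd ?q))) has_real_derivative lc c (\<omega> c) ?q \<bullet> k) (at 0)"
      by (rule has_derivative_imp_has_field_derivative) simp
    have "lc c (\<omega> c) ?q \<bullet> k = (M c ?q *v \<beta> ?q) \<bullet> k" using M\<beta>[OF qU] by simp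
    also have "\<dots> = \<beta> ?q \<bullet> axis i 1" unfolding M_inner[OF c Uci'[OF qU]] Mk ..
    also have "\<dots> = f' b y" using True by (simp add: f'_def i)
    finally have v: "lc c (\<omega> c) ?q \<bullet> k = f' b y" .
    have "open ((\<lambda>s. y + s *\<^sub>R b) -` V')" by (intro open_vimage continuous_intros oV)
    then have "\<forall>\<^sub>F s in nhds 0. s \<in> (\<lambda>s. y + s *\<^sub>R b) -` V'"
      by (intro eventually_nhds_in_open) (use True in auto)
    then have ev: "\<forall>\<^sub>F s in nhds 0. uu (y + s *\<^sub>R b) = lc c f (fst ?q, \<gamma> s, snd (snd ?q))"
    proof (rule eventually_mono)
      fix s assume "s \<in> (\<lambda>s. y + s *\<^sub>R b) -` V'"
      then have s: "y + s *\<^sub>R b \<in> V'" by simp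
      have "g (y + s *\<^sub>R b) = (fst ?q, \<gamma> s, snd (snd ?q))"
        using g_simps[OF s] g_simps[OF True] by (intro prod_eqI) (simp_all add: \<gamma>_def i)
      then show "uu (y + s *\<^sub>R b) = lc c f (fst ?q, \<gamma> s, snd (snd ?q))" using s by (simp add: uu_def)
    qed
    show ?thesis using d0 unfolding v by (subst DERIV_cong_ev[OF refl ev refl])
  next
    case False
    then have yK: "y \<notin> KV" using KV(2) by blast
    have "open ((\<lambda>s. y + s *\<^sub>R b) -` (- KV))"
      by (intro open_vimage continuous_intros) (use compact_imp_closed[OF KV(1)] in auto)
    then have "\<forall>\<^sub>F s in nhds 0. s \<in> (\<lambda>s. y + s *\<^sub>R b) -` (- KV)"
      by (intro eventually_nhds_in_open) (use yK in auto)
    then have ev: "\<forall>\<^sub>F s in nhds 0. uu (y + s *\<^sub>R b) = 0" by (rule eventually_mono) (use uu0 in auto)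
    show ?thesis unfolding f'0[OF yK] by (subst DERIV_cong_ev[OF refl ev refl]) simp
  qed
  obtain d where d: "d > 0" "compact {x. \<exists>y\<in>KV. dist x y \<le> d}" "{x. \<exists>y\<in>KV. dist x y \<le> d} \<subseteq> V'"
    by (rule compact_neighbourhood[OF KV(1) oV KV(2)])
  \<comment> \<open>Mollification enlarges the support by up to \<open>d\<close>; the enlarged set
    must still lie in the domain of the inverse Legendre map.\<close>
  define KN where "KN = {x. \<exists>y\<in>KV. dist x y \<le> d}"
  have KN: "compact KN" "KN \<subseteq> V'" using d by (simp_all only: KN_def)
  have gKN: "compact (g ` KN)" "g ` KN \<subseteq> U'"
    using compact_continuous_image[OF continuous_on_subset[OF g_cont KN(2)] KN(1)] g_in KN(2) by blast+
  have K_KN: "K \<subseteq> g ` KN"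
  proof
    fix q assume q: "q \<in> K"
    then have "Leg c q \<in> KN" unfolding KN_def KV_def using d(1) by (intro CollectI bexI[of _ "Leg c q"]) auto
    moreover have "q = g (Leg c q)" using g_Leg[of q] q K(2) by auto
    ultimately show "q \<in> g ` KN" by blast
  qed
  have gKci: "g ` KN \<subseteq> ci c" using gKN(2) Uci by (rule order_trans)
  let ?S = "unc c ` (g ` KN) \<inter> supp"
  let ?MW = "\<lambda>i p. (M c (coord c p) *v W C c p) $ i"
  have bW: "bounded (vertical (W C) c ` ?S)" using nW c gKN(1) gKci unfolding nice_def by blast
  have bMW: "bounded (?MW i ` ?S)" for i
  proof -
    have bWj: "bounded ((\<lambda>p. W C c p $ j) ` ?S)" for j
    proof -
      have "(\<lambda>p. W C c p $ j) ` ?S = (\<lambda>x. fst (snd x) $ j) ` (vertical (W C) c ` ?S)" by (simp add: image_image vertical_def)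
      moreover have "bounded_linear (\<lambda>x :: 'n coords. fst (snd x) $ j)"
        by (intro bounded_linear_compose[OF bounded_linear_vec_nth] bounded_linear_compose[OF bounded_linear_fst] bounded_linear_snd)
      ultimately show ?thesis using bounded_linear_image[OF bW] by simp
    qed
    have "bounded ((\<lambda>p. \<Sum>j\<in>UNIV. M c (coord c p) $ i $ j * W C c p $ j) ` ?S)"
      by (intro bounded_sum_image bounded_mult_image bWj bounded_continuous_coord[OF c M_cont[OF c] gKN(1) gKci]) simp
    then show ?thesis by (simp add: matrix_vector_mult_def)
  qed
  have "\<exists>B. \<forall>p\<in>?S. \<bar>?MW i p\<bar> \<le> B" for i using bMW[of i] unfolding bounded_iff by (simp add: image_iff Bex_def del: split_paired_All)
  then obtain B where B: "\<forall>i. \<forall>p\<in>?S. \<bar>?MW i p\<bar> \<le> B i" by metis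
  \<comment> \<open>By symmetry of L_vv the pointwise error is the pairing of \<beta> minus the
    momentum gradient of \<open>u\<close>, at most \<open>e\<close> in each component, with L_vv W.
    The sum \<open>BB\<close> bounds the components of the latter.\<close>
  define BB where "BB = (\<Sum>i\<in>UNIV. \<bar>B i\<bar>)"
  interpret finite_measure \<mu> by (rule finite_mu)
  have main: "\<bar>LINT p|\<mu>. vert \<omega> (W C) p\<bar> \<le> e * (BB * measure \<mu> (space \<mu>))" if e: "e > 0" for e
  proof -
    obtain u where u: "smooth_on u UNIV" "\<And>x. u x \<noteq> 0 \<Longrightarrow> \<exists>y\<in>KV. dist x y \<le> d" "\<And>x. \<bar>u x - uu x\<bar> \<le> e"
      "\<And>b x. b \<in> range dir_v \<Longrightarrow> \<bar>dir_deriv UNIV u b x - f' b x\<bar> \<le> e"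
      by (rule smooth_approximation[OF uuc KV(1) uu0 du f'c _ e d(1)]) auto
    have u0: "\<forall>x. x \<notin> KN \<longrightarrow> u x = 0" using u(2) unfolding KN_def by blast
    note F = Ff_horizontal[OF u(1) KN u0]
    have I0: "(LINT p|\<mu>. vert (wF (Ff u)) (W C) p) = 0"
      by (rule critical_vert_0[OF C crit F Ff_closed[OF u(1) KN u0] c gKN(1) gKci]) (rule Ff_0[OF u(1) KN u0])
    have i1: "integrable \<mu> (vert \<omega> (W C))" by (rule vert_integrable[OF fo nW])
    have i2: "integrable \<mu> (vert (wF (Ff u)) (W C))" by (rule vert_wF_integrable[OF F nW])
    have pt: "\<bar>vert \<omega> (W C) p - vert (wF (Ff u)) (W C) p\<bar> \<le> e * BB" if p: "p \<in> supp" for p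
    proof (cases "p \<in> unc c ` (g ` KN)")
      case True
      have pc: "p \<in> cd c" and qU: "coord c p \<in> U'" using KK_cd[OF u(1) KN u0 True] by blast+
      let ?q = "coord c p"
      have cv: "cov (vertical (W C)) p" using nW cd_TM[OF pc] unfolding nice_def by blast
      have "\<omega> c p = M c ?q *v \<beta> ?q" using M\<beta>[OF qU] lc_coord[OF c pc, of "\<omega> c"] by simp
      moreover have "wF (Ff u) c p = M c ?q *v \<phi> u ?q" by (simp add: wF_def Ff_c[OF pc qU])
      ultimately have "vert \<omega> (W C) p - vert (wF (Ff u)) (W C) p = (M c ?q *v (\<beta> ?q - \<phi> u ?q)) \<bullet> W C c p"
        unfolding vert_chart[OF fo cv c pc] vert_wF_chart[OF F nW c pc] by (simp add: matrix_vector_mult_diff_distrib inner_diff_left)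
      also have "\<dots> = (\<beta> ?q - \<phi> u ?q) \<bullet> (M c ?q *v W C c p)" by (rule M_inner[OF c Uci'[OF qU]])
      also have "\<dots> = (\<Sum>i\<in>UNIV. (\<beta> ?q $ i - \<phi> u ?q $ i) * ?MW i p)" by (simp add: inner_vec_def)
      also have "\<bar>\<dots>\<bar> \<le> (\<Sum>i\<in>UNIV. e * \<bar>B i\<bar>)"
      proof (rule order_trans[OF sum_abs], rule sum_mono)
        fix i :: 'n
        have "f' (dir_v i) (Leg c ?q) = \<beta> ?q $ i"
          using Leg_in[OF qU] g_Leg[OF qU] by (simp add: f'_def inner_axis)
        then have "\<bar>\<beta> ?q $ i - \<phi> u ?q $ i\<bar> \<le> e"
          using u(4)[of "dir_v i" "Leg c ?q"] by (simp add: \<phi>_def abs_minus_commute)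
        moreover have "\<bar>?MW i p\<bar> \<le> \<bar>B i\<bar>" using bspec[OF spec[OF B, of i] IntI[OF True p]] by linarith
        ultimately show "\<bar>(\<beta> ?q $ i - \<phi> u ?q $ i) * ?MW i p\<bar> \<le> e * \<bar>B i\<bar>"
          unfolding abs_mult using e by (intro mult_mono) auto
      qed
      finally show ?thesis by (simp add: BB_def sum_distrib_left)
    next
      case False
      have "p \<in> TM - unc c ` K" using False K_KN supp_TM p by blast
      then have "vert \<omega> (W C) p = 0" by (rule vert_0[OF fo TK]) (use f0 in blast)
      moreover have "vert (wF (Ff u)) (W C) p = 0" using Ff_0[OF u(1) KN u0 False] by (simp add: vert_def wF_def)
      moreover have "BB \<ge> 0" unfolding BB_def by (intro sum_nonneg) auto
      ultimately show ?thesis using e by simp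
    qed
    have "(LINT p|\<mu>. vert \<omega> (W C) p) = (LINT p|\<mu>. vert \<omega> (W C) p - vert (wF (Ff u)) (W C) p)"
      using I0 by (simp add: Bochner_Integration.integral_diff[OF i1 i2])
    also have "\<bar>\<dots>\<bar> \<le> (LINT p|\<mu>. \<bar>vert \<omega> (W C) p - vert (wF (Ff u)) (W C) p\<bar>)" by (rule integral_abs_bound)
    also have "\<dots> \<le> (LINT p|\<mu>. e * BB)"
    proof (rule integral_mono_AE)
      show "AE p in \<mu>. \<bar>vert \<omega> (W C) p - vert (wF (Ff u)) (W C) p\<bar> \<le> e * BB"
        using AE_supp by (rule AE_mp) (intro AE_I2 impI pt)
    qed (use i1 i2 in simp_all)
    finally show ?thesis by (simp add: mult_ac)
  qed
  show ?thesis
  proof (rule ccontr)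
    let ?I = "\<bar>LINT p|\<mu>. vert \<omega> (W C) p\<bar>" and ?X = "BB * measure \<mu> (space \<mu>)"
    assume "(LINT p|\<mu>. vert \<omega> (W C) p) \<noteq> 0"
    then have I: "?I > 0" by simp
    \<comment> \<open>For this \<open>e\<close> the estimate \<open>main\<close> is at most half of
      the integral it should dominate; the summand 1 keeps the denominator positive.\<close>
    define e where "e = ?I / (2 * (\<bar>?X\<bar> + 1))"
    have e: "e > 0" using I by (simp add: e_def)
    have "e * ?X \<le> e * (\<bar>?X\<bar> + 1)" using e by (intro mult_left_mono) auto
    also have "\<dots> = ?I / 2" by (simp add: e_def field_simps)
    finally show False using main[OF e] I by linarith
  qed
qed

end

context lag
begin

lemma critical_EL:
  assumes C: "second_derivative A t0 \<mu> C" and crit: "horizontally_critical A t0 L \<mu>"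
  shows "EL_invariant A t0 L V \<mu>"
  unfolding EL_invariant_iff[OF C]
proof (intro allI impI)
  fix f assume f: "smooth_TMI A t0 f \<and> vanishes_at_ends A t0 f"
  then have f1: "Ck_TMI A t0 (Suc 0) f" unfolding smooth_TMI_def by blast
  have "(LINT p|\<mu>. deriv_along A t0 (vertical (W C)) f p) = (LINT p|\<mu>. vert (vgrad f) (W C) p)"
    by (rule Bochner_Integration.integral_cong[OF refl]) (simp add: space_mu deriv_along_vertical[OF f1])
  also have "\<dots> = 0"
  proof (rule vert_interior_reduction[OF W_nice'[OF C] _ C1_fib[OF f1]])
    show "vanishes_at_ends A t0 f" using f by blast
    fix p assume p: "p \<in> supp" "0 < snd (snd p)" "snd (snd p) < t0"
    have pT: "p \<in> TM" and pV: "p \<in> V" using p(1) supp_TM suppV by blast+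
    obtain c where c: "c \<in> A" "p \<in> cd c" using exists_cd[OF pT] by blast
    obtain U' V' g g' where I0: "open U' \<and> coord c p \<in> U' \<and> U' \<subseteq> interior_img c \<and> (\<forall>q\<in>U'. unc c q \<in> V) \<and>
      open V' \<and> homeomorphism U' V' (Leg c) g \<and> (\<forall>y\<in>V'. (g has_derivative g' y) (at y)) \<and>
      (\<forall>y\<in>V'. \<forall>h. DL c (g y) (g' y h) = h)"
      using exists_Leg_inverse[OF c pV p(2,3)] by (elim exE)
    have I: "open U'" "coord c p \<in> U'" "U' \<subseteq> interior_img c" "\<And>q. q \<in> U' \<Longrightarrow> unc c q \<in> V"
      "open V'" "homeomorphism U' V' (Leg c) g" "\<And>y. y \<in> V' \<Longrightarrow> (g has_derivative g' y) (at y)"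
      "\<And>y h. y \<in> V' \<Longrightarrow> DL c (g y) (g' y h) = h"
      using I0 by blast+
    have h: "leg A t0 \<mu> L V c U' V' g g'"
      by (intro leg.intro leg_axioms.intro lag_axioms c I(1,3,5,6)) (erule I(4) I(7) I(8))+
    obtain r where r: "r > 0" "cball (coord c p) r \<subseteq> U'" using I(1,2) unfolding open_contains_cball by blast
    let ?U = "unc c ` (ci c \<inter> ball (coord c p) r)"
    have oU: "openin top ?U" by (rule openin_image[OF c(1)]) auto
    have pU: "p \<in> ?U"
      by (rule image_eqI[of p "unc c" "coord c p"]) (use c coord_in unc_coord r(1) in simp_all)
    have UK: "?U \<subseteq> unc c ` cball (coord c p) r" using ball_subset_cball[of "coord c p" r] by blast
    have z: "(LINT p|\<mu>. vert \<omega> (W C) p) = 0" if "fib f \<omega>" "\<forall>q. q \<notin> ?U \<longrightarrow> f q = 0" for f \<omega>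
      by (rule leg.critical_local[OF h C crit that(1) compact_cball r(2)]) (use that(2) UK in blast)
    show "\<exists>U. openin top U \<and> p \<in> U \<and> (\<forall>f \<omega>. fib f \<omega> \<longrightarrow> (\<forall>q. q \<notin> U \<longrightarrow> f q = 0) \<longrightarrow> (LINT p|\<mu>. vert \<omega> (W C) p) = 0)"
      by (intro exI[of _ ?U] conjI oU pU allI impI) (erule (1) z)
  qed
  finally show "(LINT p|\<mu>. deriv_along A t0 (vertical (W C)) f p) = 0" .
qed

lemma EL_invariant_iff_critical:
  "EL_invariant A t0 L V \<mu> \<longleftrightarrow> \<mu> \<in> closed_velocity_measures A t0 \<and> horizontally_critical A t0 L \<mu>"
proof
  assume inv: "EL_invariant A t0 L V \<mu>"
  obtain C where C: "second_derivative A t0 \<mu> C" using EL_second_derivative[OF inv] by (rule exE)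
  show "\<mu> \<in> closed_velocity_measures A t0 \<and> horizontally_critical A t0 L \<mu>"
    unfolding closed_velocity_measures_def
    using second_derivative_closed[OF C] C EL_critical[OF inv] by (intro conjI CollectI exI)
next
  assume a: "\<mu> \<in> closed_velocity_measures A t0 \<and> horizontally_critical A t0 L \<mu>"
  then obtain C where C: "second_derivative A t0 \<mu> C" unfolding closed_velocity_measures_def by blast
  show "EL_invariant A t0 L V \<mu>" by (rule critical_EL[OF C conjunct2[OF a]])
qed

end

theorem theorem3:
  fixes A :: "('m::{second_countable_topology, t2_space}, 'n::finite) chart set"
    and t0 :: real
    and L :: "('m, 'n) point \<Rightarrow> real"
    and \<mu> :: "('m, 'n) point measure"
    and V :: "('m, 'n) point set"
  assumes "smooth_atlas A"
    and "t0 > 0"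
    and "C2_lipschitz A t0 L"
    and "compact_radon_measure A t0 \<mu>"
    and "openin (TMI_top A t0) V"
    and "Lvv_invertible_on A t0 L V"
    and "msupport A t0 \<mu> \<subseteq> V"
  shows "EL_invariant A t0 L V \<mu> \<longleftrightarrow>
    \<mu> \<in> closed_velocity_measures A t0 \<and> horizontally_critical A t0 L \<mu>"
proof -
  interpret lag A t0 \<mu> L V by unfold_locales (fact assms)+
  show ?thesis by (rule EL_invariant_iff_critical)
qed

end
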